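(* Consider real-analytic graphed surfaces $S=\{u=F(x,y)\}\subset\mathbb{R}^3$ with $F_{xx}\ne0\equiv F_{xx}F_{yy}-F_{xy}^2$, within the branch $\mathsf S\neq0$, $\mathsf W\equiv0$ (expressions in the context). Then: (1) There is a single differential invariant of order $5$ under $\mathsf{SA}_3(\mathbb{R})$, namely $$\mathsf X=\frac19\,\frac{(F_{xx}F_{xxy}-F_{xy}F_{xxx})\,(9F_{xx}^2F_{xxxxx}-45F_{xx}F_{xxx}F_{xxxx}+40F_{xxx}^3)}{F_{xx}^6};$$ that is, $\mathsf X$ is a differential invariant and every differential invariant of order at most $5$ in this branch is locally a function of $\mathsf X$. (2) When $\mathsf X\equiv0$, the surface is (locally) $\mathsf{SA}_3(\mathbb{R})$-equivalent to the model $$u=\frac12\,\frac{x^2}{1-y}.$$ (3) When $\mathsf X\neq0$, every surface germ $(S,p)$ is $\mathsf{SA}_3(\mathbb{R})$-equivalent to a germ at the origin of the form $$u=\frac{x^2}{2}+\frac{x^2y}{2}+\frac{x^2y^2}{2}+F_{5,0}\frac{x^5}{120}+\frac{x^2y^3}{2}+4F_{5,0}\frac{x^5y}{120}+\frac{x^2y^4}{2}+F_{7,0}\frac{x^7}{5040}+20F_{5,0}\frac{x^5y^2}{240}+\frac{x^2y^5}{2}+\sum_{j+k\ge8}F_{j,k}\,x^jy^k,$$ where $F_{5,0}$ is the value at the origin of $\mathsf X$ and $F_{7,0}$ is the value at the origin of $\mathsf Y$. (4) The collection of coefficients $F_{5,0},F_{7,0},\{F_{j,0}\}_{j\ge8}$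 is in one-to-one correspondence with equivalence classes: two germs at the origin in the form of (3) are $\mathsf{SA}_3(\mathbb{R})$-equivalent (origin to origin) if and only if these coefficients coincide.
   Context: $\mathsf{SA}_3(\mathbb{R})=\mathsf{SL}_3(\mathbb{R})\ltimes\mathbb{R}^3$ acts on $\mathbb{R}^3\ni(x,y,u)$ by affine transformations with linear part of determinant $1$. Surfaces are local and real-analytic; germs $(S,p)$, $(S',p')$ are equivalent if some $g\in\mathsf{SA}_3(\mathbb{R})$ has $g(p)=p'$ and maps a neighbourhood of $p$ in $S$ onto a neighbourhood of $p'$ in $S'$. By convention each (relative) invariant either vanishes identically or vanishes nowhere ("$\ne0$"). Real cube roots are used in fractional powers. $$\mathsf S=\frac{F_{xx}F_{xxy}-F_{xy}F_{xxx}}{F_{xx}^2},\qquad \mathsf W=\frac{F_{xx}^2F_{xxxy}-F_{xx}F_{xy}F_{xxxx}+2F_{xy}F_{xxx}^2-2F_{xx}F_{xxx}F_{xxy}}{F_{xx}^2(F_{xx}F_{xxy}-F_{xy}F_{xxx})^{2/3}}.$$ With $F_k:=\partial_x^kF$, $$\mathsf Y=\frac1{18}\frac{(F_{xxy}F_{xx}-F_{xxx}F_{xy})^{5/3}}{F_2^{10}\,(9F_5F_2^2-45F_3F_4F_2+40F_3^3)}\Big\{11200F_3^8-12600F_3^3F_5F_2^3F_4+13230F_3F_5F_2^4F_4^2+1134F_3F_5F_2^5F_6-3150F_3^2F_4F_2^4F_6-810F_7F_2^5F_3F_4-33600F_3^6F_4F_2-7875F_3^2F_4^3F_2^3-756F_3^2F_5^2F_2^4+6720F_3^5F_5F_2^2+31500F_3^4F_4^2F_2^2-4725F_4^4F_2^4-189F_6^2F_2^6+1890F_4^2F_2^5F_6-2835F_4F_2^5F_5^2+162F_7F_2^6F_5+720F_7F_2^4F_3^3\Big\}.$$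 In this branch every partial derivative of $F$ of order $\le n$ is a rational expression in $F_y,F_{xy},F_{xxy}$ and $\{F_{x^j}\}_{j\le n}$ (denominators powers of $F_{xx}$). A differential invariant of order at most $n$ is a (locally defined, analytic) function of $x,y$ and these derivatives which takes equal values at corresponding points whenever an element of $\mathsf{SA}_3(\mathbb{R})$ (close to the identity) maps one surface of the branch to another. *)

theory Defs
  imports "HOL-Analysis.Analysis"
begin

section \<open>Real-analytic functions\<close>

text \<open>The multi-indices are the extensional functions from \<^term>\<open>Basis\<close> to the natural numbers.\<close>

definition real_analytic_at :: "('a::euclidean_space \<Rightarrow> real) \<Rightarrow> 'a \<Rightarrow> bool" where
  "real_analytic_at f p \<longleftrightarrow>
     (\<exists>c r. r > 0 \<and> (\<forall>z\<in>ball p r.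
        ((\<lambda>\<alpha>. c \<alpha> * (\<Prod>b\<in>Basis. ((z - p) \<bullet> b) ^ \<alpha> b)) has_sum f z)
          (Basis \<rightarrow>\<^sub>E (UNIV :: nat set))))"

section \<open>Graphed surfaces, special affine maps and equivalence of germs\<close>

definition graph_pt :: "(real \<times> real \<Rightarrow> real) \<Rightarrow> real \<times> real \<Rightarrow> real ^ 3" where
  "graph_pt F z = vector [fst z, snd z, F z]"

definition graph_surf :: "(real \<times> real \<Rightarrow> real) \<Rightarrow> (real \<times> real) set \<Rightarrow> (real ^ 3) set" where
  "graph_surf F D = graph_pt F ` D"

definition affine_map :: "real ^ 3 ^ 3 \<Rightarrow> real ^ 3 \<Rightarrow> real ^ 3 \<Rightarrow> real ^ 3" where
  "affine_map A b q = A *v q + b"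

definition maps_germ ::
    "(real ^ 3 \<Rightarrow> real ^ 3) \<Rightarrow> (real ^ 3) set \<Rightarrow> real ^ 3 \<Rightarrow> (real ^ 3) set \<Rightarrow> real ^ 3 \<Rightarrow> bool" where
  "maps_germ g S p S' p' \<longleftrightarrow>
     g p = p' \<and>
     (\<exists>U U'. openin (top_of_set S) U \<and> p \<in> U \<and> openin (top_of_set S') U' \<and> p' \<in> U' \<and> g ` U = U')"

definition SA3_equiv ::
    "(real ^ 3) set \<Rightarrow> real ^ 3 \<Rightarrow> (real ^ 3) set \<Rightarrow> real ^ 3 \<Rightarrow> bool" where
  "SA3_equiv S p S' p' \<longleftrightarrow> (\<exists>A b. det A = 1 \<and> maps_germ (affine_map A b) S p S' p')"

section \<open>Partial derivatives and the relative invariants\<close>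

definition dx :: "(real \<times> real \<Rightarrow> real) \<Rightarrow> real \<times> real \<Rightarrow> real" where
  "dx F = (\<lambda>(x, y). deriv (\<lambda>t. F (t, y)) x)"

definition dy :: "(real \<times> real \<Rightarrow> real) \<Rightarrow> real \<times> real \<Rightarrow> real" where
  "dy F = (\<lambda>(x, y). deriv (\<lambda>t. F (x, t)) y)"

definition pd :: "nat \<Rightarrow> nat \<Rightarrow> (real \<times> real \<Rightarrow> real) \<Rightarrow> real \<times> real \<Rightarrow> real" where
  "pd j k F = (dx ^^ j) ((dy ^^ k) F)"

definition inv_S :: "(real \<times> real \<Rightarrow> real) \<Rightarrow> real \<times> real \<Rightarrow> real" where
  "inv_S F z =
     (pd 2 0 F z * pd 2 1 F z - pd 1 1 F z * pd 3 0 F z) / (pd 2 0 F z) ^ 2"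

text \<open>\<^term>\<open>root 3\<close> is the real (odd) cube root, also for negative arguments.\<close>

definition inv_W :: "(real \<times> real \<Rightarrow> real) \<Rightarrow> real \<times> real \<Rightarrow> real" where
  "inv_W F z =
     ((pd 2 0 F z) ^ 2 * pd 3 1 F z - pd 2 0 F z * pd 1 1 F z * pd 4 0 F z
        + 2 * pd 1 1 F z * (pd 3 0 F z) ^ 2 - 2 * pd 2 0 F z * pd 3 0 F z * pd 2 1 F z)
     / ((pd 2 0 F z) ^ 2
        * (root 3 (pd 2 0 F z * pd 2 1 F z - pd 1 1 F z * pd 3 0 F z)) ^ 2)"

definition inv_Y :: "(real \<times> real \<Rightarrow> real) \<Rightarrow> real \<times> real \<Rightarrow> real" where
  "inv_Y F z =
     (let Fxy = pd 1 1 F z; Fxxy = pd 2 1 F z;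
          F2 = pd 2 0 F z; F3 = pd 3 0 F z; F4 = pd 4 0 F z;
          F5 = pd 5 0 F z; F6 = pd 6 0 F z; F7 = pd 7 0 F z
      in 1 / 18
         * ((root 3 (Fxxy * F2 - F3 * Fxy)) ^ 5
            / (F2 ^ 10 * (9 * F5 * F2 ^ 2 - 45 * F3 * F4 * F2 + 40 * F3 ^ 3)))
         * (11200 * F3 ^ 8
            - 12600 * F3 ^ 3 * F5 * F2 ^ 3 * F4
            + 13230 * F3 * F5 * F2 ^ 4 * F4 ^ 2
            + 1134 * F3 * F5 * F2 ^ 5 * F6
            - 3150 * F3 ^ 2 * F4 * F2 ^ 4 * F6
            - 810 * F7 * F2 ^ 5 * F3 * F4
            - 33600 * F3 ^ 6 * F4 * F2
            - 7875 * F3 ^ 2 * F4 ^ 3 * F2 ^ 3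
            - 756 * F3 ^ 2 * F5 ^ 2 * F2 ^ 4
            + 6720 * F3 ^ 5 * F5 * F2 ^ 2
            + 31500 * F3 ^ 4 * F4 ^ 2 * F2 ^ 2
            - 4725 * F4 ^ 4 * F2 ^ 4
            - 189 * F6 ^ 2 * F2 ^ 6
            + 1890 * F4 ^ 2 * F2 ^ 5 * F6
            - 2835 * F4 * F2 ^ 5 * F5 ^ 2
            + 162 * F7 * F2 ^ 6 * F5
            + 720 * F7 * F2 ^ 4 * F3 ^ 3))"

section \<open>The branch\<close>

definition in_branch :: "(real \<times> real) set \<Rightarrow> (real \<times> real \<Rightarrow> real) \<Rightarrow> bool" where
  "in_branch D F \<longleftrightarrow>
     open D \<and>
     (\<forall>z\<in>D. real_analytic_at F z \<and>
        pd 2 0 F z \<noteq> 0 \<and> pd 2 0 F z * pd 0 2 F z - (pd 1 1 F z) ^ 2 = 0 \<and>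
        inv_S F z \<noteq> 0 \<and> inv_W F z = 0)"

section \<open>Differential invariants of order at most five\<close>

text \<open>In the branch the jets of order at most five are parametrized by the eleven quantities
  \<open>(x, y, F\<^sub>y, F\<^sub>x\<^sub>y, F\<^sub>x\<^sub>x\<^sub>y, F, F\<^sub>x, F\<^sub>x\<^sub>x, \<dots>, \<partial>\<^sub>x\<^sup>5 F)\<close>, listed in this order.\<close>

type_synonym jet5 =
  "real \<times> real \<times> real \<times> real \<times> real \<times> real \<times> real \<times> real \<times> real \<times> real \<times> real"

definition jet5 :: "(real \<times> real \<Rightarrow> real) \<Rightarrow> real \<times> real \<Rightarrow> jet5" where
  "jet5 F z =
     (fst z, snd z, pd 0 1 F z, pd 1 1 F z, pd 2 1 F z,
      F z, pd 1 0 F z, pd 2 0 F z, pd 3 0 F z, pd 4 0 F z, pd 5 0 F z)"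

text \<open>The equations defining the branch only serve to express the remaining derivatives through
  these coordinates, so that among the latter only the two inequations have to be imposed.\<close>

definition branch_jets :: "jet5 set" where
  "branch_jets =
     {(x, y, Fy, Fxy, Fxxy, F0, F1, F2, F3, F4, F5). F2 \<noteq> 0 \<and> F2 * Fxxy - Fxy * F3 \<noteq> 0}"

text \<open>An invariant \<open>I\<close> is defined on an open set \<open>U\<close> of jets; how close to the identity the group
  element has to be may depend on the jet.\<close>

definition diff_invariant5 :: "jet5 set \<Rightarrow> (jet5 \<Rightarrow> real) \<Rightarrow> bool" where
  "diff_invariant5 U I \<longleftrightarrow>
     open U \<and> U \<subseteq> branch_jets \<and> (\<forall>w\<in>U. real_analytic_at I w) \<and>
     (\<forall>w\<in>U. \<exists>\<epsilon>>0. \<forall>A b D F z D' F' z'.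
        det A = 1 \<and> norm (A - mat 1) < \<epsilon> \<and> norm b < \<epsilon> \<and>
        in_branch D F \<and> z \<in> D \<and> in_branch D' F' \<and> z' \<in> D' \<and>
        maps_germ (affine_map A b)
          (graph_surf F D) (graph_pt F z) (graph_surf F' D') (graph_pt F' z') \<and>
        jet5 F z = w \<and> jet5 F' z' \<in> U
        \<longrightarrow> I (jet5 F' z') = I w)"

definition X_jet :: "jet5 \<Rightarrow> real" where
  "X_jet = (\<lambda>(x, y, Fy, Fxy, Fxxy, F0, F1, F2, F3, F4, F5).
     1 / 9 * (((F2 * Fxxy - Fxy * F3) * (9 * F2 ^ 2 * F5 - 45 * F2 * F3 * F4 + 40 * F3 ^ 3))
              / F2 ^ 6))"

definition inv_X :: "(real \<times> real \<Rightarrow> real) \<Rightarrow> real \<times> real \<Rightarrow> real" where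
  "inv_X F z = X_jet (jet5 F z)"

section \<open>The model and the normal form\<close>

definition model :: "real \<times> real \<Rightarrow> real" where
  "model = (\<lambda>(x, y). 1 / 2 * (x ^ 2 / (1 - y)))"

text \<open>The remainder coefficients \<open>c j k\<close> are plain power series coefficients, without
  factorials.\<close>

definition normal_expansion ::
    "(real \<times> real \<Rightarrow> real) \<Rightarrow> real \<Rightarrow> real \<Rightarrow> (nat \<Rightarrow> nat \<Rightarrow> real) \<Rightarrow> bool" where
  "normal_expansion G a5 a7 c \<longleftrightarrow>
     (\<exists>r>0. \<forall>x y. \<bar>x\<bar> < r \<and> \<bar>y\<bar> < r \<longrightarrow>
        ((\<lambda>(j, k). c j k * x ^ j * y ^ k) has_sum
           (G (x, y)
            - (x ^ 2 / 2 + x ^ 2 * y / 2 + x ^ 2 * y ^ 2 / 2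
               + a5 * x ^ 5 / 120 + x ^ 2 * y ^ 3 / 2
               + 4 * a5 * (x ^ 5 * y) / 120 + x ^ 2 * y ^ 4 / 2
               + a7 * x ^ 7 / 5040 + 20 * a5 * (x ^ 5 * y ^ 2) / 240 + x ^ 2 * y ^ 5 / 2)))
          {(j, k). j + k \<ge> 8})"

definition normal_germ ::
    "(real \<times> real) set \<Rightarrow> (real \<times> real \<Rightarrow> real) \<Rightarrow> real \<Rightarrow> real \<Rightarrow> (nat \<Rightarrow> nat \<Rightarrow> real) \<Rightarrow> bool" where
  "normal_germ D G a5 a7 c \<longleftrightarrow>
     in_branch D G \<and> (\<forall>z\<in>D. inv_X G z \<noteq> 0) \<and> (0, 0) \<in> D \<and>
     normal_expansion G a5 a7 c \<and> a5 = inv_X G (0, 0) \<and> a7 = inv_Y G (0, 0)"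

end

theory Submission
  imports Defs "HOL-Complex_Analysis.Complex_Analysis"
begin

text \<open>On a branch surface the function \<open>q = F\<^sub>x\<^sub>y / F\<^sub>x\<^sub>x\<close> satisfies \<open>q\<^sub>y = q q\<^sub>x\<close>, \<open>q\<^sub>x \<noteq> 0\<close> and \<open>q\<^sub>x\<^sub>x = 0\<close>, so that
  \<open>q = (x - x\<^sub>0) / (y\<^sub>0 - y)\<close> and all rulings pass through one vertex: the surface is a cone over a curve
  \<open>u = \<phi>(s)\<close>. An affine map between cones matches the vertices, which leaves an equivalence problem for
  plane curves under projective maps. Moving the osculating conic to \<open>u = s\<^sup>2/2\<close> makes
  the fifth derivative of the curve equal to \<open>X\<close>. If \<open>X = 0\<close> identically, Monge's equation says that the curve
  is a conic. If \<open>X \<noteq> 0\<close>, the one-parameter group fixing the conic and the base point is used up by making the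
  sixth derivative vanish; the seventh derivative becomes \<open>Y\<close>, and the remaining Taylor coefficients
  are unique. Finally, branch jets of order five with equal \<open>X\<close> arise from one cone by affine maps depending
  continuously on the jet, so that an invariant of order five is locally constant on the level sets of \<open>X\<close>.\<close>

section \<open>Power series in several variables\<close>

text \<open>Why order five carries exactly one invariant: the jets form an 11-dimensional space and
  SA_3 has dimension 11, but the subgroup that fixes the vertex, the base point and the osculating
  conic is one-dimensional and does not change the fifth derivative, so it fixes the whole 5-jet.
  The orbits have codimension one, and order six is the first in which the last parameter can be
  spent. Working with determinant 1 instead of up to scale fixes the scaling of the curve by a
  condition \<alpha>^3 = const; it has one real solution, and this is the source of the cube root in
  Y. Two obstacles shape the proof. Equivalence of germs only speaks of relatively open pieces of
  graphs, so an affine map must be shown unable to carry a piece of one cone into another without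
  matching the vertices; this rests on the nonvanishing second derivative of the curve. And
  invariants are functions of eleven variables, analytic in the sense of unordered power series, so
  composition, division and restriction to a line are needed for such series, the last to make I an
  analytic function of X.\<close>

definition midx :: "('a::euclidean_space \<Rightarrow> nat) set" where
  "midx = Basis \<rightarrow>\<^sub>E UNIV"

definition mon :: "('a::euclidean_space \<Rightarrow> nat) \<Rightarrow> 'a \<Rightarrow> real" where
  "mon \<alpha> h = (\<Prod>b\<in>Basis. (h \<bullet> b) ^ \<alpha> b)"

definition mdeg :: "('a::euclidean_space \<Rightarrow> nat) \<Rightarrow> nat" where
  "mdeg \<alpha> = (\<Sum>b\<in>Basis. \<alpha> b)"

definition madd :: "('a::euclidean_space \<Rightarrow> nat) \<Rightarrow> ('a \<Rightarrow> nat) \<Rightarrow> 'a \<Rightarrow> nat" where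
  "madd \<alpha> \<beta> = (\<lambda>b\<in>Basis. \<alpha> b + \<beta> b)"

definition mzero :: "'a::euclidean_space \<Rightarrow> nat" where
  "mzero = (\<lambda>b\<in>Basis. 0)"

text \<open>Absolute summability is asked at the corner of a closed coordinate box instead of on a
  ball: every point of the box is then dominated by the one weighted sum \<open>pnorm R c\<close>,
  and this norm is submultiplicative.\<close>

definition pser :: "(('a::euclidean_space \<Rightarrow> nat) \<Rightarrow> real) \<Rightarrow> real \<Rightarrow> ('a \<Rightarrow> real) \<Rightarrow> 'a \<Rightarrow> bool" where
  "pser c R f p \<longleftrightarrow> R > 0 \<and> (\<lambda>\<alpha>. \<bar>c \<alpha>\<bar> * R ^ mdeg \<alpha>) summable_on midx \<and>
     (\<forall>h. (\<forall>b\<in>Basis. \<bar>h \<bullet> b\<bar> \<le> R) \<longrightarrow> ((\<lambda>\<alpha>. c \<alpha> * mon \<alpha> h) has_sum f (p + h)) midx)"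

definition pnorm :: "real \<Rightarrow> (('a::euclidean_space \<Rightarrow> nat) \<Rightarrow> real) \<Rightarrow> real" where
  "pnorm R c = (\<Sum>\<^sub>\<infinity>\<alpha>\<in>midx. \<bar>c \<alpha>\<bar> * R ^ mdeg \<alpha>)"

lemma madd_in_midx [simp]: "madd \<alpha> \<beta> \<in> midx"
  by (auto simp: midx_def madd_def)

lemma mon_madd: "mon (madd \<alpha> \<beta>) h = mon \<alpha> h * mon \<beta> h"
  by (simp add: mon_def madd_def power_add prod.distrib)

lemma mdeg_madd: "mdeg (madd \<alpha> \<beta>) = mdeg \<alpha> + mdeg \<beta>"
  by (simp add: mdeg_def madd_def sum.distrib)

lemma abs_mon_le:
  assumes "\<And>b. b \<in> Basis \<Longrightarrow> \<bar>h \<bullet> b\<bar> \<le> R"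
  shows "\<bar>mon \<alpha> h\<bar> \<le> R ^ mdeg \<alpha>"
  unfolding mon_def mdeg_def abs_prod power_sum
  by (rule prod_mono) (auto simp: power_abs assms intro!: power_mono)

lemma has_sum_fibres:
  fixes f :: "'i \<Rightarrow> real"
  assumes "(f has_sum S) I" "\<And>i. i \<in> I \<Longrightarrow> \<pi> i \<in> M"
  shows "((\<lambda>m. \<Sum>\<^sub>\<infinity>i\<in>{i\<in>I. \<pi> i = m}. f i) has_sum S) M"
proof -
  have "((\<lambda>(m, i). f i) has_sum S) (Sigma M (\<lambda>m. {i\<in>I. \<pi> i = m}))"
    using assms
    by (subst has_sum_reindex_bij_witness[where i="\<lambda>i. (\<pi> i, i)" and j=snd and T=I and h=f and s'=S]) auto
  thus ?thesis
    using assms(1) has_sum_imp_summable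
    by (rule_tac has_sum_Sigma') (auto intro!: has_sum_infsum intro: summable_on_subset_banach)
qed

lemma summable_on_mon_bound:
  assumes "(\<lambda>i. \<bar>\<kappa> i\<bar> * R ^ mdeg (\<pi> i)) summable_on I"
    and "\<And>b. b \<in> Basis \<Longrightarrow> \<bar>h \<bullet> b\<bar> \<le> R"
  shows "(\<lambda>i. \<bar>\<kappa> i * mon (\<pi> i) h\<bar>) summable_on I" "(\<lambda>i. \<kappa> i * mon (\<pi> i) h) summable_on I"
proof -
  show *: "(\<lambda>i. \<bar>\<kappa> i * mon (\<pi> i) h\<bar>) summable_on I"
    using assms(1)
    by (rule summable_on_comparison_test)
       (auto simp: abs_mult intro!: mult_left_mono abs_mon_le assms(2))
  show "(\<lambda>i. \<kappa> i * mon (\<pi> i) h) summable_on I"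
    using * summable_on_iff_abs_summable_on_real[of "\<lambda>i. \<kappa> i * mon (\<pi> i) h"] by simp
qed

text \<open>The regrouping principle behind products, compositions, the change to double series and
  restriction to lines: a family of monomial terms with an arbitrary index set, absolutely summable
  at the corner, becomes a power series by adding the coefficients over each fibre of \<pi>.\<close>

lemma pser_indexed:
  fixes \<pi> :: "'i \<Rightarrow> 'a::euclidean_space \<Rightarrow> nat"
  assumes R: "R > 0" and \<pi>: "\<And>i. i \<in> I \<Longrightarrow> \<pi> i \<in> midx"
    and S: "(\<lambda>i. \<bar>\<kappa> i\<bar> * R ^ mdeg (\<pi> i)) summable_on I"
    and f: "\<And>h. (\<And>b. b \<in> Basis \<Longrightarrow> \<bar>h \<bullet> b\<bar> \<le> R) \<Longrightarrow> ((\<lambda>i. \<kappa> i * mon (\<pi> i) h) has_sum f (p + h)) I"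
  defines "c \<equiv> (\<lambda>\<alpha>. \<Sum>\<^sub>\<infinity>i\<in>{i\<in>I. \<pi> i = \<alpha>}. \<kappa> i)"
  shows "pser c R f p" "pnorm R c \<le> (\<Sum>\<^sub>\<infinity>i\<in>I. \<bar>\<kappa> i\<bar> * R ^ mdeg (\<pi> i))"
proof -
  let ?F = "\<lambda>\<alpha>. {i\<in>I. \<pi> i = \<alpha>}"
  have sub: "(\<lambda>i. \<bar>\<kappa> i\<bar> * R ^ mdeg (\<pi> i)) summable_on ?F \<alpha>" for \<alpha>
    by (rule summable_on_subset_banach[OF S]) auto
  have "(\<lambda>i. \<bar>\<kappa> i\<bar> * R ^ mdeg \<alpha>) summable_on ?F \<alpha>" for \<alpha>
    using sub[of \<alpha>] by (rule summable_on_cong[THEN iffD1, rotated]) auto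
  hence abs: "(\<lambda>i. \<bar>\<kappa> i\<bar>) summable_on ?F \<alpha>" for \<alpha>
    using R by (subst (asm) summable_on_cmult_left') auto
  hence fib: "\<kappa> summable_on ?F \<alpha>" for \<alpha>
    using summable_on_iff_abs_summable_on_real[of \<kappa>] by simp
  have tot: "((\<lambda>\<alpha>. \<Sum>\<^sub>\<infinity>i\<in>?F \<alpha>. \<bar>\<kappa> i\<bar> * R ^ mdeg (\<pi> i)) has_sum (\<Sum>\<^sub>\<infinity>i\<in>I. \<bar>\<kappa> i\<bar> * R ^ mdeg (\<pi> i))) midx"
    using has_sum_infsum[OF S] \<pi> by (rule has_sum_fibres)
  have le: "\<bar>c \<alpha>\<bar> * R ^ mdeg \<alpha> \<le> (\<Sum>\<^sub>\<infinity>i\<in>?F \<alpha>. \<bar>\<kappa> i\<bar> * R ^ mdeg (\<pi> i))" for \<alpha>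
  proof -
    have "\<bar>c \<alpha>\<bar> \<le> (\<Sum>\<^sub>\<infinity>i\<in>?F \<alpha>. \<bar>\<kappa> i\<bar>)"
      unfolding c_def using norm_infsum_bound[of \<kappa> "?F \<alpha>"] abs by simp
    hence "\<bar>c \<alpha>\<bar> * R ^ mdeg \<alpha> \<le> (\<Sum>\<^sub>\<infinity>i\<in>?F \<alpha>. \<bar>\<kappa> i\<bar>) * R ^ mdeg \<alpha>"
      using R by (intro mult_right_mono) auto
    also have "\<dots> = (\<Sum>\<^sub>\<infinity>i\<in>?F \<alpha>. \<bar>\<kappa> i\<bar> * R ^ mdeg \<alpha>)"
      by (rule infsum_cmult_left'[symmetric])
    also have "\<dots> = (\<Sum>\<^sub>\<infinity>i\<in>?F \<alpha>. \<bar>\<kappa> i\<bar> * R ^ mdeg (\<pi> i))"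
      by (rule infsum_cong) auto
    finally show ?thesis .
  qed
  have sc: "(\<lambda>\<alpha>. \<bar>c \<alpha>\<bar> * R ^ mdeg \<alpha>) summable_on midx"
    using has_sum_imp_summable[OF tot] le by (rule summable_on_comparison_test) (use R in auto)
  show "pnorm R c \<le> (\<Sum>\<^sub>\<infinity>i\<in>I. \<bar>\<kappa> i\<bar> * R ^ mdeg (\<pi> i))"
    unfolding pnorm_def using has_sum_infsum[OF sc] tot le by (rule has_sum_mono)
  have "((\<lambda>\<alpha>. c \<alpha> * mon \<alpha> h) has_sum f (p + h)) midx" if h: "\<forall>b\<in>Basis. \<bar>h \<bullet> b\<bar> \<le> R" for h
  proof -
    have "((\<lambda>\<alpha>. \<Sum>\<^sub>\<infinity>i\<in>?F \<alpha>. \<kappa> i * mon (\<pi> i) h) has_sum f (p + h)) midx"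
      using f \<pi> h by (intro has_sum_fibres) auto
    also have "(\<lambda>\<alpha>. \<Sum>\<^sub>\<infinity>i\<in>?F \<alpha>. \<kappa> i * mon (\<pi> i) h) = (\<lambda>\<alpha>. \<Sum>\<^sub>\<infinity>i\<in>?F \<alpha>. \<kappa> i * mon \<alpha> h)"
      by (intro ext infsum_cong) auto
    also have "\<dots> = (\<lambda>\<alpha>. c \<alpha> * mon \<alpha> h)"
      unfolding c_def by (simp add: infsum_cmult_left')
    finally show ?thesis .
  qed
  thus "pser c R f p" using R sc unfolding pser_def by blast
qed

lemma pserD:
  assumes "pser c R f p"
  shows "R > 0" "(\<lambda>\<alpha>. \<bar>c \<alpha>\<bar> * R ^ mdeg \<alpha>) summable_on midx"
    "(\<And>b. b \<in> Basis \<Longrightarrow> \<bar>h \<bullet> b\<bar> \<le> R) \<Longrightarrow> ((\<lambda>\<alpha>. c \<alpha> * mon \<alpha> h) has_sum f (p + h)) midx"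
  using assms unfolding pser_def by auto

lemma pser_mono:
  assumes "pser c R f p" "0 < R'" "R' \<le> R"
  shows "pser c R' f p"
proof -
  note * = pserD[OF assms(1)]
  have "(\<lambda>\<alpha>. \<bar>c \<alpha>\<bar> * R' ^ mdeg \<alpha>) summable_on midx"
    using *(2) by (rule summable_on_comparison_test)
      (use assms in \<open>auto intro!: mult_left_mono power_mono\<close>)
  moreover have "((\<lambda>\<alpha>. c \<alpha> * mon \<alpha> h) has_sum f (p + h)) midx" if "\<forall>b\<in>Basis. \<bar>h \<bullet> b\<bar> \<le> R'" for h
    using that assms(3) by (intro *(3)) force
  ultimately show ?thesis using assms unfolding pser_def by simp
qed

text \<open>Unordered sums of reals converge absolutely, so convergence at the corner of a box
  inside the ball already gives the weighted summability.\<close>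

lemma real_analytic_at_iff_pser: "real_analytic_at f p \<longleftrightarrow> (\<exists>c R. pser c R f p)"
proof
  assume "real_analytic_at f p"
  then obtain c r where r: "r > 0" and
    c: "\<And>z. z \<in> ball p r \<Longrightarrow> ((\<lambda>\<alpha>. c \<alpha> * (\<Prod>b\<in>Basis. ((z - p) \<bullet> b) ^ \<alpha> b)) has_sum f z) midx"
    unfolding real_analytic_at_def midx_def by blast
  \<comment> \<open>If all coordinates of h are at most R in absolute value, then the norm of h is
    at most DIM('a) times R, that is r/2, so the box lies inside the ball.\<close>
  define R where "R = r / (2 * DIM('a))"
  have R: "R > 0" using r by (simp add: R_def DIM_positive)
  have box: "((\<lambda>\<alpha>. c \<alpha> * mon \<alpha> h) has_sum f (p + h)) midx" if "\<And>b. b \<in> Basis \<Longrightarrow> \<bar>h \<bullet> b\<bar> \<le> R" for h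
  proof -
    have "norm h \<le> (\<Sum>b\<in>Basis. \<bar>h \<bullet> b\<bar>)" by (rule norm_le_l1)
    also have "\<dots> \<le> (\<Sum>b\<in>(Basis::'a set). R)" by (rule sum_mono) (rule that)
    also have "\<dots> = r / 2" by (simp add: R_def)
    also have "\<dots> < r" using r by simp
    finally have "p + h \<in> ball p r" by (simp add: dist_norm)
    from c[OF this] show ?thesis by (simp add: mon_def)
  qed
  define h0 :: 'a where "h0 = (\<Sum>b\<in>Basis. R *\<^sub>R b)"
  have h0: "h0 \<bullet> b = R" if "b \<in> Basis" for b
    using that by (simp add: h0_def inner_sum_left inner_Basis if_distrib cong: if_cong)
  have mon0: "mon \<alpha> h0 = R ^ mdeg \<alpha>" for \<alpha>
    by (simp add: mon_def mdeg_def h0 power_sum)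
  have "(\<lambda>\<alpha>. c \<alpha> * mon \<alpha> h0) summable_on midx"
    by (rule has_sum_imp_summable[OF box]) (use h0 R in simp)
  hence "(\<lambda>\<alpha>. norm (c \<alpha> * mon \<alpha> h0)) summable_on midx"
    by (rule summable_on_iff_abs_summable_on_real[THEN iffD1])
  hence "(\<lambda>\<alpha>. \<bar>c \<alpha>\<bar> * R ^ mdeg \<alpha>) summable_on midx"
    using R by (simp add: mon0 abs_mult)
  hence "pser c R f p" using R box by (auto simp: pser_def)
  thus "\<exists>c R. pser c R f p" by blast
next
  assume "\<exists>c R. pser c R f p"
  then obtain c R where c: "pser c R f p" by blast
  show "real_analytic_at f p"
    unfolding real_analytic_at_def
  proof (rule exI[of _ c], rule exI[of _ R], intro conjI ballI)
    show "R > 0" using pserD(1)[OF c] .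
    fix z assume z: "z \<in> ball p R"
    have "\<bar>(z - p) \<bullet> b\<bar> \<le> R" if "b \<in> Basis" for b
      using Basis_le_norm[OF that, of "z - p"] z by (simp add: dist_norm norm_minus_commute)
    from pserD(3)[OF c, of "z - p", OF this]
    show "((\<lambda>\<alpha>. c \<alpha> * (\<Prod>b\<in>Basis. ((z - p) \<bullet> b) ^ \<alpha> b)) has_sum f z) (Basis \<rightarrow>\<^sub>E UNIV)"
      by (simp add: mon_def midx_def)
  qed
qed

lemma pser_add:
  assumes "pser c R f p" "pser d R g p"
  shows "pser (\<lambda>\<alpha>. c \<alpha> + d \<alpha>) R (\<lambda>z. f z + g z) p"
proof -
  note 1 = pserD[OF assms(1)] and 2 = pserD[OF assms(2)]
  have "(\<lambda>\<alpha>. \<bar>c \<alpha> + d \<alpha>\<bar> * R ^ mdeg \<alpha>) summable_on midx"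
    using summable_on_add[OF 1(2) 2(2)]
    by (rule summable_on_comparison_test)
       (use 1(1) in \<open>auto simp flip: distrib_right intro!: mult_right_mono\<close>)
  thus ?thesis using 1 2 unfolding pser_def by (auto simp: distrib_right intro!: has_sum_add)
qed

lemma mzero_in_midx [simp]: "mzero \<in> midx" by (auto simp: midx_def mzero_def)

lemma mdeg_mzero [simp]: "mdeg mzero = 0" by (simp add: mdeg_def mzero_def)

lemma mon_mzero [simp]: "mon mzero h = 1" by (simp add: mon_def mzero_def)

lemma mdeg_eq_0_iff: "\<alpha> \<in> midx \<Longrightarrow> mdeg \<alpha> = 0 \<longleftrightarrow> \<alpha> = mzero"
  by (auto simp: mdeg_def mzero_def midx_def intro: PiE_ext[where k=Basis and s="\<lambda>_. UNIV"])

lemma pser_const: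
  fixes p :: "'a::euclidean_space"
  assumes "R > 0"
  shows "pser (\<lambda>\<alpha>. if \<alpha> = mzero then a else 0) R (\<lambda>_. a) p"
    and "pnorm R (\<lambda>\<alpha>::'a \<Rightarrow> nat. if \<alpha> = mzero then a else 0) = \<bar>a\<bar>"
proof -
  have 1: "((\<lambda>\<alpha>. \<bar>if \<alpha> = mzero then a else 0\<bar> * R ^ mdeg \<alpha>) has_sum \<bar>a\<bar>) midx"
    by (rule has_sum_finite_neutralI[where B="{mzero}"]) auto
  have 2: "((\<lambda>\<alpha>. (if \<alpha> = mzero then a else 0) * mon \<alpha> h) has_sum a) midx" for h
    by (rule has_sum_finite_neutralI[where B="{mzero}"]) auto
  show "pser (\<lambda>\<alpha>. if \<alpha> = mzero then a else 0) R (\<lambda>_. a) p"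
    using assms has_sum_imp_summable[OF 1] 2 unfolding pser_def by blast
  show "pnorm R (\<lambda>\<alpha>. if \<alpha> = mzero then a else 0) = \<bar>a\<bar>"
    unfolding pnorm_def using 1 by (rule infsumI)
qed

text \<open>Cauchy product: pairs (\<alpha>, \<beta>) are regrouped by their sum. The norm bound is
  recorded because a composition must control all powers of one series on the same box.\<close>

lemma pser_mult:
  assumes "pser c R f p" "pser d R g p"
  shows "\<exists>e. pser e R (\<lambda>z. f z * g z) p \<and> pnorm R e \<le> pnorm R c * pnorm R d"
proof -
  note 1 = pserD[OF assms(1)] and 2 = pserD[OF assms(2)]
  let ?\<kappa> = "\<lambda>(\<alpha>, \<beta>). c \<alpha> * d \<beta>" and ?\<pi> = "\<lambda>(\<alpha>, \<beta>). madd \<alpha> \<beta>"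
  have prod: "((\<lambda>(\<alpha>, \<beta>). u \<alpha> * v \<beta>) has_sum (infsum u midx * infsum v midx)) (midx \<times> midx)"
    if "(\<lambda>\<alpha>. \<bar>u \<alpha>\<bar>) summable_on midx" "(\<lambda>\<alpha>. \<bar>v \<alpha>\<bar>) summable_on midx" for u v :: "('a \<Rightarrow> nat) \<Rightarrow> real"
  proof -
    have su: "u summable_on midx" "v summable_on midx"
      using that summable_on_iff_abs_summable_on_real[of u] summable_on_iff_abs_summable_on_real[of v] by simp_all
    have "(\<lambda>x. norm ((\<lambda>(\<alpha>, \<beta>). u \<alpha> * v \<beta>) x)) summable_on (midx \<times> midx)"
    proof (rule Infinite_Sum.abs_summable_on_Sigma_iff[THEN iffD2], intro conjI ballI)
      show "(\<lambda>\<beta>. norm ((\<lambda>(\<alpha>, \<beta>). u \<alpha> * v \<beta>) (\<alpha>, \<beta>))) summable_on midx" for \<alpha>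
        using summable_on_cmult_right[OF that(2), of "\<bar>u \<alpha>\<bar>"] by (simp add: abs_mult)
      have "(\<lambda>\<alpha>. \<bar>u \<alpha>\<bar> * infsum (\<lambda>\<beta>. \<bar>v \<beta>\<bar>) midx) summable_on midx"
        by (rule summable_on_cmult_left[OF that(1)])
      moreover have "infsum (\<lambda>\<beta>. \<bar>v \<beta>\<bar>) midx \<ge> 0" by (rule infsum_nonneg) auto
      ultimately show "(\<lambda>\<alpha>. norm (infsum (\<lambda>\<beta>. norm ((\<lambda>(\<alpha>, \<beta>). u \<alpha> * v \<beta>) (\<alpha>, \<beta>))) midx)) summable_on midx"
        by (simp add: abs_mult infsum_cmult_right')
    qed
    hence "(\<lambda>(\<alpha>, \<beta>). u \<alpha> * v \<beta>) summable_on (midx \<times> midx)" by (rule abs_summable_summable)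
    moreover have "((\<lambda>\<beta>. (\<lambda>(\<alpha>, \<beta>). u \<alpha> * v \<beta>) (\<alpha>, \<beta>)) has_sum (u \<alpha> * infsum v midx)) midx" for \<alpha>
      using has_sum_cmult_right[OF has_sum_infsum[OF su(2)]] by simp
    moreover have "((\<lambda>\<alpha>. u \<alpha> * infsum v midx) has_sum (infsum u midx * infsum v midx)) midx"
      using has_sum_cmult_left[OF has_sum_infsum[OF su(1)]] by simp
    ultimately show ?thesis by (intro has_sum_SigmaI) auto
  qed
  have abs: "((\<lambda>i. \<bar>?\<kappa> i\<bar> * R ^ mdeg (?\<pi> i)) has_sum (pnorm R c * pnorm R d)) (midx \<times> midx)"
  proof -
    have "(\<lambda>\<alpha>. \<bar>\<bar>c \<alpha>\<bar> * R ^ mdeg \<alpha>\<bar>) summable_on midx" "(\<lambda>\<alpha>. \<bar>\<bar>d \<alpha>\<bar> * R ^ mdeg \<alpha>\<bar>) summable_on midx"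
      using 1 2 by (simp_all add: abs_mult)
    from prod[OF this] show ?thesis
      unfolding pnorm_def
      by (rule has_sum_cong[THEN iffD1, rotated]) (auto simp: mdeg_madd power_add abs_mult)
  qed
  have f: "((\<lambda>i. ?\<kappa> i * mon (?\<pi> i) h) has_sum (f (p + h) * g (p + h))) (midx \<times> midx)"
    if h: "\<And>b. b \<in> Basis \<Longrightarrow> \<bar>h \<bullet> b\<bar> \<le> R" for h
  proof -
    have "infsum (\<lambda>\<alpha>. c \<alpha> * mon \<alpha> h) midx = f (p + h)" "infsum (\<lambda>\<alpha>. d \<alpha> * mon \<alpha> h) midx = g (p + h)"
      using 1(3)[OF h] 2(3)[OF h] by (auto intro!: infsumI)
    with prod[OF summable_on_mon_bound(1)[OF 1(2) h] summable_on_mon_bound(1)[OF 2(2) h]]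
    have "((\<lambda>(\<alpha>, \<beta>). c \<alpha> * mon \<alpha> h * (d \<beta> * mon \<beta> h)) has_sum f (p + h) * g (p + h)) (midx \<times> midx)"
      by simp
    thus ?thesis by (rule has_sum_cong[THEN iffD1, rotated]) (auto simp: mon_madd)
  qed
  have "?\<pi> i \<in> midx" for i by (cases i) auto
  from pser_indexed[where \<kappa>="?\<kappa>" and \<pi>="?\<pi>" and R=R and I="midx \<times> midx" and p=p and f="\<lambda>z. f z * g z", OF 1(1) this has_sum_imp_summable[OF abs] f]
  show ?thesis unfolding infsumI[OF abs] by blast
qed

lemma pser_power:
  fixes p :: "'a::euclidean_space"
  assumes "pser c R f p"
  shows "\<exists>e. pser e R (\<lambda>z. f z ^ n) p \<and> pnorm R e \<le> pnorm R c ^ n"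
proof (induction n)
  case 0
  note R = pserD(1)[OF assms]
  have "pser (\<lambda>\<alpha>. if \<alpha> = mzero then 1 else 0) R (\<lambda>_. 1) p"
    "pnorm R (\<lambda>\<alpha>::'a \<Rightarrow> nat. if \<alpha> = mzero then 1 else 0) = \<bar>1\<bar>"
    by (rule pser_const[OF R])+
  thus ?case by (intro exI conjI) auto
next
  case (Suc n)
  then obtain e where e: "pser e R (\<lambda>z. f z ^ n) p" "pnorm R e \<le> pnorm R c ^ n" by blast
  from pser_mult[OF assms e(1)] obtain e' where
    e': "pser e' R (\<lambda>z. f z * f z ^ n) p" "pnorm R e' \<le> pnorm R c * pnorm R e" by blast
  have "pnorm R c \<ge> 0" unfolding pnorm_def using pserD(1)[OF assms] by (intro infsum_nonneg) auto
  hence "pnorm R c * pnorm R e \<le> pnorm R c ^ Suc n" using e(2) by (simp add: mult_left_mono)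
  thus ?case using e' by (intro exI[of _ e']) auto
qed

text \<open>Shrinking the box by \<theta> \<le> 1 multiplies each nonconstant term by \<theta>^deg
  \<le> \<theta>, so the norm comes arbitrarily close to the constant coefficient alone.\<close>

lemma pser_small_norm:
  fixes c :: "('a::euclidean_space \<Rightarrow> nat) \<Rightarrow> real"
  assumes "pser c R f p" "e > 0"
  shows "\<exists>R'>0. R' \<le> R \<and> pnorm R' c \<le> \<bar>c mzero\<bar> + e"
proof -
  note 1 = pserD[OF assms(1)]
  have N: "pnorm R c \<ge> 0" unfolding pnorm_def using 1(1) by (intro infsum_nonneg) auto
  define \<theta> where "\<theta> = min 1 (e / (pnorm R c + 1))"
  have \<theta>: "0 < \<theta>" "\<theta> \<le> 1" "\<theta> * pnorm R c \<le> e"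
  proof -
    show "0 < \<theta>" "\<theta> \<le> 1" using assms(2) N by (auto simp: \<theta>_def)
    have "\<theta> * pnorm R c \<le> e / (pnorm R c + 1) * pnorm R c"
      using N by (intro mult_right_mono) (auto simp: \<theta>_def)
    also have "\<dots> \<le> e" using N assms(2) by (simp add: field_simps)
    finally show "\<theta> * pnorm R c \<le> e" .
  qed
  have R': "0 < \<theta> * R" "\<theta> * R \<le> R" using \<theta> 1(1) by (auto simp: mult_left_le_one_le)
  note 2 = pserD[OF pser_mono[OF assms(1) R']]
  have z: "((\<lambda>\<alpha>. if \<alpha> = mzero then \<bar>c mzero\<bar> else 0) has_sum \<bar>c mzero\<bar>) midx"
    by (rule has_sum_finite_neutralI[where B="{mzero}"]) auto
  have "((\<lambda>\<alpha>. (if \<alpha> = mzero then \<bar>c mzero\<bar> else 0) + \<theta> * (\<bar>c \<alpha>\<bar> * R ^ mdeg \<alpha>)) has_sum (\<bar>c mzero\<bar> + \<theta> * pnorm R c)) midx"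
    unfolding pnorm_def using 1(2) by (intro has_sum_add z has_sum_cmult_right has_sum_infsum)
  moreover have "\<bar>c \<alpha>\<bar> * (\<theta> * R) ^ mdeg \<alpha> \<le> (if \<alpha> = mzero then \<bar>c mzero\<bar> else 0) + \<theta> * (\<bar>c \<alpha>\<bar> * R ^ mdeg \<alpha>)"
    if "\<alpha> \<in> midx" for \<alpha>
  proof (cases "\<alpha> = mzero")
    case True
    thus ?thesis using \<theta> by auto
  next
    case False
    hence "mdeg \<alpha> \<noteq> 0"
      using that by (simp add: mdeg_eq_0_iff)
    hence "\<theta> ^ mdeg \<alpha> \<le> \<theta> ^ 1" using \<theta> by (intro power_decreasing) auto
    hence "\<theta> ^ mdeg \<alpha> * (\<bar>c \<alpha>\<bar> * R ^ mdeg \<alpha>) \<le> \<theta> * (\<bar>c \<alpha>\<bar> * R ^ mdeg \<alpha>)"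
      using 1(1) by (intro mult_right_mono) auto
    thus ?thesis using False by (simp add: power_mult_distrib mult_ac)
  qed
  ultimately have "pnorm (\<theta> * R) c \<le> \<bar>c mzero\<bar> + \<theta> * pnorm R c"
    unfolding pnorm_def[of "\<theta> * R"] using has_sum_infsum[OF 2(2)] by (rule_tac has_sum_mono) auto
  thus ?thesis using R' \<theta>(3) by (intro exI[of _ "\<theta> * R"]) auto
qed

lemma pser_coeff_0:
  assumes "pser c R f p"
  shows "c mzero = f p"
proof -
  have "((\<lambda>\<alpha>. c \<alpha> * mon \<alpha> 0) has_sum f p) midx"
    using pserD(3)[OF assms, of 0] pserD(1)[OF assms] by simp
  moreover have "((\<lambda>\<alpha>. c \<alpha> * mon \<alpha> 0) has_sum c mzero) midx"
  proof (rule has_sum_finite_neutralI[where B="{mzero}"])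
    fix \<alpha> :: "'a \<Rightarrow> nat" assume "\<alpha> \<in> midx - {mzero}"
    then obtain b where "b \<in> Basis" "\<alpha> b \<noteq> 0"
      using mdeg_eq_0_iff[of \<alpha>] by (auto simp: mdeg_def)
    thus "c \<alpha> * mon \<alpha> 0 = 0" by (auto simp: mon_def intro!: prod_zero)
  qed auto
  ultimately show ?thesis using has_sum_unique by blast
qed

lemma pser_bound:
  assumes "pser c R f p" "\<And>b. b \<in> Basis \<Longrightarrow> \<bar>h \<bullet> b\<bar> \<le> R"
  shows "\<bar>f (p + h)\<bar> \<le> pnorm R c"
proof -
  note 1 = pserD[OF assms(1)]
  have "\<bar>f (p + h)\<bar> \<le> (\<Sum>\<^sub>\<infinity>\<alpha>\<in>midx. \<bar>c \<alpha> * mon \<alpha> h\<bar>)"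
    using norm_infsum_bound[of "\<lambda>\<alpha>. c \<alpha> * mon \<alpha> h" midx] summable_on_mon_bound(1)[OF 1(2) assms(2)]
      infsumI[OF 1(3)[OF assms(2)]] by simp
  also have "\<dots> \<le> pnorm R c"
    unfolding pnorm_def using summable_on_mon_bound(1)[OF 1(2) assms(2)] 1(2)
    by (rule infsum_mono) (auto simp: abs_mult intro!: mult_left_mono abs_mon_le assms(2))
  finally show ?thesis .
qed

section \<open>Real-analytic functions of one variable\<close>

text \<open>Extensions to the complex plane give access to the inverse function theorem.\<close>

definition analytic1 :: "(real \<Rightarrow> real) \<Rightarrow> real \<Rightarrow> bool" where
  "analytic1 \<phi> s \<longleftrightarrow>
     (\<exists>h. h analytic_on {complex_of_real s} \<and> (\<forall>\<^sub>F t in nhds s. h (complex_of_real t) = complex_of_real (\<phi> t)))"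

definition jet :: "(real \<Rightarrow> real) \<Rightarrow> real \<Rightarrow> real fps" where
  "jet \<phi> s = Abs_fps (\<lambda>n. (deriv ^^ n) \<phi> s / fact n)"

definition cfps :: "real fps \<Rightarrow> complex fps" where
  "cfps F = Abs_fps (\<lambda>n. complex_of_real (fps_nth F n))"

lemma cfps_nth [simp]: "fps_nth (cfps F) n = complex_of_real (fps_nth F n)"
  by (simp add: cfps_def)

lemma cfps_1 [simp]: "cfps 1 = 1"
  by (rule fps_ext) simp

lemma cfps_mult: "cfps (F * G) = cfps F * cfps G"
  by (rule fps_ext) (simp add: fps_mult_nth)

lemma cfps_power: "cfps (F ^ n) = cfps F ^ n"
  by (induction n) (simp_all add: cfps_mult)

lemma cfps_compose: "cfps (F oo G) = cfps F oo cfps G"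
  by (rule fps_ext) (simp add: fps_compose_nth flip: cfps_power)

lemma fps_conv_radius_cfps [simp]: "fps_conv_radius (cfps F) = fps_conv_radius F"
  by (simp add: fps_conv_radius_def conv_radius_def)

lemma eval_cfps:
  assumes "ereal \<bar>t\<bar> < fps_conv_radius F"
  shows "eval_fps (cfps F) (complex_of_real t) = complex_of_real (eval_fps F t)"
proof -
  have "(\<lambda>n. complex_of_real (fps_nth F n * t ^ n)) sums complex_of_real (eval_fps F t)"
    using sums_eval_fps[of t F] assms by (subst sums_of_real_iff) simp
  thus ?thesis by (simp add: eval_fps_def sums_iff)
qed

lemma eventually_nhds_shift:
  fixes s :: "'a::real_normed_vector"
  shows "eventually P (nhds s) \<longleftrightarrow> eventually (\<lambda>t. P (s + t)) (nhds 0)"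
  by (subst nhds_to_0[of s]) (simp add: eventually_filtermap add.commute)

lemma eventually_eball:
  assumes "fps_conv_radius F > 0"
  shows "\<forall>\<^sub>F t in nhds 0. ereal (norm t) < fps_conv_radius (F::'a::{banach,real_normed_div_algebra} fps)"
proof -
  have "\<forall>\<^sub>F z in nhds 0. z \<in> eball 0 (fps_conv_radius F)"
    using assms by (intro eventually_nhds_in_open) (auto simp: zero_ereal_def)
  thus ?thesis by eventually_elim (simp add: dist_norm)
qed

lemma filterlim_complex_of_real_0: "filterlim complex_of_real (nhds 0) (nhds 0)"
proof -
  have "isCont complex_of_real 0" by (intro continuous_intros)
  thus ?thesis using tendsto_at_iff_tendsto_nhds[of complex_of_real 0] by (simp add: isCont_def)
qed

text \<open>On the real axis the extension takes real values, so replacing the coefficients of its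
  series by their real parts does not change the sum there.\<close>

lemma analytic1_complexD:
  assumes "h analytic_on {complex_of_real s}"
    and h: "\<forall>\<^sub>F t in nhds s. h (complex_of_real t) = complex_of_real (\<phi> t)"
  shows "\<exists>F. (\<lambda>t. \<phi> (s + t)) has_fps_expansion F"
proof -
  obtain \<Phi> where \<Phi>: "(\<lambda>w. h (complex_of_real s + w)) has_fps_expansion \<Phi>"
    using analytic_at_imp_has_fps_expansion[OF assms(1)] by blast
  define F where "F = Abs_fps (\<lambda>n. Re (fps_nth \<Phi> n))"
  have "\<forall>\<^sub>F w in nhds 0. (\<lambda>n. fps_nth \<Phi> n * w ^ n) sums h (complex_of_real s + w)"
  proof -
    have "fps_conv_radius \<Phi> > 0" "\<forall>\<^sub>F w in nhds 0. eval_fps \<Phi> w = h (complex_of_real s + w)"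
      using \<Phi> by (auto simp: has_fps_expansion_def)
    from this(2) eventually_eball[OF this(1)] show ?thesis
    proof eventually_elim
      case (elim w)
      thus ?case using sums_eval_fps[of w \<Phi>] by simp
    qed
  qed
  moreover have "filterlim complex_of_real (nhds 0) (nhds 0)"
    by (rule filterlim_complex_of_real_0)
  ultimately have "\<forall>\<^sub>F t in nhds 0. (\<lambda>n. fps_nth \<Phi> n * complex_of_real t ^ n) sums h (complex_of_real s + complex_of_real t)"
    by (rule eventually_compose_filterlim)
  moreover have "\<forall>\<^sub>F t in nhds 0. h (complex_of_real (s + t)) = complex_of_real (\<phi> (s + t))"
    using h by (subst (asm) eventually_nhds_shift)
  ultimately have "\<forall>\<^sub>F t in nhds 0. (\<lambda>n. fps_nth F n * t ^ n) sums \<phi> (s + t)"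
  proof eventually_elim
    case (elim t)
    have "(\<lambda>n. Re (fps_nth \<Phi> n * complex_of_real t ^ n)) sums Re (complex_of_real (\<phi> (s + t)))"
      using elim by (intro sums_Re) simp
    thus ?case by (simp add: F_def flip: of_real_power)
  qed
  from has_fps_expansionI[OF this] show ?thesis by blast
qed

lemma analytic1_fpsI:
  assumes "(\<lambda>t. \<phi> (s + t)) has_fps_expansion F"
  shows "\<exists>h. h analytic_on {complex_of_real s} \<and> (\<forall>\<^sub>F t in nhds s. h (complex_of_real t) = complex_of_real (\<phi> t))
     \<and> (\<lambda>w. h (complex_of_real s + w)) has_fps_expansion cfps F"
proof (intro exI conjI)
  let ?h = "\<lambda>z. eval_fps (cfps F) (z - complex_of_real s)"
  have F: "fps_conv_radius F > 0" "\<forall>\<^sub>F t in nhds 0. eval_fps F t = \<phi> (s + t)"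
    using assms by (auto simp: has_fps_expansion_def)
  show "(\<lambda>w. ?h (complex_of_real s + w)) has_fps_expansion cfps F"
    using eval_fps_has_fps_expansion[of "cfps F"] F(1) by simp
  thus "?h analytic_on {complex_of_real s}"
    by (rule has_fps_expansion_imp_analytic)
  show "\<forall>\<^sub>F t in nhds s. ?h (complex_of_real t) = complex_of_real (\<phi> t)"
    unfolding eventually_nhds_shift[of _ s]
    using F(2) eventually_eball[OF F(1)]
    by eventually_elim (simp add: eval_cfps)
qed

lemma analytic1_iff_fps: "analytic1 \<phi> s \<longleftrightarrow> (\<exists>F. (\<lambda>t. \<phi> (s + t)) has_fps_expansion F)"
  unfolding analytic1_def using analytic1_complexD analytic1_fpsI by blast

lemma deriv_shift_arg: "deriv (\<lambda>t. \<phi> (s + t)) = (\<lambda>t. deriv \<phi> (s + t :: real))"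
  by (rule ext) (simp add: deriv_def DERIV_shift add.commute)

lemma has_fps_expansion_eq_jet:
  fixes \<phi> :: "real \<Rightarrow> real"
  assumes "(\<lambda>t. \<phi> (s + t)) has_fps_expansion F"
  shows "F = jet \<phi> s"
proof -
  have "fps_nth F n = (deriv ^^ n) \<phi> s / fact n" for n
    using assms
  proof (induction n arbitrary: F \<phi>)
    case 0
    have "\<forall>\<^sub>F t in nhds 0. eval_fps F t = \<phi> (s + t)" using 0 by (simp add: has_fps_expansion_def)
    from eventually_nhds_x_imp_x[OF this] show ?case by (simp add: eval_fps_at_0)
  next
    case (Suc n)
    have "(\<lambda>t. deriv \<phi> (s + t)) has_fps_expansion fps_deriv F"
      using has_fps_expansion_deriv[OF Suc.prems] by (simp add: deriv_shift_arg)
    from Suc.IH[OF this] have "of_nat (Suc n) * fps_nth F (Suc n) = (deriv ^^ Suc n) \<phi> s / fact n"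
      by (simp add: funpow_swap1)
    hence "fps_nth F (Suc n) = (deriv ^^ Suc n) \<phi> s / (of_nat (Suc n) * fact n)"
      by (simp add: field_simps del: of_nat_Suc funpow.simps)
    thus ?case by (simp del: of_nat_Suc funpow.simps)
  qed
  thus ?thesis by (auto simp: jet_def fps_eq_iff)
qed

lemma analytic1_jet: "analytic1 \<phi> s \<Longrightarrow> (\<lambda>t. \<phi> (s + t)) has_fps_expansion jet \<phi> s"
  unfolding analytic1_iff_fps using has_fps_expansion_eq_jet by blast

lemma jet_nth: "fps_nth (jet \<phi> s) n = (deriv ^^ n) \<phi> s / fact n"
  by (simp add: jet_def)

lemma jet_nth_0 [simp]: "fps_nth (jet \<phi> s) 0 = \<phi> s"
  by (simp add: jet_def)

text \<open>The holomorphic extension lives on an open set, whose real points form a neighbourhood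
  of s.\<close>

lemma analytic1_eventually:
  assumes "analytic1 \<phi> s" shows "\<forall>\<^sub>F t in nhds s. analytic1 \<phi> t"
proof -
  obtain h where h: "h analytic_on {complex_of_real s}"
    "\<forall>\<^sub>F t in nhds s. h (complex_of_real t) = complex_of_real (\<phi> t)"
    using assms unfolding analytic1_def by blast
  obtain S where S: "open S" "complex_of_real s \<in> S" "h analytic_on S"
    using h(1) analytic_at[of h] analytic_on_open[of _ h] by blast
  have "\<forall>\<^sub>F t in nhds s. complex_of_real t \<in> S"
    using S by (intro eventually_nhds_in_open[where s="complex_of_real -` S", simplified])
      (auto intro!: open_vimage continuous_intros)
  moreover have "\<forall>\<^sub>F u in nhds s. \<forall>\<^sub>F t in nhds u. h (complex_of_real t) = complex_of_real (\<phi> t)"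
    using h(2) by (simp add: eventually_eventually)
  ultimately show ?thesis
  proof eventually_elim
    case (elim u)
    moreover have "h analytic_on {complex_of_real u}"
      using elim(1) by (intro analytic_on_subset[OF S(3)]) simp
    ultimately show ?case unfolding analytic1_def by blast
  qed
qed

lemma analytic1_cong:
  assumes "analytic1 \<phi> s" "\<forall>\<^sub>F t in nhds s. \<psi> t = \<phi> t"
  shows "analytic1 \<psi> s"
proof -
  obtain h where h: "h analytic_on {complex_of_real s}"
    "\<forall>\<^sub>F t in nhds s. h (complex_of_real t) = complex_of_real (\<phi> t)"
    using assms(1) unfolding analytic1_def by blast
  have "\<forall>\<^sub>F t in nhds s. h (complex_of_real t) = complex_of_real (\<psi> t)"
    using h(2) assms(2) by eventually_elim simp
  thus ?thesis using h(1) unfolding analytic1_def by blast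
qed

lemma jet_cong:
  assumes "\<forall>\<^sub>F t in nhds s. \<psi> t = \<phi> t"
  shows "jet \<psi> s = jet \<phi> s"
proof -
  have "(deriv ^^ n) \<psi> s = (deriv ^^ n) \<phi> s" for n
  proof -
    have "\<forall>\<^sub>F t in nhds s. (deriv ^^ n) \<psi> t = (deriv ^^ n) \<phi> t"
    proof (induction n)
      case 0 show ?case using assms by simp
    next
      case (Suc n)
      hence "\<forall>\<^sub>F u in nhds s. \<forall>\<^sub>F t in nhds u. (deriv ^^ n) \<psi> t = (deriv ^^ n) \<phi> t"
        by (simp add: eventually_eventually)
      thus ?case by eventually_elim (auto intro: deriv_cong_ev)
    qed
    thus ?thesis by (rule eventually_nhds_x_imp_x)
  qed
  thus ?thesis by (simp add: jet_def)
qed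

text \<open>The composition law for complex expansions is restricted to the real axis;
  \<open>cfps\<close> has the same convergence radius and commutes with composition.\<close>

lemma has_fps_expansion_compose_real:
  fixes f g :: "real \<Rightarrow> real"
  assumes F: "f has_fps_expansion F" and G: "g has_fps_expansion G" "fps_nth G 0 = 0"
  shows "(\<lambda>t. f (g t)) has_fps_expansion (F oo G)"
proof -
  have F': "fps_conv_radius F > 0" "\<forall>\<^sub>F t in nhds 0. eval_fps F t = f t"
    and G': "fps_conv_radius G > 0" "\<forall>\<^sub>F t in nhds 0. eval_fps G t = g t"
    using F G(1) by (auto simp: has_fps_expansion_def)
  have "(eval_fps (cfps F) \<circ> eval_fps (cfps G)) has_fps_expansion (cfps F oo cfps G)"
    using F' G' G(2) by (intro has_fps_expansion_compose eval_fps_has_fps_expansion) auto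
  hence H: "fps_conv_radius (F oo G) > 0"
    "\<forall>\<^sub>F w in nhds 0. eval_fps (cfps (F oo G)) w = eval_fps (cfps F) (eval_fps (cfps G) w)"
    by (auto simp: has_fps_expansion_def cfps_compose[symmetric])
  have lim: "filterlim complex_of_real (nhds 0) (nhds 0)"
    by (rule filterlim_complex_of_real_0)
  have g0: "g 0 = 0" using eventually_nhds_x_imp_x[OF G'(2)] G(2) by (simp add: eval_fps_at_0)
  have "isCont g 0" by (rule has_fps_expansion_imp_continuous[OF G(1)])
  hence limg: "filterlim g (nhds 0) (nhds 0)"
    using tendsto_at_iff_tendsto_nhds[of g 0] g0 by (simp add: isCont_def)
  have "\<forall>\<^sub>F t in nhds 0. eval_fps (F oo G) t = f (g t)"
    using eventually_compose_filterlim[OF H(2) lim] eventually_eball[OF G'(1)] G'(2)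
      eventually_compose_filterlim[OF eventually_eball[OF F'(1)] limg]
      eventually_compose_filterlim[OF F'(2) limg] eventually_eball[OF H(1)]
  proof eventually_elim
    case (elim t)
    have "complex_of_real (eval_fps (F oo G) t) = complex_of_real (f (g t))"
      using elim eval_cfps[of t "F oo G"] eval_cfps[of t G] eval_cfps[of "g t" F] by simp
    thus ?case by simp
  qed
  thus ?thesis using H(1) by (simp add: has_fps_expansion_def)
qed

lemma analytic1_fps:
  assumes "(\<lambda>t. \<phi> (s + t)) has_fps_expansion F"
  shows "analytic1 \<phi> s" "jet \<phi> s = F"
  using assms has_fps_expansion_eq_jet[OF assms] unfolding analytic1_iff_fps by auto

lemma analytic1_const [simp]: "analytic1 (\<lambda>_. c) s" "jet (\<lambda>_. c) s = fps_const c"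
  by (rule analytic1_fps[of "\<lambda>_. c"] has_fps_expansion_const)+

lemma analytic1_ident [simp]: "analytic1 (\<lambda>t. t) s" "jet (\<lambda>t. t) s = fps_const s + fps_X"
  by (rule analytic1_fps[of "\<lambda>t. t"] has_fps_expansion_add has_fps_expansion_const has_fps_expansion_fps_X)+

lemma analytic1_add:
  assumes "analytic1 f s" "analytic1 g s"
  shows "analytic1 (\<lambda>t. f t + g t) s" "jet (\<lambda>t. f t + g t) s = jet f s + jet g s"
  by (rule analytic1_fps[of "\<lambda>t. f t + g t"] has_fps_expansion_add analytic1_jet assms)+

lemma analytic1_diff:
  assumes "analytic1 f s" "analytic1 g s"
  shows "analytic1 (\<lambda>t. f t - g t) s" "jet (\<lambda>t. f t - g t) s = jet f s - jet g s"
  by (rule analytic1_fps[of "\<lambda>t. f t - g t"] has_fps_expansion_diff analytic1_jet assms)+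

lemma analytic1_mult:
  assumes "analytic1 f s" "analytic1 g s"
  shows "analytic1 (\<lambda>t. f t * g t) s" "jet (\<lambda>t. f t * g t) s = jet f s * jet g s"
  by (rule analytic1_fps[of "\<lambda>t. f t * g t"] has_fps_expansion_mult analytic1_jet assms)+

lemma analytic1_divide:
  assumes "analytic1 f s" "analytic1 g s" "g s \<noteq> 0"
  shows "analytic1 (\<lambda>t. f t / g t) s" "jet (\<lambda>t. f t / g t) s = jet f s / jet g s"
  by (rule analytic1_fps[of "\<lambda>t. f t / g t"] has_fps_expansion_divide' analytic1_jet assms |
      simp add: assms)+

lemma analytic1_minus:
  assumes "analytic1 f s"
  shows "analytic1 (\<lambda>t. - f t) s" "jet (\<lambda>t. - f t) s = - jet f s"
  by (rule analytic1_fps[of "\<lambda>t. - f t"] has_fps_expansion_minus analytic1_jet assms)+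

lemma analytic1_compose:
  assumes "analytic1 g s" "analytic1 f (g s)"
  shows "analytic1 (\<lambda>t. f (g t)) s" "jet (\<lambda>t. f (g t)) s = jet f (g s) oo (jet g s - fps_const (g s))"
proof -
  have "(\<lambda>t. g (s + t) - g s) has_fps_expansion (jet g s - fps_const (g s))"
    by (intro has_fps_expansion_diff analytic1_jet assms has_fps_expansion_const)
  from has_fps_expansion_compose_real[OF analytic1_jet[OF assms(2)] this]
  have *: "(\<lambda>t. f (g (s + t))) has_fps_expansion (jet f (g s) oo (jet g s - fps_const (g s)))"
    by simp
  show "analytic1 (\<lambda>t. f (g t)) s" "jet (\<lambda>t. f (g t)) s = jet f (g s) oo (jet g s - fps_const (g s))"
    by (rule analytic1_fps[of "\<lambda>t. f (g t)", OF *])+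
qed

lemma analytic1_deriv:
  assumes "analytic1 f s"
  shows "analytic1 (deriv f) s" "jet (deriv f) s = fps_deriv (jet f s)"
    "(f has_field_derivative deriv f s) (at s)"
proof -
  have *: "(\<lambda>t. deriv f (s + t)) has_fps_expansion fps_deriv (jet f s)"
    using has_fps_expansion_deriv[OF analytic1_jet[OF assms]] by (simp add: deriv_shift_arg)
  show "analytic1 (deriv f) s" "jet (deriv f) s = fps_deriv (jet f s)"
    by (rule analytic1_fps[OF *])+
  have J: "fps_conv_radius (jet f s) > 0" "\<forall>\<^sub>F t in nhds 0. eval_fps (jet f s) t = f (s + t)"
    using analytic1_jet[OF assms] by (auto simp: has_fps_expansion_def)
  have "(eval_fps (jet f s) has_field_derivative eval_fps (fps_deriv (jet f s)) 0) (at 0)"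
    using J(1) by (intro has_field_derivative_eval_fps) (simp add: zero_ereal_def)
  hence "((\<lambda>t. f (s + t)) has_field_derivative eval_fps (fps_deriv (jet f s)) 0) (at 0)"
    by (rule DERIV_cong_ev[THEN iffD1, rotated -1]) (use J(2) in auto)
  hence "(f has_field_derivative eval_fps (fps_deriv (jet f s)) 0) (at s)"
    using DERIV_shift[of f _ 0 s] by (simp add: add.commute)
  thus "(f has_field_derivative deriv f s) (at s)"
    using DERIV_imp_deriv[of f _ s] by simp
qed

lemma analytic1_isCont: "analytic1 f s \<Longrightarrow> isCont f s"
  using analytic1_deriv(3) DERIV_isCont by blast

lemma jet_nth_1: "fps_nth (jet f s) (Suc 0) = deriv f s"
  by (simp add: jet_nth)

text \<open>The extension h is locally biholomorphic. Since h sends real points near s to the real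
  values of f, its inverse k is real on the image of f, and the real part of k is an analytic
  inverse.\<close>

lemma analytic1_inverse_function:
  assumes "analytic1 f s" "deriv f s \<noteq> 0"
  obtains g where "analytic1 g (f s)" "\<forall>\<^sub>F t in nhds s. g (f t) = t" "\<forall>\<^sub>F u in nhds (f s). f (g u) = u"
proof -
  obtain h where h: "h analytic_on {complex_of_real s}"
    "\<forall>\<^sub>F t in nhds s. h (complex_of_real t) = complex_of_real (f t)"
    "(\<lambda>w. h (complex_of_real s + w)) has_fps_expansion cfps (jet f s)"
    using analytic1_fpsI[OF analytic1_jet[OF assms(1)]] by blast
  obtain S where S: "open S" "complex_of_real s \<in> S" "h holomorphic_on S"
    using h(1) unfolding analytic_at by blast
  have "deriv h (complex_of_real s) = fps_nth (cfps (jet f s)) 1"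
    using fps_nth_fps_expansion[OF h(3), of 1] deriv_shift_0'[where f=h and z="complex_of_real s"]
    by (simp add: o_def)
  hence dh: "deriv h (complex_of_real s) \<noteq> 0"
    using assms(2) by (simp add: jet_nth_1)
  obtain r where r: "r > 0" "ball (complex_of_real s) r \<subseteq> S" "open (h ` ball (complex_of_real s) r)"
      "inj_on h (ball (complex_of_real s) r)"
    using has_complex_derivative_locally_invertible[OF S(3,2,1) dh] .
  have "h holomorphic_on ball (complex_of_real s) r" using S(3) r(2) holomorphic_on_subset by blast
  obtain k where k: "k holomorphic_on (h ` ball (complex_of_real s) r)"
    "\<And>z. z \<in> ball (complex_of_real s) r \<Longrightarrow> deriv h z * deriv k (h z) = 1"
    "\<And>z. z \<in> ball (complex_of_real s) r \<Longrightarrow> k (h z) = z"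
    by (rule holomorphic_has_inverse[OF \<open>h holomorphic_on ball (complex_of_real s) r\<close> open_ball r(4)]) (rule that)
  have "\<forall>\<^sub>F t in nhds s. analytic1 f t \<and> h (complex_of_real t) = complex_of_real (f t)"
    using analytic1_eventually[OF assms(1)] h(2) by (rule eventually_conj)
  then obtain T where T: "open T" "s \<in> T" "\<And>t. t \<in> T \<Longrightarrow> analytic1 f t"
    "\<And>t. t \<in> T \<Longrightarrow> h (complex_of_real t) = complex_of_real (f t)"
    unfolding eventually_nhds by blast
  define U where "U = T \<inter> ball s r"
  have U: "open U" "s \<in> U" using T r(1) by (auto simp: U_def)
  have ball: "complex_of_real t \<in> ball (complex_of_real s) r" if "t \<in> U" for t
    using that by (auto simp: U_def dist_of_real)
  define g where "g = (\<lambda>u. Re (k (complex_of_real u)))"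
  have kf: "k (complex_of_real (f t)) = complex_of_real t" if "t \<in> U" for t
    using k(3)[OF ball[OF that]] T(4)[of t] that by (simp add: U_def)
  hence gf: "g (f t) = t" if "t \<in> U" for t using that by (simp add: g_def)
  have "continuous_on U f"
    by (rule continuous_at_imp_continuous_on) (use T(3) analytic1_isCont in \<open>auto simp: U_def\<close>)
  moreover have "inj_on f U" by (rule inj_on_inverseI[of _ g]) (rule gf)
  \<comment> \<open>Invariance of domain makes the image a neighbourhood of f s, so the identities
    known only on the image hold near f s.\<close>
  ultimately have opn: "open (f ` U)" using U(1) by (intro invariance_of_domain)
  have ev: "\<forall>\<^sub>F u in nhds (f s). u \<in> f ` U" using opn U(2) by (intro eventually_nhds_in_open) auto
  show ?thesis
  proof
    have "h (complex_of_real s) = complex_of_real (f s)" using T by blast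
    hence "complex_of_real (f s) \<in> h ` ball (complex_of_real s) r"
      using r(1) by (intro image_eqI[of _ _ "complex_of_real s"]) auto
    hence "k analytic_on {complex_of_real (f s)}"
      unfolding analytic_at using k(1) r(3) by blast
    moreover have "\<forall>\<^sub>F u in nhds (f s). k (complex_of_real u) = complex_of_real (g u)"
      using ev by eventually_elim (auto simp: kf gf)
    ultimately show "analytic1 g (f s)" unfolding analytic1_def by blast
    show "\<forall>\<^sub>F t in nhds s. g (f t) = t"
      using eventually_nhds_in_open[OF U] by eventually_elim (rule gf)
    show "\<forall>\<^sub>F u in nhds (f s). f (g u) = u"
      using ev by eventually_elim (auto simp: gf)
  qed
qed

lemma analytic1_series:
  assumes "analytic1 \<phi> s"
  obtains \<rho> where "\<rho> > 0" "summable (\<lambda>n. \<bar>fps_nth (jet \<phi> s) n\<bar> * \<rho> ^ n)"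
    "\<And>t. \<bar>t\<bar> \<le> \<rho> \<Longrightarrow> (\<lambda>n. fps_nth (jet \<phi> s) n * t ^ n) sums \<phi> (s + t)"
proof -
  let ?J = "jet \<phi> s"
  have J: "fps_conv_radius ?J > 0" "\<forall>\<^sub>F t in nhds 0. eval_fps ?J t = \<phi> (s + t)"
    using analytic1_jet[OF assms] by (auto simp: has_fps_expansion_def)
  have "\<forall>\<^sub>F t in nhds 0. eval_fps ?J t = \<phi> (s + t) \<and> ereal (norm t) < fps_conv_radius ?J"
    using J(2) eventually_eball[OF J(1)] by (rule eventually_conj)
  then obtain d where d: "d > 0" "\<And>t. \<bar>t\<bar> < d \<Longrightarrow> eval_fps ?J t = \<phi> (s + t) \<and> ereal \<bar>t\<bar> < fps_conv_radius ?J"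
    unfolding eventually_nhds_metric by (auto simp: dist_norm)
  show ?thesis
  proof (rule that[of "d / 2"])
    show "d / 2 > 0" using d by simp
    show "summable (\<lambda>n. \<bar>fps_nth ?J n\<bar> * (d / 2) ^ n)"
      using norm_summable_fps[of "d / 2" ?J] d(1) d(2)[of "d / 2"] by (simp add: abs_mult power_abs)
    fix t :: real assume "\<bar>t\<bar> \<le> d / 2"
    thus "(\<lambda>n. fps_nth (jet \<phi> s) n * t ^ n) sums \<phi> (s + t)"
      using sums_eval_fps[of t ?J] d(1) d(2)[of t] by simp
  qed
qed

text \<open>The powers of g - g p are substituted into the Taylor series of \<phi>; the resulting
  family indexed by (n, \<alpha>) is absolutely summable on a small box and is regrouped by
  \<open>pser_indexed\<close>.\<close>

lemma real_analytic_at_compose: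
  fixes g :: "'a::euclidean_space \<Rightarrow> real"
  assumes "real_analytic_at g p" "analytic1 \<phi> (g p)"
  shows "real_analytic_at (\<lambda>z. \<phi> (g z)) p"
proof -
  let ?s = "g p" and ?a = "fps_nth (jet \<phi> (g p))"
  obtain \<rho> where \<rho>: "\<rho> > 0" "summable (\<lambda>n. \<bar>?a n\<bar> * \<rho> ^ n)"
    "\<And>t. \<bar>t\<bar> \<le> \<rho> \<Longrightarrow> (\<lambda>n. ?a n * t ^ n) sums \<phi> (?s + t)"
    using analytic1_series[OF assms(2)] by blast
  obtain c0 R0 where c0: "pser c0 R0 g p"
    using assms(1) unfolding real_analytic_at_iff_pser by blast
  obtain c where c: "pser c R0 (\<lambda>z. g z + - ?s) p"
    using pser_add[OF c0 pser_const(1)[OF pserD(1)[OF c0], of "- ?s"]] by blast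
  obtain R where R: "0 < R" "R \<le> R0" "pnorm R c \<le> \<rho>"
    using pser_small_norm[OF c \<rho>(1)] pser_coeff_0[OF c] by auto
  note cR = pser_mono[OF c R(1,2)]
  have "\<forall>n. \<exists>e. pser e R (\<lambda>z. (g z + - ?s) ^ n) p \<and> pnorm R e \<le> pnorm R c ^ n"
    using pser_power[OF cR] by blast
  from choice[OF this] obtain e where
    e: "\<And>n. pser (e n) R (\<lambda>z. (g z + - ?s) ^ n) p" "\<And>n. pnorm R (e n) \<le> pnorm R c ^ n"
    by blast
  have N0: "pnorm R c \<ge> 0" "pnorm R (e n) \<ge> 0" for n
    using R(1) by (auto simp: pnorm_def intro!: infsum_nonneg)
  have eN: "pnorm R (e n) \<le> \<rho> ^ n" for n
    using e(2)[of n] power_mono[OF R(3) N0(1), of n] by simp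
  let ?\<kappa> = "\<lambda>(n, \<alpha>). ?a n * e n \<alpha>"
  have S: "(\<lambda>i. \<bar>?\<kappa> i\<bar> * R ^ mdeg (snd i)) summable_on (UNIV \<times> midx)"
  proof (rule summable_on_SigmaI)
    fix n :: nat
    have "((\<lambda>\<alpha>. \<bar>?a n\<bar> * (\<bar>e n \<alpha>\<bar> * R ^ mdeg \<alpha>)) has_sum \<bar>?a n\<bar> * pnorm R (e n)) midx"
      unfolding pnorm_def by (intro has_sum_cmult_right has_sum_infsum pserD(2)[OF e(1)])
    thus "((\<lambda>\<alpha>. \<bar>?\<kappa> (n, \<alpha>)\<bar> * R ^ mdeg (snd (n, \<alpha>))) has_sum \<bar>?a n\<bar> * pnorm R (e n)) midx"
      by (simp add: abs_mult mult.assoc)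
  next
    have "(\<lambda>n. \<bar>?a n\<bar> * \<rho> ^ n) summable_on UNIV"
      using \<rho>(1,2) by (intro summable_nonneg_imp_summable_on) auto
    thus "(\<lambda>n. \<bar>?a n\<bar> * pnorm R (e n)) summable_on UNIV"
      by (rule summable_on_comparison_test) (auto intro!: mult_left_mono mult_nonneg_nonneg eN N0)
  qed (use R(1) in auto)
  have "((\<lambda>i. ?\<kappa> i * mon (snd i) h) has_sum \<phi> (g (p + h))) (UNIV \<times> midx)"
    if h: "\<And>b. b \<in> Basis \<Longrightarrow> \<bar>h \<bullet> b\<bar> \<le> R" for h
  proof (rule has_sum_SigmaI)
    let ?t = "g (p + h) + - ?s"
    have t: "\<bar>?t\<bar> \<le> \<rho>" using pser_bound[OF cR h] R(3) by simp
    fix n :: nat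
    show "((\<lambda>\<alpha>. ?\<kappa> (n, \<alpha>) * mon (snd (n, \<alpha>)) h) has_sum (?a n * ?t ^ n)) midx"
      using has_sum_cmult_right[OF pserD(3)[OF e(1)[of n] h], of "?a n"] by (simp add: mult.assoc)
    have "(\<lambda>n. norm (?a n * ?t ^ n)) sums (\<Sum>n. norm (?a n * ?t ^ n))"
      by (rule summable_sums, rule summable_comparison_test'[OF \<rho>(2)])
         (use t in \<open>auto simp: abs_mult power_abs intro!: mult_left_mono power_mono\<close>)
    hence "summable (\<lambda>n. norm (?a n * ?t ^ n))" by (rule sums_summable)
    from norm_summable_imp_has_sum[OF this \<rho>(3)[OF t]]
    show "((\<lambda>n. ?a n * ?t ^ n) has_sum \<phi> (g (p + h))) UNIV" by simp
  next
    show "(\<lambda>i. ?\<kappa> i * mon (snd i) h) summable_on (UNIV \<times> midx)"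
      by (rule summable_on_mon_bound(2)[OF S h])
  qed
  moreover have "snd i \<in> midx" if "i \<in> UNIV \<times> midx" for i :: "nat \<times> ('a \<Rightarrow> nat)"
    using that by auto
  ultimately show ?thesis
    unfolding real_analytic_at_iff_pser
    using pser_indexed(1)[OF R(1) _ S, where f="\<lambda>z. \<phi> (g z)" and p=p] by blast
qed

section \<open>Closure properties of real-analytic functions\<close>

lemma real_analytic_at_const [simp]: "real_analytic_at (\<lambda>_. a) p"
  unfolding real_analytic_at_iff_pser using pser_const(1)[of 1] by force

lemma real_analytic_at_common:
  assumes "real_analytic_at f p" "real_analytic_at g p"
  obtains c d R where "pser c R f p" "pser d R g p"
proof -
  obtain c R1 d R2 where *: "pser c R1 f p" "pser d R2 g p"
    using assms unfolding real_analytic_at_iff_pser by blast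
  have "min R1 R2 > 0" using pserD(1) * by auto
  with * show ?thesis by (intro that[of c "min R1 R2" d] pser_mono[OF *(1)] pser_mono[OF *(2)]) auto
qed

lemma real_analytic_at_add:
  "real_analytic_at f p \<Longrightarrow> real_analytic_at g p \<Longrightarrow> real_analytic_at (\<lambda>z. f z + g z) p"
  by (erule (1) real_analytic_at_common) (auto simp: real_analytic_at_iff_pser dest: pser_add)

lemma real_analytic_at_mult:
  assumes "real_analytic_at f p" "real_analytic_at g p"
  shows "real_analytic_at (\<lambda>z. f z * g z) p"
proof -
  obtain c d R where "pser c R f p" "pser d R g p"
    using real_analytic_at_common[OF assms] .
  from pser_mult[OF this] show ?thesis unfolding real_analytic_at_iff_pser by blast
qed

lemma real_analytic_at_diff:
  assumes "real_analytic_at f p" "real_analytic_at g p"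
  shows "real_analytic_at (\<lambda>z. f z - g z) p"
  using real_analytic_at_add[OF assms(1) real_analytic_at_mult[OF real_analytic_at_const[of "-1"] assms(2)]] by simp

lemma real_analytic_at_power:
  "real_analytic_at f p \<Longrightarrow> real_analytic_at (\<lambda>z. f z ^ n) p"
  by (induction n) (auto intro: real_analytic_at_mult)

lemma real_analytic_at_divide:
  assumes "real_analytic_at f p" "real_analytic_at g p" "g p \<noteq> 0"
  shows "real_analytic_at (\<lambda>z. f z / g z) p"
proof -
  have "analytic1 (\<lambda>t. 1 / t) (g p)" using assms(3) by (intro analytic1_divide) auto
  from real_analytic_at_mult[OF assms(1) real_analytic_at_compose[OF assms(2) this]]
  show ?thesis by simp
qed

lemma real_analytic_at_sum:
  "(\<And>i. i \<in> I \<Longrightarrow> real_analytic_at (f i) p) \<Longrightarrow> real_analytic_at (\<lambda>z. \<Sum>i\<in>I. f i z) p"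
  by (induction I rule: infinite_finite_induct) (auto intro: real_analytic_at_add)

lemma real_analytic_at_coordinate:
  fixes p :: "'a::euclidean_space"
  assumes b: "b \<in> Basis"
  shows "real_analytic_at (\<lambda>z. z \<bullet> b) p"
proof -
  define e :: "'a \<Rightarrow> nat" where "e = (\<lambda>b'\<in>Basis. if b' = b then 1 else 0)"
  have e: "e \<in> midx" "e \<noteq> mzero" using b by (auto simp: e_def midx_def mzero_def fun_eq_iff)
  have me: "mon e h = h \<bullet> b" for h
  proof -
    have "mon e h = (\<Prod>b'\<in>Basis. if b' = b then h \<bullet> b else 1)"
      unfolding mon_def e_def by (rule prod.cong) auto
    thus ?thesis using b by simp
  qed
  have "pser (\<lambda>\<alpha>. if \<alpha> = mzero then p \<bullet> b else if \<alpha> = e then 1 else 0) 1 (\<lambda>z. z \<bullet> b) p"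
    unfolding pser_def
  proof (intro conjI allI impI)
    show "(\<lambda>\<alpha>. \<bar>if \<alpha> = mzero then p \<bullet> b else if \<alpha> = e then 1 else 0\<bar> * 1 ^ mdeg \<alpha>) summable_on midx"
      by (rule finite_nonzero_values_imp_summable_on, rule finite_subset[of _ "{mzero, e}"]) auto
    fix h :: 'a
    show "((\<lambda>\<alpha>. (if \<alpha> = mzero then p \<bullet> b else if \<alpha> = e then 1 else 0) * mon \<alpha> h) has_sum (p + h) \<bullet> b) midx"
      by (rule has_sum_finite_neutralI[where B="{mzero, e}"]) (use e in \<open>auto simp: me inner_add_left\<close>)
  qed simp
  thus ?thesis unfolding real_analytic_at_iff_pser by blast
qed

lemma real_analytic_at_linear:
  fixes L :: "'a::euclidean_space \<Rightarrow> real"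
  assumes "bounded_linear L"
  shows "real_analytic_at L p"
proof -
  interpret bounded_linear L by fact
  have "L = (\<lambda>z. \<Sum>b\<in>Basis. (z \<bullet> b) * L b)"
  proof
    fix z
    have "L z = L (\<Sum>b\<in>Basis. (z \<bullet> b) *\<^sub>R b)" by (simp add: euclidean_representation)
    also have "\<dots> = (\<Sum>b\<in>Basis. (z \<bullet> b) * L b)" by (simp add: sum scale)
    finally show "L z = (\<Sum>b\<in>Basis. (z \<bullet> b) * L b)" .
  qed
  moreover have "real_analytic_at (\<lambda>z. \<Sum>b\<in>Basis. (z \<bullet> b) * L b) p"
    by (intro real_analytic_at_sum real_analytic_at_mult real_analytic_at_coordinate real_analytic_at_const)
  ultimately show ?thesis by simp
qed

lemma real_analytic_at_cong:
  assumes "real_analytic_at f p" "\<forall>\<^sub>F z in nhds p. g z = f z"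
  shows "real_analytic_at g p"
proof -
  obtain c r where r: "r > 0" and c: "\<And>z. z \<in> ball p r \<Longrightarrow>
      ((\<lambda>\<alpha>. c \<alpha> * (\<Prod>b\<in>Basis. ((z - p) \<bullet> b) ^ \<alpha> b)) has_sum f z) (Basis \<rightarrow>\<^sub>E (UNIV :: nat set))"
    using assms(1) unfolding real_analytic_at_def by blast
  obtain d where d: "d > 0" "\<And>z. dist z p < d \<Longrightarrow> g z = f z"
    using assms(2) unfolding eventually_nhds_metric by blast
  show ?thesis unfolding real_analytic_at_def
    by (rule exI[of _ c], rule exI[of _ "min r d"]) (use r c d in \<open>auto simp: dist_commute\<close>)
qed

section \<open>Partial derivatives of real-analytic functions\<close>

text \<open>The planar form of \<open>pser\<close>, indexed by pairs of exponents, in which termwise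
  differentiation and the link with \<open>pd\<close> become index shifts.\<close>

definition dser :: "(nat \<Rightarrow> nat \<Rightarrow> real) \<Rightarrow> real \<Rightarrow> (real \<times> real \<Rightarrow> real) \<Rightarrow> real \<times> real \<Rightarrow> bool" where
  "dser c R F p \<longleftrightarrow> R > 0 \<and> (\<lambda>(j, k). \<bar>c j k\<bar> * R ^ (j + k)) summable_on UNIV \<and>
     (\<forall>x y. \<bar>x\<bar> \<le> R \<longrightarrow> \<bar>y\<bar> \<le> R \<longrightarrow> ((\<lambda>(j, k). c j k * x ^ j * y ^ k) has_sum F (p + (x, y))) UNIV)"

lemma dserD:
  assumes "dser c R F p"
  shows "R > 0" "(\<lambda>(j, k). \<bar>c j k\<bar> * R ^ (j + k)) summable_on UNIV"
    "\<bar>x\<bar> \<le> R \<Longrightarrow> \<bar>y\<bar> \<le> R \<Longrightarrow> ((\<lambda>(j, k). c j k * x ^ j * y ^ k) has_sum F (p + (x, y))) UNIV"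
  using assms unfolding dser_def by auto

definition pair_idx :: "nat \<times> nat \<Rightarrow> real \<times> real \<Rightarrow> nat" where
  "pair_idx jk = (\<lambda>b\<in>Basis. if b = (1, 0) then fst jk else snd jk)"

lemma Basis_real2: "(Basis :: (real \<times> real) set) = {(1, 0), (0, 1)}"
  by (auto simp: Basis_prod_def)

lemma pair_idx_in_midx [simp]: "pair_idx jk \<in> midx"
  unfolding pair_idx_def midx_def by (intro restrict_PiE_iff[THEN iffD2] ballI UNIV_I)

lemma pair_idx_apply [simp]: "pair_idx jk (1, 0) = fst jk" "pair_idx jk (0, 1) = snd jk"
  by (simp_all add: pair_idx_def Basis_real2)

lemma bij_pair_idx: "bij_betw pair_idx UNIV midx"
  unfolding bij_betw_def
proof (intro conjI subset_antisym subsetI)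
  show "inj pair_idx"
    by (rule inj_on_inverseI[where g="\<lambda>\<alpha>. (\<alpha> (1, 0), \<alpha> (0, 1))"]) simp
  fix \<alpha> :: "real \<times> real \<Rightarrow> nat" assume a: "\<alpha> \<in> midx"
  have "\<alpha> b = pair_idx (\<alpha> (1, 0), \<alpha> (0, 1)) b" if "b \<in> Basis" for b
  proof -
    have "b = (1, 0) \<or> b = (0, 1)" using that unfolding Basis_real2 by blast
    thus ?thesis by (elim disjE) simp_all
  qed
  hence "\<alpha> = pair_idx (\<alpha> (1, 0), \<alpha> (0, 1))"
    by (rule PiE_ext[OF a[unfolded midx_def] pair_idx_in_midx[unfolded midx_def]])
  thus "\<alpha> \<in> range pair_idx" by blast
next
  fix \<alpha> assume "\<alpha> \<in> range pair_idx" thus "\<alpha> \<in> midx" by auto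
qed

lemma mon_pair_idx: "mon (pair_idx (j, k)) (x, y) = x ^ j * y ^ k"
  by (simp add: mon_def pair_idx_def Basis_real2)

lemma mdeg_pair_idx: "mdeg (pair_idx (j, k)) = j + k"
  by (simp add: mdeg_def pair_idx_def Basis_real2)

lemma real_analytic_at_iff_dser: "real_analytic_at F p \<longleftrightarrow> (\<exists>c R. dser c R F p)"
proof
  assume "real_analytic_at F p"
  then obtain c R where c: "pser c R F p" unfolding real_analytic_at_iff_pser by blast
  note 1 = pserD[OF c]
  have "dser (\<lambda>j k. c (pair_idx (j, k))) R F p"
    unfolding dser_def
  proof (intro conjI allI impI)
    show "R > 0" by fact
    have "(\<lambda>i. \<bar>c (pair_idx i)\<bar> * R ^ mdeg (pair_idx i)) summable_on UNIV"
      using summable_on_reindex_bij_betw[OF bij_pair_idx, THEN iffD2, OF 1(2)] .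
    thus "(\<lambda>(j, k). \<bar>c (pair_idx (j, k))\<bar> * R ^ (j + k)) summable_on UNIV"
      by (simp add: case_prod_unfold flip: mdeg_pair_idx)
    fix x y :: real assume "\<bar>x\<bar> \<le> R" "\<bar>y\<bar> \<le> R"
    hence "((\<lambda>\<alpha>. c \<alpha> * mon \<alpha> (x, y)) has_sum F (p + (x, y))) midx"
      by (intro 1(3)) (auto simp: Basis_real2)
    hence "((\<lambda>i. c (pair_idx i) * mon (pair_idx i) (x, y)) has_sum F (p + (x, y))) UNIV"
      by (rule has_sum_reindex_bij_betw[OF bij_pair_idx, THEN iffD2])
    thus "((\<lambda>(j, k). c (pair_idx (j, k)) * x ^ j * y ^ k) has_sum F (p + (x, y))) UNIV"
      by (simp add: case_prod_unfold mult.assoc flip: mon_pair_idx)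
  qed
  thus "\<exists>c R. dser c R F p" by blast
next
  assume "\<exists>c R. dser c R F p"
  then obtain c R where c: "dser c R F p" by blast
  note 1 = dserD[OF c]
  have a: "pair_idx i \<in> midx" for i using bij_pair_idx by (auto simp: bij_betw_def)
  have b: "(\<lambda>i. \<bar>case i of (j, k) \<Rightarrow> c j k\<bar> * R ^ mdeg (pair_idx i)) summable_on UNIV"
    using 1(2) by (rule summable_on_cong[THEN iffD1, rotated]) (auto simp: mdeg_pair_idx)
  have "((\<lambda>i. (case i of (j, k) \<Rightarrow> c j k) * mon (pair_idx i) h) has_sum F (p + h)) UNIV"
    if "\<And>b. b \<in> Basis \<Longrightarrow> \<bar>h \<bullet> b\<bar> \<le> R" for h
  proof -
    have "\<bar>fst h\<bar> \<le> R" "\<bar>snd h\<bar> \<le> R"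
      using that[of "(1, 0)"] that[of "(0, 1)"] by (cases h; simp add: Basis_real2)+
    from 1(3)[OF this] have "((\<lambda>(j, k). c j k * fst h ^ j * snd h ^ k) has_sum F (p + h)) UNIV" by simp
    thus ?thesis
      by (rule has_sum_cong[THEN iffD1, rotated]) (cases h, auto simp: mon_pair_idx)
  qed
  from pser_indexed(1)[OF 1(1) a b, of F p, OF this] show "real_analytic_at F p"
    unfolding real_analytic_at_iff_pser by blast
qed

lemma dser_row:
  assumes "dser c R F p" "\<bar>x\<bar> \<le> R" "\<bar>y\<bar> \<le> R"
  shows "(\<lambda>k. c j k * y ^ k) summable_on UNIV"
    "((\<lambda>j. (\<Sum>\<^sub>\<infinity>k. c j k * y ^ k) * x ^ j) has_sum F (p + (x, y))) UNIV"
proof -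
  note 1 = dserD[OF assms(1)]
  have R: "R ^ j \<noteq> 0" using 1(1) by simp
  have "(\<lambda>(j, k). \<bar>c j k\<bar> * R ^ (j + k)) summable_on (UNIV \<times> UNIV)" using 1(2) by simp
  hence "(\<lambda>k. \<bar>c j k\<bar> * R ^ (j + k)) summable_on UNIV" for j by (rule summable_on_SigmaD1) simp
  hence "(\<lambda>k. R ^ j * (\<bar>c j k\<bar> * R ^ k)) summable_on UNIV" for j
    by (simp add: power_add mult.left_commute)
  hence a: "(\<lambda>k. \<bar>c j k\<bar> * R ^ k) summable_on UNIV" for j
    using 1(1) by (subst (asm) summable_on_cmult_right') auto
  have b: "(\<lambda>k. c j k * y ^ k) summable_on UNIV" for j
  proof -
    have "(\<lambda>k. \<bar>c j k * y ^ k\<bar>) summable_on UNIV"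
      using a[of j] by (rule summable_on_comparison_test)
        (use assms(3) in \<open>auto simp: abs_mult power_abs intro!: mult_left_mono power_mono\<close>)
    thus ?thesis using summable_on_iff_abs_summable_on_real[of "\<lambda>k. c j k * y ^ k"] by simp
  qed
  thus "(\<lambda>k. c j k * y ^ k) summable_on UNIV" .
  show "((\<lambda>j. (\<Sum>\<^sub>\<infinity>k. c j k * y ^ k) * x ^ j) has_sum F (p + (x, y))) UNIV"
  proof (rule has_sum_Sigma')
    show "((\<lambda>(j, k). c j k * x ^ j * y ^ k) has_sum F (p + (x, y))) (UNIV \<times> UNIV)"
      using 1(3)[OF assms(2,3)] by simp
    show "((\<lambda>k. case (j, k) of (j, k) \<Rightarrow> c j k * x ^ j * y ^ k) has_sum (\<Sum>\<^sub>\<infinity>k. c j k * y ^ k) * x ^ j) UNIV" for j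
      using has_sum_cmult_left[OF has_sum_infsum[OF b[of j]], of "x ^ j"] by (simp add: mult_ac)
  qed
qed

lemma dser_line:
  assumes "dser c R F p"
  shows "analytic1 (\<lambda>t. F (t, snd p)) (fst p)" "fps_nth (jet (\<lambda>t. F (t, snd p)) (fst p)) j = c j 0"
proof -
  note 1 = dserD[OF assms]
  have "(\<lambda>j. c j 0 * x ^ j) sums F (fst p + x, snd p)" if "\<bar>x\<bar> \<le> R" for x
  proof -
    have "(\<Sum>\<^sub>\<infinity>k. c j k * 0 ^ k) = c j 0" for j
      by (rule infsumI, rule has_sum_finite_neutralI[where B="{0}"]) auto
    thus ?thesis using dser_row(2)[OF assms that, of 0] 1(1)
      by (cases p) (auto intro: has_sum_imp_sums)
  qed
  moreover have "\<forall>\<^sub>F x in nhds 0. \<bar>x\<bar> < R"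
    using 1(1) by (auto simp: eventually_nhds_metric dist_norm)
  ultimately have "\<forall>\<^sub>F x in nhds 0. (\<lambda>j. fps_nth (Abs_fps (\<lambda>j. c j 0)) j * x ^ j) sums F (fst p + x, snd p)"
    by (auto elim: eventually_mono)
  from has_fps_expansionI[OF this]
  have *: "(\<lambda>x. F (fst p + x, snd p)) has_fps_expansion Abs_fps (\<lambda>j. c j 0)" .
  show "analytic1 (\<lambda>t. F (t, snd p)) (fst p)" "fps_nth (jet (\<lambda>t. F (t, snd p)) (fst p)) j = c j 0"
    using analytic1_fps[of "\<lambda>t. F (t, snd p)", OF *] by auto
qed

lemma dser_coeff_0: "dser c R F p \<Longrightarrow> c 0 0 = F p"
  using dser_line(2)[of c R F p 0] by simp

text \<open>For fixed y the series is summed over k into a power series in x and differentiated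
  termwise. The derivative is obtained on a whole box, not only at p, so that the result is again a
  double series and the argument iterates.\<close>

lemma dser_dx:
  assumes "dser c R F p"
  shows "dser (\<lambda>j k. real (Suc j) * c (Suc j) k) (R / 2) (dx F) p"
    and "\<bar>x\<bar> \<le> R / 2 \<Longrightarrow> \<bar>y\<bar> \<le> R / 2 \<Longrightarrow>
      ((\<lambda>t. F (t, snd p + y)) has_field_derivative dx F (p + (x, y))) (at (fst p + x))"
proof -
  note 1 = dserD[OF assms]
  let ?C = "\<lambda>y j. \<Sum>\<^sub>\<infinity>k. c j k * y ^ k"
  have D: "((\<lambda>t. F (t, snd p + y)) has_field_derivative (\<Sum>j. diffs (?C y) j * x ^ j)) (at (fst p + x))"
    and D': "summable (\<lambda>j. diffs (?C y) j * x ^ j)"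
    if x: "\<bar>x\<bar> \<le> R / 2" and y: "\<bar>y\<bar> \<le> R / 2" for x y
  proof -
    have s: "(\<lambda>j. ?C y j * t ^ j) sums F (p + (t, y))" if "\<bar>t\<bar> \<le> R" for t
      using dser_row(2)[OF assms that, of y] y 1(1) by (auto intro: has_sum_imp_sums)
    have sR: "summable (\<lambda>j. ?C y j * R ^ j)" using s[of R] 1(1) by (auto simp: sums_iff)
    have xR: "norm x < norm R" using x 1(1) by auto
    from termdiffs_strong[OF sR xR]
    have "((\<lambda>t. \<Sum>j. ?C y j * t ^ j) has_field_derivative (\<Sum>j. diffs (?C y) j * x ^ j)) (at x)" .
    moreover have ev: "\<forall>\<^sub>F t in nhds x. (\<Sum>j. ?C y j * t ^ j) = F (fst p + t, snd p + y)"
    proof -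
      have "\<forall>\<^sub>F t in nhds x. t \<in> {-R<..<R}"
        using xR 1(1) by (intro eventually_nhds_in_open) auto
      thus ?thesis
      proof eventually_elim
        case (elim t)
        thus ?case using s[of t] by (cases p) (auto simp: sums_iff)
      qed
    qed
    ultimately have "((\<lambda>t. F (fst p + t, snd p + y)) has_field_derivative (\<Sum>j. diffs (?C y) j * x ^ j)) (at x)"
      by (rule_tac DERIV_cong_ev[THEN iffD1, OF refl ev refl])
    thus "((\<lambda>t. F (t, snd p + y)) has_field_derivative (\<Sum>j. diffs (?C y) j * x ^ j)) (at (fst p + x))"
      using DERIV_shift[of "\<lambda>t. F (t, snd p + y)" _ x "fst p"] by (simp add: add.commute)
    show "summable (\<lambda>j. diffs (?C y) j * x ^ j)"
      by (rule termdiff_converges[OF xR]) (use s 1(1) in \<open>auto simp: sums_iff\<close>)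
  qed
  have dxF: "dx F (p + (x, y)) = (\<Sum>j. diffs (?C y) j * x ^ j)"
    if "\<bar>x\<bar> \<le> R / 2" "\<bar>y\<bar> \<le> R / 2" for x y
    using DERIV_imp_deriv[OF D[OF that]] by (cases p) (simp add: dx_def)
  show "\<bar>x\<bar> \<le> R / 2 \<Longrightarrow> \<bar>y\<bar> \<le> R / 2 \<Longrightarrow>
      ((\<lambda>t. F (t, snd p + y)) has_field_derivative dx F (p + (x, y))) (at (fst p + x))"
    using D dxF by simp
  let ?d = "\<lambda>j k. real (Suc j) * c (Suc j) k"
  have S: "(\<lambda>(j, k). \<bar>?d j k\<bar> * (R / 2) ^ (j + k)) summable_on UNIV"
  proof (rule summable_on_comparison_test)
    have "(\<lambda>(j, k). \<bar>c j k\<bar> * R ^ (j + k)) summable_on (map_prod Suc id ` UNIV)"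
      using 1(2) by (rule summable_on_subset_banach) auto
    hence "(\<lambda>(j, k). \<bar>c (Suc j) k\<bar> * R ^ (Suc j + k)) summable_on UNIV"
      by (subst (asm) summable_on_reindex) (auto simp: o_def case_prod_unfold inj_on_def)
    thus "(\<lambda>jk. inverse R * (case jk of (j, k) \<Rightarrow> \<bar>c (Suc j) k\<bar> * R ^ (Suc j + k))) summable_on UNIV"
      by (rule summable_on_cmult_right)
  next
    fix jk :: "nat \<times> nat"
    obtain j k where jk: "jk = (j, k)" by (cases jk)
    \<comment> \<open>Halving the radius pays for the factor j + 1 produced by
      differentiation.\<close>
    have "real (Suc j) \<le> 2 ^ j"
      by (induction j) auto
    hence "real (Suc j) * (R / 2) ^ (j + k) \<le> 2 ^ j * (R / 2) ^ (j + k)"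
      using 1(1) by (intro mult_right_mono) auto
    also have "\<dots> \<le> 2 ^ (j + k) * (R / 2) ^ (j + k)"
      using 1(1) by (intro mult_right_mono power_increasing) auto
    also have "\<dots> = R ^ (j + k)" by (simp flip: power_mult_distrib)
    finally have "real (Suc j) * (R / 2) ^ (j + k) \<le> R ^ (j + k)" .
    from mult_left_mono[OF this, of "\<bar>c (Suc j) k\<bar>"]
    have "\<bar>?d j k\<bar> * (R / 2) ^ (j + k) \<le> \<bar>c (Suc j) k\<bar> * R ^ (j + k)"
      by (simp add: abs_mult mult_ac)
    also have "\<dots> = inverse R * (\<bar>c (Suc j) k\<bar> * R ^ (Suc j + k))"
      using 1(1) by simp
    finally show "(case jk of (j, k) \<Rightarrow> \<bar>?d j k\<bar> * (R / 2) ^ (j + k)) \<le>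
        inverse R * (case jk of (j, k) \<Rightarrow> \<bar>c (Suc j) k\<bar> * R ^ (Suc j + k))"
      by (simp only: jk prod.case)
  qed (use 1(1) in auto)
  have "((\<lambda>(j, k). ?d j k * x ^ j * y ^ k) has_sum dx F (p + (x, y))) UNIV"
    if x: "\<bar>x\<bar> \<le> R / 2" and y: "\<bar>y\<bar> \<le> R / 2" for x y
  proof -
    have yR: "\<bar>y\<bar> \<le> R" using y 1(1) by auto
    have "(\<lambda>(j, k). \<bar>?d j k * x ^ j * y ^ k\<bar>) summable_on UNIV"
      using S by (rule summable_on_comparison_test)
        (use x y in \<open>auto simp: abs_mult power_abs power_add mult.assoc intro!: mult_left_mono mult_mono power_mono\<close>)
    hence sm: "(\<lambda>(j, k). ?d j k * x ^ j * y ^ k) summable_on (UNIV \<times> UNIV)"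
      using summable_on_iff_abs_summable_on_real[of "\<lambda>(j, k). ?d j k * x ^ j * y ^ k"]
      by (simp add: case_prod_unfold)
    have inner: "((\<lambda>k. case (j, k) of (j, k) \<Rightarrow> ?d j k * x ^ j * y ^ k) has_sum (diffs (?C y) j * x ^ j)) UNIV" for j
      using has_sum_cmult_left[OF has_sum_infsum[OF dser_row(1)[OF assms yR yR, of "Suc j"]], of "real (Suc j) * x ^ j"]
      by (simp add: diffs_def mult_ac)
    have "((\<lambda>j. diffs (?C y) j * x ^ j) has_sum (\<Sum>\<^sub>\<infinity>(j, k)\<in>UNIV \<times> UNIV. ?d j k * x ^ j * y ^ k)) UNIV"
      using has_sum_infsum[OF sm] inner by (rule has_sum_Sigma')
    hence "(\<Sum>\<^sub>\<infinity>(j, k)\<in>UNIV \<times> UNIV. ?d j k * x ^ j * y ^ k) = (\<Sum>j. diffs (?C y) j * x ^ j)"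
      by (rule sums_unique[OF has_sum_imp_sums])
    thus ?thesis using has_sum_infsum[OF sm] dxF[OF x y] by simp
  qed
  thus "dser ?d (R / 2) (dx F) p" using S 1(1) unfolding dser_def by auto
qed

lemma dser_swap:
  assumes "dser c R F p"
  shows "dser (\<lambda>j k. c k j) R (F \<circ> prod.swap) (prod.swap p)"
proof -
  note 1 = dserD[OF assms]
  have b: "bij_betw prod.swap (UNIV :: (nat \<times> nat) set) UNIV" by (rule bij_swap)
  have "(\<lambda>(j, k). \<bar>c k j\<bar> * R ^ (j + k)) summable_on UNIV"
    using summable_on_reindex_bij_betw[OF b, of "\<lambda>(j, k). \<bar>c j k\<bar> * R ^ (j + k)"] 1(2)
    by (simp add: case_prod_unfold add.commute)
  moreover have "((\<lambda>(j, k). c k j * x ^ j * y ^ k) has_sum (F \<circ> prod.swap) (prod.swap p + (x, y))) UNIV"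
    if "\<bar>x\<bar> \<le> R" "\<bar>y\<bar> \<le> R" for x y
    using has_sum_reindex_bij_betw[OF b, of "\<lambda>(j, k). c j k * y ^ j * x ^ k"] 1(3)[OF that(2,1)]
    by (cases p) (simp add: case_prod_unfold mult_ac)
  ultimately show ?thesis using 1(1) unfolding dser_def by blast
qed

lemma dy_eq_dx_swap: "dy F = dx (F \<circ> prod.swap) \<circ> prod.swap"
  by (auto simp: dy_def dx_def fun_eq_iff)

lemma dser_dy:
  assumes "dser c R F p"
  shows "dser (\<lambda>j k. real (Suc k) * c j (Suc k)) (R / 2) (dy F) p"
    and "\<bar>x\<bar> \<le> R / 2 \<Longrightarrow> \<bar>y\<bar> \<le> R / 2 \<Longrightarrow>
      ((\<lambda>t. F (fst p + x, t)) has_field_derivative dy F (p + (x, y))) (at (snd p + y))"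
proof -
  note s = dser_swap[OF assms]
  show "dser (\<lambda>j k. real (Suc k) * c j (Suc k)) (R / 2) (dy F) p"
    using dser_swap[OF dser_dx(1)[OF s]] by (simp add: dy_eq_dx_swap)
  show "\<bar>x\<bar> \<le> R / 2 \<Longrightarrow> \<bar>y\<bar> \<le> R / 2 \<Longrightarrow>
      ((\<lambda>t. F (fst p + x, t)) has_field_derivative dy F (p + (x, y))) (at (snd p + y))"
    using dser_dx(2)[OF s, of y x] by (cases p) (simp add: dy_eq_dx_swap)
qed

lemma dser_pd:
  assumes "dser c R F p"
  shows "\<exists>R'. dser (\<lambda>j k. (fact (j + m) / fact j) * (fact (k + n) / fact k) * c (j + m) (k + n)) R' (pd m n F) p"
proof -
  have y: "\<exists>R'. dser (\<lambda>j k. (fact (k + n) / fact k) * c j (k + n)) R' ((dy ^^ n) F) p" for n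
  proof (induction n)
    case 0 thus ?case using assms by auto
  next
    case (Suc n)
    then obtain R' where "dser (\<lambda>j k. (fact (k + n) / fact k) * c j (k + n)) R' ((dy ^^ n) F) p" by blast
    from dser_dy(1)[OF this] show ?case
      by (auto simp: field_simps simp del: of_nat_Suc)
  qed
  show ?thesis
  proof (induction m)
    case 0 thus ?case using y by (simp add: pd_def)
  next
    case (Suc m)
    then obtain R' where "dser (\<lambda>j k. (fact (j + m) / fact j) * (fact (k + n) / fact k) * c (j + m) (k + n)) R' (pd m n F) p" by blast
    from dser_dx(1)[OF this] show ?case
      by (auto simp: field_simps pd_def simp del: of_nat_Suc)
  qed
qed

lemma pd_eq_coeff:
  assumes "dser c R F p" shows "pd m n F p = fact m * fact n * c m n"
proof -
  obtain R' where c': "dser (\<lambda>j k. (fact (j + m) / fact j) * (fact (k + n) / fact k) * c (j + m) (k + n)) R' (pd m n F) p"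
    using dser_pd[OF assms] by blast
  from dser_coeff_0[OF this] show ?thesis by simp
qed

lemma real_analytic_at_pd: "real_analytic_at F p \<Longrightarrow> real_analytic_at (pd m n F) p"
  using dser_pd unfolding real_analytic_at_iff_dser by blast

lemma real_analytic_at_dx_deriv:
  assumes "real_analytic_at F (x, y)"
  shows "((\<lambda>t. F (t, y)) has_field_derivative dx F (x, y)) (at x)"
proof -
  obtain c R where c: "dser c R F (x, y)" using assms unfolding real_analytic_at_iff_dser by blast
  from dser_dx(2)[OF c, of 0 0] dserD(1)[OF c] show ?thesis by simp
qed

lemma real_analytic_at_dy_deriv:
  assumes "real_analytic_at F (x, y)"
  shows "((\<lambda>t. F (x, t)) has_field_derivative dy F (x, y)) (at y)"
proof -
  obtain c R where c: "dser c R F (x, y)" using assms unfolding real_analytic_at_iff_dser by blast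
  from dser_dy(2)[OF c, of 0 0] dserD(1)[OF c] show ?thesis by simp
qed

lemma dx_pd: "dx (pd m n F) = pd (Suc m) n F"
  by (simp add: pd_def)

lemma dy_pd:
  assumes "real_analytic_at F p"
  shows "dy (pd m n F) p = pd m (Suc n) F p"
proof -
  obtain c R where c: "dser c R F p" using assms unfolding real_analytic_at_iff_dser by blast
  obtain R' where c': "dser (\<lambda>j k. (fact (j + m) / fact j) * (fact (k + n) / fact k) * c (j + m) (k + n)) R' (pd m n F) p"
    using dser_pd[OF c] by blast
  show ?thesis
    using dser_coeff_0[OF dser_dy(1)[OF c']] pd_eq_coeff[OF c, of m "Suc n"] by simp
qed

lemma real_analytic_at_isCont:
  fixes f :: "'a::euclidean_space \<Rightarrow> real"
  assumes "real_analytic_at f p"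
  shows "isCont f p"
proof -
  obtain c0 R0 where c0: "pser c0 R0 f p"
    using assms(1) unfolding real_analytic_at_iff_pser by blast
  obtain c where c: "pser c R0 (\<lambda>z. f z + - f p) p"
    using pser_add[OF c0 pser_const(1)[OF pserD(1)[OF c0], of "- f p"]] by blast
  have "\<exists>d>0. \<forall>z. dist z p < d \<longrightarrow> dist (f z) (f p) < e" if "e > 0" for e
  proof -
    obtain R where R: "0 < R" "R \<le> R0" "pnorm R c \<le> e / 2"
      using pser_small_norm[OF c, of "e / 2"] pser_coeff_0[OF c] \<open>e > 0\<close> by auto
    have "dist (f z) (f p) < e" if z: "dist z p < R" for z
    proof -
      have "\<bar>(z - p) \<bullet> b\<bar> \<le> R" if "b \<in> Basis" for b
        using Basis_le_norm[OF that, of "z - p"] z by (simp add: dist_norm)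
      from pser_bound[OF pser_mono[OF c R(1,2)] this] R(3) \<open>e > 0\<close>
      show ?thesis by (simp add: dist_norm)
    qed
    thus ?thesis using R(1) by blast
  qed
  thus ?thesis unfolding continuous_at_eps_delta by (auto simp: dist_commute)
qed

text \<open>Differentiability follows from the x-partial at p alone together with the y-partial on a
  box and its continuity at p.\<close>

lemma real_analytic_at_has_derivative:
  fixes F :: "real \<times> real \<Rightarrow> real"
  assumes "real_analytic_at F p"
  shows "(F has_derivative (\<lambda>(u, v). dx F p * u + dy F p * v)) (at p)"
proof -
  obtain x y where p: "p = (x, y)" by (cases p)
  obtain c R where c: "dser c R F p" using assms unfolding real_analytic_at_iff_dser by blast
  note R = dserD(1)[OF c]
  define X Y where "X = ball x (R / 2)" and "Y = ball y (R / 2)"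
  have "((\<lambda>(x, y). F (x, y)) has_derivative
      (\<lambda>(tx, ty). dx F p * tx + blinfun_apply (blinfun_scaleR_left (dy F (x, y)) ) ty)) (at (x, y) within X \<times> Y)"
  proof (rule has_derivative_partialsI)
    show "((\<lambda>x. F (x, y)) has_derivative (\<lambda>tx. dx F p * tx)) (at x within X)"
      using real_analytic_at_dx_deriv[OF assms[unfolded p]]
      by (simp add: p has_field_derivative_def has_derivative_at_withinI)
    show "((\<lambda>y. F (x', y)) has_derivative blinfun_apply (blinfun_scaleR_left (dy F (x', y')))) (at y' within Y)"
      if "x' \<in> X" "y' \<in> Y" for x' y'
    proof -
      have "\<bar>x' - x\<bar> \<le> R / 2" "\<bar>y' - y\<bar> \<le> R / 2"
        using that by (simp_all add: X_def Y_def dist_real_def abs_minus_commute)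
      from dser_dy(2)[OF c this] have "((\<lambda>t. F (x', t)) has_field_derivative dy F (x', y')) (at y')"
        by (simp add: p)
      moreover have "blinfun_apply (blinfun_scaleR_left (dy F (x', y'))) = (*) (dy F (x', y'))"
        by (rule ext) (simp add: blinfun_scaleR_left.rep_eq)
      ultimately show ?thesis
        by (simp add: has_field_derivative_def has_derivative_at_withinI)
    qed
    have "isCont (dy F) p"
      using real_analytic_at_isCont[OF real_analytic_at_pd[OF assms, of 0 1]] by (simp add: pd_def)
    hence "isCont (\<lambda>z. blinfun_scaleR_left (dy F z) :: real \<Rightarrow>\<^sub>L real) p"
      by (rule bounded_linear.isCont[OF bounded_linear_blinfun_scaleR_left])
    thus "continuous (at (x, y) within X \<times> Y) (\<lambda>(x, y). blinfun_scaleR_left (dy F (x, y)) :: real \<Rightarrow>\<^sub>L real)"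
      unfolding p by (simp add: case_prod_unfold continuous_at_imp_continuous_at_within)
    show "y \<in> Y" "convex Y" using R by (auto simp: Y_def)
  qed
  moreover have "at (x, y) within X \<times> Y = at (x, y)"
    using R by (intro at_within_open) (auto simp: X_def Y_def open_Times)
  moreover have "(\<lambda>(tx, ty). dx F p * tx + blinfun_apply (blinfun_scaleR_left (dy F (x, y))) ty) =
      (\<lambda>(u, v). dx F p * u + dy F p * v)"
    by (rule ext) (auto simp: p blinfun_scaleR_left.rep_eq)
  ultimately show ?thesis by (simp add: p)
qed

section \<open>Branch surfaces as cones\<close>

lemma eventually_eq_refine:
  assumes "\<forall>\<^sub>F z in nhds (x, y). P z"
  shows "\<forall>\<^sub>F t in nhds x. P (t, y)" "\<forall>\<^sub>F t in nhds y. P (x, t)"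
proof -
  have "filterlim (\<lambda>t. (t, y)) (nhds (x, y)) (nhds x)" "filterlim (\<lambda>t. (x, t)) (nhds (x, y)) (nhds y)"
    by (intro tendsto_Pair tendsto_const filterlim_ident)+
  from this[THEN eventually_compose_filterlim[OF assms]]
  show "\<forall>\<^sub>F t in nhds x. P (t, y)" "\<forall>\<^sub>F t in nhds y. P (x, t)" .
qed

lemma dx_cong: "\<forall>\<^sub>F z' in nhds z. F z' = G z' \<Longrightarrow> dx F z = dx G z"
  by (cases z) (auto simp: dx_def intro!: deriv_cong_ev dest!: eventually_eq_refine(1))

lemma dy_cong: "\<forall>\<^sub>F z' in nhds z. F z' = G z' \<Longrightarrow> dy F z = dy G z"
  by (cases z) (auto simp: dy_def intro!: deriv_cong_ev dest!: eventually_eq_refine(2))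

lemma pd_cong_eventually:
  assumes "\<forall>\<^sub>F z' in nhds z. F z' = G z'"
  shows "\<forall>\<^sub>F z' in nhds z. pd j k F z' = pd j k G z'"
proof -
  have e: "\<forall>\<^sub>F z' in nhds z. H F z' = H G z' \<Longrightarrow> \<forall>\<^sub>F z' in nhds z. dx (H F) z' = dx (H G) z'"
    "\<forall>\<^sub>F z' in nhds z. H F z' = H G z' \<Longrightarrow> \<forall>\<^sub>F z' in nhds z. dy (H F) z' = dy (H G) z'" for H
    by (subst (asm) eventually_eventually[symmetric], erule eventually_mono, erule dx_cong dy_cong)+
  have y: "\<forall>\<^sub>F z' in nhds z. (dy ^^ k) F z' = (dy ^^ k) G z'" for k
    by (induction k) (use assms e(2)[of "dy ^^ _"] in \<open>auto\<close>)
  show ?thesis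
  proof (induction j)
    case 0 thus ?case using y by (simp add: pd_def)
  next
    case (Suc j) thus ?case using e(1)[of "pd j k"] by (simp add: pd_def)
  qed
qed

lemma pd_cong:
  assumes "\<forall>\<^sub>F z' in nhds z. F z' = G z'"
  shows "pd j k F z = pd j k G z"
  using eventually_nhds_x_imp_x[OF pd_cong_eventually[OF assms]] .

lemma dx_mult:
  assumes "real_analytic_at f z" "real_analytic_at g z"
  shows "dx (\<lambda>z. f z * g z) z = dx f z * g z + f z * dx g z"
proof -
  obtain x y where z: "z = (x, y)" by (cases z)
  have "((\<lambda>t. f (t, y) * g (t, y)) has_field_derivative dx f z * g z + f z * dx g z) (at x)"
    using assms unfolding z by (auto intro!: derivative_eq_intros real_analytic_at_dx_deriv)
  from DERIV_imp_deriv[OF this] show ?thesis by (simp add: z dx_def)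
qed

lemma dy_mult:
  assumes "real_analytic_at f z" "real_analytic_at g z"
  shows "dy (\<lambda>z. f z * g z) z = dy f z * g z + f z * dy g z"
proof -
  obtain x y where z: "z = (x, y)" by (cases z)
  have "((\<lambda>t. f (x, t) * g (x, t)) has_field_derivative dy f z * g z + f z * dy g z) (at y)"
    using assms unfolding z by (auto intro!: derivative_eq_intros real_analytic_at_dy_deriv)
  from DERIV_imp_deriv[OF this] show ?thesis by (simp add: z dy_def)
qed

lemma constant_on_ball:
  fixes f :: "real \<times> real \<Rightarrow> real"
  assumes "\<And>x y. (x, y) \<in> ball p e \<Longrightarrow> ((\<lambda>t. f (t, y)) has_field_derivative 0) (at x)"
    "\<And>x y. (x, y) \<in> ball p e \<Longrightarrow> ((\<lambda>t. f (x, t)) has_field_derivative 0) (at y)"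
    "\<And>z. z \<in> ball p e \<Longrightarrow> real_analytic_at f z" "z \<in> ball p e" "e > 0"
  shows "f z = f p"
proof (rule has_derivative_zero_unique[of "ball p e" f z p])
  fix z' assume z': "z' \<in> ball p e"
  obtain x y where xy: "z' = (x, y)" by (cases z')
  have "dx f z' = 0" "dy f z' = 0"
    using assms(1,2)[of x y] z' by (auto simp: xy dx_def dy_def intro!: DERIV_imp_deriv)
  hence "(f has_derivative (\<lambda>(u, v). 0)) (at z')"
    using real_analytic_at_has_derivative[OF assms(3)[OF z']] by simp
  thus "(f has_derivative (\<lambda>x. 0)) (at z' within ball p e)"
    by (simp add: case_prod_unfold has_derivative_at_withinI)
qed (use assms in auto)

text \<open>The cone with vertex \<open>(x\<^sub>0, y\<^sub>0, u\<^sub>0)\<close>, whose rulings have the directions \<open>(s, -1, \<phi>(s))\<close>.\<close>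

definition cone :: "real \<Rightarrow> real \<Rightarrow> real \<Rightarrow> (real \<Rightarrow> real) \<Rightarrow> real \<times> real \<Rightarrow> real" where
  "cone x0 y0 u0 \<phi> = (\<lambda>(x, y). u0 + (y0 - y) * \<phi> ((x - x0) / (y0 - y)))"

lemma analytic1_line:
  fixes F :: "real \<times> real \<Rightarrow> real"
  assumes "real_analytic_at F (x, y)" shows "analytic1 (\<lambda>t. F (t, y)) x"
proof -
  obtain c R where "dser c R F (x, y)" using assms unfolding real_analytic_at_iff_dser by blast
  from dser_line(1)[OF this] show ?thesis by simp
qed

lemma real_analytic_at_fst: "real_analytic_at fst (p :: real \<times> real)"
  and real_analytic_at_snd: "real_analytic_at snd (p :: real \<times> real)"
  using real_analytic_at_linear[OF bounded_linear_fst] real_analytic_at_linear[OF bounded_linear_snd] .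

section \<open>From the branch equations to a cone\<close>

lemma in_branchD:
  assumes "in_branch D F" "z \<in> D"
  shows "real_analytic_at F z" "pd 2 0 F z \<noteq> 0" "pd 2 0 F z * pd 0 2 F z = (pd 1 1 F z)\<^sup>2"
    "pd 2 0 F z * pd 2 1 F z - pd 1 1 F z * pd 3 0 F z \<noteq> 0"
    "(pd 2 0 F z) ^ 2 * pd 3 1 F z - pd 2 0 F z * pd 1 1 F z * pd 4 0 F z
        + 2 * pd 1 1 F z * (pd 3 0 F z) ^ 2 - 2 * pd 2 0 F z * pd 3 0 F z * pd 2 1 F z = 0"
proof -
  from assms have *: "real_analytic_at F z" "pd 2 0 F z \<noteq> 0" "pd 2 0 F z * pd 0 2 F z - (pd 1 1 F z)\<^sup>2 = 0"
    "inv_S F z \<noteq> 0" "inv_W F z = 0" unfolding in_branch_def by auto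
  show "real_analytic_at F z" "pd 2 0 F z \<noteq> 0" "pd 2 0 F z * pd 0 2 F z = (pd 1 1 F z)\<^sup>2" using * by auto
  show S: "pd 2 0 F z * pd 2 1 F z - pd 1 1 F z * pd 3 0 F z \<noteq> 0" using *(4) by (auto simp: inv_S_def)
  show "(pd 2 0 F z) ^ 2 * pd 3 1 F z - pd 2 0 F z * pd 1 1 F z * pd 4 0 F z
        + 2 * pd 1 1 F z * (pd 3 0 F z) ^ 2 - 2 * pd 2 0 F z * pd 3 0 F z * pd 2 1 F z = 0"
    using *(5) S *(2) by (auto simp: inv_W_def)
qed

lemma in_branch_open: "in_branch D F \<Longrightarrow> open D"
  by (simp add: in_branch_def)

text \<open>The rulings project to lines of slope \<open>dx/dy = -q\<close>. The vanishing of the Hessian gives Burgers' equation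
  \<open>q\<^sub>y = q q\<^sub>x\<close>, while \<open>S\<close> and \<open>W\<close> are multiples of \<open>q\<^sub>x\<close> and \<open>q\<^sub>x\<^sub>x\<close>.\<close>

lemma branch_burgers:
  assumes b: "in_branch D F"
  defines "q \<equiv> (\<lambda>z. pd 1 1 F z / pd 2 0 F z)"
  shows "\<And>z. z \<in> D \<Longrightarrow> real_analytic_at q z" "\<And>z. z \<in> D \<Longrightarrow> dx q z \<noteq> 0"
    "\<And>z. z \<in> D \<Longrightarrow> dx (dx q) z = 0" "\<And>z. z \<in> D \<Longrightarrow> dy q z = q z * dx q z"
    "\<And>z. z \<in> D \<Longrightarrow> dy (dx q) z = (dx q z)\<^sup>2"
proof -
  note B = in_branchD[OF b]
  have ev: "\<forall>\<^sub>F z' in nhds z. z' \<in> D" if "z \<in> D" for z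
    using in_branch_open[OF b] that by (rule eventually_nhds_in_open)
  have A: "real_analytic_at (pd j k F) z" if "z \<in> D" for z j k
    by (rule real_analytic_at_pd[OF B(1)[OF that]])
  show qa: "real_analytic_at q z" if "z \<in> D" for z
    unfolding q_def by (intro real_analytic_at_divide A B that)
  have qx: "real_analytic_at (dx q) z" if "z \<in> D" for z
    using real_analytic_at_pd[OF qa[OF that], of 1 0] by (simp add: pd_def)
  have q1: "q z * pd 2 0 F z = pd 1 1 F z" if "z \<in> D" for z using B(2)[OF that] by (simp add: q_def)
  have q2: "q z * pd 1 1 F z = pd 0 2 F z" if "z \<in> D" for z
    using B(2,3)[OF that] by (simp add: q_def field_simps power2_eq_square)
  have e1: "dx q z * pd 2 0 F z + q z * pd 3 0 F z = pd 2 1 F z" if z: "z \<in> D" for z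
  proof -
    have "dx (\<lambda>z. q z * pd 2 0 F z) z = dx (pd 1 1 F) z"
      by (rule dx_cong) (use ev[OF z] q1 in \<open>auto elim: eventually_mono\<close>)
    thus ?thesis using dx_mult[OF qa[OF z] A[OF z], of 2 0] by (simp add: dx_pd numeral_eq_Suc)
  qed
  have e2: "dx (dx q) z * pd 2 0 F z + 2 * dx q z * pd 3 0 F z + q z * pd 4 0 F z = pd 3 1 F z" if z: "z \<in> D" for z
  proof -
    have "dx (\<lambda>z. dx q z * pd 2 0 F z + q z * pd 3 0 F z) z = dx (pd 2 1 F) z"
      by (rule dx_cong) (use ev[OF z] e1 in \<open>auto elim: eventually_mono\<close>)
    moreover have "dx (\<lambda>z. dx q z * pd 2 0 F z + q z * pd 3 0 F z) z =
        dx (\<lambda>z. dx q z * pd 2 0 F z) z + dx (\<lambda>z. q z * pd 3 0 F z) z"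
    proof -
      obtain x y where xy: "z = (x, y)" by (cases z)
      have "real_analytic_at (\<lambda>z. dx q z * pd 2 0 F z) z" "real_analytic_at (\<lambda>z. q z * pd 3 0 F z) z"
        by (intro real_analytic_at_mult qx qa A z)+
      from DERIV_add[OF this[unfolded xy, THEN real_analytic_at_dx_deriv], THEN DERIV_imp_deriv]
      show ?thesis by (simp add: xy dx_def)
    qed
    ultimately show ?thesis
      using dx_mult[OF qx[OF z] A[OF z], of 2 0] dx_mult[OF qa[OF z] A[OF z], of 3 0]
      by (simp add: dx_pd numeral_eq_Suc)
  qed
  \<comment> \<open>\<open>e3\<close> and \<open>e4\<close> compute F_xyy twice, as the y-derivative
    of F_xy = q F_xx and as the x-derivative of F_yy = q F_xy. Their difference is Burgers' equation
    multiplied by F_xx.\<close>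
  have e3: "dy q z * pd 2 0 F z + q z * pd 2 1 F z = pd 1 2 F z" if z: "z \<in> D" for z
  proof -
    have "dy (\<lambda>z. q z * pd 2 0 F z) z = dy (pd 1 1 F) z"
      by (rule dy_cong) (use ev[OF z] q1 in \<open>auto elim: eventually_mono\<close>)
    thus ?thesis using dy_mult[OF qa[OF z] A[OF z], of 2 0]
      by (simp add: dy_pd[OF B(1)[OF z]] numeral_eq_Suc)
  qed
  have e4: "dx q z * pd 1 1 F z + q z * pd 2 1 F z = pd 1 2 F z" if z: "z \<in> D" for z
  proof -
    have "dx (\<lambda>z. q z * pd 1 1 F z) z = dx (pd 0 2 F) z"
      by (rule dx_cong) (use ev[OF z] q2 in \<open>auto elim: eventually_mono\<close>)
    thus ?thesis using dx_mult[OF qa[OF z] A[OF z], of 1 1] by (simp add: dx_pd numeral_eq_Suc)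
  qed
  show qx0: "dx q z \<noteq> 0" if z: "z \<in> D" for z
  proof
    assume "dx q z = 0"
    hence "pd 2 1 F z = q z * pd 3 0 F z" using e1[OF z] by simp
    thus False using B(4)[OF z] q1[OF z, symmetric] by (simp add: mult_ac)
  qed
  \<comment> \<open>Once F_xy, F_xxy and F_xxxy are expressed through q, the numerator of
    \<open>inv_W\<close> collapses to F_xx^3 q_xx.\<close>
  show qxx: "dx (dx q) z = 0" if z: "z \<in> D" for z
  proof -
    have "(pd 2 0 F z) ^ 3 * dx (dx q) z = 0"
      using B(5)[OF z] unfolding e2[OF z, symmetric] e1[OF z, symmetric] q1[OF z, symmetric]
      by algebra
    thus ?thesis using B(2)[OF z] by simp
  qed
  show qy: "dy q z = q z * dx q z" if z: "z \<in> D" for z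
  proof -
    have "dy q z * pd 2 0 F z = dx q z * pd 1 1 F z"
      using e3[OF z] e4[OF z] by linarith
    also have "\<dots> = (q z * dx q z) * pd 2 0 F z"
      unfolding q1[OF z, symmetric] by (simp only: mult_ac)
    finally have "dy q z * pd 2 0 F z = (q z * dx q z) * pd 2 0 F z" .
    thus ?thesis using B(2)[OF z] by simp
  qed
  show "dy (dx q) z = (dx q z)\<^sup>2" if z: "z \<in> D" for z
  proof -
    have "dy (dx q) z = dx (dy q) z"
      using dy_pd[OF qa[OF z], of 1 0] by (simp add: pd_def)
    also have "\<dots> = dx (\<lambda>z. q z * dx q z) z"
      by (rule dx_cong) (use ev[OF z] qy in \<open>auto elim: eventually_mono\<close>)
    finally show ?thesis using dx_mult[OF qa[OF z] qx[OF z]] qxx[OF z] by (simp add: power2_eq_square)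
  qed
qed

text \<open>Since \<open>1/q\<^sub>x = y\<^sub>0 - y\<close>, all rulings pass through one point.\<close>

lemma branch_vertex:
  assumes b: "in_branch D F" and p: "p \<in> D"
  obtains e x0 y0 u0 where "e > 0" "ball p e \<subseteq> D"
    "\<And>x y. (x, y) \<in> ball p e \<Longrightarrow> y \<noteq> y0 \<and> F (x, y) = u0 + (x - x0) * pd 1 0 F (x, y) + (y - y0) * pd 0 1 F (x, y)"
proof -
  define q where "q = (\<lambda>z. pd 1 1 F z / pd 2 0 F z)"
  note B = in_branchD[OF b] and Q = branch_burgers[OF b, folded q_def]
  have Q4: "dy q z = q z * dx q z" if "z \<in> D" for z
    using Q(4)[OF that] unfolding q_def .
  obtain e where e: "e > 0" "ball p e \<subseteq> D" using in_branch_open[OF b] p open_contains_ball by blast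
  have A: "real_analytic_at (pd j k F) z" if "z \<in> D" for z j k
    by (rule real_analytic_at_pd[OF B(1)[OF that]])
  have qx: "real_analytic_at (dx q) z" if "z \<in> D" for z
    using real_analytic_at_pd[OF Q(1)[OF that], of 1 0] by (simp add: pd_def)
  have Dx: "((\<lambda>t. q (t, y)) has_field_derivative dx q (x, y)) (at x)"
    "((\<lambda>t. dx q (t, y)) has_field_derivative 0) (at x)"
    "((\<lambda>t. F (t, y)) has_field_derivative pd 1 0 F (x, y)) (at x)"
    "((\<lambda>t. pd 1 0 F (t, y)) has_field_derivative pd 2 0 F (x, y)) (at x)"
    "((\<lambda>t. pd 0 1 F (t, y)) has_field_derivative q (x, y) * pd 2 0 F (x, y)) (at x)"
    "((\<lambda>t. q (x, t)) has_field_derivative q (x, y) * dx q (x, y)) (at y)"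
    "((\<lambda>t. dx q (x, t)) has_field_derivative (dx q (x, y))\<^sup>2) (at y)"
    "((\<lambda>t. F (x, t)) has_field_derivative pd 0 1 F (x, y)) (at y)"
    "((\<lambda>t. pd 1 0 F (x, t)) has_field_derivative q (x, y) * pd 2 0 F (x, y)) (at y)"
    "((\<lambda>t. pd 0 1 F (x, t)) has_field_derivative q (x, y) * q (x, y) * pd 2 0 F (x, y)) (at y)"
    if z: "(x, y) \<in> ball p e" for x y
  proof -
    have zD: "(x, y) \<in> D" using z e by blast
    have 1: "pd 1 1 F (x, y) = q (x, y) * pd 2 0 F (x, y)" "pd 0 2 F (x, y) = q (x, y) * q (x, y) * pd 2 0 F (x, y)"
      using B(2,3)[OF zD] by (simp_all add: q_def field_simps power2_eq_square)
    show "((\<lambda>t. q (t, y)) has_field_derivative dx q (x, y)) (at x)"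
      by (rule real_analytic_at_dx_deriv[OF Q(1)[OF zD]])
    show "((\<lambda>t. dx q (t, y)) has_field_derivative 0) (at x)"
      using real_analytic_at_dx_deriv[OF qx[OF zD]] Q(3)[OF zD] by simp
    show "((\<lambda>t. F (t, y)) has_field_derivative pd 1 0 F (x, y)) (at x)"
      using real_analytic_at_dx_deriv[OF B(1)[OF zD]] by (simp add: pd_def)
    show "((\<lambda>t. pd 1 0 F (t, y)) has_field_derivative pd 2 0 F (x, y)) (at x)"
      using real_analytic_at_dx_deriv[OF A[OF zD, of 1 0]] by (simp add: dx_pd numeral_eq_Suc)
    show "((\<lambda>t. pd 0 1 F (t, y)) has_field_derivative q (x, y) * pd 2 0 F (x, y)) (at x)"
      using real_analytic_at_dx_deriv[OF A[OF zD, of 0 1]] 1 by (simp add: dx_pd numeral_eq_Suc)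
    show "((\<lambda>t. q (x, t)) has_field_derivative q (x, y) * dx q (x, y)) (at y)"
      using real_analytic_at_dy_deriv[OF Q(1)[OF zD]] Q4[OF zD] by simp
    show "((\<lambda>t. dx q (x, t)) has_field_derivative (dx q (x, y))\<^sup>2) (at y)"
      using real_analytic_at_dy_deriv[OF qx[OF zD]] Q(5)[OF zD] by simp
    show "((\<lambda>t. F (x, t)) has_field_derivative pd 0 1 F (x, y)) (at y)"
      using real_analytic_at_dy_deriv[OF B(1)[OF zD]] by (simp add: pd_def)
    show "((\<lambda>t. pd 1 0 F (x, t)) has_field_derivative q (x, y) * pd 2 0 F (x, y)) (at y)"
      using real_analytic_at_dy_deriv[OF A[OF zD, of 1 0]] dy_pd[OF B(1)[OF zD], of 1 0] 1
      by (simp add: numeral_eq_Suc)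
    show "((\<lambda>t. pd 0 1 F (x, t)) has_field_derivative q (x, y) * q (x, y) * pd 2 0 F (x, y)) (at y)"
      using real_analytic_at_dy_deriv[OF A[OF zD, of 0 1]] dy_pd[OF B(1)[OF zD], of 0 1] 1
      by (simp add: numeral_eq_Suc)
  qed
  have nz: "dx q z \<noteq> 0" if "z \<in> ball p e" for z using Q(2) that e by blast
  \<comment> \<open>The vertex as seen from z: \<open>X0\<close> and \<open>Y0\<close> solve q = (x
    - x0)/(y0 - y) and q_x = 1/(y0 - y), and \<open>U0\<close> is the height of the tangent plane at
    z above that point. It remains to see that all three are constant.\<close>
  define Y0 where "Y0 = (\<lambda>z. snd z + 1 / dx q z)"
  define X0 where "X0 = (\<lambda>z. fst z - q z / dx q z)"
  define U0 where "U0 = (\<lambda>z. F z - q z / dx q z * pd 1 0 F z + 1 / dx q z * pd 0 1 F z)"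
  have Y: "Y0 z = Y0 p" if "z \<in> ball p e" for z
  proof (rule constant_on_ball[OF _ _ _ that e(1)])
    fix x y assume z: "(x, y) \<in> ball p e"
    have "((\<lambda>t. Y0 (t, y)) has_field_derivative 0 + (0 * dx q (x, y) - 1 * 0) / (dx q (x, y) * dx q (x, y))) (at x)"
      unfolding Y0_def by (intro DERIV_add DERIV_diff DERIV_mult DERIV_divide DERIV_const DERIV_ident Dx[OF z] nz[OF z] | simp only: fst_conv snd_conv)+
    thus "((\<lambda>t. Y0 (t, y)) has_field_derivative 0) (at x)"
      using nz[OF z] by simp
    have "((\<lambda>t. Y0 (x, t)) has_field_derivative 1 + (0 * dx q (x, y) - 1 * (dx q (x, y))\<^sup>2) / (dx q (x, y) * dx q (x, y))) (at y)"
      unfolding Y0_def by (intro DERIV_add DERIV_diff DERIV_mult DERIV_divide DERIV_const DERIV_ident Dx[OF z] nz[OF z] | simp only: fst_conv snd_conv)+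
    thus "((\<lambda>t. Y0 (x, t)) has_field_derivative 0) (at y)"
      using nz[OF z] by (simp add: power2_eq_square)
  next
    fix z assume z: "z \<in> ball p e"
    have zD: "z \<in> D" using z e(2) by blast
    show "real_analytic_at Y0 z"
      unfolding Y0_def by (intro real_analytic_at_add real_analytic_at_diff real_analytic_at_mult real_analytic_at_divide
        real_analytic_at_const real_analytic_at_fst real_analytic_at_snd qx[OF zD] Q(1)[OF zD] A[OF zD] B(1)[OF zD] nz[OF z])
  qed
  have X: "X0 z = X0 p" if "z \<in> ball p e" for z
  proof (rule constant_on_ball[OF _ _ _ that e(1)])
    fix x y assume z: "(x, y) \<in> ball p e"
    have "((\<lambda>t. X0 (t, y)) has_field_derivative 1 - (dx q (x, y) * dx q (x, y) - q (x, y) * 0) / (dx q (x, y) * dx q (x, y))) (at x)"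
      unfolding X0_def by (intro DERIV_add DERIV_diff DERIV_mult DERIV_divide DERIV_const DERIV_ident Dx[OF z] nz[OF z] | simp only: fst_conv snd_conv)+
    thus "((\<lambda>t. X0 (t, y)) has_field_derivative 0) (at x)"
      using nz[OF z] by simp
    have "((\<lambda>t. X0 (x, t)) has_field_derivative 0 - ((q (x, y) * dx q (x, y)) * dx q (x, y) - q (x, y) * (dx q (x, y))\<^sup>2) / (dx q (x, y) * dx q (x, y))) (at y)"
      unfolding X0_def by (intro DERIV_add DERIV_diff DERIV_mult DERIV_divide DERIV_const DERIV_ident Dx[OF z] nz[OF z] | simp only: fst_conv snd_conv)+
    thus "((\<lambda>t. X0 (x, t)) has_field_derivative 0) (at y)"
      using nz[OF z] by (simp add: power2_eq_square)
  next
    fix z assume z: "z \<in> ball p e"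
    have zD: "z \<in> D" using z e(2) by blast
    show "real_analytic_at X0 z"
      unfolding X0_def by (intro real_analytic_at_add real_analytic_at_diff real_analytic_at_mult real_analytic_at_divide
        real_analytic_at_const real_analytic_at_fst real_analytic_at_snd qx[OF zD] Q(1)[OF zD] A[OF zD] B(1)[OF zD] nz[OF z])
  qed
  have U: "U0 z = U0 p" if "z \<in> ball p e" for z
  proof (rule constant_on_ball[OF _ _ _ that e(1)])
    fix x y assume z: "(x, y) \<in> ball p e"
    have "((\<lambda>t. U0 (t, y)) has_field_derivative pd 1 0 F (x, y) - ((dx q (x, y) * dx q (x, y) - q (x, y) * 0) / (dx q (x, y) * dx q (x, y)) * pd 1 0 F (x, y) + pd 2 0 F (x, y) * (q (x, y) / dx q (x, y))) + ((0 * dx q (x, y) - 1 * 0) / (dx q (x, y) * dx q (x, y)) * pd 0 1 F (x, y) + q (x, y) * pd 2 0 F (x, y) * (1 / dx q (x, y)))) (at x)"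
      unfolding U0_def by (intro DERIV_add DERIV_diff DERIV_mult DERIV_divide DERIV_const DERIV_ident Dx[OF z] nz[OF z] | simp only: fst_conv snd_conv)+
    thus "((\<lambda>t. U0 (t, y)) has_field_derivative 0) (at x)"
      using nz[OF z] by simp
    have "((\<lambda>t. U0 (x, t)) has_field_derivative pd 0 1 F (x, y) - (((q (x, y) * dx q (x, y)) * dx q (x, y) - q (x, y) * (dx q (x, y))\<^sup>2) / (dx q (x, y) * dx q (x, y)) * pd 1 0 F (x, y) + q (x, y) * pd 2 0 F (x, y) * (q (x, y) / dx q (x, y))) + ((0 * dx q (x, y) - 1 * (dx q (x, y))\<^sup>2) / (dx q (x, y) * dx q (x, y)) * pd 0 1 F (x, y) + q (x, y) * q (x, y) * pd 2 0 F (x, y) * (1 / dx q (x, y)))) (at y)"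
      unfolding U0_def by (intro DERIV_add DERIV_diff DERIV_mult DERIV_divide DERIV_const DERIV_ident Dx[OF z] nz[OF z] | simp only: fst_conv snd_conv)+
    thus "((\<lambda>t. U0 (x, t)) has_field_derivative 0) (at y)"
      using nz[OF z] by (simp add: power2_eq_square)
  next
    fix z assume z: "z \<in> ball p e"
    have zD: "z \<in> D" using z e(2) by blast
    show "real_analytic_at U0 z"
      unfolding U0_def by (intro real_analytic_at_add real_analytic_at_diff real_analytic_at_mult real_analytic_at_divide
        real_analytic_at_const real_analytic_at_fst real_analytic_at_snd qx[OF zD] Q(1)[OF zD] A[OF zD] B(1)[OF zD] nz[OF z])
  qed
  show ?thesis
  proof (rule that[OF e, of "Y0 p" "U0 p" "X0 p"])
    fix x y assume z: "(x, y) \<in> ball p e"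
    have "Y0 p - y = 1 / dx q (x, y)" "x - X0 p = q (x, y) / dx q (x, y)"
      "U0 p = F (x, y) - q (x, y) / dx q (x, y) * pd 1 0 F (x, y) + 1 / dx q (x, y) * pd 0 1 F (x, y)"
      using X[OF z] Y[OF z] U[OF z] by (auto simp: X0_def Y0_def U0_def)
    moreover have "1 / dx q (x, y) \<noteq> 0" using nz[OF z] by simp
    ultimately have y: "y \<noteq> Y0 p" "y - Y0 p = - (1 / dx q (x, y))" "x - X0 p = q (x, y) / dx q (x, y)"
      and u: "U0 p = F (x, y) - q (x, y) / dx q (x, y) * pd 1 0 F (x, y) + 1 / dx q (x, y) * pd 0 1 F (x, y)"
      by auto
    show "y \<noteq> Y0 p \<and> F (x, y) = U0 p + (x - X0 p) * pd 1 0 F (x, y) + (y - Y0 p) * pd 0 1 F (x, y)"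
      unfolding y(2,3) u using y(1) by simp
  qed
qed

text \<open>The tangent planes all pass through the vertex, which is Euler's relation: F - u0 is
  homogeneous of degree one along the lines through (x0, y0). Hence F is determined near the base
  point by its slice y = y1, from which \<phi> is read off.\<close>

lemma branch_cone:
  assumes b: "in_branch D F" and p: "(x1, y1) \<in> D"
  obtains x0 y0 u0 \<phi> where "y1 \<noteq> y0" "analytic1 \<phi> ((x1 - x0) / (y0 - y1))"
    "\<forall>\<^sub>F z in nhds (x1, y1). F z = cone x0 y0 u0 \<phi> z"
proof -
  obtain e x0 y0 u0 where e: "e > 0" "ball (x1, y1) e \<subseteq> D" and
    E: "\<And>x y. (x, y) \<in> ball (x1, y1) e \<Longrightarrow> y \<noteq> y0 \<and>
      F (x, y) = u0 + (x - x0) * pd 1 0 F (x, y) + (y - y0) * pd 0 1 F (x, y)"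
    by (rule branch_vertex[OF b p]) (rule that)
  let ?B = "ball (x1, y1) e"
  define r1 where "r1 = y0 - y1"
  define \<phi> where "\<phi> = (\<lambda>s. (F (x0 + s * r1, y1) - u0) / r1)"
  have r1: "r1 \<noteq> 0" using E[of x1 y1] e(1) by (auto simp: r1_def)
  have "analytic1 (\<lambda>t. F (t, y1)) (x0 + (x1 - x0) / r1 * r1)"
    using analytic1_line[OF in_branchD(1)[OF b p]] r1 by simp
  hence "analytic1 (\<lambda>s. F (x0 + s * r1, y1)) ((x1 - x0) / r1)"
    by (rule analytic1_compose(1)[where f="\<lambda>t. F (t, y1)" and g="\<lambda>s. x0 + s * r1", rotated])
      (rule analytic1_add(1)[OF analytic1_const(1) analytic1_mult(1)[OF analytic1_ident(1) analytic1_const(1)]])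
  hence an: "analytic1 \<phi> ((x1 - x0) / (y0 - y1))"
    unfolding \<phi>_def r1_def[symmetric]
    by (rule analytic1_divide(1)[OF analytic1_diff(1)[OF _ analytic1_const(1)] analytic1_const(1) r1])
  \<comment> \<open>The foot of z: the point with y = y1 on the line through z and (x0, y0). When z
    and its foot lie in the ball, so does the segment between them.\<close>
  let ?\<pi> = "\<lambda>z. (x0 + (fst z - x0) / (y0 - snd z) * r1, y1)"
  have "isCont ?\<pi> (x1, y1)" using r1 by (intro continuous_intros) (auto simp: r1_def)
  hence "filterlim ?\<pi> (nhds (x1, y1)) (nhds (x1, y1))"
    using tendsto_at_iff_tendsto_nhds[of ?\<pi> "(x1, y1)"] r1 by (simp add: isCont_def r1_def)
  moreover have ev: "\<forall>\<^sub>F z in nhds (x1, y1). z \<in> ?B"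
    using e(1) by (intro eventually_nhds_in_open) auto
  ultimately have "\<forall>\<^sub>F z in nhds (x1, y1). ?\<pi> z \<in> ?B"
    by (rule_tac eventually_compose_filterlim)
  from this ev have "\<forall>\<^sub>F z in nhds (x1, y1). F z = cone x0 y0 u0 \<phi> z"
  proof eventually_elim
    case (elim z)
    obtain x y where z: "z = (x, y)" by (cases z)
    define s where "s = (x - x0) / (y0 - y)"
    have yy: "y \<noteq> y0" using E elim z by blast
    have xs: "x = x0 + s * (y0 - y)" using yy by (simp add: s_def)
    let ?S = "closed_segment y y1"
    have inB: "(x0 + s * (y0 - t), t) \<in> ?B" if "t \<in> ?S" for t
    proof -
      obtain u where u: "0 \<le> u" "u \<le> 1" "t = (1 - u) * y + u * y1"
        using \<open>t \<in> ?S\<close> by (auto simp: in_segment)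
      have "(1 - u) *\<^sub>R (x, y) + u *\<^sub>R (x0 + s * r1, y1) \<in> ?B"
        using elim u by (intro convexD[OF convex_ball]) (auto simp: z s_def)
      moreover have "(1 - u) *\<^sub>R (x, y) + u *\<^sub>R (x0 + s * r1, y1) = (x0 + s * (y0 - t), t)"
        unfolding xs u(3) r1_def by (simp add: algebra_simps)
      ultimately show ?thesis by simp
    qed
    \<comment> \<open>Along the line of slope s the quotient (F - u0)/(y0 - t) is constant by
      Euler's relation; its values at z and at the foot are compared.\<close>
    define H where "H = (\<lambda>t. (F (x0 + s * (y0 - t), t) - u0) / (y0 - t))"
    have "(H has_field_derivative 0) (at t within ?S)" if t: "t \<in> ?S" for t
    proof -
      let ?z = "(x0 + s * (y0 - t), t)"
      note zB = inB[OF t]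
      have zD: "?z \<in> D" using zB e(2) by blast
      have nz: "y0 - t \<noteq> 0" using E[OF zB] by simp
      have "((\<lambda>t. (x0 + s * (y0 - t), t)) has_derivative (\<lambda>h. (- s * h, h))) (at t)"
        by (auto intro!: derivative_eq_intros simp: fun_eq_iff)
      from has_derivative_compose[OF this real_analytic_at_has_derivative[OF in_branchD(1)[OF b zD]]]
      have "((\<lambda>t. F (x0 + s * (y0 - t), t)) has_derivative (\<lambda>h. (dy F ?z - s * dx F ?z) * h)) (at t)"
        by (simp add: algebra_simps)
      hence d: "((\<lambda>t. F (x0 + s * (y0 - t), t)) has_field_derivative (dy F ?z - s * dx F ?z)) (at t)"
        by (simp add: has_field_derivative_def)
      have "F ?z = u0 + s * (y0 - t) * dx F ?z + (t - y0) * dy F ?z"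
        using E[OF zB] by (simp add: pd_def)
      hence "(dy F ?z - s * dx F ?z) * (y0 - t) + (F ?z - u0) = 0" by (simp add: algebra_simps)
      hence "(H has_field_derivative 0) (at t)"
        unfolding H_def using nz by (auto intro!: derivative_eq_intros d)
      thus ?thesis by (rule DERIV_subset) simp
    qed
    hence "\<exists>c. \<forall>t\<in>?S. H t = c" by (intro has_field_derivative_zero_constant) auto
    hence "H y = H y1" by force
    hence "F (x, y) - u0 = (y0 - y) * \<phi> s"
    proof -
      have "H y = (F (x, y) - u0) / (y0 - y)" by (simp add: H_def flip: xs)
      moreover have "H y1 = \<phi> s" by (simp add: H_def \<phi>_def r1_def)
      ultimately have "(F (x, y) - u0) / (y0 - y) = \<phi> s" using \<open>H y = H y1\<close> by simp
      thus ?thesis using yy by (simp add: nonzero_divide_eq_eq mult.commute)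
    qed
    thus ?case by (simp add: z cone_def s_def)
  qed
  thus ?thesis using that[of y0 \<phi> x0 u0] an r1 by (auto simp: r1_def)
qed

section \<open>Derivatives of a cone through those of its curve\<close>

definition slope :: "real \<Rightarrow> real \<Rightarrow> real \<times> real \<Rightarrow> real" where
  "slope x0 y0 z = (fst z - x0) / (y0 - snd z)"

definition cone_dom :: "real \<Rightarrow> real \<Rightarrow> (real \<Rightarrow> real) \<Rightarrow> (real \<times> real) set" where
  "cone_dom x0 y0 \<phi> = {z. snd z \<noteq> y0 \<and> analytic1 \<phi> (slope x0 y0 z)}"

lemma isCont_slope: "snd z \<noteq> y0 \<Longrightarrow> isCont (slope x0 y0) z"
  unfolding slope_def[abs_def] by (intro continuous_intros) auto

lemma filterlim_slope:
  "snd z \<noteq> y0 \<Longrightarrow> filterlim (slope x0 y0) (nhds (slope x0 y0 z)) (nhds z)"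
  using isCont_slope[of z y0 x0] tendsto_at_iff_tendsto_nhds[of "slope x0 y0" z] by (simp add: isCont_def)

lemma eventually_snd_neq: "snd z \<noteq> y0 \<Longrightarrow> \<forall>\<^sub>F w in nhds z. snd w \<noteq> (y0::real)"
  by (rule eventually_nhds_in_open[where s="snd -` (- {y0})", simplified])
     (auto intro!: open_vimage continuous_intros)

lemma cone_dom_eventually:
  assumes "z \<in> cone_dom x0 y0 \<phi>"
  shows "\<forall>\<^sub>F w in nhds z. w \<in> cone_dom x0 y0 \<phi>"
proof -
  have z: "snd z \<noteq> y0" "analytic1 \<phi> (slope x0 y0 z)" using assms by (auto simp: cone_dom_def)
  show ?thesis
    using eventually_compose_filterlim[OF analytic1_eventually[OF z(2)] filterlim_slope[OF z(1)]]
      eventually_snd_neq[OF z(1)]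
    by eventually_elim (simp add: cone_dom_def)
qed

lemma analytic1_higher_deriv: "analytic1 \<phi> s \<Longrightarrow> analytic1 ((deriv ^^ n) \<phi>) s"
  by (induction n) (auto intro: analytic1_deriv(1))

lemma higher_deriv_has_deriv:
  "analytic1 \<phi> s \<Longrightarrow> ((deriv ^^ n) \<phi> has_field_derivative (deriv ^^ Suc n) \<phi> s) (at s)"
  using analytic1_deriv(3)[OF analytic1_higher_deriv[of \<phi> s n]] by simp

text \<open>At fixed y the slope is affine in x with coefficient 1/(y0 - y), so each x-derivative
  differentiates the curve once and costs one power of y0 - y.\<close>

lemma dx_slope:
  assumes "z \<in> cone_dom x0 y0 \<phi>"
    and G: "\<And>w. w \<in> cone_dom x0 y0 \<phi> \<Longrightarrow> G w = \<psi> (slope x0 y0 w) / (y0 - snd w) ^ m"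
    and "(\<psi> has_field_derivative \<psi>') (at (slope x0 y0 z))"
  shows "dx G z = \<psi>' / (y0 - snd z) ^ Suc m"
proof -
  obtain x y where z: "z = (x, y)" by (cases z)
  have y: "y0 - y \<noteq> 0" using assms(1) by (auto simp: z cone_dom_def)
  have "((\<lambda>t. \<psi> ((t - x0) / (y0 - y)) / (y0 - y) ^ m) has_field_derivative \<psi>' * (1 / (y0 - y)) / (y0 - y) ^ m) (at x)"
    using y assms(3) by (intro DERIV_cdivide DERIV_chain2[where f=\<psi> and g="\<lambda>t. (t - x0) / (y0 - y)"])
      (auto simp: slope_def z intro!: derivative_eq_intros)
  note DERIV_imp_deriv[OF this]
  moreover have "dx G z = deriv (\<lambda>t. \<psi> ((t - x0) / (y0 - y)) / (y0 - y) ^ m) x"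
    unfolding dx_def z prod.case using eventually_eq_refine(1)[OF cone_dom_eventually[OF assms(1)[unfolded z]]]
    by (intro deriv_cong_ev) (auto elim!: eventually_mono simp: G slope_def)
  ultimately have "dx G z = \<psi>' * (1 / (y0 - y)) / (y0 - y) ^ m" by simp
  thus ?thesis by (simp add: z)
qed

lemma cone_pd_x:
  assumes "z \<in> cone_dom x0 y0 \<phi>"
  shows "pd (Suc j) 0 (cone x0 y0 u0 \<phi>) z = (deriv ^^ Suc j) \<phi> (slope x0 y0 z) / (y0 - snd z) ^ j"
  using assms
proof (induction j arbitrary: z)
  case 0
  obtain x y where z: "z = (x, y)" by (cases z)
  have y: "y0 - y \<noteq> 0" and a: "analytic1 \<phi> ((x - x0) / (y0 - y))"
    using 0 by (auto simp: z cone_dom_def slope_def)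
  have "((\<lambda>t. u0 + (y0 - y) * \<phi> ((t - x0) / (y0 - y))) has_field_derivative
      0 + (y0 - y) * (deriv \<phi> ((x - x0) / (y0 - y)) * (1 / (y0 - y)))) (at x)"
    using y analytic1_deriv(3)[OF a]
    by (intro DERIV_add DERIV_const DERIV_cmult DERIV_chain2[where f=\<phi> and g="\<lambda>t. (t - x0) / (y0 - y)"])
      (auto intro!: derivative_eq_intros)
  from DERIV_imp_deriv[OF this] show ?case
    using y by (simp add: z pd_def dx_def cone_def slope_def)
next
  case (Suc j)
  have "analytic1 \<phi> (slope x0 y0 z)" using Suc.prems by (simp add: cone_dom_def)
  from dx_slope[OF Suc.prems Suc.IH higher_deriv_has_deriv[OF this]]
  show ?case by (simp add: dx_pd)
qed

text \<open>The function s \<phi>'(s) - \<phi>(s) is the y-derivative of (y0 - y) \<phi>((x -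
  x0)/(y0 - y)); its higher derivatives give all mixed derivatives with one y.\<close>

lemma radial_deriv:
  assumes "analytic1 \<phi> s"
  shows "(deriv ^^ n) (\<lambda>s. s * deriv \<phi> s - \<phi> s) s = s * (deriv ^^ Suc n) \<phi> s + (real n - 1) * (deriv ^^ n) \<phi> s"
  using assms
proof (induction n arbitrary: s)
  case (Suc n)
  have "((\<lambda>s. s * (deriv ^^ Suc n) \<phi> s + (real n - 1) * (deriv ^^ n) \<phi> s) has_field_derivative
      (1 * (deriv ^^ Suc n) \<phi> s + (deriv ^^ Suc (Suc n)) \<phi> s * s) + (real n - 1) * (deriv ^^ Suc n) \<phi> s) (at s)"
    by (intro DERIV_add DERIV_mult DERIV_ident DERIV_cmult higher_deriv_has_deriv Suc.prems)
  moreover have "(deriv ^^ Suc n) (\<lambda>s. s * deriv \<phi> s - \<phi> s) s =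
      deriv (\<lambda>s. s * (deriv ^^ Suc n) \<phi> s + (real n - 1) * (deriv ^^ n) \<phi> s) s"
    unfolding funpow.simps o_def using analytic1_eventually[OF Suc.prems]
    by (intro deriv_cong_ev) (auto elim!: eventually_mono simp: Suc.IH)
  ultimately show ?case using DERIV_imp_deriv by (fastforce simp: algebra_simps)
qed simp

lemma cone_pd_1:
  assumes "z \<in> cone_dom x0 y0 \<phi>"
  defines "s \<equiv> slope x0 y0 z"
  shows "pd j 1 (cone x0 y0 u0 \<phi>) z = (s * (deriv ^^ Suc j) \<phi> s + (real j - 1) * (deriv ^^ j) \<phi> s) / (y0 - snd z) ^ j"
proof -
  let ?\<chi> = "\<lambda>s. s * deriv \<phi> s - \<phi> s"
  have a: "analytic1 ?\<chi> s" if "analytic1 \<phi> s" for s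
    by (rule analytic1_diff(1)[OF analytic1_mult(1)[OF analytic1_ident(1) analytic1_deriv(1)[OF that]] that])
  have "pd j 1 (cone x0 y0 u0 \<phi>) z = (deriv ^^ j) ?\<chi> (slope x0 y0 z) / (y0 - snd z) ^ j"
    using assms(1)
  proof (induction j arbitrary: z)
    case 0
    obtain x y where z: "z = (x, y)" by (cases z)
    have y: "y0 - y \<noteq> 0" and a: "analytic1 \<phi> ((x - x0) / (y0 - y))"
      using 0 by (auto simp: z cone_dom_def slope_def)
    have g: "((\<lambda>t. (x - x0) / (y0 - t)) has_field_derivative (x - x0) / ((y0 - y) * (y0 - y))) (at y)"
      using y by (auto intro!: derivative_eq_intros)
    have "((\<lambda>t. u0 + (y0 - t) * \<phi> ((x - x0) / (y0 - t))) has_field_derivative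
        0 + ((0 - 1) * \<phi> ((x - x0) / (y0 - y)) + (deriv \<phi> ((x - x0) / (y0 - y)) * ((x - x0) / ((y0 - y) * (y0 - y)))) * (y0 - y))) (at y)"
      by (intro DERIV_add DERIV_mult DERIV_const DERIV_diff DERIV_ident
          DERIV_chain2[where f=\<phi> and g="\<lambda>t. (x - x0) / (y0 - t)", OF analytic1_deriv(3)[OF a] g])
    from DERIV_imp_deriv[OF this] show ?case
      using y by (simp add: z pd_def dy_def cone_def slope_def)
  next
    case (Suc j)
    have "analytic1 \<phi> (slope x0 y0 z)" using Suc.prems by (simp add: cone_dom_def)
    from dx_slope[OF Suc.prems Suc.IH higher_deriv_has_deriv[OF a[OF this]]]
    show ?case by (simp add: dx_pd)
  qed
  moreover have "analytic1 \<phi> s" using assms(1) by (simp add: cone_dom_def s_def)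
  ultimately show ?thesis unfolding s_def by (simp only: radial_deriv)
qed

lemma cone_pd_02:
  assumes "z \<in> cone_dom x0 y0 \<phi>"
  defines "s \<equiv> slope x0 y0 z"
  shows "pd 0 2 (cone x0 y0 u0 \<phi>) z = s\<^sup>2 * deriv (deriv \<phi>) s / (y0 - snd z)"
proof -
  let ?\<chi> = "\<lambda>s. s * deriv \<phi> s - \<phi> s"
  obtain x y where z: "z = (x, y)" by (cases z)
  have s: "s = (x - x0) / (y0 - y)" by (simp add: s_def slope_def z)
  have y: "y0 - y \<noteq> 0" and a: "analytic1 \<phi> s"
    using assms(1) by (auto simp: z cone_dom_def s_def)
  have g: "((\<lambda>t. (x - x0) / (y0 - t)) has_field_derivative (x - x0) / ((y0 - y) * (y0 - y))) (at y)"
    using y by (auto intro!: derivative_eq_intros)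
  have "analytic1 ?\<chi> s"
    by (rule analytic1_diff(1)[OF analytic1_mult(1)[OF analytic1_ident(1) analytic1_deriv(1)[OF a]] a])
  from analytic1_deriv(3)[OF this] have "(?\<chi> has_field_derivative s * deriv (deriv \<phi>) s) (at s)"
    using radial_deriv[OF a, of 1] by simp
  hence "(?\<chi> has_field_derivative s * deriv (deriv \<phi>) s) (at ((x - x0) / (y0 - y)))" by (simp add: s)
  from DERIV_imp_deriv[OF DERIV_chain2[OF this g]]
  have "deriv (\<lambda>t. ?\<chi> ((x - x0) / (y0 - t))) y = s * deriv (deriv \<phi>) s * ((x - x0) / ((y0 - y) * (y0 - y)))" .
  moreover have "pd 0 2 (cone x0 y0 u0 \<phi>) z = deriv (\<lambda>t. ?\<chi> ((x - x0) / (y0 - t))) y"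
  proof -
    have "dy (cone x0 y0 u0 \<phi>) w = ?\<chi> (slope x0 y0 w)" if "w \<in> cone_dom x0 y0 \<phi>" for w
      using cone_pd_1[OF that, of 0 u0] by (simp add: pd_def)
    hence "deriv (\<lambda>t. dy (cone x0 y0 u0 \<phi>) (x, t)) y = deriv (\<lambda>t. ?\<chi> ((x - x0) / (y0 - t))) y"
      using eventually_eq_refine(2)[OF cone_dom_eventually[OF assms(1)[unfolded z]]]
      by (intro deriv_cong_ev) (auto elim!: eventually_mono simp: slope_def)
    thus ?thesis by (simp add: pd_def numeral_2_eq_2 dy_def z)
  qed
  ultimately have "pd 0 2 (cone x0 y0 u0 \<phi>) z = s * deriv (deriv \<phi>) s * ((x - x0) / ((y0 - y) * (y0 - y)))"
    by simp
  thus ?thesis using y by (simp add: s z power2_eq_square field_simps)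
qed

lemma cone_real_analytic:
  assumes "z \<in> cone_dom x0 y0 \<phi>"
  shows "real_analytic_at (cone x0 y0 u0 \<phi>) z"
proof -
  have z: "y0 - snd z \<noteq> 0" "analytic1 \<phi> ((fst z - x0) / (y0 - snd z))"
    using assms by (auto simp: cone_dom_def slope_def)
  have "real_analytic_at (\<lambda>z. u0 + (y0 - snd z) * \<phi> ((fst z - x0) / (y0 - snd z))) z"
  proof (rule real_analytic_at_add[OF real_analytic_at_const real_analytic_at_mult])
    show y: "real_analytic_at (\<lambda>z. y0 - snd z) z"
      by (rule real_analytic_at_diff[OF real_analytic_at_const real_analytic_at_snd])
    have "real_analytic_at (\<lambda>z. (fst z - x0) / (y0 - snd z)) z"
      by (rule real_analytic_at_divide[OF real_analytic_at_diff[OF real_analytic_at_fst real_analytic_at_const] y z(1)])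
    thus "real_analytic_at (\<lambda>z. \<phi> ((fst z - x0) / (y0 - snd z))) z"
      by (rule real_analytic_at_compose) (rule z(2))
  qed
  thus ?thesis by (simp add: cone_def case_prod_unfold)
qed

lemma cone_jets:
  fixes u0 :: real
  assumes "z \<in> cone_dom x0 y0 \<phi>"
  defines "s \<equiv> slope x0 y0 z" and "r \<equiv> y0 - snd z" and "C \<equiv> cone x0 y0 u0 \<phi>"
  shows "r \<noteq> 0" "C z = u0 + r * \<phi> s" "pd 1 0 C z = deriv \<phi> s" "pd 2 0 C z = (deriv ^^ 2) \<phi> s / r"
    "pd 3 0 C z = (deriv ^^ 3) \<phi> s / r ^ 2" "pd 4 0 C z = (deriv ^^ 4) \<phi> s / r ^ 3"
    "pd 5 0 C z = (deriv ^^ 5) \<phi> s / r ^ 4" "pd 6 0 C z = (deriv ^^ 6) \<phi> s / r ^ 5"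
    "pd 7 0 C z = (deriv ^^ 7) \<phi> s / r ^ 6"
    "pd 0 1 C z = s * deriv \<phi> s - \<phi> s" "pd 1 1 C z = s * (deriv ^^ 2) \<phi> s / r"
    "pd 2 1 C z = (s * (deriv ^^ 3) \<phi> s + (deriv ^^ 2) \<phi> s) / r ^ 2"
    "pd 3 1 C z = (s * (deriv ^^ 4) \<phi> s + 2 * (deriv ^^ 3) \<phi> s) / r ^ 3"
    "pd 0 2 C z = s\<^sup>2 * (deriv ^^ 2) \<phi> s / r"
proof -
  note x = cone_pd_x[OF assms(1), of _ u0, folded s_def r_def C_def]
  note y = cone_pd_1[OF assms(1), of _ u0, folded s_def r_def C_def]
  show "r \<noteq> 0" using assms(1) by (auto simp: r_def cone_dom_def)
  show "C z = u0 + r * \<phi> s" by (cases z) (simp add: C_def cone_def r_def s_def slope_def)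
  have n: "1 = Suc 0" "2 = Suc 1" "3 = Suc 2" "4 = Suc 3" "5 = Suc 4" "6 = Suc 5" "7 = Suc 6" by simp_all
  show "pd 1 0 C z = deriv \<phi> s" using x[of 0] by simp
  show "pd 2 0 C z = (deriv ^^ 2) \<phi> s / r" using x[of 1] unfolding n(2)[symmetric] by simp
  show "pd 3 0 C z = (deriv ^^ 3) \<phi> s / r ^ 2" using x[of 2] unfolding n(3)[symmetric] by simp
  show "pd 4 0 C z = (deriv ^^ 4) \<phi> s / r ^ 3" using x[of 3] unfolding n(4)[symmetric] by simp
  show "pd 5 0 C z = (deriv ^^ 5) \<phi> s / r ^ 4" using x[of 4] unfolding n(5)[symmetric] by simp
  show "pd 6 0 C z = (deriv ^^ 6) \<phi> s / r ^ 5" using x[of 5] unfolding n(6)[symmetric] by simp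
  show "pd 7 0 C z = (deriv ^^ 7) \<phi> s / r ^ 6" using x[of 6] unfolding n(7)[symmetric] by simp
  show "pd 0 1 C z = s * deriv \<phi> s - \<phi> s" using y[of 0] by simp
  show "pd 1 1 C z = s * (deriv ^^ 2) \<phi> s / r" using y[of 1] unfolding n(2)[symmetric] by simp
  show "pd 2 1 C z = (s * (deriv ^^ 3) \<phi> s + (deriv ^^ 2) \<phi> s) / r ^ 2"
    using y[of 2] unfolding n(3)[symmetric] by simp
  show "pd 3 1 C z = (s * (deriv ^^ 4) \<phi> s + 2 * (deriv ^^ 3) \<phi> s) / r ^ 3"
    using y[of 3] unfolding n(4)[symmetric] by simp
  show "pd 0 2 C z = s\<^sup>2 * (deriv ^^ 2) \<phi> s / r"
    using cone_pd_02[OF assms(1), of u0, folded s_def r_def C_def] by (simp add: numeral_2_eq_2)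
qed

text \<open>Converse to \<open>branch_cone\<close>, needed to return from curves to surfaces of the
  branch. Here S is exactly 1/(y0 - y), and the terms of the numerator of W cancel
  identically.\<close>

lemma in_branch_cone:
  assumes "open E" "\<And>z. z \<in> E \<Longrightarrow> F z = cone x0 y0 u0 \<phi> z" "E \<subseteq> cone_dom x0 y0 \<phi>"
    "\<And>z. z \<in> E \<Longrightarrow> (deriv ^^ 2) \<phi> (slope x0 y0 z) \<noteq> 0"
  shows "in_branch E F"
  unfolding in_branch_def
proof (intro conjI ballI)
  fix z assume z: "z \<in> E"
  have ev: "\<forall>\<^sub>F w in nhds z. F w = cone x0 y0 u0 \<phi> w"
    using eventually_nhds_in_open[OF assms(1) z] by eventually_elim (rule assms(2))
  note p = pd_cong[OF ev]
  have zd: "z \<in> cone_dom x0 y0 \<phi>" using z assms(3) by blast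
  note J = cone_jets[OF zd] and n = assms(4)[OF z]
  show "real_analytic_at F z"
    by (rule real_analytic_at_cong[OF cone_real_analytic[OF zd] ev])
  show "pd 2 0 F z \<noteq> 0" using J(1) n by (simp add: p J)
  show "pd 2 0 F z * pd 0 2 F z - (pd 1 1 F z)\<^sup>2 = 0"
    by (simp only: p J) (simp add: power2_eq_square)
  show "inv_S F z \<noteq> 0"
  proof -
    have "(p2 / r * ((s * p3 + p2) / r ^ 2) - s * p2 / r * (p3 / r ^ 2)) / (p2 / r) ^ 2 = 1 / r"
      if "r \<noteq> 0" "p2 \<noteq> 0" for r p2 p3 s :: real
      using that by (simp add: power2_eq_square field_simps)
    from this[OF J(1) n] have "inv_S F z = 1 / (y0 - snd z)" by (simp only: inv_S_def p J)
    thus ?thesis using J(1) by simp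
  qed
  show "inv_W F z = 0"
  proof -
    have "(p2 / r) ^ 2 * ((s * p4 + 2 * p3) / r ^ 3) - p2 / r * (s * p2 / r) * (p4 / r ^ 3)
        + 2 * (s * p2 / r) * (p3 / r ^ 2) ^ 2 - 2 * (p2 / r) * (p3 / r ^ 2) * ((s * p3 + p2) / r ^ 2) = 0"
      if "r \<noteq> 0" for r p2 p3 p4 s :: real
      using that by (simp add: power2_eq_square power3_eq_cube field_simps)
    from this[OF J(1)] show ?thesis by (simp only: inv_W_def p J div_0)
  qed
qed fact

section \<open>Affine maps between cones\<close>

text \<open>The components of \<open>A (s, -1, \<phi>(s))\<close>. In \<open>curve_map\<close>, \<open>r0\<close> and \<open>r1\<close> are the values of \<open>y\<^sub>0 - y\<close> at
  the base points of the two cones.\<close>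

definition row :: "real ^ 3 ^ 3 \<Rightarrow> 3 \<Rightarrow> (real \<Rightarrow> real) \<Rightarrow> real \<Rightarrow> real" where
  "row A i \<phi> s = A $ i $ 1 * s - A $ i $ 2 + A $ i $ 3 * \<phi> s"

definition curve_map ::
    "real ^ 3 ^ 3 \<Rightarrow> (real \<Rightarrow> real) \<Rightarrow> real \<Rightarrow> real \<Rightarrow> (real \<Rightarrow> real) \<Rightarrow> real \<Rightarrow> real \<Rightarrow> bool" where
  "curve_map A \<phi> s0 r0 \<psi> s1 r1 \<longleftrightarrow>
     r0 * row A 2 \<phi> s0 = - r1 \<and> r0 * row A 1 \<phi> s0 = r1 * s1 \<and>
     (\<forall>\<^sub>F s in nhds s0. \<psi> (- row A 1 \<phi> s / row A 2 \<phi> s) = - row A 3 \<phi> s / row A 2 \<phi> s)"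

definition is_cone :: "(real \<times> real \<Rightarrow> real) \<Rightarrow> real \<times> real \<Rightarrow> real \<Rightarrow> real \<Rightarrow> real \<Rightarrow> (real \<Rightarrow> real) \<Rightarrow> bool" where
  "is_cone F z x0 y0 u0 \<phi> \<longleftrightarrow> z \<in> cone_dom x0 y0 \<phi> \<and> (\<forall>\<^sub>F w in nhds z. F w = cone x0 y0 u0 \<phi> w)"

lemma row_isCont: "isCont \<phi> s \<Longrightarrow> isCont (row A i \<phi>) s"
  unfolding row_def[abs_def] by (intro continuous_intros)

section \<open>Affine maps that carry one cone germ to another\<close>

lemma affine_graph_pt:
  "affine_map A b (graph_pt F (x, y)) $ i = A $ i $ 1 * x + A $ i $ 2 * y + A $ i $ 3 * F (x, y) + b $ i"
  by (simp add: affine_map_def graph_pt_def matrix_vector_mult_def sum_3)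

text \<open>The offset a says by how much the image of the first vertex misses the second one. It is
  0 in \<open>maps_germ_cone\<close>, and showing that it must be 0 is the core of
  \<open>maps_germ_coneD\<close>.\<close>

lemma affine_cone_pt:
  assumes v: "affine_map A b (vector [x0, y0, u0]) = vector [x1, y1, u1] + a"
    and F: "F z = cone x0 y0 u0 \<phi> z" and y: "snd z \<noteq> y0"
  shows "affine_map A b (graph_pt F z) = vector [x1, y1, u1] + a + (y0 - snd z) *\<^sub>R (\<chi> i. row A i \<phi> (slope x0 y0 z))"
proof -
  obtain x y where z: "z = (x, y)" by (cases z)
  define s where "s = slope x0 y0 z"
  have x: "x = x0 + (y0 - y) * s" using y by (simp add: s_def slope_def z)
  have Fz: "F (x, y) = u0 + (y0 - y) * \<phi> s" using F by (simp add: z cone_def s_def slope_def)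
  have "affine_map A b (graph_pt F z) $ i = (vector [x1, y1, u1] + a) $ i + (y0 - y) * row A i \<phi> s" for i
  proof -
    have "(vector [x1, y1, u1] + a) $ i = A $ i $ 1 * x0 + A $ i $ 2 * y0 + A $ i $ 3 * u0 + b $ i"
      unfolding v[symmetric] by (simp add: affine_map_def matrix_vector_mult_def sum_3)
    thus ?thesis unfolding z affine_graph_pt Fz unfolding x row_def by (simp add: algebra_simps)
  qed
  thus ?thesis by (simp add: vec_eq_iff s_def z)
qed

lemma graph_pt_inj: "graph_pt F z = graph_pt G w \<Longrightarrow> z = w"
  by (auto simp: graph_pt_def vec_eq_iff forall_3 prod_eq_iff)

lemma graph_pt_eqI:
  fixes q :: "real ^ 3"
  assumes "q $ 1 = x" "q $ 2 = y" "q $ 3 = F (x, y)" shows "q = graph_pt F (x, y)"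
  using assms by (simp add: graph_pt_def vec_eq_iff forall_3)

lemma affine_map_inj:
  assumes "det A = 1" "affine_map A b p = affine_map A b q"
  shows "p = q"
proof -
  have "invertible A" using assms(1) by (simp add: invertible_det_nz)
  hence "inj ((*v) A)" by (simp add: invertible_eq_bij bij_is_inj)
  thus ?thesis using assms(2) by (auto simp: affine_map_def dest: injD)
qed

lemma openin_graph:
  assumes "open N" "N \<subseteq> D"
  shows "openin (top_of_set (graph_surf F D)) (graph_pt F ` N)"
proof -
  have "open ((\<lambda>q::real^3. (q $ 1, q $ 2)) -` N)"
    by (rule open_vimage[OF assms(1)]) (intro continuous_intros)
  moreover have "graph_pt F ` N = graph_surf F D \<inter> (\<lambda>q::real^3. (q $ 1, q $ 2)) -` N"
    using assms(2) by (auto simp: graph_surf_def graph_pt_def)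
  ultimately show ?thesis by (metis openin_open)
qed

lemma is_coneD:
  assumes "is_cone F z x0 y0 u0 \<phi>"
  shows "z \<in> cone_dom x0 y0 \<phi>" "\<forall>\<^sub>F w in nhds z. F w = cone x0 y0 u0 \<phi> w" "F z = cone x0 y0 u0 \<phi> z"
    "snd z \<noteq> y0" "analytic1 \<phi> (slope x0 y0 z)"
  using assms eventually_nhds_x_imp_x unfolding is_cone_def cone_dom_def by auto

text \<open>The affine map induces a map T of the (x, y)-plane, and the curve relation places the
  image of each point on the graph of G over T w. Injectivity of the affine map passes to T, and
  invariance of domain turns this into the relatively open image that \<open>maps_germ\<close>
  requires.\<close>

lemma maps_germ_cone:
  assumes F: "is_cone F z x0 y0 u0 \<phi>" and G: "is_cone G z' x1 y1 u1 \<psi>"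
    and D: "open D" "z \<in> D" and E: "open E" "z' \<in> E" and A: "det A = 1"
    and v: "affine_map A b (vector [x0, y0, u0]) = vector [x1, y1, u1]"
    and c: "curve_map A \<phi> (slope x0 y0 z) (y0 - snd z) \<psi> (slope x1 y1 z') (y1 - snd z')"
  shows "maps_germ (affine_map A b) (graph_surf F D) (graph_pt F z) (graph_surf G E) (graph_pt G z')"
proof -
  note F' = is_coneD[OF F] and G' = is_coneD[OF G]
  let ?m = "\<lambda>i w. row A i \<phi> (slope x0 y0 w)"
  define T where "T = (\<lambda>w. (x1 + (y0 - snd w) * ?m 1 w, y1 + (y0 - snd w) * ?m 2 w))"
  have c1: "(y0 - snd z) * ?m 2 z = - (y1 - snd z')"
    "(y0 - snd z) * ?m 1 z = (y1 - snd z') * slope x1 y1 z'"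
    and c2: "\<forall>\<^sub>F s in nhds (slope x0 y0 z). \<psi> (- row A 1 \<phi> s / row A 2 \<phi> s) = - row A 3 \<phi> s / row A 2 \<phi> s"
    using c by (auto simp: curve_map_def)
  have Tz: "T z = z'" using c1 G'(4) by (auto simp: T_def slope_def prod_eq_iff)
  have m2: "?m 2 z \<noteq> 0" using c1 G'(4) by auto
  have contm: "isCont (\<lambda>w. ?m i w) w" if "w \<in> cone_dom x0 y0 \<phi>" for i w
    using that row_isCont[OF analytic1_isCont] isCont_slope
    by (intro isCont_o2[of w "slope x0 y0" "row A i \<phi>"]) (auto simp: cone_dom_def)
  have contT: "isCont T w" if "w \<in> cone_dom x0 y0 \<phi>" for w
    unfolding T_def by (intro continuous_intros contm that)
  have limT: "filterlim T (nhds z') (nhds z)"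
    using contT[OF F'(1)] tendsto_at_iff_tendsto_nhds[of T z] by (simp add: isCont_def Tz)
  have limm: "filterlim (\<lambda>w. ?m 2 w) (nhds (?m 2 z)) (nhds z)"
    using contm[OF F'(1), of 2] tendsto_at_iff_tendsto_nhds[of "\<lambda>w. ?m 2 w" z] by (simp add: isCont_def)
  have "\<forall>\<^sub>F t in nhds (?m 2 z). t \<noteq> 0" using m2 by (simp add: t1_space_nhds)
  hence ev1: "\<forall>\<^sub>F w in nhds z. ?m 2 w \<noteq> 0" by (rule eventually_compose_filterlim[OF _ limm])
  have ev2: "\<forall>\<^sub>F w in nhds z. T w \<in> E \<and> G (T w) = cone x1 y1 u1 \<psi> (T w)"
    by (rule eventually_compose_filterlim[OF eventually_conj[OF eventually_nhds_in_open[OF E] G'(2)] limT])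
  have ev3: "\<forall>\<^sub>F w in nhds z. \<psi> (- ?m 1 w / ?m 2 w) = - ?m 3 w / ?m 2 w"
    by (rule eventually_compose_filterlim[OF c2 filterlim_slope[OF F'(4)]])
  have "\<forall>\<^sub>F w in nhds z. w \<in> D \<and> w \<in> cone_dom x0 y0 \<phi> \<and> T w \<in> E \<and>
      affine_map A b (graph_pt F w) = graph_pt G (T w)"
    using eventually_nhds_in_open[OF D] cone_dom_eventually[OF F'(1)] F'(2) ev1 ev2 ev3
  proof eventually_elim
    case (elim w)
    let ?r = "y0 - snd w"
    have r: "?r \<noteq> 0" using elim by (auto simp: cone_dom_def)
    have P: "affine_map A b (graph_pt F w) = vector [x1, y1, u1] + ?r *\<^sub>R (\<chi> i. ?m i w)"
      using affine_cone_pt[of A b x0 y0 u0 x1 y1 u1 0 F w \<phi>] v elim r by simp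
    have G: "G (T w) = u1 + (- ?r * ?m 2 w) * \<psi> (- ?m 1 w / ?m 2 w)"
    proof -
      have "G (T w) = u1 + (y1 - snd (T w)) * \<psi> ((fst (T w) - x1) / (y1 - snd (T w)))"
        using elim by (simp add: cone_def case_prod_unfold)
      also have "y1 - snd (T w) = - ?r * ?m 2 w" by (simp add: T_def algebra_simps)
      also have "fst (T w) - x1 = ?r * ?m 1 w" by (simp add: T_def)
      also have "?r * ?m 1 w / (- ?r * ?m 2 w) = - ?m 1 w / ?m 2 w"
      proof -
        have "\<rho> * c / (- \<rho> * d) = - c / d" if "\<rho> \<noteq> 0" for \<rho> c d :: real
          using that by (cases "d = 0") (auto simp: field_simps)
        from this[OF r] show ?thesis .
      qed
      finally show ?thesis .
    qed
    have "(- ?r * ?m 2 w) * (- ?m 3 w / ?m 2 w) = ?r * ?m 3 w" using elim(4) by (simp add: field_simps)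
    hence G3: "G (T w) = u1 + ?r * ?m 3 w" unfolding G elim(6) by (rule arg_cong)
    have "affine_map A b (graph_pt F w) = graph_pt G (T w)"
      unfolding P T_def
    proof (rule graph_pt_eqI)
      show "(vector [x1, y1, u1] + ?r *\<^sub>R (\<chi> i. ?m i w)) $ 3 = G (x1 + ?r * ?m 1 w, y1 + ?r * ?m 2 w)"
        using G3 by (simp add: T_def)
    qed simp_all
    thus ?case using elim by blast
  qed
  then obtain N where N: "open N" "z \<in> N" "\<And>w. w \<in> N \<Longrightarrow> w \<in> D" "\<And>w. w \<in> N \<Longrightarrow> w \<in> cone_dom x0 y0 \<phi>"
    "\<And>w. w \<in> N \<Longrightarrow> T w \<in> E" "\<And>w. w \<in> N \<Longrightarrow> affine_map A b (graph_pt F w) = graph_pt G (T w)"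
    unfolding eventually_nhds by blast
  have "inj_on T N"
  proof (rule inj_onI)
    fix w w' assume w: "w \<in> N" "w' \<in> N" "T w = T w'"
    hence "affine_map A b (graph_pt F w) = affine_map A b (graph_pt F w')" using N(6) by simp
    from graph_pt_inj[OF affine_map_inj[OF A this]] show "w = w'" .
  qed
  moreover have "continuous_on N T" by (rule continuous_at_imp_continuous_on) (use N(4) contT in auto)
  ultimately have TN: "open (T ` N)" using N(1) by (intro invariance_of_domain)
  show ?thesis
    unfolding maps_germ_def
  proof (intro conjI exI)
    show "affine_map A b (graph_pt F z) = graph_pt G z'" using N(6)[OF N(2)] Tz by simp
    show "openin (top_of_set (graph_surf F D)) (graph_pt F ` N)" using N(1,3) by (intro openin_graph) auto
    show "openin (top_of_set (graph_surf G E)) (graph_pt G ` T ` N)" using TN N(5) by (intro openin_graph) auto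
    show "graph_pt F z \<in> graph_pt F ` N" using N(2) by blast
    show "graph_pt G z' \<in> graph_pt G ` T ` N" using N(2) Tz by blast
    show "affine_map A b ` graph_pt F ` N = graph_pt G ` T ` N"
      unfolding image_image by (rule image_cong) (auto simp: N(6))
  qed
qed

text \<open>Coordinates are relative to the vertex. A segment a + r m inside a cone whose curve has
  nonzero second derivative lies on a ruling: if the slope \<mu> moved along the segment, the cone
  equation would force \<psi>'(\<mu>) to be constant.\<close>

lemma segment_in_cone:
  fixes a m :: "3 \<Rightarrow> real"
  assumes "r \<in> I" "open I"
    and nz: "\<And>r. r \<in> I \<Longrightarrow> a 2 + r * m 2 \<noteq> 0"
    and eq: "\<And>r. r \<in> I \<Longrightarrow> \<psi> (- (a 1 + r * m 1) / (a 2 + r * m 2)) = - (a 3 + r * m 3) / (a 2 + r * m 2)"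
    and an: "\<And>r. r \<in> I \<Longrightarrow> analytic1 \<psi> (- (a 1 + r * m 1) / (a 2 + r * m 2))"
    and n2: "\<And>r. r \<in> I \<Longrightarrow> deriv (deriv \<psi>) (- (a 1 + r * m 1) / (a 2 + r * m 2)) \<noteq> 0"
  shows "m 1 * a 2 = a 1 * m 2" "m 3 * a 2 = a 3 * m 2"
proof -
  define \<mu> where "\<mu> = (\<lambda>r. - (a 1 + r * m 1) / (a 2 + r * m 2))"
  define K where "K = m 1 * a 2 - a 1 * m 2"
  define L where "L = m 3 * a 2 - a 3 * m 2"
  have d: "((\<lambda>r. - (c + r * e) / (a 2 + r * m 2)) has_field_derivative - (e * a 2 - c * m 2) / (a 2 + t * m 2)\<^sup>2) (at t)"
    if "t \<in> I" for c e t
    using nz[OF that] by (auto intro!: derivative_eq_intros simp: power2_eq_square field_simps)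
  have d1: "(\<mu> has_field_derivative - K / (a 2 + t * m 2)\<^sup>2) (at t)" if "t \<in> I" for t
    unfolding \<mu>_def K_def by (rule d[OF that])
  \<comment> \<open>Both sides of the cone equation are differentiated along the segment; the common
    factor 1/(a 2 + t * m 2)^2 cancels.\<close>
  have key: "deriv \<psi> (\<mu> t) * K = L" if t: "t \<in> I" for t
  proof -
    have "((\<lambda>r. \<psi> (\<mu> r)) has_field_derivative deriv \<psi> (\<mu> t) * (- K / (a 2 + t * m 2)\<^sup>2)) (at t)"
      by (rule DERIV_chain2[OF analytic1_deriv(3) d1[OF t]]) (use an[OF t] in \<open>simp add: \<mu>_def\<close>)
    moreover have ev: "\<forall>\<^sub>F r in nhds t. - (a 3 + r * m 3) / (a 2 + r * m 2) = \<psi> (\<mu> r)"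
      using eventually_nhds_in_open[OF assms(2) t] by eventually_elim (simp only: \<mu>_def eq)
    hence "((\<lambda>r. \<psi> (\<mu> r)) has_field_derivative - L / (a 2 + t * m 2)\<^sup>2) (at t)"
      using DERIV_cong_ev[OF refl ev refl] d[OF t, of "a 3" "m 3"] by (simp add: L_def)
    ultimately have "deriv \<psi> (\<mu> t) * (- K / (a 2 + t * m 2)\<^sup>2) = - L / (a 2 + t * m 2)\<^sup>2"
      by (rule DERIV_unique)
    thus ?thesis using nz[OF t] by (simp add: field_simps)
  qed
  have "K = 0"
  proof (rule ccontr)
    assume K: "K \<noteq> 0"
    have "((\<lambda>t. deriv \<psi> (\<mu> t)) has_field_derivative deriv (deriv \<psi>) (\<mu> r) * (- K / (a 2 + r * m 2)\<^sup>2)) (at r)"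
      by (rule DERIV_chain2[OF analytic1_deriv(3)[OF analytic1_deriv(1)] d1[OF assms(1)]])
        (use an[OF assms(1)] in \<open>simp add: \<mu>_def\<close>)
    moreover have ev: "\<forall>\<^sub>F t in nhds r. L / K = deriv \<psi> (\<mu> t)"
      using eventually_nhds_in_open[OF assms(2,1)]
      by eventually_elim (use key K in \<open>auto simp: field_simps\<close>)
    have "((\<lambda>t. L / K) has_field_derivative 0) (at r)" by simp
    hence "((\<lambda>t. deriv \<psi> (\<mu> t)) has_field_derivative 0) (at r)"
      by (rule DERIV_cong_ev[THEN iffD1, OF refl ev refl])
    ultimately have "deriv (deriv \<psi>) (\<mu> r) * (- K / (a 2 + r * m 2)\<^sup>2) = 0" by (rule DERIV_unique)
    thus False using n2[OF assms(1)] K nz[OF assms(1)] by (simp add: \<mu>_def)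
  qed
  moreover from this key[OF assms(1)] have "L = 0" by simp
  ultimately show "m 1 * a 2 = a 1 * m 2" "m 3 * a 2 = a 3 * m 2" by (auto simp: K_def L_def)
qed

text \<open>Linear independence of s, 1 and \<phi> near s0: two differentiations isolate \<kappa>
  \<phi>''(s0).\<close>

lemma affine_dependent_zero:
  assumes an: "analytic1 \<phi> s0" and n: "deriv (deriv \<phi>) s0 \<noteq> 0"
    and ev: "\<forall>\<^sub>F s in nhds s0. \<alpha> * s + \<beta> + \<kappa> * \<phi> s = 0"
  shows "\<alpha> = 0" "\<beta> = 0" "\<kappa> = 0"
proof -
  have d: "((\<lambda>s. \<alpha> * s + \<beta> + \<kappa> * \<phi> s) has_field_derivative \<alpha> + \<kappa> * deriv \<phi> s) (at s)" if "analytic1 \<phi> s" for s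
    using analytic1_deriv(3)[OF that] by (auto intro!: derivative_eq_intros)
  have "\<forall>\<^sub>F s in nhds s0. \<forall>\<^sub>F s in nhds s. \<alpha> * s + \<beta> + \<kappa> * \<phi> s = 0"
    using ev by (simp add: eventually_eventually)
  hence ev': "\<forall>\<^sub>F s in nhds s0. \<alpha> + \<kappa> * deriv \<phi> s = 0"
    using analytic1_eventually[OF an]
  proof eventually_elim
    case (elim s)
    have "((\<lambda>s. \<alpha> * s + \<beta> + \<kappa> * \<phi> s) has_field_derivative 0) (at s)"
      using DERIV_cong_ev[OF refl elim(1) refl, of 0] by simp
    from DERIV_unique[OF d[OF elim(2)] this] show ?case .
  qed
  have "((\<lambda>s. \<alpha> + \<kappa> * deriv \<phi> s) has_field_derivative \<kappa> * deriv (deriv \<phi>) s0) (at s0)"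
    using analytic1_deriv(3)[OF analytic1_deriv(1)[OF an]] by (auto intro!: derivative_eq_intros)
  moreover have "((\<lambda>s. \<alpha> + \<kappa> * deriv \<phi> s) has_field_derivative 0) (at s0)"
    using DERIV_cong_ev[OF refl ev' refl, of 0] by simp
  ultimately have "\<kappa> * deriv (deriv \<phi>) s0 = 0" by (rule DERIV_unique)
  thus k: "\<kappa> = 0" using n by simp
  show a: "\<alpha> = 0" using eventually_nhds_x_imp_x[OF ev'] k by simp
  show "\<beta> = 0" using eventually_nhds_x_imp_x[OF ev] k a by simp
qed

text \<open>The image of a ruling is a segment on the second cone, hence part of one of its rulings,
  so the offset a is parallel to the image direction of every ruling of the first cone. These
  directions are not all proportional, because A is invertible and \<phi> is not affine; so a =
  0.\<close>

lemma maps_germ_coneD: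
  assumes F: "is_cone F z x0 y0 u0 \<phi>" and G: "is_cone G z' x1 y1 u1 \<psi>"
    and n: "deriv (deriv \<phi>) (slope x0 y0 z) \<noteq> 0" "deriv (deriv \<psi>) (slope x1 y1 z') \<noteq> 0"
    and D: "open D" "z \<in> D" and A: "det A = 1"
    and g: "maps_germ (affine_map A b) (graph_surf F D) (graph_pt F z) (graph_surf G E) (graph_pt G z')"
  shows "affine_map A b (vector [x0, y0, u0]) = vector [x1, y1, u1]"
    and "curve_map A \<phi> (slope x0 y0 z) (y0 - snd z) \<psi> (slope x1 y1 z') (y1 - snd z')"
proof -
  note F' = is_coneD[OF F] and G' = is_coneD[OF G]
  define av where "av = affine_map A b (vector [x0, y0, u0]) - vector [x1, y1, u1]"
  define a where "a = (\<lambda>i::3. av $ i)"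
  define m where "m = (\<lambda>s (i::3). row A i \<phi> s)"
  have v: "affine_map A b (vector [x0, y0, u0]) = vector [x1, y1, u1] + av" by (simp add: av_def)
  let ?s0 = "slope x0 y0 z" and ?r0 = "y0 - snd z"
  have r0: "?r0 \<noteq> 0" using F'(4) by simp
  from g obtain U U' where U: "openin (top_of_set (graph_surf F D)) U" "graph_pt F z \<in> U"
    "openin (top_of_set (graph_surf G E)) U'" "affine_map A b ` U = U'"
    and gp: "affine_map A b (graph_pt F z) = graph_pt G z'"
    unfolding maps_germ_def by blast
  obtain O' where O': "open O'" "U = graph_surf F D \<inter> O'" using U(1) by (auto simp: openin_open)
  have Fc: "isCont F z"
    using real_analytic_at_isCont[OF real_analytic_at_cong[OF cone_real_analytic[OF F'(1)] F'(2)]] .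
  have gc: "isCont (graph_pt F) z"
    unfolding isCont_def
  proof (rule vec_tendstoI)
    fix i :: 3
    have "isCont fst z" "isCont snd z" by (intro continuous_intros)+
    thus "(\<lambda>w. graph_pt F w $ i) \<midarrow>z\<rightarrow> graph_pt F z $ i"
      using exhaust_3[of i] Fc unfolding isCont_def graph_pt_def by auto
  qed
  have "filterlim (graph_pt F) (nhds (graph_pt F z)) (nhds z)"
    using gc tendsto_at_iff_tendsto_nhds[of "graph_pt F" z] by (simp add: isCont_def)
  from eventually_compose_filterlim[OF eventually_nhds_in_open[OF O'(1)] this]
  have evO: "\<forall>\<^sub>F w in nhds z. graph_pt F w \<in> O'" using U(2) O'(2) by blast
  define T where "T = (\<lambda>w. (affine_map A b (graph_pt F w) $ 1, affine_map A b (graph_pt F w) $ 2))"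
  have Tz: "T z = z'" unfolding T_def gp by (cases z') (simp add: graph_pt_def)
  have contT: "isCont T z"
  proof -
    have "isCont (\<lambda>w. affine_map A b (graph_pt F (fst w, snd w)) $ i) z" for i
      unfolding affine_graph_pt by (intro continuous_intros) (simp add: Fc)
    hence "isCont (\<lambda>w. affine_map A b (graph_pt F w) $ i) z" for i by simp
    thus ?thesis unfolding T_def by (intro continuous_Pair)
  qed
  have limT: "filterlim T (nhds z') (nhds z)"
    using contT tendsto_at_iff_tendsto_nhds[of T z] by (simp add: isCont_def Tz)
  have s1ev: "\<forall>\<^sub>F t in nhds (slope x1 y1 z'). analytic1 \<psi> t \<and> deriv (deriv \<psi>) t \<noteq> 0"
  proof (rule eventually_conj[OF analytic1_eventually[OF G'(5)]])
    have "isCont (deriv (deriv \<psi>)) (slope x1 y1 z')"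
      by (intro analytic1_isCont analytic1_deriv(1) G'(5))
    hence "filterlim (deriv (deriv \<psi>)) (nhds (deriv (deriv \<psi>) (slope x1 y1 z'))) (nhds (slope x1 y1 z'))"
      using tendsto_at_iff_tendsto_nhds[of "deriv (deriv \<psi>)" "slope x1 y1 z'"] by (simp add: isCont_def)
    moreover have "\<forall>\<^sub>F t in nhds (deriv (deriv \<psi>) (slope x1 y1 z')). t \<noteq> 0"
      using n(2) by (simp add: t1_space_nhds)
    ultimately show "\<forall>\<^sub>F t in nhds (slope x1 y1 z'). deriv (deriv \<psi>) t \<noteq> 0"
      by (rule_tac eventually_compose_filterlim)
  qed
  have "\<forall>\<^sub>F w in nhds z'. G w = cone x1 y1 u1 \<psi> w \<and> snd w \<noteq> y1 \<and>
      analytic1 \<psi> (slope x1 y1 w) \<and> deriv (deriv \<psi>) (slope x1 y1 w) \<noteq> 0"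
    using G'(2) eventually_snd_neq[OF G'(4)] eventually_compose_filterlim[OF s1ev filterlim_slope[OF G'(4)]]
    by eventually_elim auto
  from eventually_compose_filterlim[OF this limT]
  have evT: "\<forall>\<^sub>F w in nhds z. G (T w) = cone x1 y1 u1 \<psi> (T w) \<and> snd (T w) \<noteq> y1 \<and>
      analytic1 \<psi> (slope x1 y1 (T w)) \<and> deriv (deriv \<psi>) (slope x1 y1 (T w)) \<noteq> 0" .
  have evR: "\<forall>\<^sub>F w in nhds z. let s = slope x0 y0 w; r = y0 - snd w in
     a 2 + r * m s 2 \<noteq> 0 \<and> \<psi> (- (a 1 + r * m s 1) / (a 2 + r * m s 2)) = - (a 3 + r * m s 3) / (a 2 + r * m s 2) \<and>
     analytic1 \<psi> (- (a 1 + r * m s 1) / (a 2 + r * m s 2)) \<and>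
     deriv (deriv \<psi>) (- (a 1 + r * m s 1) / (a 2 + r * m s 2)) \<noteq> 0"
    using evO evT F'(2) eventually_nhds_in_open[OF D] eventually_snd_neq[OF F'(4)]
  proof eventually_elim
    case (elim w)
    define s r where "s = slope x0 y0 w" and "r = y0 - snd w"
    have P: "affine_map A b (graph_pt F w) = vector [x1, y1, u1] + av + r *\<^sub>R (\<chi> i. row A i \<phi> s)"
      using affine_cone_pt[OF v, of F w \<phi>] elim by (simp add: s_def r_def)
    have "graph_pt F w \<in> U" using elim O'(2) by (auto simp: graph_surf_def)
    hence "affine_map A b (graph_pt F w) \<in> graph_surf G E"
      using U(3,4) openin_imp_subset by blast
    then obtain w' where w': "affine_map A b (graph_pt F w) = graph_pt G w'" by (auto simp: graph_surf_def)
    hence "T w = w'" by (cases w') (simp add: T_def graph_pt_def)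
    with w' have "affine_map A b (graph_pt F w) = graph_pt G (T w)" by simp
    hence 3: "(affine_map A b (graph_pt F w)) $ 3 = G (T w)" by (simp add: graph_pt_def)
    have Tw: "T w = (x1 + (a 1 + r * m s 1), y1 + (a 2 + r * m s 2))"
      unfolding T_def P by (simp add: a_def m_def)
    have nz: "a 2 + r * m s 2 \<noteq> 0" using elim Tw by auto
    have sl: "slope x1 y1 (T w) = - (a 1 + r * m s 1) / (a 2 + r * m s 2)"
    proof -
      have "slope x1 y1 (T w) = (a 1 + r * m s 1) / - (a 2 + r * m s 2)"
        by (simp add: Tw slope_def)
      also have "\<dots> = - (a 1 + r * m s 1) / (a 2 + r * m s 2)"
        by (simp only: minus_divide_right[symmetric] minus_divide_left)
      finally show ?thesis .
    qed
    have "u1 + (a 3 + r * m s 3) = u1 + (- (a 2 + r * m s 2)) * \<psi> (slope x1 y1 (T w))"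
    proof -
      have "G (T w) = cone x1 y1 u1 \<psi> (T w)" using elim by simp
      also have "\<dots> = u1 + (y1 - snd (T w)) * \<psi> (slope x1 y1 (T w))"
        by (cases "T w") (simp add: cone_def slope_def)
      also have "y1 - snd (T w) = - (a 2 + r * m s 2)" by (simp add: Tw)
      finally show ?thesis using 3 unfolding P by (simp add: a_def m_def)
    qed
    hence "\<psi> (slope x1 y1 (T w)) = - (a 3 + r * m s 3) / (a 2 + r * m s 2)"
      using nz by (simp add: field_simps)
    thus ?case using nz elim unfolding Let_def s_def[symmetric] r_def[symmetric] sl by simp
  qed
  \<comment> \<open>In the coordinates (s, r) = (slope, y0 - y) the neighbourhood contains a product
    of open sets, so for each s near the base slope a whole open piece of the ruling is available to
    \<open>segment_in_cone\<close>.\<close>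
  have lim2: "filterlim (\<lambda>(s, r). (x0 + r * s, y0 - r)) (nhds z) (nhds (?s0, ?r0))"
  proof -
    have "isCont (\<lambda>p. (x0 + snd p * fst p, y0 - snd p)) (?s0, ?r0)" by (intro continuous_intros)
    moreover have "(x0 + ?r0 * ?s0, y0 - ?r0) = z" using r0 by (simp add: slope_def prod_eq_iff)
    ultimately show ?thesis
      using tendsto_at_iff_tendsto_nhds[of "\<lambda>p. (x0 + snd p * fst p, y0 - snd p)" "(?s0, ?r0)"]
      by (simp add: isCont_def case_prod_unfold)
  qed
  define Q where "Q = (\<lambda>s r. a 2 + r * m s 2 \<noteq> 0 \<and> \<psi> (- (a 1 + r * m s 1) / (a 2 + r * m s 2)) = - (a 3 + r * m s 3) / (a 2 + r * m s 2) \<and>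
     analytic1 \<psi> (- (a 1 + r * m s 1) / (a 2 + r * m s 2)) \<and>
     deriv (deriv \<psi>) (- (a 1 + r * m s 1) / (a 2 + r * m s 2)) \<noteq> 0)"
  have "\<forall>\<^sub>F p in nhds (?s0, ?r0). snd p \<noteq> 0"
    using eventually_snd_neq[of "(?s0, ?r0)" 0] r0 by simp
  hence "\<forall>\<^sub>F p in nhds (?s0, ?r0). Q (fst p) (snd p)"
    using eventually_compose_filterlim[OF evR lim2]
  proof eventually_elim
    case (elim p)
    have "slope x0 y0 (x0 + snd p * fst p, y0 - snd p) = fst p" using elim by (simp add: slope_def)
    thus ?case using elim by (simp add: Q_def case_prod_unfold Let_def)
  qed
  then obtain W where W: "open W" "(?s0, ?r0) \<in> W" "\<And>p. p \<in> W \<Longrightarrow> Q (fst p) (snd p)"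
    unfolding eventually_nhds by blast
  obtain S R where SR': "open S" "open R" "(?s0, ?r0) \<in> S \<times> R" "S \<times> R \<subseteq> W"
    by (rule open_prod_elim[OF W(1,2)])
  have SR: "open S" "open R" "?s0 \<in> S" "?r0 \<in> R" "\<And>s r. s \<in> S \<Longrightarrow> r \<in> R \<Longrightarrow> Q s r"
    using SR' W(3) by force+
  have par: "m s 1 * a 2 = a 1 * m s 2" "m s 3 * a 2 = a 3 * m s 2" if "s \<in> S" for s
    using segment_in_cone[OF SR(4,2), of a "m s" \<psi>] SR(5)[OF that] unfolding Q_def by blast+
  \<comment> \<open>Otherwise the independence of s, 1 and \<phi> makes the first row of A equal to
    a 1 / a 2 times the second, contradicting determinant 1.\<close>
  have a0: "a 2 = 0"
  proof (rule ccontr)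
    assume a2: "a 2 \<noteq> 0"
    have ev: "\<forall>\<^sub>F s in nhds ?s0. s \<in> S" using SR(1,3) by (rule eventually_nhds_in_open)
    have "\<forall>\<^sub>F s in nhds ?s0. (A $ 1 $ 1 * a 2 - a 1 * A $ 2 $ 1) * s + (a 1 * A $ 2 $ 2 - A $ 1 $ 2 * a 2)
        + (A $ 1 $ 3 * a 2 - a 1 * A $ 2 $ 3) * \<phi> s = 0"
      using ev by eventually_elim (use par(1) in \<open>simp add: m_def row_def algebra_simps\<close>)
    from affine_dependent_zero[OF F'(5) n(1) this]
    have "A $ 1 $ j = a 1 / a 2 * A $ 2 $ j" for j
      using a2 exhaust_3[of j] by (auto simp: field_simps)
    hence "det A = 0" by (simp add: det_3)
    thus False using A by simp
  qed
  have "m ?s0 2 \<noteq> 0" using SR(5)[OF SR(3,4)] a0 by (auto simp: Q_def)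
  hence "a 1 = 0" "a 3 = 0" using par[OF SR(3)] a0 by auto
  hence a: "a i = 0" for i using a0 exhaust_3[of i] by auto
  hence av: "av = 0" by (simp add: a_def vec_eq_iff)
  thus v': "affine_map A b (vector [x0, y0, u0]) = vector [x1, y1, u1]" using v by simp
  have zz: "graph_pt G z' = vector [x1, y1, u1] + ?r0 *\<^sub>R (\<chi> i. row A i \<phi> ?s0)"
    unfolding gp[symmetric] using affine_cone_pt[OF v, of F z \<phi>, OF F'(3,4)] av by simp
  have "fst z' = x1 + ?r0 * row A 1 \<phi> ?s0" "snd z' = y1 + ?r0 * row A 2 \<phi> ?s0"
    using arg_cong[OF zz, of "\<lambda>q::real^3. q $ 1"] arg_cong[OF zz, of "\<lambda>q::real^3. q $ 2"] by (simp_all add: graph_pt_def)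
  moreover have "\<forall>\<^sub>F s in nhds ?s0. \<psi> (- row A 1 \<phi> s / row A 2 \<phi> s) = - row A 3 \<phi> s / row A 2 \<phi> s"
  proof -
    have "\<forall>\<^sub>F s in nhds ?s0. s \<in> S" using SR(1,3) by (rule eventually_nhds_in_open)
    thus ?thesis
    proof eventually_elim
      case (elim s)
      have "\<psi> (- (?r0 * m s 1) / (?r0 * m s 2)) = - (?r0 * m s 3) / (?r0 * m s 2)"
        using SR(5)[OF elim SR(4)] unfolding Q_def a add_0 by blast
      moreover have "- (?r0 * c) / (?r0 * d) = - c / d" for c d using r0 by simp
      ultimately show ?case by (simp only: m_def)
    qed
  qed
  ultimately show "curve_map A \<phi> ?s0 ?r0 \<psi> (slope x1 y1 z') (y1 - snd z')"
    using G'(4) by (simp add: curve_map_def slope_def)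
qed

section \<open>Inversion and composition of maps of germs\<close>

lemma maps_germ_inverse:
  assumes "maps_germ g S p S' p'" "\<And>x. h (g x) = x"
  shows "maps_germ h S' p' S p"
proof -
  obtain U U' where "g p = p'" and U: "openin (top_of_set S) U" "p \<in> U" "openin (top_of_set S') U'" "p' \<in> U'" "g ` U = U'"
    using assms(1) unfolding maps_germ_def by blast
  moreover have "h ` U' = U" using U(5) by (force simp: assms(2) image_iff)
  ultimately show ?thesis using assms(2) unfolding maps_germ_def by blast
qed

text \<open>The intermediate open pieces U' and V may differ; both ends are cut down to what passes
  through their intersection. Continuity of the inverse of h keeps the final piece relatively
  open.\<close>

lemma maps_germ_compose:
  assumes g: "maps_germ g S p S' p'" and h: "maps_germ h S' p' S'' p''"
    and c: "continuous_on UNIV g" "continuous_on UNIV hi" "\<And>x. hi (h x) = x"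
  shows "maps_germ (\<lambda>x. h (g x)) S p S'' p''"
proof -
  obtain U U' where U: "g p = p'" "openin (top_of_set S) U" "p \<in> U" "openin (top_of_set S') U'" "p' \<in> U'" "g ` U = U'"
    using g unfolding maps_germ_def by blast
  obtain V V' where V: "h p' = p''" "openin (top_of_set S') V" "p' \<in> V" "openin (top_of_set S'') V'" "p'' \<in> V'" "h ` V = V'"
    using h unfolding maps_germ_def by blast
  have "openin (top_of_set S') (U' \<inter> V)" using U V by (intro openin_Int)
  then obtain Z where Z: "open Z" "U' \<inter> V = S' \<inter> Z" by (auto simp: openin_open)
  have sub: "U' \<subseteq> S'" "V \<subseteq> S'" using U(4) V(2) openin_imp_subset by blast+
  have 1: "openin (top_of_set S) (U \<inter> g -` Z)" "openin (top_of_set S'') (V' \<inter> hi -` Z)"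
    using U(2) V(4) Z(1) c(1,2)
    by (auto intro!: openin_Int_open open_vimage)
  have "(\<lambda>x. h (g x)) ` (U \<inter> g -` Z) = V' \<inter> hi -` Z"
  proof (intro subset_antisym subsetI)
    fix y assume "y \<in> (\<lambda>x. h (g x)) ` (U \<inter> g -` Z)"
    then obtain x where x: "x \<in> U" "g x \<in> Z" "y = h (g x)" by auto
    hence "g x \<in> U' \<inter> V" using U(6) sub Z(2) by blast
    hence "y \<in> V'" using x(3) V(6) by blast
    moreover have "hi y = g x" using x(3) c(3) by simp
    ultimately show "y \<in> V' \<inter> hi -` Z" using x(2) by simp
  next
    fix y assume y: "y \<in> V' \<inter> hi -` Z"
    then obtain w where w: "w \<in> V" "y = h w" using V(6) by auto
    hence "w \<in> U' \<inter> V" using y c(3) sub Z(2) by auto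
    then obtain x where "x \<in> U" "w = g x" using U(6) by auto
    thus "y \<in> (\<lambda>x. h (g x)) ` (U \<inter> g -` Z)" using w y c(3) by auto
  qed
  moreover have "p \<in> U \<inter> g -` Z" using U V Z by auto
  moreover have "p'' \<in> V' \<inter> hi -` Z"
  proof -
    have "hi p'' = p'" using V(1) c(3) by auto
    moreover have "p' \<in> Z" using U(5) V(3) Z(2) by blast
    ultimately show ?thesis using V(5) by simp
  qed
  ultimately show ?thesis using 1 U(1) V(1) unfolding maps_germ_def by blast
qed

lemma affine_map_continuous: "continuous_on UNIV (affine_map A b)"
  unfolding affine_map_def by (intro continuous_intros)

lemma affine_map_compose:
  "affine_map A2 b2 (affine_map A1 b1 q) = affine_map (A2 ** A1) (A2 *v b1 + b2) q"
  by (simp add: affine_map_def matrix_vector_mul_assoc matrix_vector_right_distrib)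

definition inv_translation :: "real ^ 3 ^ 3 \<Rightarrow> real ^ 3 \<Rightarrow> real ^ 3" where
  "inv_translation A b = - (matrix_inv A *v b)"

lemma affine_map_inverse:
  assumes "det A = 1"
  shows "affine_map (matrix_inv A) (inv_translation A b) (affine_map A b q) = q"
    "affine_map A b (affine_map (matrix_inv A) (inv_translation A b) q) = q"
    "det (matrix_inv A) = 1" "matrix_inv A ** A = mat 1" "A ** matrix_inv A = mat 1"
proof -
  have i: "invertible A" using assms by (simp add: invertible_det_nz)
  have m: "A ** matrix_inv A = mat 1" "matrix_inv A ** A = mat 1"
    using someI_ex[OF i[unfolded invertible_def]] by (auto simp: matrix_inv_def)
  show "matrix_inv A ** A = mat 1" "A ** matrix_inv A = mat 1" by (rule m)+
  have "det (A ** matrix_inv A) = 1" using m by simp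
  thus "det (matrix_inv A) = 1" using assms by (simp add: det_mul)
  show "affine_map (matrix_inv A) (inv_translation A b) (affine_map A b q) = q"
    by (simp add: affine_map_compose inv_translation_def m) (simp add: affine_map_def)
  show "affine_map A b (affine_map (matrix_inv A) (inv_translation A b) q) = q"
    by (simp add: affine_map_compose inv_translation_def m matrix_vector_mul_assoc
        linear_neg[OF matrix_vector_mul_linear]) (simp add: affine_map_def)
qed

lemma maps_germ_affine_inverse:
  assumes "det A = 1" "maps_germ (affine_map A b) S p S' p'"
  shows "maps_germ (affine_map (matrix_inv A) (inv_translation A b)) S' p' S p"
  using maps_germ_inverse[OF assms(2) affine_map_inverse(1)[OF assms(1)]] .

lemma maps_germ_affine_compose:
  assumes "det A2 = 1" "maps_germ (affine_map A1 b1) S p S' p'" "maps_germ (affine_map A2 b2) S' p' S'' p''"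
  shows "maps_germ (affine_map (A2 ** A1) (A2 *v b1 + b2)) S p S'' p''"
  using maps_germ_compose[OF assms(2,3) affine_map_continuous affine_map_continuous affine_map_inverse(1)[OF assms(1)]]
  unfolding affine_map_compose .

lemma SA3_equiv_sym: "SA3_equiv S p S' p' \<Longrightarrow> SA3_equiv S' p' S p"
  unfolding SA3_equiv_def using maps_germ_affine_inverse affine_map_inverse(3) by blast

lemma SA3_equiv_trans: "SA3_equiv S p S' p' \<Longrightarrow> SA3_equiv S' p' S'' p'' \<Longrightarrow> SA3_equiv S p S'' p''"
  unfolding SA3_equiv_def using maps_germ_affine_compose by (metis det_mul mult_1)

lemma maps_germ_cone_translation:
  assumes "is_cone F z x0 y0 u0 \<phi>" "is_cone G z' x1 y1 u1 \<psi>"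
    and "open D" "z \<in> D" "open E" "z' \<in> E" "det A = 1"
    and "curve_map A \<phi> (slope x0 y0 z) (y0 - snd z) \<psi> (slope x1 y1 z') (y1 - snd z')"
  shows "maps_germ (affine_map A (vector [x1, y1, u1] - A *v vector [x0, y0, u0]))
    (graph_surf F D) (graph_pt F z) (graph_surf G E) (graph_pt G z')"
  by (rule maps_germ_cone[OF assms(1-7) _ assms(8)]) (simp add: affine_map_def)

lemma curve_map_mat_1:
  assumes "analytic1 \<phi> s" "r \<noteq> 0" shows "curve_map (mat 1) \<phi> s r \<phi> s r"
  using assms by (simp add: curve_map_def row_def mat_def)

lemma SA3_equiv_same_cone:
  assumes "is_cone F z x0 y0 u0 \<phi>" "is_cone G z x0 y0 u0 \<phi>" "open D" "z \<in> D" "open E" "z \<in> E"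
  shows "SA3_equiv (graph_surf F D) (graph_pt F z) (graph_surf G E) (graph_pt G z)"
proof -
  have "curve_map (mat 1) \<phi> (slope x0 y0 z) (y0 - snd z) \<phi> (slope x0 y0 z) (y0 - snd z)"
    using is_coneD[OF assms(1)] by (intro curve_map_mat_1) auto
  from maps_germ_cone_translation[OF assms(1,2,3,4,5,6) _ this] show ?thesis
    unfolding SA3_equiv_def by (metis det_I)
qed

text \<open>The normalised cones have their vertex at \<open>(0, 1, 0)\<close> and pass through the origin.\<close>

lemma is_cone_origin:
  assumes "analytic1 \<psi> 0"
  shows "is_cone (cone 0 1 0 \<psi>) (0, 0) 0 1 0 \<psi>"
  using assms by (simp add: is_cone_def cone_dom_def slope_def)

lemma slope_origin [simp]: "slope 0 1 (0, 0) = 0"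
  by (simp add: slope_def)

lemma graph_pt_0: "F (0, 0) = 0 \<Longrightarrow> graph_pt F (0, 0) = 0"
  by (simp add: graph_pt_def vec_eq_iff forall_3)

section \<open>The induced transformation of plane curves\<close>

lemma row_analytic:
  assumes "analytic1 \<phi> s"
  shows "analytic1 (row A i \<phi>) s"
    "jet (row A i \<phi>) s = fps_const (A $ i $ 1) * (fps_const s + fps_X) - fps_const (A $ i $ 2) + fps_const (A $ i $ 3) * jet \<phi> s"
proof -
  have c: "analytic1 (\<lambda>s. A $ i $ 1 * s) s" "jet (\<lambda>s. A $ i $ 1 * s) s = fps_const (A $ i $ 1) * (fps_const s + fps_X)"
    using analytic1_mult[OF analytic1_const(1) analytic1_ident(1)] by auto
  have d: "analytic1 (\<lambda>s. A $ i $ 1 * s - A $ i $ 2) s"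
    "jet (\<lambda>s. A $ i $ 1 * s - A $ i $ 2) s = fps_const (A $ i $ 1) * (fps_const s + fps_X) - fps_const (A $ i $ 2)"
    using analytic1_diff[OF c(1) analytic1_const(1)] c(2) by auto
  have e: "analytic1 (\<lambda>s. A $ i $ 3 * \<phi> s) s" "jet (\<lambda>s. A $ i $ 3 * \<phi> s) s = fps_const (A $ i $ 3) * jet \<phi> s"
    using analytic1_mult[OF analytic1_const(1) assms] by auto
  show "analytic1 (row A i \<phi>) s"
    "jet (row A i \<phi>) s = fps_const (A $ i $ 1) * (fps_const s + fps_X) - fps_const (A $ i $ 2) + fps_const (A $ i $ 3) * jet \<phi> s"
    unfolding row_def[abs_def] using analytic1_add[OF d(1) e(1)] d(2) e(2) by auto
qed

text \<open>The transformed curve is the new height as a function of the new slope: the inverse of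
  the parameter change s \<mapsto> -m1/m2 is substituted into -m3/m2.\<close>

lemma curve_map_exists:
  assumes a: "analytic1 \<phi> s0" and m: "row A 2 \<phi> s0 \<noteq> 0"
    and d: "deriv (\<lambda>s. - row A 1 \<phi> s / row A 2 \<phi> s) s0 \<noteq> 0" and r: "r0 \<noteq> 0"
  obtains \<psi> where "analytic1 \<psi> (- row A 1 \<phi> s0 / row A 2 \<phi> s0)"
    "curve_map A \<phi> s0 r0 \<psi> (- row A 1 \<phi> s0 / row A 2 \<phi> s0) (- r0 * row A 2 \<phi> s0)"
proof -
  let ?\<sigma> = "\<lambda>s. - row A 1 \<phi> s / row A 2 \<phi> s" and ?\<nu> = "\<lambda>s. - row A 3 \<phi> s / row A 2 \<phi> s"
  have an: "analytic1 ?\<sigma> s0" "analytic1 ?\<nu> s0"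
    by (intro analytic1_divide(1) analytic1_minus(1) row_analytic(1) a m)+
  obtain g where g: "analytic1 g (?\<sigma> s0)" "\<forall>\<^sub>F t in nhds s0. g (?\<sigma> t) = t"
    by (rule analytic1_inverse_function[OF an(1) d])
  have gs: "g (?\<sigma> s0) = s0" using eventually_nhds_x_imp_x[OF g(2)] .
  show ?thesis
  proof (rule that)
    show "analytic1 (\<lambda>u. ?\<nu> (g u)) (?\<sigma> s0)"
      by (rule analytic1_compose(1)[OF g(1), of ?\<nu>]) (simp only: gs an(2))
    show "curve_map A \<phi> s0 r0 (\<lambda>u. ?\<nu> (g u)) (?\<sigma> s0) (- r0 * row A 2 \<phi> s0)"
      unfolding curve_map_def
    proof (intro conjI)
      show "\<forall>\<^sub>F s in nhds s0. ?\<nu> (g (?\<sigma> s)) = ?\<nu> s" using g(2) by eventually_elim simp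
    qed (use m in auto)
  qed
qed

text \<open>Comparing Taylor series at base points \<open>0\<close>: with \<open>S\<close> the jet of the parameter change,
  the curve relation reads \<open>(\<Psi> \<circ> S) R = -m\<^sub>3\<close>, \<open>S R = m\<^sub>1\<close> with \<open>R = -m\<^sub>2\<close>.\<close>

lemma curve_map_jets:
  fixes A :: "real ^ 3 ^ 3"
  assumes c: "curve_map A \<phi> 0 1 \<psi> 0 1" and a: "analytic1 \<phi> 0" "analytic1 \<psi> 0" and z: "\<phi> 0 = 0" "\<psi> 0 = 0"
  obtains S where "A $ 2 $ 2 = 1" "A $ 1 $ 2 = 0" "A $ 3 $ 2 = 0" "fps_nth S 0 = 0"
    "S * (1 - fps_const (A $ 2 $ 1) * fps_X - fps_const (A $ 2 $ 3) * jet \<phi> 0) =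
       fps_const (A $ 1 $ 1) * fps_X + fps_const (A $ 1 $ 3) * jet \<phi> 0"
    "(jet \<psi> 0 oo S) * (1 - fps_const (A $ 2 $ 1) * fps_X - fps_const (A $ 2 $ 3) * jet \<phi> 0) =
       fps_const (A $ 3 $ 1) * fps_X + fps_const (A $ 3 $ 3) * jet \<phi> 0"
proof -
  let ?\<sigma> = "\<lambda>s. - row A 1 \<phi> s / row A 2 \<phi> s" and ?\<nu> = "\<lambda>s. - row A 3 \<phi> s / row A 2 \<phi> s"
  have A2: "A $ 2 $ 2 = 1" "A $ 1 $ 2 = 0" using c z by (simp_all add: curve_map_def row_def)
  have m: "row A 2 \<phi> 0 = - 1" using c by (simp add: curve_map_def)
  have ev: "\<forall>\<^sub>F s in nhds 0. \<psi> (?\<sigma> s) = ?\<nu> s" using c by (simp add: curve_map_def)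
  have s0: "?\<sigma> 0 = 0" using A2 z by (simp add: row_def)
  from eventually_nhds_x_imp_x[OF ev] have A3: "A $ 3 $ 2 = 0"
    using s0 z m by (simp add: row_def)
  have an: "analytic1 ?\<sigma> 0" "analytic1 ?\<nu> 0"
    using m by (intro analytic1_divide(1) analytic1_minus(1) row_analytic(1) a; simp)+
  have R: "jet (row A 2 \<phi>) 0 = - (1 - fps_const (A $ 2 $ 1) * fps_X - fps_const (A $ 2 $ 3) * jet \<phi> 0)"
    "jet (row A 1 \<phi>) 0 = fps_const (A $ 1 $ 1) * fps_X + fps_const (A $ 1 $ 3) * jet \<phi> 0"
    "jet (row A 3 \<phi>) 0 = fps_const (A $ 3 $ 1) * fps_X + fps_const (A $ 3 $ 3) * jet \<phi> 0"
    by (simp_all add: row_analytic(2)[OF a(1)] A2 A3)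
  have ne: "\<forall>\<^sub>F s in nhds 0. row A 2 \<phi> s \<noteq> 0"
  proof -
    have "isCont (row A 2 \<phi>) 0" by (rule row_isCont[OF analytic1_isCont[OF a(1)]])
    hence "filterlim (row A 2 \<phi>) (nhds (- 1)) (nhds 0)"
      using tendsto_at_iff_tendsto_nhds[of "row A 2 \<phi>" 0] m by (simp add: isCont_def)
    moreover have "\<forall>\<^sub>F t in nhds (- 1 :: real). t \<noteq> 0" by (rule t1_space_nhds) simp
    ultimately show ?thesis by (rule_tac eventually_compose_filterlim)
  qed
  have prod: "jet (\<lambda>s. - g s / row A 2 \<phi> s) 0 * jet (row A 2 \<phi>) 0 = - jet g 0"
    if g: "analytic1 g 0" for g
  proof -
    have q: "analytic1 (\<lambda>s. - g s / row A 2 \<phi> s) 0"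
      using m by (intro analytic1_divide(1) analytic1_minus(1) row_analytic(1) a g) simp
    have "jet (\<lambda>s. - g s / row A 2 \<phi> s) 0 * jet (row A 2 \<phi>) 0 = jet (\<lambda>s. - g s / row A 2 \<phi> s * row A 2 \<phi> s) 0"
      by (rule analytic1_mult(2)[OF q row_analytic(1)[OF a(1)], symmetric])
    also have "\<dots> = jet (\<lambda>s. - g s) 0" by (rule jet_cong) (use ne in eventually_elim, simp)
    also have "\<dots> = - jet g 0" by (rule analytic1_minus(2)[OF g])
    finally show ?thesis .
  qed
  have "jet (\<lambda>s. \<psi> (?\<sigma> s)) 0 = jet \<psi> 0 oo (jet ?\<sigma> 0)"
    using analytic1_compose(2)[OF an(1), of \<psi>, unfolded s0, OF a(2)] by simp
  moreover have "jet (\<lambda>s. \<psi> (?\<sigma> s)) 0 = jet ?\<nu> 0" by (rule jet_cong[OF ev])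
  ultimately have comp: "jet \<psi> 0 oo (jet ?\<sigma> 0) = jet ?\<nu> 0" by simp
  show ?thesis
  proof (rule that[of "jet ?\<sigma> 0"])
    show "fps_nth (jet ?\<sigma> 0) 0 = 0" using s0 by simp
    show "jet ?\<sigma> 0 * (1 - fps_const (A $ 2 $ 1) * fps_X - fps_const (A $ 2 $ 3) * jet \<phi> 0) =
       fps_const (A $ 1 $ 1) * fps_X + fps_const (A $ 1 $ 3) * jet \<phi> 0"
      using prod[OF row_analytic(1)[OF a(1), of A 1]] unfolding R mult_minus_right neg_equal_iff_equal .
    show "(jet \<psi> 0 oo jet ?\<sigma> 0) * (1 - fps_const (A $ 2 $ 1) * fps_X - fps_const (A $ 2 $ 3) * jet \<phi> 0) =
       fps_const (A $ 3 $ 1) * fps_X + fps_const (A $ 3 $ 3) * jet \<phi> 0"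
      unfolding comp using prod[OF row_analytic(1)[OF a(1), of A 3]] unfolding R mult_minus_right neg_equal_iff_equal .
  qed fact+
qed

section \<open>Projective normal forms of plane curves\<close>

text \<open>Degrees six and seven are only needed when the outer curve has vanishing third and
  fourth coefficients, which removes most of their terms.\<close>

lemma fps_compose_nth_small:
  fixes P S :: "real fps"
  assumes S: "fps_nth S 0 = 0" and P: "fps_nth P 0 = 0" "fps_nth P 1 = 0"
  defines "s \<equiv> fps_nth S" and "p \<equiv> fps_nth P" and "c \<equiv> fps_nth (P oo S)"
  shows "c 0 = 0" "c 1 = 0" "c 2 = p 2 * (s 1)\<^sup>2" "c 3 = 2 * p 2 * s 1 * s 2 + p 3 * s 1 ^ 3"
    "c 4 = p 2 * ((s 2)\<^sup>2 + 2 * s 1 * s 3) + 3 * p 3 * (s 1)\<^sup>2 * s 2 + p 4 * s 1 ^ 4"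
    "c 5 = p 2 * (2 * s 1 * s 4 + 2 * s 2 * s 3) + p 3 * (3 * (s 1)\<^sup>2 * s 3 + 3 * s 1 * (s 2)\<^sup>2)
       + 4 * p 4 * s 1 ^ 3 * s 2 + p 5 * s 1 ^ 5"
    "p 3 = 0 \<Longrightarrow> p 4 = 0 \<Longrightarrow> c 6 = p 2 * (2 * s 1 * s 5 + 2 * s 2 * s 4 + (s 3)\<^sup>2) + 5 * p 5 * s 1 ^ 4 * s 2 + p 6 * s 1 ^ 6"
    "p 3 = 0 \<Longrightarrow> p 4 = 0 \<Longrightarrow> c 7 = p 2 * (2 * s 1 * s 6 + 2 * s 2 * s 5 + 2 * s 3 * s 4)
       + p 5 * (5 * s 1 ^ 4 * s 3 + 10 * s 1 ^ 3 * (s 2)\<^sup>2) + 6 * p 6 * s 1 ^ 5 * s 2 + p 7 * s 1 ^ 7"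
proof -
  note e = fps_mult_nth sum.atLeast0_atMost_Suc numeral_eq_Suc
  have s0: "s 0 = 0" using S by (simp add: s_def)
  have 2: "fps_nth (S\<^sup>2) 0 = 0" "fps_nth (S\<^sup>2) 1 = 0" "fps_nth (S\<^sup>2) 2 = (s 1)\<^sup>2" "fps_nth (S\<^sup>2) 3 = 2 * s 1 * s 2"
    "fps_nth (S\<^sup>2) 4 = (s 2)\<^sup>2 + 2 * s 1 * s 3" "fps_nth (S\<^sup>2) 5 = 2 * s 1 * s 4 + 2 * s 2 * s 3"
    "fps_nth (S\<^sup>2) 6 = 2 * s 1 * s 5 + 2 * s 2 * s 4 + (s 3)\<^sup>2"
    "fps_nth (S\<^sup>2) 7 = 2 * s 1 * s 6 + 2 * s 2 * s 5 + 2 * s 3 * s 4"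
    unfolding power2_eq_square[of S] by (simp_all add: e S s_def algebra_simps)
  have 3: "fps_nth (S ^ 3) 0 = 0" "fps_nth (S ^ 3) 1 = 0" "fps_nth (S ^ 3) 2 = 0" "fps_nth (S ^ 3) 3 = s 1 ^ 3"
    "fps_nth (S ^ 3) 4 = 3 * (s 1)\<^sup>2 * s 2" "fps_nth (S ^ 3) 5 = 3 * (s 1)\<^sup>2 * s 3 + 3 * s 1 * (s 2)\<^sup>2"
    unfolding power3_eq_cube[of S] by (simp_all add: e S s_def algebra_simps)
  have 4: "fps_nth (S ^ 4) 0 = 0" "fps_nth (S ^ 4) 1 = 0" "fps_nth (S ^ 4) 2 = 0" "fps_nth (S ^ 4) 3 = 0"
    "fps_nth (S ^ 4) 4 = s 1 ^ 4" "fps_nth (S ^ 4) 5 = 4 * s 1 ^ 3 * s 2"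
    "fps_nth (S ^ 4) 6 = 4 * s 1 ^ 3 * s 3 + 6 * (s 1)\<^sup>2 * (s 2)\<^sup>2"
  proof -
    have p: "S ^ 4 = S\<^sup>2 * S\<^sup>2" by (simp flip: power_add)
    show "fps_nth (S ^ 4) 0 = 0" "fps_nth (S ^ 4) 1 = 0" "fps_nth (S ^ 4) 2 = 0" "fps_nth (S ^ 4) 3 = 0"
      "fps_nth (S ^ 4) 4 = s 1 ^ 4" "fps_nth (S ^ 4) 5 = 4 * s 1 ^ 3 * s 2"
      "fps_nth (S ^ 4) 6 = 4 * s 1 ^ 3 * s 3 + 6 * (s 1)\<^sup>2 * (s 2)\<^sup>2"
      unfolding p using 2 by (simp_all add: e) (simp_all add: algebra_simps power2_eq_square)
  qed
  have z: "fps_nth (S ^ k) n = 0" if "n < k" for n k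
    using startsby_zero_power_prefix[OF S, of k] that by auto
  have d: "fps_nth (S ^ k) k = s 1 ^ k" for k
    using startsby_zero_power_nth_same[OF S, of k] by (simp add: s_def)
  have n: "{0..2::nat} = {0,1,2}" "{0..3::nat} = {0,1,2,3}" "{0..4::nat} = {0,1,2,3,4}" "{0..5::nat} = {0,1,2,3,4,5}"
    "{0..6::nat} = {0,1,2,3,4,5,6}" "{0..7::nat} = {0,1,2,3,4,5,6,7}" by auto
  have S5: "S ^ 5 = S * S ^ 4" and S6: "S ^ 6 = S * S ^ 5" by (simp_all flip: power_Suc)
  have 5: "fps_nth (S ^ 5) 5 = s 1 ^ 5" "fps_nth (S ^ 5) 6 = 5 * s 1 ^ 4 * s 2"
    "fps_nth (S ^ 5) 7 = 5 * s 1 ^ 4 * s 3 + 10 * s 1 ^ 3 * (s 2)\<^sup>2"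
  proof -
    show "fps_nth (S ^ 5) 5 = s 1 ^ 5" by (rule d)
    have "fps_nth (S ^ 5) 6 = s 1 * (4 * s 1 ^ 3 * s 2) + s 2 * s 1 ^ 4"
      unfolding S5 fps_mult_nth n using 4 S z by (simp add: s_def)
    thus "fps_nth (S ^ 5) 6 = 5 * s 1 ^ 4 * s 2" by (simp add: eval_nat_numeral)
    have "fps_nth (S ^ 5) 7 = s 1 * (4 * s 1 ^ 3 * s 3 + 6 * (s 1)\<^sup>2 * (s 2)\<^sup>2) + s 2 * (4 * s 1 ^ 3 * s 2) + s 3 * s 1 ^ 4"
      unfolding S5 fps_mult_nth n using 4 S z by (simp add: s_def)
    thus "fps_nth (S ^ 5) 7 = 5 * s 1 ^ 4 * s 3 + 10 * s 1 ^ 3 * (s 2)\<^sup>2"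
      by (simp add: eval_nat_numeral algebra_simps)
  qed
  have 6: "fps_nth (S ^ 6) 7 = 6 * s 1 ^ 5 * s 2"
  proof -
    have "fps_nth (S ^ 6) 7 = s 1 * (5 * s 1 ^ 4 * s 2) + s 2 * s 1 ^ 5"
      unfolding S6 fps_mult_nth n using 5 S z by (simp add: s_def)
    thus ?thesis by (simp add: eval_nat_numeral)
  qed
  have c: "c n = (\<Sum>i=0..n. p i * fps_nth (S ^ i) n)" for n
    by (simp add: c_def fps_compose_nth p_def)
  have c0: "p 0 = 0" "p (Suc 0) = 0" using P by (auto simp: p_def)
  show "c 0 = 0" "c 1 = 0" using c0 by (simp_all add: c)
  show "c 2 = p 2 * (s 1)\<^sup>2" "c 3 = 2 * p 2 * s 1 * s 2 + p 3 * s 1 ^ 3"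
    "c 4 = p 2 * ((s 2)\<^sup>2 + 2 * s 1 * s 3) + 3 * p 3 * (s 1)\<^sup>2 * s 2 + p 4 * s 1 ^ 4"
    "c 5 = p 2 * (2 * s 1 * s 4 + 2 * s 2 * s 3) + p 3 * (3 * (s 1)\<^sup>2 * s 3 + 3 * s 1 * (s 2)\<^sup>2)
       + 4 * p 4 * s 1 ^ 3 * s 2 + p 5 * s 1 ^ 5"
    unfolding c n using c0 2 3 4 5 d[of 2] by simp_all
  assume p34: "p 3 = 0" "p 4 = 0"
  show "c 6 = p 2 * (2 * s 1 * s 5 + 2 * s 2 * s 4 + (s 3)\<^sup>2) + 5 * p 5 * s 1 ^ 4 * s 2 + p 6 * s 1 ^ 6"
    unfolding c n using c0 2 5 d[of 6] p34 by simp
  show "c 7 = p 2 * (2 * s 1 * s 6 + 2 * s 2 * s 5 + 2 * s 3 * s 4)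
       + p 5 * (5 * s 1 ^ 4 * s 3 + 10 * s 1 ^ 3 * (s 2)\<^sup>2) + 6 * p 6 * s 1 ^ 5 * s 2 + p 7 * s 1 ^ 7"
    unfolding c n using c0 2 5 6 d[of 7] p34 by simp
qed

text \<open>Multiplication by \<open>1 - \<beta>X - \<delta>\<Phi>\<close>, read as a recursion for the coefficients of \<open>T\<close>.\<close>

lemma fps_denominator_nth:
  fixes T Q :: "real fps"
  assumes "T * (1 - fps_const \<beta> * fps_X - fps_const \<delta> * Q) = fps_const \<alpha> * fps_X + fps_const \<gamma> * Q"
    and Q: "fps_nth Q 0 = 0" "fps_nth Q 1 = 0"
  defines "t \<equiv> fps_nth T" and "q \<equiv> fps_nth Q"
  shows "t 0 = 0" "t 1 = \<alpha>" "t 2 = \<gamma> * q 2 + \<beta> * t 1" "t 3 = \<gamma> * q 3 + \<beta> * t 2 + \<delta> * (q 2 * t 1)"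
    "t 4 = \<gamma> * q 4 + \<beta> * t 3 + \<delta> * (q 2 * t 2 + q 3 * t 1)"
    "t 5 = \<gamma> * q 5 + \<beta> * t 4 + \<delta> * (q 2 * t 3 + q 3 * t 2 + q 4 * t 1)"
    "t 6 = \<gamma> * q 6 + \<beta> * t 5 + \<delta> * (q 2 * t 4 + q 3 * t 3 + q 4 * t 2 + q 5 * t 1)"
    "t 7 = \<gamma> * q 7 + \<beta> * t 6 + \<delta> * (q 2 * t 5 + q 3 * t 4 + q 4 * t 3 + q 5 * t 2 + q 6 * t 1)"
proof -
  have eq: "T = fps_const \<alpha> * fps_X + fps_const \<gamma> * Q + fps_const \<beta> * (fps_X * T) + fps_const \<delta> * (Q * T)"
    using assms(1) by (simp add: algebra_simps)
  have t: "t n = \<alpha> * fps_nth fps_X n + \<gamma> * q n + \<beta> * (if n = 0 then 0 else t (n - 1)) + \<delta> * fps_nth (Q * T) n" for n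
    unfolding t_def q_def by (subst eq) simp
  note e = fps_mult_nth sum.atLeast0_atMost_Suc numeral_eq_Suc
  have q0: "q 0 = 0" "q (Suc 0) = 0" using Q by (auto simp: q_def)
  have t0: "t 0 = 0" using t[of 0] q0 by (simp add: fps_mult_nth flip: q_def)
  have m: "fps_nth (Q * T) 1 = 0" "fps_nth (Q * T) 2 = 0" "fps_nth (Q * T) 3 = q 2 * t 1"
    "fps_nth (Q * T) 4 = q 2 * t 2 + q 3 * t 1" "fps_nth (Q * T) 5 = q 2 * t 3 + q 3 * t 2 + q 4 * t 1"
    "fps_nth (Q * T) 6 = q 2 * t 4 + q 3 * t 3 + q 4 * t 2 + q 5 * t 1"
    "fps_nth (Q * T) 7 = q 2 * t 5 + q 3 * t 4 + q 4 * t 3 + q 5 * t 2 + q 6 * t 1"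
    using q0 t0 by (simp_all add: e flip: q_def t_def)
  show "t 0 = 0" by fact
  show "t 1 = \<alpha>" using t[of 1] m q0 t0 by simp
  show "t 2 = \<gamma> * q 2 + \<beta> * t 1" using t[of 2] m by simp
  show "t 3 = \<gamma> * q 3 + \<beta> * t 2 + \<delta> * (q 2 * t 1)" using t[of 3] m by simp
  show "t 4 = \<gamma> * q 4 + \<beta> * t 3 + \<delta> * (q 2 * t 2 + q 3 * t 1)" using t[of 4] m by simp
  show "t 5 = \<gamma> * q 5 + \<beta> * t 4 + \<delta> * (q 2 * t 3 + q 3 * t 2 + q 4 * t 1)" using t[of 5] m by simp
  show "t 6 = \<gamma> * q 6 + \<beta> * t 5 + \<delta> * (q 2 * t 4 + q 3 * t 3 + q 4 * t 2 + q 5 * t 1)" using t[of 6] m by simp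
  show "t 7 = \<gamma> * q 7 + \<beta> * t 6 + \<delta> * (q 2 * t 5 + q 3 * t 4 + q 4 * t 3 + q 5 * t 2 + q 6 * t 1)" using t[of 7] m by simp
qed

text \<open>The linear maps fixing the vertex direction and preserving the tangent plane at the origin.\<close>

definition frame_change :: "real \<Rightarrow> real \<Rightarrow> real \<Rightarrow> real ^ 3 ^ 3" where
  "frame_change \<beta> \<gamma> \<delta> = vector [vector [1, 0, \<gamma>], vector [\<beta>, 1, \<delta>], vector [0, 0, 1]]"

lemma frame_change_entries [simp]:
  "frame_change \<beta> \<gamma> \<delta> $ 1 = vector [1, 0, \<gamma>]" "frame_change \<beta> \<gamma> \<delta> $ 2 = vector [\<beta>, 1, \<delta>]"
  "frame_change \<beta> \<gamma> \<delta> $ 3 = vector [0, 0, 1]"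
  by (simp_all add: frame_change_def)

lemma det_frame_change: "det (frame_change \<beta> \<gamma> \<delta>) = 1"
  by (simp add: det_3)

text \<open>Contact of order two with the conic u = s^2/2 at the origin.\<close>

definition osculating :: "(real \<Rightarrow> real) \<Rightarrow> bool" where
  "osculating \<phi> \<longleftrightarrow> analytic1 \<phi> 0 \<and> \<phi> 0 = 0 \<and> deriv \<phi> 0 = 0 \<and> (deriv ^^ 2) \<phi> 0 = 1"

lemma osculating_jet:
  assumes "osculating \<phi>"
  shows "fps_nth (jet \<phi> 0) 0 = 0" "fps_nth (jet \<phi> 0) 1 = 0" "fps_nth (jet \<phi> 0) 2 = 1 / 2"
  using assms by (simp_all add: osculating_def jet_nth)

lemma frame_change_exists:
  assumes \<phi>: "osculating \<phi>"
  obtains \<psi> where "analytic1 \<psi> 0" "\<psi> 0 = 0" "curve_map (frame_change \<beta> \<gamma> \<delta>) \<phi> 0 1 \<psi> 0 1"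
proof -
  let ?A = "frame_change \<beta> \<gamma> \<delta>"
  have a: "analytic1 \<phi> 0" and z: "\<phi> 0 = 0" "deriv \<phi> 0 = 0" using \<phi> by (auto simp: osculating_def)
  have m: "row ?A 2 \<phi> 0 = - 1" "row ?A 1 \<phi> 0 = 0" "row ?A 3 \<phi> 0 = 0" by (simp_all add: row_def z)
  have d\<phi>: "(\<phi> has_field_derivative 0) (at 0)" using analytic1_deriv(3)[OF a] z by simp
  have "((\<lambda>s. - row ?A 1 \<phi> s / row ?A 2 \<phi> s) has_field_derivative 1) (at 0)"
    unfolding row_def by (auto intro!: derivative_eq_intros d\<phi> simp: z)
  hence d: "deriv (\<lambda>s. - row ?A 1 \<phi> s / row ?A 2 \<phi> s) 0 = 1" by (rule DERIV_imp_deriv)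
  obtain \<psi> where \<psi>: "analytic1 \<psi> 0" "curve_map ?A \<phi> 0 1 \<psi> 0 1"
    using curve_map_exists[OF a, of ?A 1] m d by auto
  have "\<psi> 0 = 0"
  proof -
    have "\<forall>\<^sub>F s in nhds 0. \<psi> (- row ?A 1 \<phi> s / row ?A 2 \<phi> s) = - row ?A 3 \<phi> s / row ?A 2 \<phi> s"
      using \<psi>(2) by (simp add: curve_map_def)
    from eventually_nhds_x_imp_x[OF this] show ?thesis by (simp add: m)
  qed
  thus ?thesis using that \<psi> by blast
qed

text \<open>Here s lists the coefficients of the parameter change S and c those of the composite of
  \<psi> with S. The sequence c is computed twice, from \<phi> by the denominator recursion and from
  \<psi> by composition, and equating the two determines the coefficients p of \<psi> degree by
  degree.\<close>

lemma frame_change_coeffs: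
  assumes \<phi>: "osculating \<phi>" and \<psi>: "analytic1 \<psi> 0" "\<psi> 0 = 0"
    and c: "curve_map (frame_change \<beta> \<gamma> \<delta>) \<phi> 0 1 \<psi> 0 1"
  defines "q \<equiv> fps_nth (jet \<phi> 0)" and "p \<equiv> fps_nth (jet \<psi> 0)"
  obtains s c :: "nat \<Rightarrow> real" where "osculating \<psi>"
    "s 1 = 1" "s 2 = \<gamma> / 2 + \<beta>" "s 3 = \<gamma> * q 3 + \<beta> * s 2 + \<delta> / 2"
    "s 4 = \<gamma> * q 4 + \<beta> * s 3 + \<delta> * (s 2 / 2 + q 3)"
    "s 5 = \<gamma> * q 5 + \<beta> * s 4 + \<delta> * (s 3 / 2 + q 3 * s 2 + q 4)"
    "s 6 = \<gamma> * q 6 + \<beta> * s 5 + \<delta> * (s 4 / 2 + q 3 * s 3 + q 4 * s 2 + q 5)"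
    "c 2 = 1 / 2" "c 3 = q 3 + \<beta> / 2" "c 4 = q 4 + \<beta> * c 3 + \<delta> / 4"
    "c 5 = q 5 + \<beta> * c 4 + \<delta> * (c 3 / 2 + q 3 / 2)"
    "c 6 = q 6 + \<beta> * c 5 + \<delta> * (c 4 / 2 + q 3 * c 3 + q 4 / 2)"
    "c 7 = q 7 + \<beta> * c 6 + \<delta> * (c 5 / 2 + q 3 * c 4 + q 4 * c 3 + q 5 / 2)"
    "c 3 = s 2 + p 3" "c 4 = ((s 2)\<^sup>2 + 2 * s 3) / 2 + 3 * p 3 * s 2 + p 4"
    "c 5 = (s 4 + s 2 * s 3) + p 3 * (3 * s 3 + 3 * (s 2)\<^sup>2) + 4 * p 4 * s 2 + p 5"
    "p 3 = 0 \<Longrightarrow> p 4 = 0 \<Longrightarrow> c 6 = (2 * s 5 + 2 * s 2 * s 4 + (s 3)\<^sup>2) / 2 + 5 * p 5 * s 2 + p 6"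
    "p 3 = 0 \<Longrightarrow> p 4 = 0 \<Longrightarrow> c 7 = (s 6 + s 2 * s 5 + s 3 * s 4)
       + p 5 * (5 * s 3 + 10 * (s 2)\<^sup>2) + 6 * p 6 * s 2 + p 7"
proof -
  have a: "analytic1 \<phi> 0" "\<phi> 0 = 0" using \<phi> by (auto simp: osculating_def)
  note j = osculating_jet[OF \<phi>]
  obtain S where S: "fps_nth S 0 = 0"
    "S * (1 - fps_const \<beta> * fps_X - fps_const \<delta> * jet \<phi> 0) = fps_const 1 * fps_X + fps_const \<gamma> * jet \<phi> 0"
    "(jet \<psi> 0 oo S) * (1 - fps_const \<beta> * fps_X - fps_const \<delta> * jet \<phi> 0) = fps_const 0 * fps_X + fps_const 1 * jet \<phi> 0"
    by (rule curve_map_jets[OF c a(1) \<psi>(1) a(2) \<psi>(2)]) simp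
  note s = fps_denominator_nth[OF S(2) j(1,2)]
  note t = fps_denominator_nth[OF S(3) j(1,2)]
  have p0: "fps_nth (jet \<psi> 0) 0 = 0" using \<psi>(2) by simp
  have p1: "fps_nth (jet \<psi> 0) 1 = 0"
  proof -
    have "fps_nth (jet \<psi> 0 oo S) 1 = fps_nth (jet \<psi> 0) 1 * fps_nth S 1"
      by (simp add: fps_compose_nth p0)
    thus ?thesis using t(2) s(2) by simp
  qed
  note k = fps_compose_nth_small[OF S(1) p0 p1]
  have p2: "fps_nth (jet \<psi> 0) 2 = 1 / 2" using k(3) t(2,3) s(2) j(3) by simp
  have o: "osculating \<psi>"
    using \<psi> p1 p2 by (simp add: osculating_def jet_nth)
  note e = q_def p_def j(3) p2 s(2)
  have t1: "fps_nth (jet \<psi> 0 oo S) 1 = 0" "fps_nth (jet \<psi> 0 oo S) 2 = 1 / 2" using t(2,3) j(3) by simp_all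
  show ?thesis
  proof (rule that[OF o, of "fps_nth S" "fps_nth (jet \<psi> 0 oo S)"])
    show "fps_nth S 1 = 1"
      using s(2) .
    show "fps_nth S 2 = \<gamma> / 2 + \<beta>"
      using s(3) unfolding e by simp
    show "fps_nth S 3 = \<gamma> * q 3 + \<beta> * fps_nth S 2 + \<delta> / 2"
      using s(4) unfolding e by simp
    show "fps_nth S 4 = \<gamma> * q 4 + \<beta> * fps_nth S 3 + \<delta> * (fps_nth S 2 / 2 + q 3)"
      using s(5) unfolding e by simp
    show "fps_nth S 5 = \<gamma> * q 5 + \<beta> * fps_nth S 4 + \<delta> * (fps_nth S 3 / 2 + q 3 * fps_nth S 2 + q 4)"
      using s(6) unfolding e by simp
    show "fps_nth S 6 = \<gamma> * q 6 + \<beta> * fps_nth S 5 + \<delta> * (fps_nth S 4 / 2 + q 3 * fps_nth S 3 + q 4 * fps_nth S 2 + q 5)"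
      using s(7) unfolding e by simp
    show "fps_nth (jet \<psi> 0 oo S) 2 = 1 / 2"
      using t1(2) .
    show "fps_nth (jet \<psi> 0 oo S) 3 = q 3 + \<beta> / 2"
      using t(4) unfolding e t1 by simp
    show "fps_nth (jet \<psi> 0 oo S) 4 = q 4 + \<beta> * fps_nth (jet \<psi> 0 oo S) 3 + \<delta> / 4"
      using t(5) unfolding e t1 by simp
    show "fps_nth (jet \<psi> 0 oo S) 5 = q 5 + \<beta> * fps_nth (jet \<psi> 0 oo S) 4 + \<delta> * (fps_nth (jet \<psi> 0 oo S) 3 / 2 + q 3 / 2)"
      using t(6) unfolding e t1 by simp
    show "fps_nth (jet \<psi> 0 oo S) 6 = q 6 + \<beta> * fps_nth (jet \<psi> 0 oo S) 5 + \<delta> * (fps_nth (jet \<psi> 0 oo S) 4 / 2 + q 3 * fps_nth (jet \<psi> 0 oo S) 3 + q 4 / 2)"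
      using t(7) unfolding e t1 by simp
    show "fps_nth (jet \<psi> 0 oo S) 7 = q 7 + \<beta> * fps_nth (jet \<psi> 0 oo S) 6 + \<delta> * (fps_nth (jet \<psi> 0 oo S) 5 / 2 + q 3 * fps_nth (jet \<psi> 0 oo S) 4 + q 4 * fps_nth (jet \<psi> 0 oo S) 3 + q 5 / 2)"
      using t(8) unfolding e t1 by simp
    show "fps_nth (jet \<psi> 0 oo S) 3 = fps_nth S 2 + p 3"
      using k(4) unfolding e by simp
    show "fps_nth (jet \<psi> 0 oo S) 4 = ((fps_nth S 2)\<^sup>2 + 2 * fps_nth S 3) / 2 + 3 * p 3 * fps_nth S 2 + p 4"
      using k(5) unfolding e by simp
    show "fps_nth (jet \<psi> 0 oo S) 5 = (fps_nth S 4 + fps_nth S 2 * fps_nth S 3) + p 3 * (3 * fps_nth S 3 + 3 * (fps_nth S 2)\<^sup>2) + 4 * p 4 * fps_nth S 2 + p 5"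
      using k(6) unfolding e by simp
    show "fps_nth (jet \<psi> 0 oo S) 6 = (2 * fps_nth S 5 + 2 * fps_nth S 2 * fps_nth S 4 + (fps_nth S 3)\<^sup>2) / 2 + 5 * p 5 * fps_nth S 2 + p 6" if "p 3 = 0" "p 4 = 0"
      using k(7)[OF that[unfolded p_def]] unfolding e by simp
    show "fps_nth (jet \<psi> 0 oo S) 7 = (fps_nth S 6 + fps_nth S 2 * fps_nth S 5 + fps_nth S 3 * fps_nth S 4)
       + p 5 * (5 * fps_nth S 3 + 10 * (fps_nth S 2)\<^sup>2) + 6 * p 6 * fps_nth S 2 + p 7" if "p 3 = 0" "p 4 = 0"
      using k(8)[OF that[unfolded p_def]] unfolding e by simp
  qed
qed

section \<open>Curves in contact of order four with the conic\<close>

lemma power_expand: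
  fixes x :: real
  shows "x ^ 2 = x * x" "x ^ 3 = x * x * x" "x ^ 4 = x * x * x * x" "x ^ 5 = x * x * x * x * x"
    "x ^ 6 = x * x * x * x * x * x" "x ^ 7 = x * x * x * x * x * x * x" "x ^ 8 = x * x * x * x * x * x * x * x"
  by (simp_all add: eval_nat_numeral)

lemma jet_deriv: "(deriv ^^ n) \<phi> s = fact n * fps_nth (jet \<phi> s) n"
  by (simp add: jet_nth)

text \<open>The osculating conic at the origin is u = s^2/2.\<close>

definition flat :: "(real \<Rightarrow> real) \<Rightarrow> bool" where
  "flat \<psi> \<longleftrightarrow> osculating \<psi> \<and> (deriv ^^ 3) \<psi> 0 = 0 \<and> (deriv ^^ 4) \<psi> 0 = 0"

lemma flatD:
  assumes "flat \<psi>"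
  shows "osculating \<psi>" "analytic1 \<psi> 0" "\<psi> 0 = 0" "deriv \<psi> 0 = 0" "(deriv ^^ 2) \<psi> 0 = 1"
    "fps_nth (jet \<psi> 0) 3 = 0" "fps_nth (jet \<psi> 0) 4 = 0"
  using assms by (auto simp: flat_def osculating_def jet_nth)

text \<open>The frame change moves the conic with the same derivatives of order at most four to \<open>u = s\<^sup>2/2\<close>.\<close>

lemma flatten_curve:
  assumes \<phi>: "osculating \<phi>"
  defines "p \<equiv> (\<lambda>n. (deriv ^^ n) \<phi> 0)"
  obtains \<psi> where "flat \<psi>"
    "curve_map (frame_change 0 (p 3 / 3) (p 4 / 6 - 5 * (p 3)\<^sup>2 / 18)) \<phi> 0 1 \<psi> 0 1"
    "(deriv ^^ 5) \<psi> 0 = (9 * p 5 - 45 * p 3 * p 4 + 40 * p 3 ^ 3) / 9"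
    "18 * (9 * p 5 - 45 * p 3 * p 4 + 40 * p 3 ^ 3) * (deriv ^^ 7) \<psi> 0 - 189 * ((deriv ^^ 6) \<psi> 0)\<^sup>2 =
      11200 * p 3 ^ 8 - 12600 * p 3 ^ 3 * p 5 * p 4 + 13230 * p 3 * p 5 * p 4 ^ 2 + 1134 * p 3 * p 5 * p 6
      - 3150 * p 3 ^ 2 * p 4 * p 6 - 810 * p 7 * p 3 * p 4 - 33600 * p 3 ^ 6 * p 4 - 7875 * p 3 ^ 2 * p 4 ^ 3
      - 756 * p 3 ^ 2 * p 5 ^ 2 + 6720 * p 3 ^ 5 * p 5 + 31500 * p 3 ^ 4 * p 4 ^ 2 - 4725 * p 4 ^ 4
      - 189 * p 6 ^ 2 + 1890 * p 4 ^ 2 * p 6 - 2835 * p 4 * p 5 ^ 2 + 162 * p 7 * p 5 + 720 * p 7 * p 3 ^ 3"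
proof -
  \<comment> \<open>With \<beta> = 0, the vanishing of the third coefficient of \<psi> forces
    \<gamma> and that of the fourth then forces \<delta>. The freedom lost by \<beta> = 0 is the
    one-parameter group fixing the conic.\<close>
  let ?\<gamma> = "p 3 / 3" and ?\<delta> = "p 4 / 6 - 5 * (p 3)\<^sup>2 / 18"
  have q: "fps_nth (jet \<phi> 0) 3 = p 3 / 6" "fps_nth (jet \<phi> 0) 4 = p 4 / 24" "fps_nth (jet \<phi> 0) 5 = p 5 / 120"
    "fps_nth (jet \<phi> 0) 6 = p 6 / 720" "fps_nth (jet \<phi> 0) 7 = p 7 / 5040"
    by (simp_all add: jet_nth p_def fact_numeral)
  obtain \<psi> where \<psi>: "analytic1 \<psi> 0" "\<psi> 0 = 0" "curve_map (frame_change 0 ?\<gamma> ?\<delta>) \<phi> 0 1 \<psi> 0 1"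
    by (rule frame_change_exists[OF \<phi>])
  define P where "P = fps_nth (jet \<psi> 0)"
  obtain s c :: "nat \<Rightarrow> real" where o: "osculating \<psi>" and
    s: "s 2 = ?\<gamma> / 2 + 0" "s 3 = ?\<gamma> * (p 3 / 6) + 0 * s 2 + ?\<delta> / 2"
    "s 4 = ?\<gamma> * (p 4 / 24) + 0 * s 3 + ?\<delta> * (s 2 / 2 + p 3 / 6)"
    "s 5 = ?\<gamma> * (p 5 / 120) + 0 * s 4 + ?\<delta> * (s 3 / 2 + p 3 / 6 * s 2 + p 4 / 24)"
    "s 6 = ?\<gamma> * (p 6 / 720) + 0 * s 5 + ?\<delta> * (s 4 / 2 + p 3 / 6 * s 3 + p 4 / 24 * s 2 + p 5 / 120)"
    and c: "c 3 = p 3 / 6 + 0 / 2" "c 4 = p 4 / 24 + 0 * c 3 + ?\<delta> / 4"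
    "c 5 = p 5 / 120 + 0 * c 4 + ?\<delta> * (c 3 / 2 + p 3 / 6 / 2)"
    "c 6 = p 6 / 720 + 0 * c 5 + ?\<delta> * (c 4 / 2 + p 3 / 6 * c 3 + p 4 / 24 / 2)"
    "c 7 = p 7 / 5040 + 0 * c 6 + ?\<delta> * (c 5 / 2 + p 3 / 6 * c 4 + p 4 / 24 * c 3 + p 5 / 120 / 2)"
    and e: "c 3 = s 2 + P 3" "c 4 = ((s 2)\<^sup>2 + 2 * s 3) / 2 + 3 * P 3 * s 2 + P 4"
    "c 5 = (s 4 + s 2 * s 3) + P 3 * (3 * s 3 + 3 * (s 2)\<^sup>2) + 4 * P 4 * s 2 + P 5"
    "P 3 = 0 \<Longrightarrow> P 4 = 0 \<Longrightarrow> c 6 = (2 * s 5 + 2 * s 2 * s 4 + (s 3)\<^sup>2) / 2 + 5 * P 5 * s 2 + P 6"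
    "P 3 = 0 \<Longrightarrow> P 4 = 0 \<Longrightarrow> c 7 = (s 6 + s 2 * s 5 + s 3 * s 4)
       + P 5 * (5 * s 3 + 10 * (s 2)\<^sup>2) + 6 * P 6 * s 2 + P 7"
    using frame_change_coeffs[OF \<phi> \<psi>, folded P_def, unfolded q] by blast
  define a b d f g where "a = p 3" and "b = p 4" and "d = p 5" and "f = p 6" and "g = p 7"
  note v = a_def[symmetric] b_def[symmetric] d_def[symmetric] f_def[symmetric] g_def[symmetric]
  note w = power_expand field_simps
  have s2: "s 2 = 1 / 6 * a" unfolding s(1) v by simp
  have s3: "s 3 = - 1 / 12 * a ^ 2 + 1 / 12 * b" unfolding s(2) s2 v by (simp add: w)
  have s4: "s 4 = 1 / 18 * a * b - 5 / 72 * a ^ 3" unfolding s(3) s2 s3 v by (simp add: w)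
  have s5: "s 5 = 1 / 360 * a * d - 11 / 432 * a ^ 2 * b + 5 / 1296 * a ^ 4 + 1 / 72 * b ^ 2"
    unfolding s(4) s2 s3 s4 v by (simp add: w)
  have s6: "s 6 = 7 / 864 * a * b ^ 2 + 1 / 2160 * a * f - 1 / 432 * a ^ 2 * d - 7 / 324 * a ^ 3 * b + 35 / 2592 * a ^ 5 + 1 / 720 * b * d"
    unfolding s(5) s2 s3 s4 s5 v by (simp add: w)
  have c3: "c 3 = 1 / 6 * a" unfolding c(1) v by simp
  have c4: "c 4 = - 5 / 72 * a ^ 2 + 1 / 12 * b" unfolding c(2) c3 v by (simp add: w)
  have c5: "c 5 = 1 / 36 * a * b - 5 / 108 * a ^ 3 + 1 / 120 * d" unfolding c(3) c3 c4 v by (simp add: w)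
  have c6: "c 6 = - 1 / 54 * a ^ 2 * b + 5 / 2592 * a ^ 4 + 1 / 96 * b ^ 2 + 1 / 720 * f"
    unfolding c(4) c3 c4 c5 v by (simp add: w)
  have c7: "c 7 = 5 / 864 * a * b ^ 2 - 1 / 432 * a ^ 2 * d - 5 / 324 * a ^ 3 * b + 25 / 2592 * a ^ 5 + 1 / 720 * b * d + 1 / 5040 * g"
    unfolding c(5) c3 c4 c5 c6 v by (simp add: w)
  have P3: "P 3 = 0" using e(1) c3 s2 by simp
  have P4: "P 4 = 0" using e(2) unfolding P3 c4 s2 s3 by (simp add: w)
  have "P 5 = c 5 - (s 4 + s 2 * s 3)" using e(3) P3 P4 by simp
  hence P5: "P 5 = - 1 / 24 * a * b + 1 / 27 * a ^ 3 + 1 / 120 * d"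
    unfolding c5 s2 s3 s4 by (simp add: w)
  have "P 6 = c 6 - (2 * s 5 + 2 * s 2 * s 4 + (s 3)\<^sup>2) / 2 - 5 * P 5 * s 2" using e(4)[OF P3 P4] by simp
  hence P6: "P 6 = - 7 / 720 * a * d + 17 / 432 * a ^ 2 * b - 2 / 81 * a ^ 4 - 1 / 144 * b ^ 2 + 1 / 720 * f"
    unfolding c6 s2 s3 s4 s5 P5 by (simp add: w)
  have "P 7 = c 7 - (s 6 + s 2 * s 5 + s 3 * s 4) - P 5 * (5 * s 3 + 10 * (s 2)\<^sup>2) - 6 * P 6 * s 2"
    using e(5)[OF P3 P4] by simp
  hence P7: "P 7 = 13 / 864 * a * b ^ 2 - 1 / 540 * a * f + 1 / 96 * a ^ 2 * d - 103 / 2592 * a ^ 3 * b + 19 / 972 * a ^ 5 - 1 / 288 * b * d + 1 / 5040 * g"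
    unfolding c7 s2 s3 s4 s5 s6 P5 P6 by (simp add: w)
  have D5: "P 5 = (9 * d - 45 * a * b + 40 * a ^ 3) / 1080"
    unfolding P5 by (simp add: field_simps)
  \<comment> \<open>With M = 9 \<psi>^(5), this combination is 18 M (\<psi>^(7) - (7/6)
    (\<psi>^(6))^2 / \<psi>^(5)), the seventh derivative after removal of the sixth, cleared of
    denominators. Its right side is the bracket of Y at F_2 = 1.\<close>
  have D67: "18 * (9 * d - 45 * a * b + 40 * a ^ 3) * (5040 * P 7) - 189 * (720 * P 6)\<^sup>2 =
      11200 * a ^ 8 - 12600 * a ^ 3 * d * b + 13230 * a * d * b ^ 2 + 1134 * a * d * f
      - 3150 * a ^ 2 * b * f - 810 * g * a * b - 33600 * a ^ 6 * b - 7875 * a ^ 2 * b ^ 3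
      - 756 * a ^ 2 * d ^ 2 + 6720 * a ^ 5 * d + 31500 * a ^ 4 * b ^ 2 - 4725 * b ^ 4
      - 189 * f ^ 2 + 1890 * b ^ 2 * f - 2835 * b * d ^ 2 + 162 * g * d + 720 * g * a ^ 3"
    unfolding P6 P7 by (simp add: w)
  show ?thesis
  proof (rule that)
    show "flat \<psi>" using o P3 P4 by (simp add: flat_def jet_deriv P_def)
    show "curve_map (frame_change 0 ?\<gamma> ?\<delta>) \<phi> 0 1 \<psi> 0 1" by (rule \<psi>(3))
    show "(deriv ^^ 5) \<psi> 0 = (9 * p 5 - 45 * p 3 * p 4 + 40 * p 3 ^ 3) / 9"
      using D5 by (simp add: jet_deriv P_def a_def b_def d_def fact_numeral)
  next
    have "(deriv ^^ 6) \<psi> 0 = 720 * P 6" "(deriv ^^ 7) \<psi> 0 = 5040 * P 7"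
      by (simp_all add: jet_deriv P_def fact_numeral)
    thus "18 * (9 * p 5 - 45 * p 3 * p 4 + 40 * p 3 ^ 3) * (deriv ^^ 7) \<psi> 0 - 189 * ((deriv ^^ 6) \<psi> 0)\<^sup>2 =
      11200 * p 3 ^ 8 - 12600 * p 3 ^ 3 * p 5 * p 4 + 13230 * p 3 * p 5 * p 4 ^ 2 + 1134 * p 3 * p 5 * p 6
      - 3150 * p 3 ^ 2 * p 4 * p 6 - 810 * p 7 * p 3 * p 4 - 33600 * p 3 ^ 6 * p 4 - 7875 * p 3 ^ 2 * p 4 ^ 3
      - 756 * p 3 ^ 2 * p 5 ^ 2 + 6720 * p 3 ^ 5 * p 5 + 31500 * p 3 ^ 4 * p 4 ^ 2 - 4725 * p 4 ^ 4
      - 189 * p 6 ^ 2 + 1890 * p 4 ^ 2 * p 6 - 2835 * p 4 * p 5 ^ 2 + 162 * p 7 * p 5 + 720 * p 7 * p 3 ^ 3"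
      using D67 unfolding a_def b_def d_def f_def g_def by simp
  qed
qed

text \<open>The one-parameter group of projective maps fixing the conic \<open>u = s\<^sup>2/2\<close> and the origin.\<close>

lemma conic_stabiliser_curve:
  assumes \<phi>: "flat \<phi>" and p5: "(deriv ^^ 5) \<phi> 0 \<noteq> 0"
  defines "p \<equiv> (\<lambda>n. (deriv ^^ n) \<phi> 0)"
  defines "k \<equiv> p 6 / (6 * p 5)"
  obtains \<psi> where "flat \<psi>" "curve_map (frame_change (2 * k) (- 2 * k) (- 2 * k\<^sup>2)) \<phi> 0 1 \<psi> 0 1"
    "(deriv ^^ 5) \<psi> 0 = p 5" "(deriv ^^ 6) \<psi> 0 = 0" "(deriv ^^ 7) \<psi> 0 = p 7 - 7 / 6 * (p 6)\<^sup>2 / p 5"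
proof -
  \<comment> \<open>On the conic these parameters induce s \<mapsto> s/(1 - k s): the numerator is s
    - k s^2 and the denominator (1 - k s)^2, so u = s^2/2 is preserved.\<close>
  let ?\<beta> = "2 * k" and ?\<gamma> = "- 2 * k" and ?\<delta> = "- 2 * k\<^sup>2"
  have q: "fps_nth (jet \<phi> 0) 3 = 0" "fps_nth (jet \<phi> 0) 4 = 0" "fps_nth (jet \<phi> 0) 5 = p 5 / 120"
    "fps_nth (jet \<phi> 0) 6 = p 6 / 720" "fps_nth (jet \<phi> 0) 7 = p 7 / 5040"
    using flatD(6,7)[OF \<phi>] by (simp_all add: jet_nth p_def fact_numeral)
  obtain \<psi> where \<psi>: "analytic1 \<psi> 0" "\<psi> 0 = 0" "curve_map (frame_change ?\<beta> ?\<gamma> ?\<delta>) \<phi> 0 1 \<psi> 0 1"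
    by (rule frame_change_exists[OF flatD(1)[OF \<phi>]])
  define P where "P = fps_nth (jet \<psi> 0)"
  obtain s c :: "nat \<Rightarrow> real" where o: "osculating \<psi>" and
    s: "s 1 = 1" "s 2 = ?\<gamma> / 2 + ?\<beta>" "s 3 = ?\<gamma> * 0 + ?\<beta> * s 2 + ?\<delta> / 2"
    "s 4 = ?\<gamma> * 0 + ?\<beta> * s 3 + ?\<delta> * (s 2 / 2 + 0)"
    "s 5 = ?\<gamma> * (p 5 / 120) + ?\<beta> * s 4 + ?\<delta> * (s 3 / 2 + 0 * s 2 + 0)"
    "s 6 = ?\<gamma> * (p 6 / 720) + ?\<beta> * s 5 + ?\<delta> * (s 4 / 2 + 0 * s 3 + 0 * s 2 + p 5 / 120)"
    and c: "c 3 = 0 + ?\<beta> / 2" "c 4 = 0 + ?\<beta> * c 3 + ?\<delta> / 4"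
    "c 5 = p 5 / 120 + ?\<beta> * c 4 + ?\<delta> * (c 3 / 2 + 0 / 2)"
    "c 6 = p 6 / 720 + ?\<beta> * c 5 + ?\<delta> * (c 4 / 2 + 0 * c 3 + 0 / 2)"
    "c 7 = p 7 / 5040 + ?\<beta> * c 6 + ?\<delta> * (c 5 / 2 + 0 * c 4 + 0 * c 3 + p 5 / 120 / 2)"
    and e: "c 3 = s 2 + P 3" "c 4 = ((s 2)\<^sup>2 + 2 * s 3) / 2 + 3 * P 3 * s 2 + P 4"
    "c 5 = (s 4 + s 2 * s 3) + P 3 * (3 * s 3 + 3 * (s 2)\<^sup>2) + 4 * P 4 * s 2 + P 5"
    "P 3 = 0 \<Longrightarrow> P 4 = 0 \<Longrightarrow> c 6 = (2 * s 5 + 2 * s 2 * s 4 + (s 3)\<^sup>2) / 2 + 5 * P 5 * s 2 + P 6"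
    "P 3 = 0 \<Longrightarrow> P 4 = 0 \<Longrightarrow> c 7 = (s 6 + s 2 * s 5 + s 3 * s 4)
       + P 5 * (5 * s 3 + 10 * (s 2)\<^sup>2) + 6 * P 6 * s 2 + P 7"
    using frame_change_coeffs[OF flatD(1)[OF \<phi>] \<psi>, folded P_def, unfolded q] by blast
  note w = power_expand field_simps
  have s2: "s 2 = k" unfolding s(2) by simp
  have s3: "s 3 = k ^ 2" unfolding s(3) s2 by (simp add: w)
  have s4: "s 4 = k ^ 3" unfolding s(4) s2 s3 by (simp add: w)
  have s5: "s 5 = - 2 * k * (p 5 / 120) + k ^ 4" unfolding s(5) s2 s3 s4 by (simp add: w)
  have s6: "s 6 = - 2 * k * (p 6 / 720) - 6 * k\<^sup>2 * (p 5 / 120) + k ^ 5"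
    unfolding s(6) s2 s3 s4 s5 by (simp add: w)
  note s' = s2 s3 s4 s5 s6
  have c3: "c 3 = k" unfolding c(1) by simp
  have c4: "c 4 = 3 / 2 * k\<^sup>2" unfolding c(2) c3 by (simp add: w)
  have c5: "c 5 = p 5 / 120 + 2 * k ^ 3" unfolding c(3) c3 c4 by (simp add: w)
  have c6: "c 6 = p 6 / 720 + 2 * k * (p 5 / 120) + 5 / 2 * k ^ 4" unfolding c(4) c3 c4 c5 by (simp add: w)
  have c7: "c 7 = p 7 / 5040 + 2 * k * (p 6 / 720) + 2 * k\<^sup>2 * (p 5 / 120) + 3 * k ^ 5"
    unfolding c(5) c3 c4 c5 c6 by (simp add: w)
  have P3: "P 3 = 0" using e(1) s2 c3 by simp
  have P4: "P 4 = 0" using e(2) P3 unfolding s2 s3 c4 by (simp add: w)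
  have P5: "P 5 = p 5 / 120" using e(3) P3 P4 unfolding s2 s3 s4 c5 by (simp add: w)
  \<comment> \<open>This equation explains the choice of k: it is the value for which the sixth
    coefficient vanishes, which requires the fifth to be nonzero.\<close>
  have P6: "P 6 = p 6 / 720 - k * (p 5 / 120)"
    using e(4)[OF P3 P4] unfolding s' c6 P5 by (simp add: w)
  have k: "k * p 5 = p 6 / 6" using p5 by (simp add: k_def p_def)
  have P6': "P 6 = 0" using k P6 by simp
  have "P 7 = c 7 - (s 6 + s 2 * s 5 + s 3 * s 4) - P 5 * (5 * s 3 + 10 * (s 2)\<^sup>2)"
    using e(5)[OF P3 P4] P6' by simp
  also have "\<dots> = p 7 / 5040 + 4 * k * (p 6 / 720) - 5 * k\<^sup>2 * (p 5 / 120)"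
    unfolding s' c7 P5 by (simp add: w)
  finally have P7: "5040 * P 7 = p 7 + 28 * (k * p 6) - 210 * (k * (k * p 5))"
    by (simp add: power2_eq_square algebra_simps)
  have "k * p 6 = (p 6)\<^sup>2 / (6 * p 5)" by (simp add: k_def power2_eq_square)
  hence P7': "5040 * P 7 = p 7 - 7 / 6 * (p 6)\<^sup>2 / p 5"
    unfolding P7 k by (simp add: field_simps)
  show ?thesis
  proof (rule that)
    show "flat \<psi>" using o P3 P4 by (simp add: flat_def jet_deriv P_def)
    show "curve_map (frame_change ?\<beta> ?\<gamma> ?\<delta>) \<phi> 0 1 \<psi> 0 1" by (rule \<psi>(3))
    show "(deriv ^^ 5) \<psi> 0 = p 5" using P5 by (simp add: jet_deriv P_def fact_numeral)
    show "(deriv ^^ 6) \<psi> 0 = 0" using P6' by (simp add: jet_deriv P_def)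
    show "(deriv ^^ 7) \<psi> 0 = p 7 - 7 / 6 * (p 6)\<^sup>2 / p 5" using P7' by (simp add: jet_deriv P_def fact_numeral)
  qed
qed

text \<open>Frame changes with \<beta> = 0 compose by adding (\<gamma>, \<delta>), so the negated
  parameters of \<open>flatten_curve\<close> undo it. Prescribed third and fourth derivatives can
  thus be produced from one fixed flat curve.\<close>

lemma unflatten_curve:
  assumes \<phi>: "flat \<phi>"
  obtains \<psi> where "osculating \<psi>"
    "curve_map (frame_change 0 (- a / 3) (5 * a\<^sup>2 / 18 - b / 6)) \<phi> 0 1 \<psi> 0 1"
    "(deriv ^^ 3) \<psi> 0 = a" "(deriv ^^ 4) \<psi> 0 = b"
    "(deriv ^^ 5) \<psi> 0 = (deriv ^^ 5) \<phi> 0 + 5 * a * b - 40 / 9 * a ^ 3"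
proof -
  let ?\<gamma> = "- a / 3" and ?\<delta> = "5 * a\<^sup>2 / 18 - b / 6"
  define p5 where "p5 = (deriv ^^ 5) \<phi> 0"
  have q: "fps_nth (jet \<phi> 0) 3 = 0" "fps_nth (jet \<phi> 0) 4 = 0" "fps_nth (jet \<phi> 0) 5 = p5 / 120"
    using flatD(6,7)[OF \<phi>] by (simp_all add: jet_nth p5_def fact_numeral)
  obtain \<psi> where \<psi>: "analytic1 \<psi> 0" "\<psi> 0 = 0" "curve_map (frame_change 0 ?\<gamma> ?\<delta>) \<phi> 0 1 \<psi> 0 1"
    by (rule frame_change_exists[OF flatD(1)[OF \<phi>]])
  define P where "P = fps_nth (jet \<psi> 0)"
  obtain s c :: "nat \<Rightarrow> real" where o: "osculating \<psi>" and
    s: "s 2 = ?\<gamma> / 2 + 0" "s 3 = ?\<gamma> * 0 + 0 * s 2 + ?\<delta> / 2"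
    "s 4 = ?\<gamma> * 0 + 0 * s 3 + ?\<delta> * (s 2 / 2 + 0)"
    and c: "c 3 = 0 + 0 / 2" "c 4 = 0 + 0 * c 3 + ?\<delta> / 4"
    "c 5 = p5 / 120 + 0 * c 4 + ?\<delta> * (c 3 / 2 + 0 / 2)"
    and e: "c 3 = s 2 + P 3" "c 4 = ((s 2)\<^sup>2 + 2 * s 3) / 2 + 3 * P 3 * s 2 + P 4"
    "c 5 = (s 4 + s 2 * s 3) + P 3 * (3 * s 3 + 3 * (s 2)\<^sup>2) + 4 * P 4 * s 2 + P 5"
    using frame_change_coeffs[OF flatD(1)[OF \<phi>] \<psi>, folded P_def, unfolded q] by blast
  have P3: "P 3 = a / 6" using e(1) c(1) s(1) by simp
  have P4: "P 4 = b / 24" using e(2) unfolding P3 c(1,2) s(1,2) by (simp add: field_simps power2_eq_square)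
  have P5: "P 5 = p5 / 120 + a * b / 24 - a ^ 3 / 27"
    using e(3) unfolding P3 P4 c(3) c(1) s(3) s(1,2) by (simp add: field_simps power2_eq_square power3_eq_cube)
  show ?thesis
  proof (rule that[OF o \<psi>(3)])
    show "(deriv ^^ 3) \<psi> 0 = a" using P3 by (simp add: jet_deriv P_def fact_numeral)
    show "(deriv ^^ 4) \<psi> 0 = b" using P4 by (simp add: jet_deriv P_def fact_numeral)
    show "(deriv ^^ 5) \<psi> 0 = (deriv ^^ 5) \<phi> 0 + 5 * a * b - 40 / 9 * a ^ 3"
      using P5 by (simp add: jet_deriv[of 5 \<psi>] P_def p5_def[symmetric] fact_numeral)
  qed
qed

text \<open>Degrees up to four force A to preserve the conic, leaving the one-parameter family
  \<gamma> = -\<beta>, \<delta> = -\<beta>^2/2. Degree five does not see \<beta>, whence the first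
  claim. Degree six changes by a nonzero multiple of \<beta> q 5, so if both sixth derivatives
  vanish and the fifth does not, then A is the identity.\<close>

lemma flat_curve_map_unique:
  fixes A :: "real ^ 3 ^ 3"
  assumes \<phi>: "flat \<phi>" and \<psi>: "flat \<psi>" and c: "curve_map A \<phi> 0 1 \<psi> 0 1" and A: "det A = 1"
  shows "(deriv ^^ 5) \<psi> 0 = (deriv ^^ 5) \<phi> 0"
    and "(deriv ^^ 5) \<phi> 0 \<noteq> 0 \<Longrightarrow> (deriv ^^ 6) \<phi> 0 = 0 \<Longrightarrow> (deriv ^^ 6) \<psi> 0 = 0 \<Longrightarrow> \<forall>\<^sub>F s in nhds 0. \<psi> s = \<phi> s"
proof -
  define \<alpha> \<beta> \<gamma> \<delta> \<epsilon> where "\<alpha> = A $ 1 $ 1" and "\<beta> = A $ 2 $ 1" and "\<gamma> = A $ 1 $ 3" and "\<delta> = A $ 2 $ 3" and "\<epsilon> = A $ 3 $ 3"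
  obtain S where A2: "A $ 2 $ 2 = 1" "A $ 1 $ 2 = 0" "A $ 3 $ 2 = 0" and S: "fps_nth S 0 = 0"
    "S * (1 - fps_const \<beta> * fps_X - fps_const \<delta> * jet \<phi> 0) = fps_const \<alpha> * fps_X + fps_const \<gamma> * jet \<phi> 0"
    "(jet \<psi> 0 oo S) * (1 - fps_const \<beta> * fps_X - fps_const \<delta> * jet \<phi> 0) =
       fps_const (A $ 3 $ 1) * fps_X + fps_const \<epsilon> * jet \<phi> 0"
    unfolding \<alpha>_def \<beta>_def \<gamma>_def \<delta>_def \<epsilon>_def
    by (rule curve_map_jets[OF c flatD(2)[OF \<phi>] flatD(2)[OF \<psi>] flatD(3)[OF \<phi>] flatD(3)[OF \<psi>]]) blast
  note jf = osculating_jet[OF flatD(1)[OF \<phi>]] and jg = osculating_jet[OF flatD(1)[OF \<psi>]]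
  define q P s t where "q = fps_nth (jet \<phi> 0)" and "P = fps_nth (jet \<psi> 0)" and "s = fps_nth S" and "t = fps_nth (jet \<psi> 0 oo S)"
  have q: "q 2 = 1 / 2" "q 3 = 0" "q 4 = 0" and P: "P 2 = 1 / 2" "P 3 = 0" "P 4 = 0"
    using jf jg flatD(6,7)[OF \<phi>] flatD(6,7)[OF \<psi>] by (auto simp: q_def P_def)
  note k = fps_compose_nth_small[OF S(1) jg(1,2), folded P_def s_def t_def]
  note sr = fps_denominator_nth[OF S(2) jf(1,2), folded q_def s_def]
  note tr = fps_denominator_nth[OF S(3) jf(1,2), folded q_def t_def]
  have A31: "A $ 3 $ 1 = 0" using tr(2) k(2) by simp
  have "det A = \<alpha> * \<epsilon>" using A2 A31 by (simp add: det_3 \<alpha>_def \<epsilon>_def)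
  hence ae: "\<alpha> * \<epsilon> = 1" using A by simp
  have e2: "\<epsilon> = \<alpha>\<^sup>2" using k(3) tr(2,3) sr(2) A31 unfolding q P by simp
  \<comment> \<open>Determinant 1 excludes scalings of the conic: preserving it gives \<epsilon> =
    \<alpha>^2, and 1 has a single real cube root.\<close>
  have "\<alpha> ^ 3 = 1" using ae unfolding e2 by (simp add: power3_eq_cube power2_eq_square)
  hence \<alpha>: "\<alpha> = 1" using odd_real_root_power_cancel[of 3 \<alpha>] by simp
  hence \<epsilon>: "\<epsilon> = 1" using e2 by simp
  have t2: "t 2 = 1 / 2" "t 1 = 0" using k(2,3) sr(2) \<alpha> P by simp_all
  have s1: "s 1 = 1" using sr(2) \<alpha> by simp
  have s2: "s 2 = \<gamma> / 2 + \<beta>" using sr(3) s1 q by simp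
  have t3: "t 3 = \<beta> / 2" "t 3 = s 2" using tr(4) k(4) t2 s1 unfolding q P by simp_all
  hence s2': "s 2 = \<beta> / 2" and \<gamma>: "\<gamma> = - \<beta>" using s2 by simp_all
  have s3: "s 3 = \<beta>\<^sup>2 / 2 + \<delta> / 2" using sr(4) s1 s2' q by (simp add: power2_eq_square)
  have t4: "t 4 = \<beta>\<^sup>2 / 2 + \<delta> / 4" using tr(5) t2 t3(1) q by (simp add: power2_eq_square)
  have "t 4 = ((s 2)\<^sup>2 + 2 * s 3) / 2" using k(5) s1 P by simp
  hence \<delta>: "\<delta> = - \<beta>\<^sup>2 / 2" unfolding t4 s2' s3 by (simp add: field_simps power2_eq_square)
  have s3': "s 3 = \<beta>\<^sup>2 / 4" using s3 \<delta> by simp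
  have t4': "t 4 = 3 / 8 * \<beta>\<^sup>2" using t4 \<delta> by simp
  have s4: "s 4 = \<beta> ^ 3 / 8" using sr(5) s1 s2' s3' \<delta> q by (simp add: power2_eq_square power3_eq_cube)
  have t5: "t 5 = q 5 + \<beta> ^ 3 / 4" using tr(6) t2 t3(1) t4' \<delta> \<epsilon> q by (simp add: power2_eq_square power3_eq_cube)
  have P5: "P 5 = q 5" using k(6) s1 P t5 s2' s3' s4 by (simp add: power2_eq_square power3_eq_cube)
  thus "(deriv ^^ 5) \<psi> 0 = (deriv ^^ 5) \<phi> 0" by (simp add: jet_deriv P_def q_def)
  assume 5: "(deriv ^^ 5) \<phi> 0 \<noteq> 0" and 6: "(deriv ^^ 6) \<phi> 0 = 0" "(deriv ^^ 6) \<psi> 0 = 0"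
  have q5: "q 5 \<noteq> 0" using 5 by (simp add: q_def jet_nth)
  have q6: "q 6 = 0" "P 6 = 0" using 6 by (simp_all add: q_def P_def jet_nth)
  have s5: "s 5 = - \<beta> * q 5 + \<beta> ^ 4 / 16"
    using sr(6) s1 s2' s3' s4 \<gamma> \<delta> q by (simp add: power_expand field_simps)
  have t6: "t 6 = \<beta> * q 5 + 5 / 32 * \<beta> ^ 4"
    using tr(7) t2 t3(1) t4' t5 \<delta> \<epsilon> q q6 by (simp add: power_expand field_simps)
  have "t 6 = s 5 + s 2 * s 4 + (s 3)\<^sup>2 / 2 + 5 * P 5 * s 2 + P 6"
    using k(7) P s1 by (simp add: field_simps)
  \<comment> \<open>The left side contributes \<beta> q 5, the right side (-1 + 5/2) \<beta> q 5,
    and all pure powers of \<beta> cancel.\<close>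
  hence "\<beta> * q 5 = 0"
    unfolding t6 s5 s2' s3' s4 P5 q6 by (simp add: power_expand field_simps)
  hence \<beta>: "\<beta> = 0" using q5 by simp
  have "A $ i $ j = (mat 1 :: real ^ 3 ^ 3) $ i $ j" for i j
    using exhaust_3[of i] exhaust_3[of j] \<beta> \<gamma> \<delta> \<alpha> \<epsilon> A2 A31
    by (auto simp: mat_def \<alpha>_def \<beta>_def \<gamma>_def \<delta>_def \<epsilon>_def)
  hence "A = mat 1" by (simp add: vec_eq_iff)
  thus "\<forall>\<^sub>F s in nhds 0. \<psi> s = \<phi> s"
    using c by (simp add: curve_map_def row_def mat_def)
qed

section \<open>The invariants of a cone\<close>

text \<open>The curve in the basis formed by the columns of \<open>frame\<close>: the tangent line
  is subtracted, the parameter is scaled by \<alpha>/r and the height by \<alpha> r^2. The second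
  derivative at 0 becomes \<alpha>^3 \<phi>''(s0), so normalising it to 1 takes a cube root.\<close>

definition rescaled :: "(real \<Rightarrow> real) \<Rightarrow> real \<Rightarrow> real \<Rightarrow> real \<Rightarrow> real \<Rightarrow> real" where
  "rescaled \<phi> s0 r \<alpha> = (\<lambda>\<tau>. \<alpha> * r\<^sup>2 * (\<phi> (s0 + \<alpha> / r * \<tau>) - \<phi> s0 - deriv \<phi> s0 * (\<alpha> / r * \<tau>)))"

text \<open>Columns: the tangent vector, the ray through the base point and the normal direction of
  the cone, scaled so that the determinant is \<open>1\<close>.\<close>

definition frame :: "real \<Rightarrow> real \<Rightarrow> real \<Rightarrow> real \<Rightarrow> real \<Rightarrow> real ^ 3 ^ 3" where
  "frame s0 r f0 f1 \<alpha> = vector [vector [\<alpha>, - (r * s0), 0], vector [0, r, 0], vector [\<alpha> * f1, - (r * f0), 1 / (\<alpha> * r)]]"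

lemma det_frame: "\<alpha> \<noteq> 0 \<Longrightarrow> r \<noteq> 0 \<Longrightarrow> det (frame s0 r f0 f1 \<alpha>) = 1"
  by (simp add: det_3 frame_def)

lemma rescaled_deriv:
  assumes a: "analytic1 \<phi> s0"
  shows "analytic1 (rescaled \<phi> s0 r \<alpha>) 0" "rescaled \<phi> s0 r \<alpha> 0 = 0" "deriv (rescaled \<phi> s0 r \<alpha>) 0 = 0"
    "n \<ge> 2 \<Longrightarrow> (deriv ^^ n) (rescaled \<phi> s0 r \<alpha>) 0 = \<alpha> * r\<^sup>2 * (\<alpha> / r) ^ n * (deriv ^^ n) \<phi> s0"
proof -
  define c where "c = \<alpha> / r"
  have 1: "analytic1 (\<lambda>\<tau>. c * \<tau>) 0" "jet (\<lambda>\<tau>. c * \<tau>) 0 = fps_const c * fps_X"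
    using analytic1_mult[OF analytic1_const(1) analytic1_ident(1)] by auto
  have 2: "analytic1 (\<lambda>\<tau>. s0 + c * \<tau>) 0" "jet (\<lambda>\<tau>. s0 + c * \<tau>) 0 = fps_const s0 + fps_const c * fps_X"
    using analytic1_add[OF analytic1_const(1) 1(1)] 1(2) by auto
  have 3: "analytic1 (\<lambda>\<tau>. \<phi> (s0 + c * \<tau>)) 0" "jet (\<lambda>\<tau>. \<phi> (s0 + c * \<tau>)) 0 = jet \<phi> s0 oo (fps_const c * fps_X)"
    using analytic1_compose[OF 2(1), of \<phi>] a 2(2) by auto
  have 4: "analytic1 (\<lambda>\<tau>. deriv \<phi> s0 * (c * \<tau>)) 0" "jet (\<lambda>\<tau>. deriv \<phi> s0 * (c * \<tau>)) 0 = fps_const (deriv \<phi> s0) * (fps_const c * fps_X)"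
    using analytic1_mult[OF analytic1_const(1) 1(1)] 1(2) by auto
  have 5: "analytic1 (\<lambda>\<tau>. \<phi> (s0 + c * \<tau>) - \<phi> s0) 0" "jet (\<lambda>\<tau>. \<phi> (s0 + c * \<tau>) - \<phi> s0) 0 = (jet \<phi> s0 oo (fps_const c * fps_X)) - fps_const (\<phi> s0)"
    using analytic1_diff[OF 3(1) analytic1_const(1)] 3(2) by auto
  have 6: "analytic1 (\<lambda>\<tau>. \<phi> (s0 + c * \<tau>) - \<phi> s0 - deriv \<phi> s0 * (c * \<tau>)) 0"
    "jet (\<lambda>\<tau>. \<phi> (s0 + c * \<tau>) - \<phi> s0 - deriv \<phi> s0 * (c * \<tau>)) 0 =
      (jet \<phi> s0 oo (fps_const c * fps_X)) - fps_const (\<phi> s0) - fps_const (deriv \<phi> s0) * (fps_const c * fps_X)"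
    using analytic1_diff[OF 5(1) 4(1)] 5(2) 4(2) by auto
  have 7: "analytic1 (rescaled \<phi> s0 r \<alpha>) 0"
    "jet (rescaled \<phi> s0 r \<alpha>) 0 = fps_const (\<alpha> * r\<^sup>2) * ((jet \<phi> s0 oo (fps_const c * fps_X)) - fps_const (\<phi> s0) - fps_const (deriv \<phi> s0) * (fps_const c * fps_X))"
    unfolding rescaled_def c_def[symmetric] using analytic1_mult[OF analytic1_const(1) 6(1)] 6(2) by auto
  show "analytic1 (rescaled \<phi> s0 r \<alpha>) 0" by fact
  show "rescaled \<phi> s0 r \<alpha> 0 = 0" by (simp add: rescaled_def)
  have n: "fps_nth (jet (rescaled \<phi> s0 r \<alpha>) 0) n = \<alpha> * r\<^sup>2 * (c ^ n * fps_nth (jet \<phi> s0) n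
     - (if n = 0 then \<phi> s0 else 0) - (if n = 1 then deriv \<phi> s0 * c else 0))" for n
    unfolding 7(2) fps_compose_linear by (cases n) (auto simp: fps_X_nth)
  show "deriv (rescaled \<phi> s0 r \<alpha>) 0 = 0"
    using n[of 1] by (simp add: jet_nth)
  show "(deriv ^^ n) (rescaled \<phi> s0 r \<alpha>) 0 = \<alpha> * r\<^sup>2 * (\<alpha> / r) ^ n * (deriv ^^ n) \<phi> s0" if "n \<ge> 2"
    using n[of n] that unfolding jet_deriv c_def[symmetric] by simp
qed

lemma curve_map_frame:
  assumes "\<alpha> \<noteq> 0" "r \<noteq> 0"
  shows "curve_map (frame s0 r (\<phi> s0) (deriv \<phi> s0) \<alpha>) (rescaled \<phi> s0 r \<alpha>) 0 1 \<phi> s0 r"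
proof -
  let ?M = "frame s0 r (\<phi> s0) (deriv \<phi> s0) \<alpha>" and ?f = "rescaled \<phi> s0 r \<alpha>"
  have row: "row ?M 1 ?f \<tau> = \<alpha> * \<tau> + r * s0" "row ?M 2 ?f \<tau> = - r"
    "row ?M 3 ?f \<tau> = \<alpha> * deriv \<phi> s0 * \<tau> + r * \<phi> s0 + ?f \<tau> / (\<alpha> * r)" for \<tau>
    by (simp_all add: row_def frame_def)
  have "\<phi> (- row ?M 1 ?f \<tau> / row ?M 2 ?f \<tau>) = - row ?M 3 ?f \<tau> / row ?M 2 ?f \<tau>" for \<tau>
  proof -
    have "- row ?M 1 ?f \<tau> / row ?M 2 ?f \<tau> = s0 + \<alpha> / r * \<tau>" using assms by (simp add: row field_simps)
    moreover have "- row ?M 3 ?f \<tau> / row ?M 2 ?f \<tau> = \<phi> (s0 + \<alpha> / r * \<tau>)"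
    proof -
      define x where "x = \<phi> (s0 + \<alpha> / r * \<tau>)"
      have f: "?f \<tau> = \<alpha> * r\<^sup>2 * (x - \<phi> s0 - deriv \<phi> s0 * (\<alpha> / r * \<tau>))" by (simp add: rescaled_def x_def)
      show ?thesis unfolding row f x_def[symmetric] using assms by (simp add: field_simps power2_eq_square)
    qed
    ultimately show ?thesis by simp
  qed
  thus ?thesis using assms by (simp add: curve_map_def row)
qed

lemma is_cone_jets:
  assumes "is_cone F z x0 y0 u0 \<phi>"
  defines "s \<equiv> slope x0 y0 z" and "r \<equiv> y0 - snd z"
  shows "r \<noteq> 0" "F z = u0 + r * \<phi> s" "pd 1 0 F z = deriv \<phi> s" "pd 2 0 F z = (deriv ^^ 2) \<phi> s / r"
    "pd 3 0 F z = (deriv ^^ 3) \<phi> s / r ^ 2" "pd 4 0 F z = (deriv ^^ 4) \<phi> s / r ^ 3"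
    "pd 5 0 F z = (deriv ^^ 5) \<phi> s / r ^ 4" "pd 6 0 F z = (deriv ^^ 6) \<phi> s / r ^ 5"
    "pd 7 0 F z = (deriv ^^ 7) \<phi> s / r ^ 6"
    "pd 0 1 F z = s * deriv \<phi> s - \<phi> s" "pd 1 1 F z = s * (deriv ^^ 2) \<phi> s / r"
    "pd 2 1 F z = (s * (deriv ^^ 3) \<phi> s + (deriv ^^ 2) \<phi> s) / r ^ 2"
  using cone_jets(1)[OF is_coneD(1)[OF assms(1)]] cone_jets(2-13)[OF is_coneD(1)[OF assms(1)], of u0]
    is_coneD(3)[OF assms(1)]
  unfolding pd_cong[OF is_coneD(2)[OF assms(1)]] s_def r_def by auto

text \<open>With \<open>\<lambda> = 1/\<alpha>\<close> the derivatives of \<open>F\<close> are \<open>F\<^sub>n = \<lambda>\<^sup>n\<^sup>+\<^sup>1 p\<^sub>n / r\<close> with \<open>p\<^sub>n\<close> those of the rescaled curve.\<close>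

lemma inv_X_rescaled:
  assumes F: "is_cone F z x0 y0 u0 \<phi>" and \<alpha>: "\<alpha> \<noteq> 0" "\<alpha> ^ 3 * (deriv ^^ 2) \<phi> (slope x0 y0 z) = 1"
  defines "p \<equiv> (\<lambda>n. (deriv ^^ n) (rescaled \<phi> (slope x0 y0 z) (y0 - snd z) \<alpha>) 0)"
  defines "M \<equiv> 9 * p 5 - 45 * p 3 * p 4 + 40 * p 3 ^ 3"
  shows "osculating (rescaled \<phi> (slope x0 y0 z) (y0 - snd z) \<alpha>)" "inv_X F z = M / 9"
    "inv_Y F z = 1 / (18 * M) *
      (11200 * p 3 ^ 8 - 12600 * p 3 ^ 3 * p 5 * p 4 + 13230 * p 3 * p 5 * p 4 ^ 2 + 1134 * p 3 * p 5 * p 6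
      - 3150 * p 3 ^ 2 * p 4 * p 6 - 810 * p 7 * p 3 * p 4 - 33600 * p 3 ^ 6 * p 4 - 7875 * p 3 ^ 2 * p 4 ^ 3
      - 756 * p 3 ^ 2 * p 5 ^ 2 + 6720 * p 3 ^ 5 * p 5 + 31500 * p 3 ^ 4 * p 4 ^ 2 - 4725 * p 4 ^ 4
      - 189 * p 6 ^ 2 + 1890 * p 4 ^ 2 * p 6 - 2835 * p 4 * p 5 ^ 2 + 162 * p 7 * p 5 + 720 * p 7 * p 3 ^ 3)"
proof -
  let ?s = "slope x0 y0 z"
  define r where "r = y0 - snd z"
  define l where "l = 1 / \<alpha>"
  note J = is_cone_jets[OF F, folded r_def] and a = is_coneD(5)[OF F]
  have l: "l \<noteq> 0" "\<alpha> = 1 / l" using \<alpha> by (auto simp: l_def)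
  note R = rescaled_deriv[OF a, where r=r and \<alpha>=\<alpha>]
  have phi: "(deriv ^^ n) \<phi> ?s = l ^ (n + 1) * r ^ n / r\<^sup>2 * p n" if "n \<ge> 2" for n
  proof -
    have "p n = \<alpha> * r\<^sup>2 * (\<alpha> / r) ^ n * (deriv ^^ n) \<phi> ?s"
      using R(4)[OF that] unfolding p_def r_def[symmetric] .
    thus ?thesis unfolding l(2) using J(1) l(1) by (simp add: field_simps)
  qed
  have p2: "p 2 = 1"
    using R(4)[of 2] J(1) \<alpha> unfolding p_def r_def[symmetric]
    by (simp add: field_simps power2_eq_square power3_eq_cube)
  show "osculating (rescaled \<phi> ?s (y0 - snd z) \<alpha>)"
    using R(1-3) p2 by (simp add: osculating_def p_def r_def)
  \<comment> \<open>Thus m is F_xx, and F_n = m l^(n - 2) p_n for n \<ge> 2.\<close>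
  define m where "m = l ^ 3 / r"
  have m: "m \<noteq> 0" using l(1) J(1) by (simp add: m_def)
  have F2: "pd 2 0 F z = m" "pd 3 0 F z = m * l * p 3" "pd 4 0 F z = m * l ^ 2 * p 4"
    "pd 5 0 F z = m * l ^ 3 * p 5" "pd 6 0 F z = m * l ^ 4 * p 6" "pd 7 0 F z = m * l ^ 5 * p 7"
    unfolding J phi[of 2, simplified] phi[of 3, simplified] phi[of 4, simplified] phi[of 5, simplified]
      phi[of 6, simplified] phi[of 7, simplified] p2 m_def
    using J(1) by (simp_all add: field_simps eval_nat_numeral)
  \<comment> \<open>The factor F_xxy F_xx - F_xxx F_xy is the perfect cube (m/l)^3, so the
    fractional power in Y becomes (m/l)^5.\<close>
  have P: "pd 2 1 F z * pd 2 0 F z - pd 3 0 F z * pd 1 1 F z = (m / l) ^ 3"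
  proof -
    have "pd 2 1 F z * pd 2 0 F z - pd 3 0 F z * pd 1 1 F z = ((deriv ^^ 2) \<phi> ?s)\<^sup>2 / r ^ 3"
      unfolding J using J(1) by (simp add: field_simps eval_nat_numeral)
    also have "(deriv ^^ 2) \<phi> ?s = l ^ 3" using phi[of 2] J(1) p2 by simp
    also have "(l ^ 3)\<^sup>2 / r ^ 3 = (m / l) ^ 3"
      using l(1) J(1) by (simp add: m_def field_simps eval_nat_numeral)
    finally show ?thesis .
  qed
  have root: "root 3 (pd 2 1 F z * pd 2 0 F z - pd 3 0 F z * pd 1 1 F z) = m / l"
    unfolding P by (simp add: odd_real_root_power_cancel)
  have P': "pd 2 0 F z * pd 2 1 F z - pd 1 1 F z * pd 3 0 F z = (m / l) ^ 3"
    using P by (simp add: mult.commute)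
  have MX: "9 * m\<^sup>2 * (m * l ^ 3 * p 5) - 45 * m * (m * l * p 3) * (m * l ^ 2 * p 4) + 40 * (m * l * p 3) ^ 3
      = m ^ 3 * l ^ 3 * M"
    unfolding M_def by algebra
  have "(m / l) ^ 3 * (m ^ 3 * l ^ 3 * M) / m ^ 6 = M"
    using m l(1) by (simp add: field_simps eval_nat_numeral)
  thus "inv_X F z = M / 9"
    unfolding inv_X_def X_jet_def jet5_def prod.case P' unfolding F2 MX by simp
  \<comment> \<open>The bracket of Y is bihomogeneous: each monomial has degree 8 in the F_n, with
    F_2 counted, and weight 8 when F_n has weight n - 2.\<close>
  have hom: "11200 * (m * l * a) ^ 8
            - 12600 * (m * l * a) ^ 3 * (m * l ^ 3 * d) * m ^ 3 * (m * l ^ 2 * b)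
            + 13230 * (m * l * a) * (m * l ^ 3 * d) * m ^ 4 * (m * l ^ 2 * b) ^ 2
            + 1134 * (m * l * a) * (m * l ^ 3 * d) * m ^ 5 * (m * l ^ 4 * f)
            - 3150 * (m * l * a) ^ 2 * (m * l ^ 2 * b) * m ^ 4 * (m * l ^ 4 * f)
            - 810 * (m * l ^ 5 * g) * m ^ 5 * (m * l * a) * (m * l ^ 2 * b)
            - 33600 * (m * l * a) ^ 6 * (m * l ^ 2 * b) * m
            - 7875 * (m * l * a) ^ 2 * (m * l ^ 2 * b) ^ 3 * m ^ 3
            - 756 * (m * l * a) ^ 2 * (m * l ^ 3 * d) ^ 2 * m ^ 4
            + 6720 * (m * l * a) ^ 5 * (m * l ^ 3 * d) * m ^ 2
            + 31500 * (m * l * a) ^ 4 * (m * l ^ 2 * b) ^ 2 * m ^ 2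
            - 4725 * (m * l ^ 2 * b) ^ 4 * m ^ 4
            - 189 * (m * l ^ 4 * f) ^ 2 * m ^ 6
            + 1890 * (m * l ^ 2 * b) ^ 2 * m ^ 5 * (m * l ^ 4 * f)
            - 2835 * (m * l ^ 2 * b) * m ^ 5 * (m * l ^ 3 * d) ^ 2
            + 162 * (m * l ^ 5 * g) * m ^ 6 * (m * l ^ 3 * d)
            + 720 * (m * l ^ 5 * g) * m ^ 4 * (m * l * a) ^ 3 = m ^ 8 * l ^ 8 * (11200 * a ^ 8 - 12600 * a ^ 3 * d * b + 13230 * a * d * b ^ 2 + 1134 * a * d * f
      - 3150 * a ^ 2 * b * f - 810 * g * a * b - 33600 * a ^ 6 * b - 7875 * a ^ 2 * b ^ 3
      - 756 * a ^ 2 * d ^ 2 + 6720 * a ^ 5 * d + 31500 * a ^ 4 * b ^ 2 - 4725 * b ^ 4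
      - 189 * f ^ 2 + 1890 * b ^ 2 * f - 2835 * b * d ^ 2 + 162 * g * d + 720 * g * a ^ 3)" for a b d f g
    by algebra
  have den: "9 * (m * l ^ 3 * p 5) * m ^ 2 - 45 * (m * l * p 3) * (m * l ^ 2 * p 4) * m + 40 * (m * l * p 3) ^ 3
      = m ^ 3 * l ^ 3 * M"
    using MX by (simp add: mult_ac)
  have fin: "1 / 18 * ((m / l) ^ 5 / (m ^ 10 * (m ^ 3 * l ^ 3 * M))) * (m ^ 8 * l ^ 8 * y) = 1 / (18 * M) * y" for y
    using m l(1) by (simp add: field_simps eval_nat_numeral)
  show "inv_Y F z = 1 / (18 * M) *
      (11200 * p 3 ^ 8 - 12600 * p 3 ^ 3 * p 5 * p 4 + 13230 * p 3 * p 5 * p 4 ^ 2 + 1134 * p 3 * p 5 * p 6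
      - 3150 * p 3 ^ 2 * p 4 * p 6 - 810 * p 7 * p 3 * p 4 - 33600 * p 3 ^ 6 * p 4 - 7875 * p 3 ^ 2 * p 4 ^ 3
      - 756 * p 3 ^ 2 * p 5 ^ 2 + 6720 * p 3 ^ 5 * p 5 + 31500 * p 3 ^ 4 * p 4 ^ 2 - 4725 * p 4 ^ 4
      - 189 * p 6 ^ 2 + 1890 * p 4 ^ 2 * p 6 - 2835 * p 4 * p 5 ^ 2 + 162 * p 7 * p 5 + 720 * p 7 * p 3 ^ 3)"
    unfolding inv_Y_def Let_def root unfolding F2 den hom by (rule fin)
qed

section \<open>Normalisation of a branch germ and invariance of X\<close>

lemma SA3_equiv_cone:
  assumes "is_cone F z x0 y0 u0 \<phi>" "is_cone G z' x1 y1 u1 \<psi>"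
    and "open D" "z \<in> D" "open E" "z' \<in> E" "det A = 1"
    and "curve_map A \<phi> (slope x0 y0 z) (y0 - snd z) \<psi> (slope x1 y1 z') (y1 - snd z')"
  shows "SA3_equiv (graph_surf F D) (graph_pt F z) (graph_surf G E) (graph_pt G z')"
  using maps_germ_cone_translation[OF assms] assms(7) unfolding SA3_equiv_def by blast

lemma branch_is_cone:
  assumes "in_branch D F" "z \<in> D"
  obtains x0 y0 u0 \<phi> where "is_cone F z x0 y0 u0 \<phi>" "(deriv ^^ 2) \<phi> (slope x0 y0 z) \<noteq> 0"
proof -
  obtain x y where z: "z = (x, y)" by (cases z)
  obtain x0 y0 u0 \<phi> where c: "y \<noteq> y0" "analytic1 \<phi> ((x - x0) / (y0 - y))"
    "\<forall>\<^sub>F w in nhds (x, y). F w = cone x0 y0 u0 \<phi> w"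
    by (rule branch_cone[OF assms[unfolded z]])
  have i: "is_cone F z x0 y0 u0 \<phi>" using c by (simp add: is_cone_def cone_dom_def slope_def z)
  have "(deriv ^^ 2) \<phi> (slope x0 y0 z) \<noteq> 0"
    using in_branchD(2)[OF assms] is_cone_jets(4)[OF i] by auto
  thus ?thesis using that i by blast
qed

abbreviation standard_cone :: "(real \<Rightarrow> real) \<Rightarrow> real \<times> real \<Rightarrow> real" where
  "standard_cone \<equiv> cone 0 1 0"

lemma standard_cone_0: "\<psi> 0 = 0 \<Longrightarrow> graph_pt (standard_cone \<psi>) (0, 0) = 0"
  by (rule graph_pt_0) (simp add: cone_def)

lemma SA3_equiv_standard_cone:
  assumes "analytic1 \<phi> 0" "analytic1 \<psi> 0" "\<phi> 0 = 0" "\<psi> 0 = 0" "det A = 1" "curve_map A \<phi> 0 1 \<psi> 0 1"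
  shows "SA3_equiv (graph_surf (standard_cone \<phi>) UNIV) 0 (graph_surf (standard_cone \<psi>) UNIV) 0"
  using SA3_equiv_cone[OF is_cone_origin[OF assms(1)] is_cone_origin[OF assms(2)], of UNIV UNIV A] assms
  by (simp add: standard_cone_0)

text \<open>\<open>frame\<close> moves vertex, base point and tangent plane into standard position,
  and \<open>flatten_curve\<close> then straightens the osculating conic. The formula for Y is
  stated before the sixth derivative is removed, because that removal is only possible when X is
  nonzero.\<close>

lemma branch_normalise:
  assumes b: "in_branch D F" and z: "z \<in> D"
  obtains \<psi> where "flat \<psi>" "(deriv ^^ 5) \<psi> 0 = inv_X F z"
    "inv_X F z \<noteq> 0 \<Longrightarrow> inv_Y F z = (deriv ^^ 7) \<psi> 0 - 7 / 6 * ((deriv ^^ 6) \<psi> 0)\<^sup>2 / (deriv ^^ 5) \<psi> 0"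
    "SA3_equiv (graph_surf F D) (graph_pt F z) (graph_surf (standard_cone \<psi>) UNIV) 0"
proof -
  obtain x0 y0 u0 \<phi> where F: "is_cone F z x0 y0 u0 \<phi>" and f2: "(deriv ^^ 2) \<phi> (slope x0 y0 z) \<noteq> 0"
    by (rule branch_is_cone[OF b z])
  let ?s = "slope x0 y0 z" and ?r = "y0 - snd z"
  define \<alpha> where "\<alpha> = 1 / root 3 ((deriv ^^ 2) \<phi> ?s)"
  have \<alpha>: "\<alpha> \<noteq> 0" "\<alpha> ^ 3 * (deriv ^^ 2) \<phi> ?s = 1"
    using f2 by (simp_all add: \<alpha>_def power_divide odd_real_root_pow)
  have r: "?r \<noteq> 0" by (rule is_cone_jets(1)[OF F])
  define f where "f = rescaled \<phi> ?s ?r \<alpha>"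
  note X = inv_X_rescaled[OF F \<alpha>, folded f_def]
  have fa: "analytic1 f 0" "f 0 = 0" using X(1) by (auto simp: osculating_def)
  \<comment> \<open>The relation for Y is recorded as a disjunction because the curve is produced
    for every value of X, whereas Y has Monge's expression in its denominator.\<close>
  obtain \<psi> where \<psi>: "flat \<psi>"
    "curve_map (frame_change 0 ((deriv ^^ 3) f 0 / 3) ((deriv ^^ 4) f 0 / 6 - 5 * ((deriv ^^ 3) f 0)\<^sup>2 / 18)) f 0 1 \<psi> 0 1"
    and D: "(deriv ^^ 5) \<psi> 0 = (9 * (deriv ^^ 5) f 0 - 45 * (deriv ^^ 3) f 0 * (deriv ^^ 4) f 0 + 40 * ((deriv ^^ 3) f 0) ^ 3) / 9"
    and E: "18 * (9 * (deriv ^^ 5) f 0 - 45 * (deriv ^^ 3) f 0 * (deriv ^^ 4) f 0 + 40 * ((deriv ^^ 3) f 0) ^ 3) * (deriv ^^ 7) \<psi> 0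
        - 189 * ((deriv ^^ 6) \<psi> 0)\<^sup>2 = 18 * (9 * (deriv ^^ 5) f 0 - 45 * (deriv ^^ 3) f 0 * (deriv ^^ 4) f 0 + 40 * ((deriv ^^ 3) f 0) ^ 3) * inv_Y F z
      \<or> (9 * (deriv ^^ 5) f 0 - 45 * (deriv ^^ 3) f 0 * (deriv ^^ 4) f 0 + 40 * ((deriv ^^ 3) f 0) ^ 3) = 0"
    by (rule flatten_curve[OF X(1)], rule that, assumption, assumption, assumption) (simp add: X(3))
  have 5: "(deriv ^^ 5) \<psi> 0 = inv_X F z" unfolding D X(2) ..
  have Y: "inv_Y F z = (deriv ^^ 7) \<psi> 0 - 7 / 6 * ((deriv ^^ 6) \<psi> 0)\<^sup>2 / (deriv ^^ 5) \<psi> 0" if "inv_X F z \<noteq> 0"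
  proof -
    define M where "M = 9 * (deriv ^^ 5) f 0 - 45 * (deriv ^^ 3) f 0 * (deriv ^^ 4) f 0 + 40 * ((deriv ^^ 3) f 0) ^ 3"
    have "M \<noteq> 0" "(deriv ^^ 5) \<psi> 0 = M / 9" using that D 5 by (auto simp: M_def)
    moreover have "18 * M * (deriv ^^ 7) \<psi> 0 - 189 * ((deriv ^^ 6) \<psi> 0)\<^sup>2 = 18 * M * inv_Y F z"
      using E \<open>M \<noteq> 0\<close> unfolding M_def by blast
    ultimately have "M \<noteq> 0" "(deriv ^^ 5) \<psi> 0 = M / 9"
      "inv_Y F z = (18 * M * (deriv ^^ 7) \<psi> 0 - 189 * ((deriv ^^ 6) \<psi> 0)\<^sup>2) / (18 * M)" by simp_all
    note * = this
    have "y = e - 7 / 6 * q / d" if "m \<noteq> 0" "d = m / 9" "y = (18 * m * e - 189 * q) / (18 * m)" for y e q d m :: real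
      unfolding that(2,3) using that(1) by (simp add: field_simps)
    from this[OF *] show ?thesis .
  qed
  have "SA3_equiv (graph_surf (standard_cone f) UNIV) (graph_pt (standard_cone f) (0, 0)) (graph_surf F D) (graph_pt F z)"
  proof (rule SA3_equiv_cone[OF is_cone_origin[OF fa(1)] F _ _ in_branch_open[OF b] z det_frame[OF \<alpha>(1) r]])
    show "curve_map (frame ?s ?r (\<phi> ?s) (deriv \<phi> ?s) \<alpha>) f (slope 0 1 (0, 0)) (1 - snd (0, 0)) \<phi> ?s ?r"
      using curve_map_frame[OF \<alpha>(1) r] by (simp add: f_def)
  qed simp_all
  hence "SA3_equiv (graph_surf F D) (graph_pt F z) (graph_surf (standard_cone f) UNIV) 0"
    using SA3_equiv_sym standard_cone_0[of f] fa(2) by metis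
  moreover have "SA3_equiv (graph_surf (standard_cone f) UNIV) 0 (graph_surf (standard_cone \<psi>) UNIV) 0"
    by (rule SA3_equiv_standard_cone[OF fa(1) flatD(2)[OF \<psi>(1)] fa(2) flatD(3)[OF \<psi>(1)] det_frame_change \<psi>(2)])
  ultimately have "SA3_equiv (graph_surf F D) (graph_pt F z) (graph_surf (standard_cone \<psi>) UNIV) 0"
    by (rule SA3_equiv_trans)
  thus ?thesis using that \<psi>(1) 5 Y by blast
qed

lemma flat_equivD:
  assumes \<phi>: "flat \<phi>" and \<psi>: "flat \<psi>" and F: "is_cone F (0, 0) 0 1 0 \<phi>" and G: "is_cone G (0, 0) 0 1 0 \<psi>"
    and "open D" "(0, 0) \<in> D" "SA3_equiv (graph_surf F D) 0 (graph_surf G E) 0"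
  obtains A where "det A = 1" "curve_map A \<phi> 0 1 \<psi> 0 1"
proof -
  obtain A b where A: "det A = 1" "maps_germ (affine_map A b) (graph_surf F D) 0 (graph_surf G E) 0"
    using assms(7) unfolding SA3_equiv_def by blast
  have 0: "graph_pt F (0, 0) = 0" "graph_pt G (0, 0) = 0"
    using is_coneD(3)[OF F] is_coneD(3)[OF G] flatD(3)[OF \<phi>] flatD(3)[OF \<psi>]
    by (auto intro!: graph_pt_0 simp: cone_def)
  have 2: "deriv (deriv \<phi>) 0 = 1" "deriv (deriv \<psi>) 0 = 1"
    using flatD(5)[OF \<phi>] flatD(5)[OF \<psi>] by (simp_all add: numeral_2_eq_2)
  have "curve_map A \<phi> 0 1 \<psi> 0 1"
    using maps_germ_coneD(2)[OF F G _ _ assms(5,6) A(1), of b E] A(2) 2 by (simp add: 0)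
  thus ?thesis using that A(1) by blast
qed

text \<open>Both values are fifth derivatives of flattened curves, and an equivalence between the
  surfaces becomes a curve map between these, which preserves the fifth derivative. The group
  element need not be close to the identity.\<close>

lemma inv_X_SA3_equiv:
  assumes "in_branch D F" "z \<in> D" "in_branch D' F'" "z' \<in> D'"
    "SA3_equiv (graph_surf F D) (graph_pt F z) (graph_surf F' D') (graph_pt F' z')"
  shows "inv_X F' z' = inv_X F z"
proof -
  obtain \<psi> where \<psi>: "flat \<psi>" "(deriv ^^ 5) \<psi> 0 = inv_X F z"
    "SA3_equiv (graph_surf F D) (graph_pt F z) (graph_surf (standard_cone \<psi>) UNIV) 0"
    by (rule branch_normalise[OF assms(1,2)])
  obtain \<psi>' where \<psi>': "flat \<psi>'" "(deriv ^^ 5) \<psi>' 0 = inv_X F' z'"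
    "SA3_equiv (graph_surf F' D') (graph_pt F' z') (graph_surf (standard_cone \<psi>') UNIV) 0"
    by (rule branch_normalise[OF assms(3,4)])
  have "SA3_equiv (graph_surf (standard_cone \<psi>) UNIV) 0 (graph_surf (standard_cone \<psi>') UNIV) 0"
    by (rule SA3_equiv_trans[OF SA3_equiv_trans[OF SA3_equiv_sym[OF \<psi>(3)] assms(5)] \<psi>'(3)])
  then obtain A where "det A = 1" "curve_map A \<psi> 0 1 \<psi>' 0 1"
    by (rule flat_equivD[OF \<psi>(1) \<psi>'(1) is_cone_origin[OF flatD(2)[OF \<psi>(1)]] is_cone_origin[OF flatD(2)[OF \<psi>'(1)]] open_UNIV UNIV_I])
  from flat_curve_map_unique(1)[OF \<psi>(1) \<psi>'(1) this(2,1)] show ?thesis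
    using \<psi>(2) \<psi>'(2) by simp
qed

text \<open>Up to a nonvanishing factor, X is Monge's differential expression of the curve, so X = 0
  is the differential equation of conics.\<close>

lemma inv_X_cone:
  assumes "is_cone F z x0 y0 u0 \<phi>" "(deriv ^^ 2) \<phi> (slope x0 y0 z) \<noteq> 0"
  defines "f \<equiv> \<lambda>n. (deriv ^^ n) \<phi> (slope x0 y0 z)"
  shows "inv_X F z = (9 * (f 2)\<^sup>2 * f 5 - 45 * f 2 * f 3 * f 4 + 40 * f 3 ^ 3) / (9 * (y0 - snd z) ^ 3 * f 2 ^ 4)"
proof -
  note J = is_cone_jets[OF assms(1)]
  have "1 / 9 * (((a / r * ((s * b + a) / r ^ 2) - s * a / r * (b / r ^ 2)) * (9 * (a / r) ^ 2 * (e / r ^ 4) - 45 * (a / r) * (b / r ^ 2) * (c / r ^ 3) + 40 * (b / r ^ 2) ^ 3)) / (a / r) ^ 6)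
    = (9 * a\<^sup>2 * e - 45 * a * b * c + 40 * b ^ 3) / (9 * r ^ 3 * a ^ 4)" if "r \<noteq> 0" "a \<noteq> 0" for r s a b c e :: real
  proof -
    have 1: "a / r * ((s * b + a) / r ^ 2) - s * a / r * (b / r ^ 2) = a\<^sup>2 / r ^ 3"
      using that by (simp add: field_simps power_expand)
    have 2: "9 * (a / r) ^ 2 * (e / r ^ 4) - 45 * (a / r) * (b / r ^ 2) * (c / r ^ 3) + 40 * (b / r ^ 2) ^ 3
      = (9 * a\<^sup>2 * e - 45 * a * b * c + 40 * b ^ 3) / r ^ 6"
      using that by (simp add: field_simps power_expand)
    show ?thesis unfolding 1 2 using that by (simp add: field_simps power_expand)
  qed
  from this[OF J(1) assms(2)] show ?thesis
    unfolding inv_X_def X_jet_def jet5_def prod.case J f_def .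
qed

lemma isCont_eventually_neq:
  fixes f :: "'a::t2_space \<Rightarrow> real"
  assumes "isCont f x" "f x \<noteq> 0" shows "\<forall>\<^sub>F y in nhds x. f y \<noteq> 0"
proof -
  have "filterlim f (nhds (f x)) (nhds x)" using assms(1) tendsto_at_iff_tendsto_nhds[of f x] by (simp add: isCont_def)
  thus ?thesis by (rule eventually_compose_filterlim[rotated]) (use assms(2) in \<open>simp add: t1_space_nhds\<close>)
qed

text \<open>At slope 0 the second derivative is 1 and Monge's expression equals 9 \<psi>^(5)(0), so
  continuity keeps the required quantities nonzero nearby. A normal germ demands X nonzero on its
  entire domain, not only at the origin.\<close>

lemma flat_domain:
  assumes \<psi>: "flat \<psi>"
  obtains E where "open E" "(0, 0) \<in> E" "in_branch E (standard_cone \<psi>)" "E \<subseteq> cone_dom 0 1 \<psi>"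
    "(deriv ^^ 5) \<psi> 0 \<noteq> 0 \<Longrightarrow> \<forall>z\<in>E. inv_X (standard_cone \<psi>) z \<noteq> 0"
proof -
  have a: "analytic1 \<psi> 0" by (rule flatD(2)[OF \<psi>])
  define f where "f = (\<lambda>n. (deriv ^^ n) \<psi>)"
  define M where "M = (\<lambda>s. 9 * (f 2 s)\<^sup>2 * f 5 s - 45 * f 2 s * f 3 s * f 4 s + 40 * (f 3 s) ^ 3)"
  have fc: "isCont (f n) 0" for n
    unfolding f_def by (rule analytic1_isCont[OF analytic1_higher_deriv[OF a]])
  have f0: "f 2 0 = 1" "f 3 0 = 0" "f 4 0 = 0" using \<psi> by (auto simp: f_def flat_def osculating_def)
  have z: "(0, 0) \<in> cone_dom 0 1 \<psi>" using a by (simp add: cone_dom_def)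
  have lim: "filterlim (slope 0 1) (nhds 0) (nhds (0, 0))" using filterlim_slope[of "(0, 0)" 1 0] by simp
  have "\<forall>\<^sub>F s in nhds 0. f 2 s \<noteq> 0" by (rule isCont_eventually_neq[OF fc]) (simp add: f0)
  moreover have "\<forall>\<^sub>F s in nhds 0. f 5 0 \<noteq> 0 \<longrightarrow> M s \<noteq> 0"
  proof (cases "f 5 0 = 0")
    case False
    have "isCont M 0" unfolding M_def by (intro continuous_intros fc)
    moreover have "M 0 \<noteq> 0" using False f0 by (simp add: M_def)
    ultimately show ?thesis by (auto dest: isCont_eventually_neq elim: eventually_mono)
  qed simp
  ultimately have "\<forall>\<^sub>F s in nhds 0. f 2 s \<noteq> 0 \<and> (f 5 0 \<noteq> 0 \<longrightarrow> M s \<noteq> 0)" by (rule eventually_conj)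
  from eventually_conj[OF eventually_compose_filterlim[OF this lim] cone_dom_eventually[OF z]]
  obtain E where E: "open E" "(0, 0) \<in> E" "\<And>w. w \<in> E \<Longrightarrow> f 2 (slope 0 1 w) \<noteq> 0 \<and> (f 5 0 \<noteq> 0 \<longrightarrow> M (slope 0 1 w) \<noteq> 0) \<and> w \<in> cone_dom 0 1 \<psi>"
    unfolding eventually_nhds by blast
  show ?thesis
  proof (rule that[OF E(1,2)])
    show "E \<subseteq> cone_dom 0 1 \<psi>" using E(3) by blast
    show "in_branch E (standard_cone \<psi>)"
      by (rule in_branch_cone[OF E(1) refl]) (use E(3) in \<open>auto simp: f_def\<close>)
    show "\<forall>z\<in>E. inv_X (standard_cone \<psi>) z \<noteq> 0" if "(deriv ^^ 5) \<psi> 0 \<noteq> 0"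
    proof
      fix w assume w: "w \<in> E"
      have c: "is_cone (standard_cone \<psi>) w 0 1 0 \<psi>" using E(3)[OF w] by (simp add: is_cone_def)
      have "1 - snd w \<noteq> 0" using is_coneD(4)[OF c] by simp
      moreover have "f 2 (slope 0 1 w) \<noteq> 0" "M (slope 0 1 w) \<noteq> 0" using E(3)[OF w] that by (auto simp: f_def)
      ultimately show "inv_X (standard_cone \<psi>) w \<noteq> 0"
        using inv_X_cone[OF c] by (simp add: f_def M_def)
    qed
  qed
qed

lemma SA3_equiv_restrict:
  assumes "flat \<psi>" "open E" "(0, 0) \<in> E"
  shows "SA3_equiv (graph_surf (standard_cone \<psi>) UNIV) 0 (graph_surf (standard_cone \<psi>) E) 0"
  using SA3_equiv_same_cone[OF is_cone_origin is_cone_origin, of \<psi> UNIV E] assms flatD(2,3)[OF assms(1)]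
  by (simp add: standard_cone_0)

section \<open>The case of vanishing X\<close>

lemma zero_deriv_imp_constant:
  fixes f :: "real \<Rightarrow> real"
  assumes "\<And>t. t \<in> ball 0 d \<Longrightarrow> (f has_field_derivative 0) (at t)" "t \<in> ball 0 d"
  shows "f t = f 0"
proof -
  have "\<exists>c. \<forall>x\<in>ball 0 d. f x = c"
    by (rule has_field_derivative_zero_constant) (use assms(1) in \<open>auto intro: DERIV_subset\<close>)
  then obtain c where "\<And>x. x \<in> ball 0 d \<Longrightarrow> f x = c" by blast
  moreover have "0 \<in> ball (0::real) d" using assms(2) zero_le_dist[of 0 t] by (simp del: zero_le_dist)
  ultimately show ?thesis using assms(2) by metis
qed

text \<open>Along a solution of Monge's equation both \<open>(3f''f'''' - 5f'''\<^sup>2)\<^sup>3 / f''\<^sup>8\<close> and then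
  \<open>f'''\<^sup>3 / f''\<^sup>5\<close> are constant.\<close>

lemma monge_equation:
  assumes \<psi>: "flat \<psi>"
    and M: "\<forall>\<^sub>F s in nhds 0. 9 * ((deriv ^^ 2) \<psi> s)\<^sup>2 * (deriv ^^ 5) \<psi> s
      - 45 * (deriv ^^ 2) \<psi> s * (deriv ^^ 3) \<psi> s * (deriv ^^ 4) \<psi> s + 40 * ((deriv ^^ 3) \<psi> s) ^ 3 = 0"
  shows "\<forall>\<^sub>F s in nhds 0. \<psi> s = s\<^sup>2 / 2"
proof -
  define f where "f = (\<lambda>n. (deriv ^^ n) \<psi>)"
  have a: "analytic1 \<psi> 0" by (rule flatD(2)[OF \<psi>])
  have f0: "f 0 0 = 0" "f 1 0 = 0" "f 2 0 = 1" "f 3 0 = 0" "f 4 0 = 0" using \<psi> by (auto simp: f_def flat_def osculating_def)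
  have "\<forall>\<^sub>F s in nhds 0. f 2 s \<noteq> 0"
    by (rule isCont_eventually_neq[OF analytic1_isCont]) (use f0 analytic1_higher_deriv[OF a, of 2] in \<open>auto simp: f_def\<close>)
  from eventually_conj[OF eventually_conj[OF this analytic1_eventually[OF a]] M]
  obtain d where d: "d > 0" "\<And>s. s \<in> ball 0 d \<Longrightarrow> f 2 s \<noteq> 0" "\<And>s. s \<in> ball 0 d \<Longrightarrow> analytic1 \<psi> s"
    "\<And>s. s \<in> ball 0 d \<Longrightarrow> 9 * (f 2 s)\<^sup>2 * f 5 s - 45 * f 2 s * f 3 s * f 4 s + 40 * (f 3 s) ^ 3 = 0"
    unfolding eventually_nhds_metric f_def by (auto simp: dist_commute)
  have D: "(f n has_field_derivative f (Suc n) s) (at s)" if "s \<in> ball 0 d" for n s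
    unfolding f_def by (rule higher_deriv_has_deriv[OF d(3)[OF that]])
  have D': "(f 1 has_field_derivative f 2 s) (at s)" "(f 2 has_field_derivative f 3 s) (at s)"
    "(f 3 has_field_derivative f 4 s) (at s)" "(f 4 has_field_derivative f 5 s) (at s)" "(f 0 has_field_derivative f 1 s) (at s)"
    if "s \<in> ball 0 d" for s
    using D[OF that, of 1] D[OF that, of 2] D[OF that, of 3] D[OF that, of 4] D[OF that, of 0] by (simp_all add: eval_nat_numeral)
  have J: "3 * f 2 s * f 4 s - 5 * (f 3 s)\<^sup>2 = 0" if s: "s \<in> ball 0 d" for s
  proof -
    \<comment> \<open>With j = 3 f'' f'''' - 5 f'''^2, Monge's equation reads 3 f'' j' = 8 f''' j.
      Integrating the logarithmic derivatives gives the exponents 3 and 8; the constant is 0 because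
      j vanishes at a flat point.\<close>
    let ?h = "\<lambda>s. (3 * f 2 s * f 4 s - 5 * (f 3 s)\<^sup>2) ^ 3 / f 2 s ^ 8"
    have "(?h has_field_derivative 0) (at t)" if t: "t \<in> ball 0 d" for t
    proof -
      have j: "((\<lambda>s. 3 * f 2 s * f 4 s - 5 * (f 3 s)\<^sup>2) has_field_derivative 3 * f 2 t * f 5 t - 7 * f 3 t * f 4 t) (at t)"
        by (auto intro!: derivative_eq_intros D'[OF t])
      let ?j = "3 * f 2 t * f 4 t - 5 * (f 3 t)\<^sup>2" and ?j' = "3 * f 2 t * f 5 t - 7 * f 3 t * f 4 t"
      have n: "(\<lambda>s. f 2 s ^ 8) t \<noteq> 0" using d(2)[OF t] by simp
      have "(?h has_field_derivative ((of_nat 3 * (?j' * ?j ^ (3 - Suc 0))) * f 2 t ^ 8 - ?j ^ 3 * (of_nat 8 * (f 3 t * f 2 t ^ (8 - Suc 0)))) / (f 2 t ^ 8 * f 2 t ^ 8)) (at t)"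
        by (rule DERIV_divide[OF DERIV_power[OF j] DERIV_power[OF D'(2)[OF t]] n])
      moreover have "3 * f 2 t * ?j' = 8 * f 3 t * ?j"
      proof -
        have "3 * f 2 t * (3 * f 2 t * ?j' - 8 * f 3 t * ?j) = 0"
          using d(4)[OF t] by algebra
        thus ?thesis using d(2)[OF t] by simp
      qed
      hence "(of_nat 3 * (?j' * ?j ^ (3 - Suc 0))) * f 2 t ^ 8 - ?j ^ 3 * (of_nat 8 * (f 3 t * f 2 t ^ (8 - Suc 0))) = 0"
      proof -
        assume h: "3 * f 2 t * ?j' = 8 * f 3 t * ?j"
        have "(of_nat 3 * (?j' * ?j ^ (3 - Suc 0))) * f 2 t ^ 8 - ?j ^ 3 * (of_nat 8 * (f 3 t * f 2 t ^ (8 - Suc 0)))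
          = (3 * f 2 t * ?j' - 8 * f 3 t * ?j) * ?j ^ 2 * f 2 t ^ 7" by (simp add: power_expand algebra_simps)
        thus ?thesis using h by simp
      qed
      ultimately show ?thesis by simp
    qed
    from zero_deriv_imp_constant[OF this s] have "?h s = 0" using f0 by simp
    thus ?thesis using d(2)[OF s] by simp
  qed
  have f3: "f 3 s = 0" if s: "s \<in> ball 0 d" for s
  proof -
    \<comment> \<open>Now j = 0 says 3 f'' f'''' = 5 f'''^2, which integrates with exponents 3 and
      5; again the value at 0 is 0.\<close>
    let ?h = "\<lambda>s. f 3 s ^ 3 / f 2 s ^ 5"
    have "(?h has_field_derivative 0) (at t)" if t: "t \<in> ball 0 d" for t
    proof -
      have n: "(\<lambda>s. f 2 s ^ 5) t \<noteq> 0" using d(2)[OF t] by simp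
      have "(?h has_field_derivative ((of_nat 3 * (f 4 t * f 3 t ^ (3 - Suc 0))) * f 2 t ^ 5 - f 3 t ^ 3 * (of_nat 5 * (f 3 t * f 2 t ^ (5 - Suc 0)))) / (f 2 t ^ 5 * f 2 t ^ 5)) (at t)"
        by (rule DERIV_divide[OF DERIV_power[OF D'(3)[OF t]] DERIV_power[OF D'(2)[OF t]] n])
      moreover have "(of_nat 3 * (f 4 t * f 3 t ^ (3 - Suc 0))) * f 2 t ^ 5 - f 3 t ^ 3 * (of_nat 5 * (f 3 t * f 2 t ^ (5 - Suc 0)))
         = (3 * f 2 t * f 4 t - 5 * (f 3 t)\<^sup>2) * (f 3 t)\<^sup>2 * f 2 t ^ 4" by (simp add: power_expand algebra_simps)
      ultimately show ?thesis using J[OF t] by simp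
    qed
    from zero_deriv_imp_constant[OF this s] have "?h s = 0" using f0 by simp
    thus ?thesis using d(2)[OF s] by simp
  qed
  have f2: "f 2 s = 1" if s: "s \<in> ball 0 d" for s
    using zero_deriv_imp_constant[of d "f 2" s] D'(2) f3 s f0 by auto
  have f1: "f 1 s = s" if s: "s \<in> ball 0 d" for s
  proof -
    have "((\<lambda>s. f 1 s - s) has_field_derivative 0) (at t)" if "t \<in> ball 0 d" for t
      using D'(1)[OF that] f2[OF that] by (auto intro!: derivative_eq_intros)
    from zero_deriv_imp_constant[OF this s] show ?thesis using f0 by simp
  qed
  have "f 0 s = s\<^sup>2 / 2" if s: "s \<in> ball 0 d" for s
  proof -
    have "((\<lambda>s. f 0 s - s\<^sup>2 / 2) has_field_derivative 0) (at t)" if "t \<in> ball 0 d" for t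
      using D'(5)[OF that] f1[OF that] by (auto intro!: derivative_eq_intros)
    from zero_deriv_imp_constant[OF this s] show ?thesis using f0 by simp
  qed
  moreover have "\<forall>\<^sub>F s in nhds 0. s \<in> ball (0::real) d" using d(1) by (intro eventually_nhds_in_open) auto
  ultimately show ?thesis by (auto elim: eventually_mono simp: f_def)
qed

lemma is_cone_cong:
  assumes "is_cone F z x0 y0 u0 \<phi>" "\<forall>\<^sub>F s in nhds (slope x0 y0 z). \<psi> s = \<phi> s"
  shows "is_cone F z x0 y0 u0 \<psi>"
proof -
  note F = is_coneD[OF assms(1)]
  have "analytic1 \<psi> (slope x0 y0 z)" by (rule analytic1_cong[OF F(5) assms(2)])
  moreover have "\<forall>\<^sub>F w in nhds z. F w = cone x0 y0 u0 \<psi> w"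
    using F(2) eventually_compose_filterlim[OF assms(2) filterlim_slope[OF F(4)]]
    by eventually_elim (auto simp: cone_def slope_def)
  ultimately show ?thesis using F(4) by (simp add: is_cone_def cone_dom_def)
qed

lemma is_cone_model: "is_cone model (0, 0) 0 1 0 (\<lambda>s. s\<^sup>2 / 2)"
proof -
  have "analytic1 (\<lambda>s. s * s / 2) 0"
    by (rule analytic1_divide(1)[OF analytic1_mult(1)[OF analytic1_ident(1) analytic1_ident(1)] analytic1_const(1)]) simp
  moreover have "\<forall>\<^sub>F w in nhds (0, 0). model w = cone 0 1 0 (\<lambda>s. s\<^sup>2 / 2) w"
  proof -
    have "\<forall>\<^sub>F w in nhds (0::real, 0::real). snd w \<noteq> 1" by (rule eventually_snd_neq) simp
    thus ?thesis
    proof eventually_elim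
      case (elim w)
      have "1 - snd w \<noteq> 0" using elim by simp
      have "1 / 2 * (x\<^sup>2 / r) = r * ((x / r)\<^sup>2 / 2)" if "r \<noteq> 0" for x r :: real
        using that by (simp add: field_simps power2_eq_square)
      from this[OF \<open>1 - snd w \<noteq> 0\<close>] show ?case by (simp add: model_def cone_def case_prod_unfold)
    qed
  qed
  ultimately show ?thesis by (simp add: is_cone_def cone_dom_def power2_eq_square)
qed

text \<open>Normalisation compares the surfaces at a single point, but Monge's equation is needed on
  an interval. The same affine map also matches the neighbouring points, so X vanishes along the
  standard cone near the origin and the curve is the conic u = s^2/2.\<close>

lemma X_zero_equiv_model:
  assumes b: "in_branch D F" and z: "z \<in> D" and X: "\<And>w. w \<in> D \<Longrightarrow> inv_X F w = 0"
  shows "SA3_equiv (graph_surf F D) (graph_pt F z) (graph_surf model {(x, y). y \<noteq> 1}) 0"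
proof -
  obtain \<psi> where \<psi>: "flat \<psi>"
    "SA3_equiv (graph_surf F D) (graph_pt F z) (graph_surf (standard_cone \<psi>) UNIV) 0"
    by (rule branch_normalise[OF b z])
  obtain E where E: "open E" "(0, 0) \<in> E" "in_branch E (standard_cone \<psi>)" "E \<subseteq> cone_dom 0 1 \<psi>"
    by (rule flat_domain[OF \<psi>(1)])
  let ?C = "standard_cone \<psi>"
  have eq: "SA3_equiv (graph_surf F D) (graph_pt F z) (graph_surf ?C E) 0"
    by (rule SA3_equiv_trans[OF \<psi>(2) SA3_equiv_restrict[OF \<psi>(1) E(1,2)]])
  then obtain A c where A: "det A = 1" "maps_germ (affine_map A c) (graph_surf F D) (graph_pt F z) (graph_surf ?C E) 0"
    unfolding SA3_equiv_def by blast
  then obtain U U' where U: "openin (top_of_set (graph_surf F D)) U"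
    "openin (top_of_set (graph_surf ?C E)) U'" "0 \<in> U'" "affine_map A c ` U = U'"
    unfolding maps_germ_def by blast
  obtain V where V: "open V" "U' = graph_surf ?C E \<inter> V" using U(2) by (auto simp: openin_open)
  \<comment> \<open>The map of germs at z is also a map of germs at every point of U, since the
    definition involves the point only through membership.\<close>
  have X0: "inv_X ?C w = 0" if w: "w \<in> E" "graph_pt ?C w \<in> V" for w
  proof -
    have "graph_pt ?C w \<in> U'" using w V(2) by (auto simp: graph_surf_def)
    then obtain q where q: "q \<in> U" "affine_map A c q = graph_pt ?C w" using U(4) by auto
    then obtain w' where w': "w' \<in> D" "q = graph_pt F w'"
      using openin_imp_subset[OF U(1)] by (auto simp: graph_surf_def)
    have "maps_germ (affine_map A c) (graph_surf F D) (graph_pt F w') (graph_surf ?C E) (graph_pt ?C w)"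
      using U q w' \<open>graph_pt ?C w \<in> U'\<close> unfolding maps_germ_def by blast
    hence "SA3_equiv (graph_surf F D) (graph_pt F w') (graph_surf ?C E) (graph_pt ?C w)"
      using A(1) unfolding SA3_equiv_def by blast
    from inv_X_SA3_equiv[OF b w'(1) E(3) w(1) this] show ?thesis using X[OF w'(1)] by simp
  qed
  have lim: "filterlim (\<lambda>s. (s, 0)) (nhds (0, 0)) (nhds (0::real))"
    by (intro tendsto_Pair tendsto_const filterlim_ident)
  have "0 \<in> V" using U(3) V(2) by blast
  moreover have "((\<lambda>s. graph_pt ?C (s, 0)) \<longlongrightarrow> 0) (nhds 0)"
  proof (rule vec_tendstoI)
    fix i :: 3
    have "isCont \<psi> 0" by (rule analytic1_isCont[OF flatD(2)[OF \<psi>(1)]])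
    hence "(\<psi> \<longlongrightarrow> 0) (nhds 0)" using tendsto_at_iff_tendsto_nhds[of \<psi> 0] flatD(3)[OF \<psi>(1)] by (simp add: isCont_def)
    thus "((\<lambda>s. graph_pt ?C (s, 0) $ i) \<longlongrightarrow> 0 $ i) (nhds 0)"
      using exhaust_3[of i] by (auto simp: graph_pt_def cone_def filterlim_ident)
  qed
  ultimately have "\<forall>\<^sub>F s in nhds 0. graph_pt ?C (s, 0) \<in> V"
    using V(1) by (intro topological_tendstoD)
  hence "\<forall>\<^sub>F s in nhds 0. 9 * ((deriv ^^ 2) \<psi> s)\<^sup>2 * (deriv ^^ 5) \<psi> s
      - 45 * (deriv ^^ 2) \<psi> s * (deriv ^^ 3) \<psi> s * (deriv ^^ 4) \<psi> s + 40 * ((deriv ^^ 3) \<psi> s) ^ 3 = 0"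
    using eventually_compose_filterlim[OF eventually_nhds_in_open[OF E(1,2)] lim]
  proof eventually_elim
    case (elim s)
    have c: "is_cone ?C (s, 0) 0 1 0 \<psi>" using elim E(4) by (auto simp: is_cone_def)
    have "(deriv ^^ 2) \<psi> s \<noteq> 0"
      using in_branchD(2)[OF E(3) elim(2)] is_cone_jets(4)[OF c] by (auto simp: slope_def)
    thus ?case using inv_X_cone[OF c] X0[OF elim(2,1)] by (simp add: slope_def)
  qed
  from monge_equation[OF \<psi>(1) this] have "\<forall>\<^sub>F s in nhds 0. s\<^sup>2 / 2 = \<psi> s" by (auto elim: eventually_mono)
  hence "is_cone ?C (0, 0) 0 1 0 (\<lambda>s. s\<^sup>2 / 2)"
    using is_cone_cong[OF is_cone_origin[OF flatD(2)[OF \<psi>(1)]]] by simp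
  from SA3_equiv_same_cone[OF this is_cone_model E(1,2), of "{(x, y). y \<noteq> 1}"]
  have "SA3_equiv (graph_surf ?C E) (graph_pt ?C (0, 0)) (graph_surf model {(x, y). y \<noteq> 1}) (graph_pt model (0, 0))"
    using open_vimage[of "- {1::real}" "snd :: real \<times> real \<Rightarrow> real"] by (auto simp: vimage_def case_prod_unfold continuous_on_snd)
  moreover have "graph_pt ?C (0, 0) = 0" "graph_pt model (0, 0) = 0"
    using standard_cone_0[of \<psi>, OF flatD(3)[OF \<psi>(1)]] by (auto intro!: graph_pt_0 simp: model_def)
  ultimately show ?thesis using SA3_equiv_trans[OF eq] by simp
qed

section \<open>The normal form of a surface germ\<close>

lemma inv_XY_flat_cone:
  assumes "flat \<psi>" "is_cone G (0, 0) 0 1 0 \<psi>"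
  shows "inv_X G (0, 0) = (deriv ^^ 5) \<psi> 0"
    "(deriv ^^ 5) \<psi> 0 \<noteq> 0 \<Longrightarrow> (deriv ^^ 6) \<psi> 0 = 0 \<Longrightarrow> inv_Y G (0, 0) = (deriv ^^ 7) \<psi> 0"
proof -
  note f = flatD[OF assms(1)]
  have 1: "rescaled \<psi> 0 1 1 = \<psi>" using f by (simp add: rescaled_def)
  have 2: "(deriv ^^ 3) \<psi> 0 = 0" "(deriv ^^ 4) \<psi> 0 = 0" using assms(1) by (auto simp: flat_def)
  have "1 ^ 3 * (deriv ^^ 2) \<psi> (slope 0 1 (0, 0)) = 1" using f(5) by (simp add: slope_def)
  note X = inv_X_rescaled[OF assms(2) _ this]
  show "inv_X G (0, 0) = (deriv ^^ 5) \<psi> 0" using X(2) by (simp add: 1 2 slope_def)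
  show "inv_Y G (0, 0) = (deriv ^^ 7) \<psi> 0" if "(deriv ^^ 5) \<psi> 0 \<noteq> 0" "(deriv ^^ 6) \<psi> 0 = 0"
    using X(3) that by (simp add: 1 2 slope_def)
qed

section \<open>Power series of a standard cone at the origin\<close>

lemma negative_binomial_sums:
  fixes y :: real
  assumes "\<bar>y\<bar> < 1"
  shows "(\<lambda>k. real ((n + k) choose k) * y ^ k) sums (1 / (1 - y)) ^ Suc n"
proof -
  have "(\<lambda>k. (- real (Suc n) gchoose k) * (- y) ^ k) sums (1 + - y) powr (- real (Suc n))"
    by (rule gen_binomial_real) (use assms in simp)
  moreover have "(- real (Suc n) gchoose k) * (- y) ^ k = real ((n + k) choose k) * y ^ k" for k
  proof -
    have "(- real (Suc n) gchoose k) = (- 1) ^ k * real ((n + k) choose k)"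
      unfolding gbinomial_minus by (simp add: binomial_gbinomial)
    moreover have "(- y) ^ k = (- 1) ^ k * y ^ k" by (rule power_minus)
    ultimately show ?thesis by (simp add: power_mult_distrib[symmetric])
  qed
  moreover have "(1 + - y) powr (- real (Suc n)) = (1 / (1 - y)) ^ Suc n"
    using assms by (simp only: powr_minus powr_realpow) (simp add: powr_realpow[symmetric] power_one_over inverse_eq_divide powr_minus del: of_nat_Suc)
  ultimately show ?thesis by simp
qed

text \<open>The term of degree j of the curve contributes (1 - y) (x/(1 - y))^j = x^j (1 - y)^(1 -
  j), a negative binomial series with n = j - 2. The truncated subtraction is harmless because a = 0
  for j < 2.\<close>

lemma cone_row_has_sum:
  fixes x y a :: real
  assumes "\<bar>y\<bar> < 1" "j < 2 \<Longrightarrow> a = 0"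
  shows "((\<lambda>k. a * real ((j - 2 + k) choose k) * x ^ j * y ^ k) has_sum (1 - y) * (a * (x / (1 - y)) ^ j)) UNIV"
proof (cases "j < 2")
  case False
  then obtain n where n: "j = Suc (Suc n)" by (metis add_2_eq_Suc le_Suc_ex not_less)
  have s: "(\<lambda>k. a * x ^ j * (real ((n + k) choose k) * t ^ k)) sums (a * x ^ j * (1 / (1 - t)) ^ Suc n)"
    if "\<bar>t\<bar> < 1" for a x t :: real
    by (intro sums_mult negative_binomial_sums that)
  have "((\<lambda>k. a * x ^ j * (real ((n + k) choose k) * y ^ k)) has_sum (a * x ^ j * (1 / (1 - y)) ^ Suc n)) UNIV"
  proof (rule norm_summable_imp_has_sum[OF _ s[OF assms(1)]])
    have "summable (\<lambda>k. \<bar>a\<bar> * \<bar>x\<bar> ^ j * (real ((n + k) choose k) * \<bar>y\<bar> ^ k))"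
      using s[of "\<bar>y\<bar>" "\<bar>a\<bar>" "\<bar>x\<bar>"] assms(1) by (auto simp: sums_iff)
    thus "summable (\<lambda>k. norm (a * x ^ j * (real ((n + k) choose k) * y ^ k)))"
      by (simp add: abs_mult power_abs)
  qed
  moreover have "a * x ^ j * (1 / r) ^ Suc n = r * (a * (x / r) ^ j)" if "r \<noteq> 0" for r
    using that by (simp add: n field_simps)
  hence "a * x ^ j * (1 / (1 - y)) ^ Suc n = (1 - y) * (a * (x / (1 - y)) ^ j)" using assms(1) by fastforce
  ultimately have "((\<lambda>k. a * x ^ j * (real ((n + k) choose k) * y ^ k)) has_sum (1 - y) * (a * (x / (1 - y)) ^ j)) UNIV"
    by simp
  moreover have "(\<lambda>k. a * x ^ j * (real ((n + k) choose k) * y ^ k)) = (\<lambda>k. a * real ((j - 2 + k) choose k) * x ^ j * y ^ k)"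
    by (simp add: n mult_ac)
  ultimately show ?thesis by simp
qed (use assms(2) in \<open>auto simp: has_sum_0\<close>)

lemma cone_has_sum:
  assumes "analytic1 \<psi> 0" "\<psi> 0 = 0" "deriv \<psi> 0 = 0"
  obtains r where "r > 0" "\<And>x y. \<bar>x\<bar> < r \<Longrightarrow> \<bar>y\<bar> < r \<Longrightarrow>
    ((\<lambda>(j, k). fps_nth (jet \<psi> 0) j * real ((j - 2 + k) choose k) * x ^ j * y ^ k) has_sum standard_cone \<psi> (x, y)) UNIV"
proof -
  let ?J = "\<lambda>j. fps_nth (jet \<psi> 0) j"
  obtain \<rho> where \<rho>: "\<rho> > 0" "summable (\<lambda>n. \<bar>?J n\<bar> * \<rho> ^ n)"
    "\<And>t. \<bar>t\<bar> \<le> \<rho> \<Longrightarrow> (\<lambda>n. ?J n * t ^ n) sums \<psi> (0 + t)"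
    by (rule analytic1_series[OF assms(1)]) (rule that)
  have J: "?J j = 0" if "j < 2" for j
    using that assms(2,3) by (auto simp: jet_nth less_2_cases_iff)
  define r where "r = min (1 / 2) (\<rho> / 2)"
  have abs: "summable (\<lambda>j. \<bar>?J j\<bar> * t ^ j)" if "0 \<le> t" "t \<le> \<rho>" for t
    by (rule summable_comparison_test'[OF \<rho>(2), of 0]) (use that in \<open>auto intro!: mult_left_mono power_mono\<close>)
  have bound: "\<bar>x\<bar> / (1 - y) \<le> \<rho>" "\<bar>y\<bar> < 1" "1 - y > 0" if "\<bar>x\<bar> < r" "\<bar>y\<bar> < r" for x y :: real
  proof -
    have "\<bar>x\<bar> \<le> \<rho> * (1 / 2)" "1 / 2 \<le> 1 - y" using that by (auto simp: r_def)
    moreover have "\<rho> * (1 / 2) \<le> \<rho> * (1 - y)" using \<rho>(1) calculation(2) by (intro mult_left_mono) auto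
    ultimately show "\<bar>x\<bar> / (1 - y) \<le> \<rho>" "1 - y > 0" by (auto simp: divide_le_eq)
    show "\<bar>y\<bar> < 1" using that by (auto simp: r_def)
  qed
  have "((\<lambda>(j, k). ?J j * real ((j - 2 + k) choose k) * x ^ j * y ^ k) has_sum standard_cone \<psi> (x, y)) (UNIV \<times> UNIV)"
    if xy: "\<bar>x\<bar> < r" "\<bar>y\<bar> < r" for x y :: real
  proof (rule has_sum_SigmaI)
    note b = bound[OF xy]
    show "((\<lambda>k. case (j, k) of (j, k) \<Rightarrow> ?J j * real ((j - 2 + k) choose k) * x ^ j * y ^ k) has_sum
        (1 - y) * (?J j * (x / (1 - y)) ^ j)) UNIV" for j
      using cone_row_has_sum[OF b(2), of j "?J j" x] J by simp
    have t: "\<bar>x / (1 - y)\<bar> \<le> \<rho>" using b by (simp add: abs_divide)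
    have "((\<lambda>j. ?J j * (x / (1 - y)) ^ j) has_sum \<psi> (x / (1 - y))) UNIV"
    proof (rule norm_summable_imp_has_sum)
      show "(\<lambda>j. ?J j * (x / (1 - y)) ^ j) sums \<psi> (x / (1 - y))" using \<rho>(3)[OF t] by simp
      show "summable (\<lambda>j. norm (?J j * (x / (1 - y)) ^ j))"
        using abs[OF _ t] by (simp add: abs_mult power_abs)
    qed
    thus "((\<lambda>j. (1 - y) * (?J j * (x / (1 - y)) ^ j)) has_sum standard_cone \<psi> (x, y)) UNIV"
      using has_sum_cmult_right[of "\<lambda>j. ?J j * (x / (1 - y)) ^ j" UNIV "\<psi> (x / (1 - y))" "1 - y"] by (simp add: cone_def)
    \<comment> \<open>Absolute summability of the double series comes from the same row sums at
      (|x|, |y|) with the coefficients replaced by their absolute values.\<close>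
    have b': "\<bar>\<bar>x\<bar>\<bar> / (1 - \<bar>y\<bar>) \<le> \<rho>" "\<bar>\<bar>y\<bar>\<bar> < 1" "1 - \<bar>y\<bar> > 0" using bound[of "\<bar>x\<bar>" "\<bar>y\<bar>"] xy by simp_all
    have "(\<lambda>(j, k). \<bar>?J j\<bar> * real ((j - 2 + k) choose k) * \<bar>x\<bar> ^ j * \<bar>y\<bar> ^ k) summable_on UNIV \<times> UNIV"
    proof (rule summable_on_SigmaI)
      show "((\<lambda>k. case (j, k) of (j, k) \<Rightarrow> \<bar>?J j\<bar> * real ((j - 2 + k) choose k) * \<bar>x\<bar> ^ j * \<bar>y\<bar> ^ k) has_sum
          (1 - \<bar>y\<bar>) * (\<bar>?J j\<bar> * (\<bar>x\<bar> / (1 - \<bar>y\<bar>)) ^ j)) UNIV" for j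
        using cone_row_has_sum[OF b'(2), of j "\<bar>?J j\<bar>" "\<bar>x\<bar>"] J by simp
      have "(\<lambda>j. \<bar>?J j\<bar> * (\<bar>x\<bar> / (1 - \<bar>y\<bar>)) ^ j) summable_on UNIV"
        using abs[of "\<bar>x\<bar> / (1 - \<bar>y\<bar>)"] b' by (intro norm_summable_imp_summable_on) (simp_all add: abs_mult power_abs)
      thus "(\<lambda>j. (1 - \<bar>y\<bar>) * (\<bar>?J j\<bar> * (\<bar>x\<bar> / (1 - \<bar>y\<bar>)) ^ j)) summable_on UNIV"
        by (rule summable_on_cmult_right)
    qed auto
    hence "(\<lambda>p. norm (case p of (j, k) \<Rightarrow> ?J j * real ((j - 2 + k) choose k) * x ^ j * y ^ k)) summable_on UNIV \<times> UNIV"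
      by (simp add: case_prod_unfold abs_mult power_abs)
    thus "(\<lambda>(j, k). ?J j * real ((j - 2 + k) choose k) * x ^ j * y ^ k) summable_on UNIV \<times> UNIV"
      by (rule abs_summable_summable)
  qed
  moreover have "r > 0" using \<rho>(1) by (simp add: r_def)
  ultimately show ?thesis using that by simp
qed

lemma degree_less_8: "{(j, k). j + k < 8} = (SIGMA j:{..<8::nat}. {..<8 - j})"
  by auto

text \<open>Below total degree 8 only the rows 2, 5 and 7 survive. In row 5 the binomials (3 + k
  choose k) are 1, 4 and 10, which explains the factors 4/120 and 20/240 of the normal form.\<close>

lemma normal_form_low_terms:
  fixes q :: "nat \<Rightarrow> real"
  assumes "q 0 = 0" "q 1 = 0" "q 2 = 1 / 2" "q 3 = 0" "q 4 = 0" "q 5 = a5 / 120" "q 6 = 0" "q 7 = a7 / 5040"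
  shows "((\<lambda>(j, k). q j * real ((j - 2 + k) choose k) * x ^ j * y ^ k) has_sum
     (x ^ 2 / 2 + x ^ 2 * y / 2 + x ^ 2 * y ^ 2 / 2 + a5 * x ^ 5 / 120 + x ^ 2 * y ^ 3 / 2
      + 4 * a5 * (x ^ 5 * y) / 120 + x ^ 2 * y ^ 4 / 2
      + a7 * x ^ 7 / 5040 + 20 * a5 * (x ^ 5 * y ^ 2) / 240 + x ^ 2 * y ^ 5 / 2)) {(j, k). j + k < 8}"
proof -
  have 8: "{..<8::nat} = {0, 1, 2, 3, 4, 5, 6, 7}" "{..<6::nat} = {0, 1, 2, 3, 4, 5}" "{..<3::nat} = {0, 1, 2}" "{..<1::nat} = {0}"
    by auto
  have b: "(1 + 3) choose 1 = (4::nat)" "(2 + 3) choose 2 = (10::nat)" by (simp_all add: numeral_eq_Suc)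
  have "(\<Sum>(j, k)\<in>{(j, k). j + k < 8}. q j * real ((j - 2 + k) choose k) * x ^ j * y ^ k)
    = (\<Sum>j<8. \<Sum>k<8 - j. q j * real ((j - 2 + k) choose k) * x ^ j * y ^ k)"
    unfolding degree_less_8 by (rule sum.Sigma[symmetric]) auto
  also have "\<dots> = (\<Sum>k<6. 1 / 2 * x ^ 2 * y ^ k) + (\<Sum>k<3. a5 / 120 * real ((3 + k) choose k) * x ^ 5 * y ^ k) + a7 / 5040 * x ^ 7"
    unfolding 8(1) by (simp add: assms 8(4) assms(2)[simplified])
  also have "\<dots> = x ^ 2 / 2 + x ^ 2 * y / 2 + x ^ 2 * y ^ 2 / 2 + a5 * x ^ 5 / 120 + x ^ 2 * y ^ 3 / 2
      + 4 * a5 * (x ^ 5 * y) / 120 + x ^ 2 * y ^ 4 / 2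
      + a7 * x ^ 7 / 5040 + 20 * a5 * (x ^ 5 * y ^ 2) / 240 + x ^ 2 * y ^ 5 / 2"
    unfolding 8 using b by (simp add: field_simps)
  finally show ?thesis
    by (intro has_sum_finiteI) (auto simp: degree_less_8)
qed

lemma normal_expansion_standard_cone:
  assumes \<psi>: "flat \<psi>" "(deriv ^^ 6) \<psi> 0 = 0"
  shows "normal_expansion (standard_cone \<psi>) ((deriv ^^ 5) \<psi> 0) ((deriv ^^ 7) \<psi> 0)
    (\<lambda>j k. fps_nth (jet \<psi> 0) j * real ((j - 2 + k) choose k))"
proof -
  note f = flatD[OF \<psi>(1)]
  obtain r where r: "r > 0" "\<And>x y. \<bar>x\<bar> < r \<Longrightarrow> \<bar>y\<bar> < r \<Longrightarrow>
    ((\<lambda>(j, k). fps_nth (jet \<psi> 0) j * real ((j - 2 + k) choose k) * x ^ j * y ^ k) has_sum standard_cone \<psi> (x, y)) UNIV"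
    by (rule cone_has_sum[OF f(2-4)]) (rule that)
  have 0: "fps_nth (jet \<psi> 0) 0 = 0" "fps_nth (jet \<psi> 0) 1 = 0" "fps_nth (jet \<psi> 0) 2 = 1 / 2"
    "fps_nth (jet \<psi> 0) 5 = (deriv ^^ 5) \<psi> 0 / 120" "fps_nth (jet \<psi> 0) 6 = 0" "fps_nth (jet \<psi> 0) 7 = (deriv ^^ 7) \<psi> 0 / 5040"
    using f \<psi>(2) by (simp_all add: jet_nth fact_numeral)
  have e: "{(j, k). j + k \<ge> 8} = UNIV - {(j, k). j + k < (8::nat)}" by auto
  show ?thesis unfolding normal_expansion_def e
    by (intro exI[of _ r] conjI r(1) allI impI has_sum_Diff r(2) normal_form_low_terms 0 f(6,7)) auto
qed

text \<open>In \<open>branch_normalise\<close>, Y is the seventh derivative corrected by the sixth;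
  the conic stabiliser performs exactly this correction, so Y is the seventh derivative of the final
  curve.\<close>

lemma X_nonzero_equiv_normal_germ:
  assumes b: "in_branch D F" and z: "z \<in> D" and X: "inv_X F z \<noteq> 0"
  obtains E G c where "normal_germ E G (inv_X F z) (inv_Y F z) c"
    "SA3_equiv (graph_surf F D) (graph_pt F z) (graph_surf G E) 0"
proof -
  obtain \<phi> where \<phi>: "flat \<phi>" "(deriv ^^ 5) \<phi> 0 = inv_X F z"
    "inv_X F z \<noteq> 0 \<Longrightarrow> inv_Y F z = (deriv ^^ 7) \<phi> 0 - 7 / 6 * ((deriv ^^ 6) \<phi> 0)\<^sup>2 / (deriv ^^ 5) \<phi> 0"
    "SA3_equiv (graph_surf F D) (graph_pt F z) (graph_surf (standard_cone \<phi>) UNIV) 0"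
    by (rule branch_normalise[OF b z]) (rule that)
  have 5: "(deriv ^^ 5) \<phi> 0 \<noteq> 0" using X \<phi>(2) by simp
  obtain \<psi> where \<psi>: "flat \<psi>"
    "curve_map (frame_change (2 * ((deriv ^^ 6) \<phi> 0 / (6 * (deriv ^^ 5) \<phi> 0))) (- 2 * ((deriv ^^ 6) \<phi> 0 / (6 * (deriv ^^ 5) \<phi> 0)))
       (- 2 * ((deriv ^^ 6) \<phi> 0 / (6 * (deriv ^^ 5) \<phi> 0))\<^sup>2)) \<phi> 0 1 \<psi> 0 1"
    "(deriv ^^ 5) \<psi> 0 = (deriv ^^ 5) \<phi> 0" "(deriv ^^ 6) \<psi> 0 = 0"
    "(deriv ^^ 7) \<psi> 0 = (deriv ^^ 7) \<phi> 0 - 7 / 6 * ((deriv ^^ 6) \<phi> 0)\<^sup>2 / (deriv ^^ 5) \<phi> 0"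
    by (rule conic_stabiliser_curve[OF \<phi>(1) 5]) (rule that)
  have D: "(deriv ^^ 5) \<psi> 0 = inv_X F z" "(deriv ^^ 7) \<psi> 0 = inv_Y F z"
    using \<psi>(3,5) \<phi>(2,3) X by simp_all
  obtain E where E: "open E" "(0, 0) \<in> E" "in_branch E (standard_cone \<psi>)"
    "(deriv ^^ 5) \<psi> 0 \<noteq> 0 \<Longrightarrow> \<forall>z\<in>E. inv_X (standard_cone \<psi>) z \<noteq> 0"
    by (rule flat_domain[OF \<psi>(1)]) (rule that)
  have c: "is_cone (standard_cone \<psi>) (0, 0) 0 1 0 \<psi>" by (rule is_cone_origin[OF flatD(2)[OF \<psi>(1)]])
  have "normal_germ E (standard_cone \<psi>) (inv_X F z) (inv_Y F z) (\<lambda>j k. fps_nth (jet \<psi> 0) j * real ((j - 2 + k) choose k))"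
    using E X D inv_XY_flat_cone[OF \<psi>(1) c] \<psi>(4) normal_expansion_standard_cone[OF \<psi>(1,4)]
    unfolding normal_germ_def by simp
  moreover have "SA3_equiv (graph_surf (standard_cone \<phi>) UNIV) 0 (graph_surf (standard_cone \<psi>) UNIV) 0"
    by (rule SA3_equiv_standard_cone[OF flatD(2)[OF \<phi>(1)] flatD(2)[OF \<psi>(1)] flatD(3)[OF \<phi>(1)] flatD(3)[OF \<psi>(1)] det_frame_change \<psi>(2)])
  hence "SA3_equiv (graph_surf F D) (graph_pt F z) (graph_surf (standard_cone \<psi>) E) 0"
    using SA3_equiv_trans[OF SA3_equiv_trans[OF \<phi>(4)] SA3_equiv_restrict[OF \<psi>(1) E(1,2)]] by blast
  ultimately show ?thesis by (rule that)
qed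

section \<open>Classification of normal germs\<close>

lemma normal_expansion_dser:
  assumes "normal_expansion G a5 a7 c"
  obtains C R where "dser C R G (0, 0)" "\<And>j k. j + k \<ge> 8 \<Longrightarrow> C j k = c j k"
    "C 0 0 = 0" "C 1 0 = 0" "C 2 0 = 1 / 2" "C 3 0 = 0" "C 4 0 = 0" "C 5 0 = a5 / 120" "C 6 0 = 0" "C 7 0 = a7 / 5040"
    "C 0 1 = 0" "C 1 1 = 0" "C 2 1 = 1 / 2"
proof -
  obtain r where r: "r > 0" "\<And>x y. \<bar>x\<bar> < r \<Longrightarrow> \<bar>y\<bar> < r \<Longrightarrow>
        ((\<lambda>(j, k). c j k * x ^ j * y ^ k) has_sum
           (G (x, y)
            - (x ^ 2 / 2 + x ^ 2 * y / 2 + x ^ 2 * y ^ 2 / 2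
               + a5 * x ^ 5 / 120 + x ^ 2 * y ^ 3 / 2
               + 4 * a5 * (x ^ 5 * y) / 120 + x ^ 2 * y ^ 4 / 2
               + a7 * x ^ 7 / 5040 + 20 * a5 * (x ^ 5 * y ^ 2) / 240 + x ^ 2 * y ^ 5 / 2)))
          {(j, k). j + k \<ge> 8}"
    using assms unfolding normal_expansion_def by blast
  define q where "q = (\<lambda>j::nat. if j = 2 then 1 / 2 else if j = 5 then a5 / 120 else if j = 7 then a7 / 5040 else 0)"
  define C where "C = (\<lambda>j k. if j + k < 8 then q j * real ((j - 2 + k) choose k) else c j k)"
  have C: "((\<lambda>(j, k). C j k * x ^ j * y ^ k) has_sum G (x, y)) UNIV" if xy: "\<bar>x\<bar> < r" "\<bar>y\<bar> < r" for x y
  proof -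
    have 1: "((\<lambda>(j, k). C j k * x ^ j * y ^ k) has_sum
      (x ^ 2 / 2 + x ^ 2 * y / 2 + x ^ 2 * y ^ 2 / 2 + a5 * x ^ 5 / 120 + x ^ 2 * y ^ 3 / 2
      + 4 * a5 * (x ^ 5 * y) / 120 + x ^ 2 * y ^ 4 / 2
      + a7 * x ^ 7 / 5040 + 20 * a5 * (x ^ 5 * y ^ 2) / 240 + x ^ 2 * y ^ 5 / 2)) {(j, k). j + k < 8}"
      by (rule iffD1[OF has_sum_cong normal_form_low_terms[of q a5 a7 x y]]) (auto simp: C_def q_def)
    have 2: "((\<lambda>(j, k). C j k * x ^ j * y ^ k) has_sum (G (x, y)
            - (x ^ 2 / 2 + x ^ 2 * y / 2 + x ^ 2 * y ^ 2 / 2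
               + a5 * x ^ 5 / 120 + x ^ 2 * y ^ 3 / 2
               + 4 * a5 * (x ^ 5 * y) / 120 + x ^ 2 * y ^ 4 / 2
               + a7 * x ^ 7 / 5040 + 20 * a5 * (x ^ 5 * y ^ 2) / 240 + x ^ 2 * y ^ 5 / 2))) {(j, k). j + k \<ge> 8}"
      by (rule iffD1[OF has_sum_cong r(2)[OF xy]]) (auto simp: C_def)
    have u: "{(j, k). j + k < (8::nat)} \<union> {(j, k). j + k \<ge> 8} = UNIV" by auto
    have "{(j, k). j + k < (8::nat)} \<inter> {(j, k). j + k \<ge> 8} = {}" by auto
    from has_sum_Un_disjoint[OF 1 2 this] show ?thesis unfolding u by simp
  qed
  have "dser C (r / 2) G (0, 0)" unfolding dser_def
  proof (intro conjI allI impI)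
    have "(\<lambda>(j, k). C j k * (r / 2) ^ j * (r / 2) ^ k) summable_on UNIV"
      using C[of "r / 2" "r / 2"] r(1) by (auto simp: summable_on_def)
    hence "(\<lambda>p. norm (case p of (j, k) \<Rightarrow> C j k * (r / 2) ^ j * (r / 2) ^ k)) summable_on UNIV"
      by (rule summable_on_iff_abs_summable_on_real[THEN iffD1])
    thus "(\<lambda>(j, k). \<bar>C j k\<bar> * (r / 2) ^ (j + k)) summable_on UNIV"
      using r(1) by (simp add: case_prod_unfold abs_mult power_add mult.assoc)
    show "((\<lambda>(j, k). C j k * x ^ j * y ^ k) has_sum G ((0, 0) + (x, y))) UNIV" if "\<bar>x\<bar> \<le> r / 2" "\<bar>y\<bar> \<le> r / 2" for x y
      using C[of x y] that r(1) by simp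
  qed (use r(1) in simp)
  thus ?thesis by (rule that) (simp_all add: C_def q_def)
qed

text \<open>A normal germ is a cone, and its low coefficients locate the vertex: F_xy = 0 gives base
  slope 0, F_xx = F_xxy = 1 gives y0 = 1, and F = F_y = 0 give u0 = 0. The curve is then the slice y
  = 0, which is why the coefficients with k = 0 determine the germ.\<close>

lemma normal_germ_cone:
  assumes "normal_germ E G a5 a7 c"
  obtains \<phi> where "is_cone G (0, 0) 0 1 0 \<phi>" "flat \<phi>" "(deriv ^^ 5) \<phi> 0 = a5" "(deriv ^^ 6) \<phi> 0 = 0"
    "(deriv ^^ 7) \<phi> 0 = a7" "\<And>j. j \<ge> 8 \<Longrightarrow> fps_nth (jet \<phi> 0) j = c j 0"
proof -
  have b: "in_branch E G" "(0, 0) \<in> E" and e: "normal_expansion G a5 a7 c"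
    using assms by (auto simp: normal_germ_def)
  obtain C R where C: "dser C R G (0, 0)" "\<And>j k. j + k \<ge> 8 \<Longrightarrow> C j k = c j k"
    and C0: "C 0 0 = 0" "C 1 0 = 0" "C 2 0 = 1 / 2" "C 3 0 = 0" "C 4 0 = 0" "C 5 0 = a5 / 120" "C 6 0 = 0" "C 7 0 = a7 / 5040"
    "C 0 1 = 0" "C 1 1 = 0" "C 2 1 = 1 / 2"
    by (rule normal_expansion_dser[OF e]) (rule that)
  obtain x0 y0 u0 \<phi> where F: "is_cone G (0, 0) x0 y0 u0 \<phi>" and f2: "(deriv ^^ 2) \<phi> (slope x0 y0 (0, 0)) \<noteq> 0"
    by (rule branch_is_cone[OF b])
  note J = is_cone_jets[OF F] and P = pd_eq_coeff[OF C(1)]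
  let ?s = "slope x0 y0 (0, 0)"
  have "?s * (deriv ^^ 2) \<phi> ?s / (y0 - snd (0, 0)) = 0" using J(11) P[of 1 1] C0 by simp
  hence s: "?s = 0" using f2 J(1) by simp
  hence x0: "x0 = 0" using J(1) by (simp add: slope_def)
  have "(deriv ^^ 2) \<phi> ?s / y0 = 1" "(?s * (deriv ^^ 3) \<phi> ?s + (deriv ^^ 2) \<phi> ?s) / y0\<^sup>2 = 1"
    using J(4,12) P[of 2 0] P[of 2 1] C0 by simp_all
  hence y0: "y0 = 1" using J(1) s by (simp add: power2_eq_square)
  have "\<phi> 0 = 0" using J(10) P[of 0 1] C0 s by simp
  hence u0: "u0 = 0" using J(2) dser_coeff_0[OF C(1)] C0 s by simp
  have c: "is_cone G (0, 0) 0 1 0 \<phi>" using F x0 y0 u0 by simp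
  have a: "analytic1 \<phi> 0" using is_coneD(5)[OF c] by (simp add: slope_def)
  have lim: "filterlim (\<lambda>s. (s, 0)) (nhds (0, 0)) (nhds (0::real))"
    by (intro tendsto_Pair tendsto_const filterlim_ident)
  have "\<forall>\<^sub>F t in nhds 0. G (t, 0) = \<phi> t"
    using eventually_compose_filterlim[OF is_coneD(2)[OF c] lim] by (simp add: cone_def)
  from jet_cong[OF this] have j: "fps_nth (jet \<phi> 0) j = C j 0" for j
    using dser_line(2)[OF C(1), of j] by simp
  have d: "(deriv ^^ j) \<phi> 0 = fact j * C j 0" for j
    using j[of j] by (simp add: jet_nth field_simps)
  show ?thesis
  proof (rule that[OF c])
    show "flat \<phi>" using a d[of 0] d[of 1] d[of 2] d[of 3] d[of 4] C0 by (simp add: flat_def osculating_def)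
    show "(deriv ^^ 5) \<phi> 0 = a5" "(deriv ^^ 6) \<phi> 0 = 0" "(deriv ^^ 7) \<phi> 0 = a7"
      using d[of 5] d[of 6] d[of 7] C0 by (simp_all add: fact_numeral)
    show "fps_nth (jet \<phi> 0) j = c j 0" if "j \<ge> 8" for j using j C(2) that by simp
  qed
qed

lemma jet_eq_imp_eventually_eq:
  assumes "analytic1 \<phi> s" "analytic1 \<psi> s" "jet \<phi> s = jet \<psi> s"
  shows "\<forall>\<^sub>F t in nhds s. \<phi> t = \<psi> t"
proof -
  obtain \<rho> where \<rho>: "\<rho> > 0" "\<And>t. \<bar>t\<bar> \<le> \<rho> \<Longrightarrow> (\<lambda>n. fps_nth (jet \<phi> s) n * t ^ n) sums \<phi> (s + t)"
    by (rule analytic1_series[OF assms(1)]) (rule that)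
  obtain \<sigma> where \<sigma>: "\<sigma> > 0" "\<And>t. \<bar>t\<bar> \<le> \<sigma> \<Longrightarrow> (\<lambda>n. fps_nth (jet \<psi> s) n * t ^ n) sums \<psi> (s + t)"
    by (rule analytic1_series[OF assms(2)]) (rule that)
  have "\<phi> t = \<psi> t" if "dist t s < min \<rho> \<sigma>" for t
    using sums_unique2[OF \<rho>(2)[of "t - s"] \<sigma>(2)[of "t - s", folded assms(3)]] that
    by (simp add: dist_real_def)
  thus ?thesis unfolding eventually_nhds_metric using \<rho>(1) \<sigma>(1) by (intro exI[of _ "min \<rho> \<sigma>"]) auto
qed

text \<open>Both germs are standard cones over flat curves with vanishing sixth and nonzero fifth
  derivative. Rigidity makes an equivalence force equality of the curves, hence of their Taylor
  coefficients; conversely, equal coefficients give the same cone.\<close>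

lemma normal_germ_equiv_iff:
  assumes G: "normal_germ E G a5 a7 c" and G': "normal_germ E' G' a5' a7' c'"
  shows "SA3_equiv (graph_surf G E) 0 (graph_surf G' E') 0 \<longleftrightarrow> a5 = a5' \<and> a7 = a7' \<and> (\<forall>j\<ge>8. c j 0 = c' j 0)"
proof -
  obtain \<phi> where c: "is_cone G (0, 0) 0 1 0 \<phi>" and \<phi>: "flat \<phi>" "(deriv ^^ 5) \<phi> 0 = a5" "(deriv ^^ 6) \<phi> 0 = 0"
    "(deriv ^^ 7) \<phi> 0 = a7" "\<And>j. j \<ge> 8 \<Longrightarrow> fps_nth (jet \<phi> 0) j = c j 0"
    by (rule normal_germ_cone[OF G]) (rule that)
  obtain \<psi> where c': "is_cone G' (0, 0) 0 1 0 \<psi>" and \<psi>: "flat \<psi>" "(deriv ^^ 5) \<psi> 0 = a5'" "(deriv ^^ 6) \<psi> 0 = 0"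
    "(deriv ^^ 7) \<psi> 0 = a7'" "\<And>j. j \<ge> 8 \<Longrightarrow> fps_nth (jet \<psi> 0) j = c' j 0"
    by (rule normal_germ_cone[OF G']) (rule that)
  have E: "open E" "(0, 0) \<in> E" "open E'" "(0, 0) \<in> E'" and a5: "a5 \<noteq> 0"
    using G G' in_branch_open by (auto simp: normal_germ_def)
  have a: "analytic1 \<phi> 0" "analytic1 \<psi> 0" by (rule flatD(2)[OF \<phi>(1)] flatD(2)[OF \<psi>(1)])+
  have jet: "jet \<phi> 0 = jet \<psi> 0 \<longleftrightarrow> a5 = a5' \<and> a7 = a7' \<and> (\<forall>j\<ge>8. c j 0 = c' j 0)"
  proof -
    have "(\<forall>j. fps_nth (jet \<phi> 0) j = fps_nth (jet \<psi> 0) j) \<longleftrightarrow>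
       (\<forall>j<8. fps_nth (jet \<phi> 0) j = fps_nth (jet \<psi> 0) j) \<and> (\<forall>j\<ge>8. fps_nth (jet \<phi> 0) j = fps_nth (jet \<psi> 0) j)"
      by (meson not_less)
    also have "(\<forall>j<8. fps_nth (jet \<phi> 0) j = fps_nth (jet \<psi> 0) j) \<longleftrightarrow> a5 = a5' \<and> a7 = a7'"
    proof -
      have "(j::nat) < 8 \<longleftrightarrow> j = 0 \<or> j = 1 \<or> j = 2 \<or> j = 3 \<or> j = 4 \<or> j = 5 \<or> j = 6 \<or> j = 7" for j by auto
      moreover have "fps_nth (jet \<phi> 0) 1 = fps_nth (jet \<psi> 0) 1" "fps_nth (jet \<phi> 0) 2 = fps_nth (jet \<psi> 0) 2"
        "fps_nth (jet \<phi> 0) 6 = fps_nth (jet \<psi> 0) 6"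
        using flatD[OF \<phi>(1)] flatD[OF \<psi>(1)] \<phi>(3) \<psi>(3) by (simp_all add: jet_nth)
      moreover have "fps_nth (jet \<phi> 0) 5 = fps_nth (jet \<psi> 0) 5 \<longleftrightarrow> a5 = a5'" "fps_nth (jet \<phi> 0) 7 = fps_nth (jet \<psi> 0) 7 \<longleftrightarrow> a7 = a7'"
        using \<phi>(2,4) \<psi>(2,4) by (simp_all add: jet_nth)
      ultimately show ?thesis using flatD(3,6,7)[OF \<phi>(1)] flatD(3,6,7)[OF \<psi>(1)] by (auto simp del: One_nat_def)
    qed
    finally show ?thesis using \<phi>(5) \<psi>(5) by (simp add: fps_eq_iff)
  qed
  have 0: "graph_pt G (0, 0) = 0" "graph_pt G' (0, 0) = 0"
    using is_coneD(3)[OF c] is_coneD(3)[OF c'] flatD(3)[OF \<phi>(1)] flatD(3)[OF \<psi>(1)]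
    by (auto intro!: graph_pt_0 simp: cone_def)
  show ?thesis unfolding jet[symmetric]
  proof
    assume "SA3_equiv (graph_surf G E) 0 (graph_surf G' E') 0"
    then obtain A where A: "det A = 1" "curve_map A \<phi> 0 1 \<psi> 0 1"
      by (rule flat_equivD[OF \<phi>(1) \<psi>(1) c c' E(1,2)]) (rule that)
    have "\<forall>\<^sub>F s in nhds 0. \<psi> s = \<phi> s"
      by (rule flat_curve_map_unique(2)[OF \<phi>(1) \<psi>(1) A(2,1)]) (use a5 \<phi>(2,3) \<psi>(3) in auto)
    thus "jet \<phi> 0 = jet \<psi> 0" by (rule jet_cong[symmetric])
  next
    assume j: "jet \<phi> 0 = jet \<psi> 0"
    have "is_cone G (0, 0) 0 1 0 \<psi>"
      by (rule is_cone_cong[OF c]) (use jet_eq_imp_eventually_eq[OF a(2,1) j[symmetric]] in \<open>simp add: slope_def\<close>)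
    from SA3_equiv_same_cone[OF this c' E] show "SA3_equiv (graph_surf G E) 0 (graph_surf G' E') 0"
      by (simp add: 0)
  qed
qed

section \<open>Invariants of order five\<close>

text \<open>On the line each monomial is a constant times a power of t with exponent its total
  degree, so the series is regrouped by degree. This supplies the analyticity of h in
  \<open>invariant_function_of_X_jet\<close>.\<close>

lemma real_analytic_at_along_line:
  fixes f :: "'a::euclidean_space \<Rightarrow> real"
  assumes "real_analytic_at f p"
  shows "real_analytic_at (\<lambda>t::real. f (p + (t - s) *\<^sub>R e)) s"
proof -
  obtain c R where c: "pser c R f p" using assms unfolding real_analytic_at_iff_pser by blast
  have R: "R > 0" and cs: "(\<lambda>\<alpha>. \<bar>c \<alpha>\<bar> * R ^ mdeg \<alpha>) summable_on midx"
    and cf: "\<And>h. (\<And>b. b \<in> Basis \<Longrightarrow> \<bar>h \<bullet> b\<bar> \<le> R) \<Longrightarrow> ((\<lambda>\<alpha>. c \<alpha> * mon \<alpha> h) has_sum f (p + h)) midx"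
    using c unfolding pser_def by auto
  define R' where "R' = R / (1 + norm e)"
  have R': "R' > 0" using R by (simp add: R'_def add_pos_nonneg)
  have box: "\<bar>(t *\<^sub>R e) \<bullet> b\<bar> \<le> R" if "\<bar>t\<bar> \<le> R'" "b \<in> Basis" for t b
  proof -
    have "\<bar>(t *\<^sub>R e) \<bullet> b\<bar> \<le> \<bar>t\<bar> * norm e"
      using Basis_le_norm[OF that(2), of "t *\<^sub>R e"] by simp
    also have "\<dots> \<le> R' * norm e" using that(1) by (rule mult_right_mono) simp
    also have "\<dots> \<le> R' * (1 + norm e)" using R' by (intro mult_left_mono) auto
    also have "\<dots> = R" using add_pos_nonneg[of 1 "norm e"] by (simp add: R'_def)
    finally show ?thesis .
  qed
  have hom: "mon \<alpha> (t *\<^sub>R e) = t ^ mdeg \<alpha> * mon \<alpha> e" for \<alpha> t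
    by (simp add: mon_def mdeg_def power_mult_distrib prod.distrib power_sum)
  define \<pi> :: "('a \<Rightarrow> nat) \<Rightarrow> real \<Rightarrow> nat" where "\<pi> = (\<lambda>\<alpha>. \<lambda>b\<in>Basis. mdeg \<alpha>)"
  have \<pi>: "\<pi> \<alpha> \<in> midx" "mdeg (\<pi> \<alpha>) = mdeg \<alpha>" "mon (\<pi> \<alpha>) h = h ^ mdeg \<alpha>" for \<alpha> h
    by (auto simp: \<pi>_def midx_def mdeg_def mon_def)
  have "pser (\<lambda>\<beta>. \<Sum>\<^sub>\<infinity>\<alpha>\<in>{\<alpha>\<in>midx. \<pi> \<alpha> = \<beta>}. c \<alpha> * mon \<alpha> e) R' (\<lambda>t. f (p + (t - s) *\<^sub>R e)) s"
  proof (rule pser_indexed(1)[OF R'])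
    have "(\<lambda>\<alpha>. norm (\<bar>c \<alpha> * mon \<alpha> e\<bar> * R' ^ mdeg (\<pi> \<alpha>))) summable_on midx"
    proof (rule Infinite_Sum.abs_summable_on_comparison_test)
      show "(\<lambda>\<alpha>. norm (\<bar>c \<alpha>\<bar> * R ^ mdeg \<alpha>)) summable_on midx" using cs R by (simp add: abs_mult)
      fix \<alpha> :: "'a \<Rightarrow> nat"
      have "\<bar>mon \<alpha> (R' *\<^sub>R e)\<bar> \<le> R ^ mdeg \<alpha>" by (rule abs_mon_le) (use box R' in auto)
      hence "\<bar>c \<alpha>\<bar> * \<bar>mon \<alpha> (R' *\<^sub>R e)\<bar> \<le> \<bar>c \<alpha>\<bar> * R ^ mdeg \<alpha>" by (rule mult_left_mono) simp
      thus "norm (\<bar>c \<alpha> * mon \<alpha> e\<bar> * R' ^ mdeg (\<pi> \<alpha>)) \<le> norm (\<bar>c \<alpha>\<bar> * R ^ mdeg \<alpha>)"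
        using R R' by (simp add: hom abs_mult \<pi> mult_ac)
    qed
    thus "(\<lambda>\<alpha>. \<bar>c \<alpha> * mon \<alpha> e\<bar> * R' ^ mdeg (\<pi> \<alpha>)) summable_on midx" by (rule abs_summable_summable)
    show "((\<lambda>\<alpha>. c \<alpha> * mon \<alpha> e * mon (\<pi> \<alpha>) h) has_sum f (p + (s + h - s) *\<^sub>R e)) midx"
      if "\<And>b. b \<in> Basis \<Longrightarrow> \<bar>h \<bullet> b\<bar> \<le> R'" for h
      using cf[of "h *\<^sub>R e"] box that[of 1] by (simp add: hom \<pi> mult_ac)
  qed (simp add: \<pi>)
  thus ?thesis unfolding real_analytic_at_iff_pser by blast
qed

section \<open>Level sets of X in the space of jets\<close>

lemma jet5_exhaust:
  fixes v :: jet5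
  obtains x y Fy Fxy Fxxy F0 F1 F2 F3 F4 F5 where "v = (x, y, Fy, Fxy, Fxxy, F0, F1, F2, F3, F4, F5)"
proof -
  obtain x y Fy Fxy Fxxy F0 t where "v = (x, y, Fy, Fxy, Fxxy, F0, t)" by (cases v)
  moreover obtain F1 F2 F3 F4 F5 where "t = (F1, F2, F3, F4, F5)" by (cases t)
  ultimately show ?thesis using that by blast
qed

lemma open_branch_jets: "open branch_jets"
  unfolding branch_jets_def case_prod_unfold
  by (intro open_Collect_conj open_Collect_neq continuous_intros)

lemma real_analytic_at_X_jet:
  assumes "w \<in> branch_jets" shows "real_analytic_at X_jet w"
  unfolding X_jet_def case_prod_unfold
  by (intro real_analytic_at_mult real_analytic_at_divide real_analytic_at_diff real_analytic_at_add real_analytic_at_power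
      real_analytic_at_const real_analytic_at_linear bounded_linear_fst_comp bounded_linear_snd_comp bounded_linear_ident)
    (use assms in \<open>auto simp: branch_jets_def\<close>)

lemma diff_invariant5_X_jet: "diff_invariant5 branch_jets X_jet"
  unfolding diff_invariant5_def
proof (intro conjI ballI)
  fix w :: jet5
  have "X_jet (jet5 F' z') = X_jet (jet5 F z)"
    if "det A = 1" "in_branch D F" "z \<in> D" "in_branch D' F'" "z' \<in> D'"
      "maps_germ (affine_map A b) (graph_surf F D) (graph_pt F z) (graph_surf F' D') (graph_pt F' z')" for A b D F z D' F' z'
    using inv_X_SA3_equiv[OF that(2-5)] that(1,6) unfolding inv_X_def SA3_equiv_def by blast
  thus "\<exists>\<epsilon>>0. \<forall>A b D F z D' F' z'.
        det A = 1 \<and> norm (A - mat 1) < \<epsilon> \<and> norm b < \<epsilon> \<and>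
        in_branch D F \<and> z \<in> D \<and> in_branch D' F' \<and> z' \<in> D' \<and>
        maps_germ (affine_map A b)
          (graph_surf F D) (graph_pt F z) (graph_surf F' D') (graph_pt F' z') \<and>
        jet5 F z = w \<and> jet5 F' z' \<in> branch_jets
        \<longrightarrow> X_jet (jet5 F' z') = X_jet w"
    \<comment> \<open>X is invariant under the whole group, so any positive \<epsilon>
      serves.\<close>
    by (intro exI[of _ 1]) auto
qed (auto simp: open_branch_jets real_analytic_at_X_jet)

text \<open>X is affine in F5 with nonzero slope on the branch, so each level set is a graph over
  the other ten coordinates; \<open>level c\<close> projects onto it along F5.\<close>

definition level :: "real \<Rightarrow> jet5 \<Rightarrow> jet5" where
  "level c = (\<lambda>(x, y, Fy, Fxy, Fxxy, F0, F1, F2, F3, F4, F5). (x, y, Fy, Fxy, Fxxy, F0, F1, F2, F3, F4,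
     (9 * c * (F2 ^ 6 / (F2 * Fxxy - Fxy * F3)) + 45 * F2 * F3 * F4 - 40 * F3 ^ 3) / (9 * F2\<^sup>2)))"

lemma X_jet_eq_iff:
  assumes "F2 \<noteq> 0" "F2 * Fxxy - Fxy * F3 \<noteq> 0"
  shows "X_jet (x, y, Fy, Fxy, Fxxy, F0, F1, F2, F3, F4, F5) = c \<longleftrightarrow>
    F5 = (9 * c * (F2 ^ 6 / (F2 * Fxxy - Fxy * F3)) + 45 * F2 * F3 * F4 - 40 * F3 ^ 3) / (9 * F2\<^sup>2)"
proof -
  have "1 / 9 * ((p * (9 * a ^ 2 * e - 45 * a * b * d + 40 * b ^ 3)) / a ^ 6) = c \<longleftrightarrow>
    e = (9 * c * (a ^ 6 / p) + 45 * a * b * d - 40 * b ^ 3) / (9 * a\<^sup>2)" if "a \<noteq> 0" "p \<noteq> 0" for a b d e p :: real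
  proof -
    have "1 / 9 * ((p * (9 * a ^ 2 * e - 45 * a * b * d + 40 * b ^ 3)) / a ^ 6) = c \<longleftrightarrow>
      p * (9 * a ^ 2 * e - 45 * a * b * d + 40 * b ^ 3) = 9 * c * a ^ 6" using that by (auto simp: divide_simps)
    also have "\<dots> \<longleftrightarrow> 9 * a ^ 2 * e - 45 * a * b * d + 40 * b ^ 3 = 9 * c * (a ^ 6 / p)"
      using that by (auto simp: divide_simps mult_ac)
    also have "\<dots> \<longleftrightarrow> e * (9 * a\<^sup>2) = 9 * c * (a ^ 6 / p) + 45 * a * b * d - 40 * b ^ 3"
      by (auto simp: algebra_simps)
    also have "\<dots> \<longleftrightarrow> e = (9 * c * (a ^ 6 / p) + 45 * a * b * d - 40 * b ^ 3) / (9 * a\<^sup>2)"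
      using that by (simp add: eq_divide_eq)
    finally show ?thesis .
  qed
  from this[OF assms] show ?thesis by (simp add: X_jet_def)
qed

lemma X_jet_level: "v \<in> branch_jets \<Longrightarrow> X_jet (level c v) = c"
  by (cases v rule: jet5_exhaust) (auto simp: level_def branch_jets_def X_jet_eq_iff)

lemma level_X_jet: "v \<in> branch_jets \<Longrightarrow> level (X_jet v) v = v"
proof (cases v rule: jet5_exhaust)
  case (1 x y Fy Fxy Fxxy F0 F1 F2 F3 F4 F5)
  assume "v \<in> branch_jets"
  hence *: "F2 \<noteq> 0" "F2 * Fxxy - Fxy * F3 \<noteq> 0" by (auto simp: 1 branch_jets_def)
  have "F5 = (9 * X_jet v * (F2 ^ 6 / (F2 * Fxxy - Fxy * F3)) + 45 * F2 * F3 * F4 - 40 * F3 ^ 3) / (9 * F2\<^sup>2)"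
    using X_jet_eq_iff[OF *, of x y Fy F0 F1 F4 F5 "X_jet v"] by (simp add: 1)
  thus ?thesis by (simp add: level_def 1)
qed

lemma isCont_level:
  assumes "v \<in> branch_jets" shows "isCont (\<lambda>(c, v). level c v) (c, v)"
  unfolding level_def case_prod_unfold
  by (intro continuous_intros) (use assms in \<open>auto simp: branch_jets_def\<close>)

text \<open>For fixed v the points \<open>level t v\<close> run along a line, so an analytic
  function of jets restricts to an analytic function of t.\<close>

lemma level_affine: "level t v = level s v + (t - s) *\<^sub>R (level 1 v - level 0 v)"
proof (cases v rule: jet5_exhaust)
  case (1 x y Fy Fxy Fxxy F0 F1 F2 F3 F4 F5)
  have "(9 * t * k + a - b) / d = (9 * s * k + a - b) / d + (t - s) * ((9 * 1 * k + a - b) / d - (9 * 0 * k + a - b) / d)"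
    for k a b d :: real
    by (simp add: add_divide_distrib diff_divide_distrib algebra_simps)
  from this[of "F2 ^ 6 / (F2 * Fxxy - Fxy * F3)"] show ?thesis
    unfolding 1 level_def prod.case by simp
qed

section \<open>A continuous choice of affine map for each jet\<close>

lemma tendsto_vector_3:
  fixes f g h :: "'b \<Rightarrow> 'a::real_normed_vector"
  assumes "(f \<longlongrightarrow> a) F" "(g \<longlongrightarrow> b) F" "(h \<longlongrightarrow> c) F"
  shows "((\<lambda>z. vector [f z, g z, h z] :: 'a ^ 3) \<longlongrightarrow> vector [a, b, c]) F"
proof (rule vec_tendstoI)
  fix i :: 3
  show "((\<lambda>z. (vector [f z, g z, h z] :: 'a ^ 3) $ i) \<longlongrightarrow> vector [a, b, c] $ i) F"
    using exhaust_3[of i] assms by auto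
qed

lemma tendsto_matrix_mult:
  fixes A B :: "'b \<Rightarrow> real ^ 3 ^ 3"
  assumes "(A \<longlongrightarrow> a) F" "(B \<longlongrightarrow> b) F"
  shows "((\<lambda>z. A z ** B z) \<longlongrightarrow> a ** b) F"
  by (intro vec_tendstoI) (simp add: matrix_matrix_mult_def, intro tendsto_intros assms)

lemma tendsto_matrix_vector:
  fixes A :: "'b \<Rightarrow> real ^ 3 ^ 3"
  assumes "(A \<longlongrightarrow> a) F" shows "((\<lambda>z. A z *v u) \<longlongrightarrow> a *v u) F"
  by (intro vec_tendstoI) (simp add: matrix_vector_mult_def, intro tendsto_intros assms)

text \<open>On a cone \<open>\<partial>\<^sub>x\<^sup>nF = \<phi>\<^sup>(\<^sup>n\<^sup>)(s) / r\<^sup>n\<^sup>-\<^sup>1\<close> with \<open>r = y\<^sub>0 - y\<close> and \<open>F\<^sub>y = s \<phi>'(s) - \<phi>(s)\<close>. Solving these relations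
  expresses \<open>s\<close>, \<open>r\<close> and \<open>\<phi>(s)\<close> through the jet; \<open>jet_\<alpha>\<close> normalises \<open>\<phi>''\<close> to \<open>1\<close>.\<close>

definition jet_s :: "jet5 \<Rightarrow> real" where
  "jet_s = (\<lambda>(x, y, Fy, Fxy, Fxxy, F0, F1, F2, F3, F4, F5). Fxy / F2)"

definition jet_r :: "jet5 \<Rightarrow> real" where
  "jet_r = (\<lambda>(x, y, Fy, Fxy, Fxxy, F0, F1, F2, F3, F4, F5). F2\<^sup>2 / (F2 * Fxxy - Fxy * F3))"

definition jet_f :: "jet5 \<Rightarrow> real" where
  "jet_f = (\<lambda>(x, y, Fy, Fxy, Fxxy, F0, F1, F2, F3, F4, F5). Fxy / F2 * F1 - Fy)"

definition jet_\<alpha> :: "jet5 \<Rightarrow> real" where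
  "jet_\<alpha> v = (case v of (x, y, Fy, Fxy, Fxxy, F0, F1, F2, F3, F4, F5) \<Rightarrow> 1 / root 3 (jet_r v * F2))"

text \<open>The third and fourth derivatives at 0 of the rescaled curve, written in terms of the
  jet.\<close>

definition jet_p :: "jet5 \<Rightarrow> real \<times> real" where
  "jet_p v = (case v of (x, y, Fy, Fxy, Fxxy, F0, F1, F2, F3, F4, F5) \<Rightarrow>
     (jet_\<alpha> v ^ 4 * jet_r v * F3, jet_\<alpha> v ^ 5 * jet_r v * F4))"

definition jet_vertex :: "jet5 \<Rightarrow> real ^ 3" where
  "jet_vertex v = (case v of (x, y, Fy, Fxy, Fxxy, F0, F1, F2, F3, F4, F5) \<Rightarrow>
     vector [x - jet_r v * jet_s v, y + jet_r v, F0 - jet_r v * jet_f v])"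

text \<open>Linear part of the map from the standard cone over a flat curve to a cone with jet v:
  the flat curve acquires the derivatives \<open>jet_p v\<close>, then \<open>frame\<close> moves it
  to the base point of v.\<close>

definition jet_matrix :: "jet5 \<Rightarrow> real ^ 3 ^ 3" where
  "jet_matrix v = (case v of (x, y, Fy, Fxy, Fxxy, F0, F1, F2, F3, F4, F5) \<Rightarrow>
     frame (jet_s v) (jet_r v) (jet_f v) F1 (jet_\<alpha> v)
     ** frame_change 0 (- fst (jet_p v) / 3) (5 * (fst (jet_p v))\<^sup>2 / 18 - snd (jet_p v) / 6))"

definition jet_shift :: "jet5 \<Rightarrow> real ^ 3" where
  "jet_shift v = jet_vertex v - jet_matrix v *v vector [0, 1, 0]"

lemma isCont_jet_frame:
  assumes "v \<in> branch_jets"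
  shows "isCont jet_matrix v" "isCont jet_shift v"
proof -
  have 0: "fst (snd (snd (snd (snd (snd (snd (snd v))))))) \<noteq> 0"
    "fst (snd (snd (snd (snd (snd (snd (snd v))))))) * fst (snd (snd (snd (snd v)))) - fst (snd (snd (snd v))) * fst (snd (snd (snd (snd (snd (snd (snd (snd v)))))))) \<noteq> 0"
    using assms by (auto simp: branch_jets_def)
  have s: "isCont jet_s v" and r: "isCont jet_r v" and f: "isCont jet_f v"
    unfolding jet_s_def jet_r_def jet_f_def case_prod_unfold by (intro continuous_intros 0)+
  have "jet_r v \<noteq> 0" using 0 unfolding jet_r_def case_prod_unfold by simp
  hence a: "isCont jet_\<alpha> v"
    unfolding jet_\<alpha>_def[abs_def] case_prod_unfold by (intro continuous_intros r) (use 0 in simp)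
  have p: "isCont jet_p v"
    unfolding jet_p_def[abs_def] case_prod_unfold by (intro continuous_intros r a)
  have r0: "jet_\<alpha> v * jet_r v \<noteq> 0" using \<open>jet_r v \<noteq> 0\<close> 0 unfolding jet_\<alpha>_def case_prod_unfold by simp
  have F1: "isCont (\<lambda>v::jet5. fst (snd (snd (snd (snd (snd (snd v))))))) v" by (intro continuous_intros)
  note t = s[unfolded isCont_def] r[unfolded isCont_def] f[unfolded isCont_def] a[unfolded isCont_def] F1[unfolded isCont_def]
    tendsto_fst[OF p[unfolded isCont_def]] tendsto_snd[OF p[unfolded isCont_def]]
  show m: "isCont jet_matrix v"
    unfolding isCont_def jet_matrix_def case_prod_unfold frame_def frame_change_def
    by (intro tendsto_matrix_mult tendsto_vector_3 tendsto_intros t r0) auto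
  have "isCont jet_vertex v"
    unfolding isCont_def jet_vertex_def case_prod_unfold by (intro tendsto_vector_3 tendsto_intros t)
  thus "isCont jet_shift v"
    using m unfolding isCont_def jet_shift_def by (intro tendsto_intros tendsto_matrix_vector)
qed

lemma cone_neighbourhood:
  assumes c: "is_cone (cone x0 y0 u0 \<phi>) z x0 y0 u0 \<phi>" and f2: "(deriv ^^ 2) \<phi> (slope x0 y0 z) \<noteq> 0"
  obtains E where "open E" "z \<in> E" "in_branch E (cone x0 y0 u0 \<phi>)"
proof -
  note a = is_coneD[OF c]
  have "\<forall>\<^sub>F s in nhds (slope x0 y0 z). (deriv ^^ 2) \<phi> s \<noteq> 0"
    by (rule isCont_eventually_neq[OF analytic1_isCont[OF analytic1_higher_deriv[OF a(5)]] f2])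
  from eventually_conj[OF eventually_compose_filterlim[OF this filterlim_slope[OF a(4)]] cone_dom_eventually[OF a(1)]]
  obtain E where E: "open E" "z \<in> E" "\<And>w. w \<in> E \<Longrightarrow> (deriv ^^ 2) \<phi> (slope x0 y0 w) \<noteq> 0 \<and> w \<in> cone_dom x0 y0 \<phi>"
    unfolding eventually_nhds by blast
  have "in_branch E (cone x0 y0 u0 \<phi>)" by (rule in_branch_cone[OF E(1) refl]) (use E(3) in auto)
  thus ?thesis using that E by blast
qed

text \<open>Rescaling forgets the value and the slope at s, so both can be prescribed when it is
  undone.\<close>

lemma rescaled_surj:
  assumes f: "osculating f" and r: "r \<noteq> 0" "\<alpha> \<noteq> 0"
  obtains \<phi> where "analytic1 \<phi> s" "\<phi> s = f0" "deriv \<phi> s = f1" "rescaled \<phi> s r \<alpha> = f"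
proof -
  define \<phi> where "\<phi> = (\<lambda>\<sigma>. f0 + f1 * (\<sigma> - s) + f (r / \<alpha> * (\<sigma> - s)) / (\<alpha> * r\<^sup>2))"
  have fa: "analytic1 f 0" "f 0 = 0" "deriv f 0 = 0" using f by (auto simp: osculating_def)
  have l: "analytic1 (\<lambda>\<sigma>. k * (\<sigma> - s)) s" for k
    by (intro analytic1_mult(1) analytic1_diff(1) analytic1_const(1) analytic1_ident(1))
  have fl: "analytic1 (\<lambda>\<sigma>. f (r / \<alpha> * (\<sigma> - s))) s" by (rule analytic1_compose(1)[OF l]) (use fa in simp)
  have a: "analytic1 \<phi> s" unfolding \<phi>_def
    by (intro analytic1_add(1) analytic1_divide(1) l fl analytic1_const(1)) (use r in simp)
  have "(f has_field_derivative 0) (at (r / \<alpha> * (s - s)))"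
    using higher_deriv_has_deriv[OF fa(1), of 0] fa(3) by simp
  hence "((\<lambda>\<sigma>. f (r / \<alpha> * (\<sigma> - s))) has_field_derivative 0 * (r / \<alpha>)) (at s)"
    by (rule DERIV_chain2) (use r in \<open>auto intro!: derivative_eq_intros\<close>)
  hence "(\<phi> has_field_derivative f1) (at s)"
    unfolding \<phi>_def using r by (auto intro!: derivative_eq_intros)
  hence d: "deriv \<phi> s = f1" by (rule DERIV_imp_deriv)
  show ?thesis
  proof (rule that[OF a _ d])
    show s: "\<phi> s = f0" by (simp add: \<phi>_def fa)
    show "rescaled \<phi> s r \<alpha> = f"
      unfolding rescaled_def d s using r by (simp add: \<phi>_def fun_eq_iff)
  qed
qed

text \<open>All jet coordinates except F5 are matched by construction. F5 is never computed: both
  jets have the same X, and on a level of X the other coordinates determine F5.\<close>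

lemma jet_realised:
  assumes v: "v \<in> branch_jets" and \<psi>: "flat \<psi>" "(deriv ^^ 5) \<psi> 0 = X_jet v"
  obtains D F z where "in_branch D F" "z \<in> D" "jet5 F z = v" "det (jet_matrix v) = 1"
    "maps_germ (affine_map (jet_matrix v) (jet_shift v)) (graph_surf (standard_cone \<psi>) UNIV) 0 (graph_surf F D) (graph_pt F z)"
proof -
  obtain x y Fy Fxy Fxxy F0 F1 F2 F3 F4 F5 where w: "v = (x, y, Fy, Fxy, Fxxy, F0, F1, F2, F3, F4, F5)" by (rule jet5_exhaust)
  define P where "P = F2 * Fxxy - Fxy * F3"
  have nz: "F2 \<noteq> 0" "P \<noteq> 0" using v by (auto simp: branch_jets_def w P_def)
  define r s f0 \<alpha> where "r = jet_r v" and "s = jet_s v" and "f0 = jet_f v" and "\<alpha> = jet_\<alpha> v"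
  have r: "r = F2\<^sup>2 / P" "r \<noteq> 0" and s: "s = Fxy / F2" and f0: "f0 = s * F1 - Fy"
    using nz by (auto simp: r_def s_def f0_def jet_r_def jet_s_def jet_f_def w P_def)
  have "\<alpha> = 1 / root 3 (r * F2)" by (simp add: \<alpha>_def jet_\<alpha>_def r_def w)
  hence \<alpha>: "\<alpha> \<noteq> 0" "\<alpha> ^ 3 * (r * F2) = 1" using nz r(2) by (simp_all add: power_divide odd_real_root_pow)
  let ?p3 = "\<alpha> ^ 4 * r * F3" and ?p4 = "\<alpha> ^ 5 * r * F4"
  let ?T = "frame_change 0 (- ?p3 / 3) (5 * ?p3\<^sup>2 / 18 - ?p4 / 6)"
  have M: "jet_matrix v = frame s r f0 F1 \<alpha> ** ?T"
    unfolding jet_matrix_def jet_p_def r_def s_def f0_def \<alpha>_def by (simp add: w)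
  have V: "jet_vertex v = vector [x - r * s, y + r, F0 - r * f0]"
    unfolding jet_vertex_def r_def s_def f0_def by (simp add: w)
  obtain f where f: "osculating f" "curve_map ?T \<psi> 0 1 f 0 1"
    "(deriv ^^ 3) f 0 = ?p3" "(deriv ^^ 4) f 0 = ?p4"
    "(deriv ^^ 5) f 0 = (deriv ^^ 5) \<psi> 0 + 5 * ?p3 * ?p4 - 40 / 9 * ?p3 ^ 3"
    by (rule unflatten_curve[OF \<psi>(1), of ?p3 ?p4]) (rule that)
  have fa: "analytic1 f 0" "f 0 = 0" "(deriv ^^ 2) f 0 = 1" using f(1) by (auto simp: osculating_def)
  obtain \<phi> where \<phi>: "analytic1 \<phi> s" "\<phi> s = f0" "deriv \<phi> s = F1" "rescaled \<phi> s r \<alpha> = f"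
    by (rule rescaled_surj[OF f(1) r(2) \<alpha>(1), of s f0 F1]) (rule that)
  let ?x = "x - r * s" and ?y = "y + r" and ?u = "F0 - r * f0"
  let ?F = "cone ?x ?y ?u \<phi>"
  have sl: "slope ?x ?y (x, y) = s" using r(2) by (simp add: slope_def)
  have c: "is_cone ?F (x, y) ?x ?y ?u \<phi>"
    using \<phi>(1) r(2) by (simp add: is_cone_def cone_dom_def sl)
  have d: "(deriv ^^ n) f 0 = \<alpha> * r\<^sup>2 * (\<alpha> / r) ^ n * (deriv ^^ n) \<phi> s" if "n \<ge> 2" for n
    using rescaled_deriv(4)[OF \<phi>(1) that, of r \<alpha>] by (simp add: \<phi>(4))
  have \<phi>2: "(deriv ^^ 2) \<phi> s = r * F2"
  proof -
    have "\<alpha> ^ 3 * (deriv ^^ 2) \<phi> s = 1" using d[of 2] fa(3) r(2) by (simp add: power_expand)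
    hence "\<alpha> ^ 3 * (deriv ^^ 2) \<phi> s = \<alpha> ^ 3 * (r * F2)" using \<alpha>(2) by simp
    thus ?thesis using \<alpha>(1) by simp
  qed
  have \<phi>3: "(deriv ^^ 3) \<phi> s = r\<^sup>2 * F3"
  proof -
    have "\<alpha> ^ 4 * ((deriv ^^ 3) \<phi> s / r) = \<alpha> ^ 4 * (r * F3)" using d[of 3] f(3) r(2) by (simp add: power_expand)
    hence "(deriv ^^ 3) \<phi> s / r = r * F3" using \<alpha>(1) by (subst (asm) mult_cancel_left) simp
    thus ?thesis using r(2) by (simp add: divide_simps power2_eq_square)
  qed
  have \<phi>4: "(deriv ^^ 4) \<phi> s = r ^ 3 * F4"
  proof -
    have "\<alpha> ^ 5 * ((deriv ^^ 4) \<phi> s / r\<^sup>2) = \<alpha> ^ 5 * (r * F4)" using d[of 4] f(4) r(2) by (simp add: power_expand)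
    hence "(deriv ^^ 4) \<phi> s / r\<^sup>2 = r * F4" using \<alpha>(1) by (subst (asm) mult_cancel_left) simp
    thus ?thesis using r(2) by (simp add: divide_simps power_expand)
  qed
  note J = is_cone_jets[OF c, unfolded sl]
  obtain E where E: "open E" "(x, y) \<in> E" "in_branch E ?F"
    by (rule cone_neighbourhood[OF c]) (use \<phi>2 nz r(2) in \<open>auto simp: sl\<close>)
  have iX: "inv_X ?F (x, y) = X_jet v"
  proof -
    have "\<alpha> ^ 3 * (deriv ^^ 2) \<phi> (slope ?x ?y (x, y)) = 1" using \<phi>2 \<alpha>(2) by (simp add: sl)
    from inv_X_rescaled(2)[OF c \<alpha>(1) this] have "inv_X ?F (x, y) = (9 * (deriv ^^ 5) f 0 - 45 * ?p3 * ?p4 + 40 * ?p3 ^ 3) / 9"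
      using \<phi>(4) f(3,4) by (simp add: sl)
    thus ?thesis unfolding f(5) \<psi>(2) by simp
  qed
  have 11: "s * (r * F2) / r = Fxy" using nz r(2) by (simp add: s)
  have 21: "(s * (r\<^sup>2 * F3) + r * F2) / r\<^sup>2 = Fxxy"
  proof -
    have "(s * (r\<^sup>2 * F3) + r * F2) / r\<^sup>2 = s * F3 + F2 / r" using r(2) by (simp add: add_divide_distrib power2_eq_square)
    also have "\<dots> = Fxxy" using nz by (simp add: s r(1) P_def field_simps power2_eq_square)
    finally show ?thesis .
  qed
  have "jet5 ?F (x, y) = (x, y, Fy, Fxy, Fxxy, F0, F1, F2, F3, F4, pd 5 0 ?F (x, y))"
    unfolding jet5_def J \<phi>(2,3) \<phi>2 \<phi>3 \<phi>4 using r(2) 11 21 by (simp add: f0)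
  \<comment> \<open>\<open>level\<close> ignores the F5 of its argument, so the still unknown fifth
    derivative does not matter here.\<close>
  hence lv: "level (X_jet v) (jet5 ?F (x, y)) = level (X_jet v) v" "jet5 ?F (x, y) \<in> branch_jets"
    using nz by (simp_all add: level_def w branch_jets_def P_def)
  have "jet5 ?F (x, y) = level (X_jet (jet5 ?F (x, y))) (jet5 ?F (x, y))" by (rule level_X_jet[OF lv(2), symmetric])
  also have "\<dots> = level (X_jet v) (jet5 ?F (x, y))" by (simp only: iX[unfolded inv_X_def])
  also have "\<dots> = v" unfolding lv(1) by (rule level_X_jet[OF v])
  finally have j: "jet5 ?F (x, y) = v" .
  have g1: "maps_germ (affine_map ?T (vector [0, 1, 0] - ?T *v vector [0, 1, 0]))
      (graph_surf (standard_cone \<psi>) UNIV) (graph_pt (standard_cone \<psi>) (0, 0)) (graph_surf (standard_cone f) UNIV) (graph_pt (standard_cone f) (0, 0))"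
    by (rule maps_germ_cone_translation[OF is_cone_origin[OF flatD(2)[OF \<psi>(1)]] is_cone_origin[OF fa(1)] _ _ _ _ det_frame_change])
      (use f(2) in simp_all)
  have g2: "maps_germ (affine_map (frame s r f0 F1 \<alpha>) (vector [?x, ?y, ?u] - frame s r f0 F1 \<alpha> *v vector [0, 1, 0]))
      (graph_surf (standard_cone f) UNIV) (graph_pt (standard_cone f) (0, 0)) (graph_surf ?F E) (graph_pt ?F (x, y))"
    by (rule maps_germ_cone_translation[OF is_cone_origin[OF fa(1)] c _ _ E(1,2) det_frame[OF \<alpha>(1) r(2)]])
      (use curve_map_frame[OF \<alpha>(1) r(2), of s \<phi>] \<phi> in \<open>simp_all add: sl\<close>)
  have b: "frame s r f0 F1 \<alpha> *v (vector [0, 1, 0] - ?T *v vector [0, 1, 0]) + (vector [?x, ?y, ?u] - frame s r f0 F1 \<alpha> *v vector [0, 1, 0]) = jet_shift v"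
    unfolding jet_shift_def M V by (simp add: matrix_vector_mult_diff_distrib matrix_vector_mul_assoc)
  have "maps_germ (affine_map (jet_matrix v) (jet_shift v)) (graph_surf (standard_cone \<psi>) UNIV) (graph_pt (standard_cone \<psi>) (0, 0))
      (graph_surf ?F E) (graph_pt ?F (x, y))"
    using maps_germ_affine_compose[OF det_frame[OF \<alpha>(1) r(2)] g1 g2] unfolding b M .
  moreover have "det (jet_matrix v) = 1"
    unfolding M det_mul by (simp add: det_frame[OF \<alpha>(1) r(2)] det_frame_change)
  ultimately show ?thesis using that[OF E(3,2) j] standard_cone_0[of \<psi>, OF flatD(3)[OF \<psi>(1)]] by simp
qed

lemma flat_quintic:
  obtains \<psi> where "flat \<psi>" "(deriv ^^ 5) \<psi> 0 = c"
proof -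
  define F where "F = fps_const (1 / 2) * fps_X ^ 2 + fps_const (c / 120) * fps_X ^ 5"
  have "(\<lambda>t. 1 / 2 * t ^ 2 + c / 120 * t ^ 5) has_fps_expansion F"
    unfolding F_def by (intro has_fps_expansion_add has_fps_expansion_mult has_fps_expansion_const has_fps_expansion_power has_fps_expansion_fps_X)
  hence "(\<lambda>t. (\<lambda>t. 1 / 2 * t ^ 2 + c / 120 * t ^ 5) (0 + t)) has_fps_expansion F" by simp
  note a = analytic1_fps[of "\<lambda>t. 1 / 2 * t ^ 2 + c / 120 * t ^ 5", OF this]
  have d: "(deriv ^^ n) (\<lambda>t. 1 / 2 * t ^ 2 + c / 120 * t ^ 5) 0 = fact n * fps_nth F n" for n
    unfolding jet_deriv a(2) ..
  show ?thesis
  proof (rule that)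
    show "flat (\<lambda>t. 1 / 2 * t ^ 2 + c / 120 * t ^ 5)"
      using a(1) d[of 1] d[of 2] d[of 3] d[of 4] by (simp add: flat_def osculating_def F_def fps_X_power_nth)
    show "(deriv ^^ 5) (\<lambda>t. 1 / 2 * t ^ 2 + c / 120 * t ^ 5) 0 = c"
      unfolding d by (simp add: F_def fps_X_power_nth fact_numeral)
  qed
qed

text \<open>All branch jets with the same value \<open>c\<close> of \<open>X\<close> are carried by affine images of one cone, over
  \<open>s\<^sup>2/2 + c s\<^sup>5/120\<close>, and the affine map depends continuously on the jet.\<close>

lemma invariant_locally_constant_on_level:
  assumes I: "diff_invariant5 U I" and w: "w \<in> U"
  shows "\<forall>\<^sub>F v in at w. v \<in> U \<and> X_jet v = X_jet w \<longrightarrow> I v = I w"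
proof -
  have U: "U \<subseteq> branch_jets" using I by (simp add: diff_invariant5_def)
  have wb: "w \<in> branch_jets" using U w by blast
  obtain \<epsilon> where \<epsilon>: "\<epsilon> > 0" "\<And>A b D F z D' F' z'.
        det A = 1 \<and> norm (A - mat 1) < \<epsilon> \<and> norm b < \<epsilon> \<and>
        in_branch D F \<and> z \<in> D \<and> in_branch D' F' \<and> z' \<in> D' \<and>
        maps_germ (affine_map A b)
          (graph_surf F D) (graph_pt F z) (graph_surf F' D') (graph_pt F' z') \<and>
        jet5 F z = w \<and> jet5 F' z' \<in> U
        \<Longrightarrow> I (jet5 F' z') = I w"
    using I w unfolding diff_invariant5_def by blast
  obtain \<psi> where \<psi>: "flat \<psi>" "(deriv ^^ 5) \<psi> 0 = X_jet w" by (rule flat_quintic)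
  obtain D F z where F: "in_branch D F" "z \<in> D" "jet5 F z = w" and det: "det (jet_matrix w) = 1"
    and g: "maps_germ (affine_map (jet_matrix w) (jet_shift w)) (graph_surf (standard_cone \<psi>) UNIV) 0 (graph_surf F D) (graph_pt F z)"
    by (rule jet_realised[OF wb \<psi>])
  let ?B = "matrix_inv (jet_matrix w)"
  define b where "b = inv_translation (jet_matrix w) (jet_shift w)"
  note inv = affine_map_inverse[OF det]
  have ginv: "maps_germ (affine_map ?B b) (graph_surf F D) (graph_pt F z) (graph_surf (standard_cone \<psi>) UNIV) 0"
    unfolding b_def by (rule maps_germ_affine_inverse[OF det g])
  note c = isCont_jet_frame[OF wb, unfolded isCont_def]
  have b0: "jet_matrix w *v b + jet_shift w = 0"
    using inv(2)[of "jet_shift w" 0] by (simp add: affine_map_def b_def)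
  \<comment> \<open>The map from the surface of w to that of v goes back to the common cone and out
    again. At v = w it is the identity with zero translation, so by continuity it is
    \<epsilon>-close to the identity for v near w.\<close>
  have "((\<lambda>v. jet_matrix v ** ?B - mat 1) \<longlongrightarrow> jet_matrix w ** ?B - mat 1) (at w)"
    by (intro tendsto_intros tendsto_matrix_mult c)
  hence "((\<lambda>v. norm (jet_matrix v ** ?B - mat 1)) \<longlongrightarrow> 0) (at w)"
    using tendsto_norm_zero inv(5) by auto
  hence 1: "\<forall>\<^sub>F v in at w. norm (jet_matrix v ** ?B - mat 1) < \<epsilon>" by (rule order_tendstoD(2)[OF _ \<epsilon>(1)])
  have "((\<lambda>v. jet_matrix v *v b + jet_shift v) \<longlongrightarrow> jet_matrix w *v b + jet_shift w) (at w)"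
    by (intro tendsto_intros tendsto_matrix_vector c)
  hence "((\<lambda>v. norm (jet_matrix v *v b + jet_shift v)) \<longlongrightarrow> 0) (at w)"
    unfolding b0 by (rule tendsto_norm_zero)
  hence 2: "\<forall>\<^sub>F v in at w. norm (jet_matrix v *v b + jet_shift v) < \<epsilon>" by (rule order_tendstoD(2)[OF _ \<epsilon>(1)])
  show ?thesis using 1 2
  proof eventually_elim
    case (elim v)
    show ?case
    proof (intro impI, elim conjE)
      assume v: "v \<in> U" "X_jet v = X_jet w"
      have "v \<in> branch_jets" "(deriv ^^ 5) \<psi> 0 = X_jet v" using U v \<psi>(2) by auto
      then obtain D' F' z' where F': "in_branch D' F'" "z' \<in> D'" "jet5 F' z' = v" and det': "det (jet_matrix v) = 1"
        and g': "maps_germ (affine_map (jet_matrix v) (jet_shift v)) (graph_surf (standard_cone \<psi>) UNIV) 0 (graph_surf F' D') (graph_pt F' z')"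
        by (rule jet_realised[OF _ \<psi>(1)])
      have "I (jet5 F' z') = I w"
        by (rule \<epsilon>(2)[of "jet_matrix v ** ?B" "jet_matrix v *v b + jet_shift v" D F z D' F' z'])
          (use elim F F' v det' inv(3) maps_germ_affine_compose[OF det' ginv g'] in \<open>simp add: det_mul\<close>)
      thus "I v = I w" using F'(3) by simp
    qed
  qed
qed

text \<open>h is I along the line of jets \<open>level c w\<close>. To compare v with the point of
  this line having the same X, a ball around w is projected onto that level set: I is locally
  constant there and the ball is connected, so the composite is constant.\<close>

lemma invariant_function_of_X_jet:
  assumes I: "diff_invariant5 U I" and w: "w \<in> U"
  obtains V h where "open V" "w \<in> V" "V \<subseteq> U"
    "\<And>v. v \<in> V \<Longrightarrow> real_analytic_at (h :: real \<Rightarrow> real) (X_jet v) \<and> I v = h (X_jet v)"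
proof -
  have U: "open U" "U \<subseteq> branch_jets" and an: "\<And>v. v \<in> U \<Longrightarrow> real_analytic_at I v"
    using I by (auto simp: diff_invariant5_def)
  have wb: "w \<in> branch_jets" using U w by blast
  let ?c = "X_jet w"
  \<comment> \<open>Joint continuity provides a ball around w and an interval of values around X(w)
    for which every projected jet stays inside U, where I is controlled.\<close>
  have "((\<lambda>(c, v). level c v) \<longlongrightarrow> level ?c w) (nhds (?c, w))"
    using isCont_level[OF wb, of ?c] tendsto_at_iff_tendsto_nhds[of "\<lambda>(c, v). level c v" "(?c, w)"] by (simp add: isCont_def)
  hence "\<forall>\<^sub>F p in nhds (?c, w). (case p of (c, v) \<Rightarrow> level c v) \<in> U"
    by (rule topological_tendstoD[OF _ U(1)]) (simp add: level_X_jet[OF wb] w)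
  then obtain S where S: "open S" "(?c, w) \<in> S" "\<And>c v. (c, v) \<in> S \<Longrightarrow> level c v \<in> U"
    unfolding eventually_nhds by fastforce
  obtain A B where AB: "open A" "open B" "?c \<in> A" "w \<in> B" "A \<times> B \<subseteq> S"
    by (rule open_prod_elim[OF S(1,2)]) (rule that, auto)
  have "open (B \<inter> U)" "w \<in> B \<inter> U" using AB U w by auto
  then obtain \<delta> where \<delta>: "\<delta> > 0" "ball w \<delta> \<subseteq> B \<inter> U" using open_contains_ball by blast
  have X: "isCont X_jet v" if "v \<in> branch_jets" for v
    by (rule real_analytic_at_isCont[OF real_analytic_at_X_jet[OF that]])
  have "continuous_on (ball w \<delta>) X_jet"
    using \<delta>(2) U(2) X by (intro continuous_at_imp_continuous_on) blast
  hence o: "open (ball w \<delta> \<inter> X_jet -` A)" by (rule continuous_open_preimage[OF _ open_ball AB(1)])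
  have L: "level c v \<in> U" if "c \<in> A" "v \<in> ball w \<delta>" for c v
    using S(3)[of c v] AB(5) \<delta>(2) that by blast
  define h where "h = (\<lambda>c. I (level c w))"
  show ?thesis
  proof (rule that[OF o])
    show "w \<in> ball w \<delta> \<inter> X_jet -` A" using AB \<delta> by simp
    show "ball w \<delta> \<inter> X_jet -` A \<subseteq> U" using \<delta> by blast
    fix v assume "v \<in> ball w \<delta> \<inter> X_jet -` A"
    hence v: "X_jet v \<in> A" "v \<in> ball w \<delta>" by simp_all
    let ?d = "X_jet v"
    have b: "u \<in> branch_jets" if "u \<in> ball w \<delta>" for u using that \<delta>(2) U(2) by blast
    have "I (level ?d w) = I (level ?d v)"
    proof (rule connected_local_const[of "ball w \<delta>" w v "\<lambda>u. I (level ?d u)"])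
      show "\<forall>a\<in>ball w \<delta>. \<forall>\<^sub>F u in at a within ball w \<delta>. I (level ?d a) = I (level ?d u)"
      proof
        fix a assume a: "a \<in> ball w \<delta>"
        have "\<forall>\<^sub>F u in at (level ?d a). u \<in> U \<and> X_jet u = X_jet (level ?d a) \<longrightarrow> I u = I (level ?d a)"
          by (rule invariant_locally_constant_on_level[OF I L[OF v(1) a]])
        hence loc: "\<forall>\<^sub>F u in nhds (level ?d a). u \<in> U \<and> X_jet u = X_jet (level ?d a) \<longrightarrow> I u = I (level ?d a)"
          by (simp add: eventually_at_filter) (auto elim: eventually_mono)
        have "isCont (level ?d) a"
          using isCont_o2[of a "\<lambda>u. (?d, u)" "\<lambda>(c, v). level c v"] isCont_level[OF b[OF a], of ?d] by (simp add: isCont_Pair)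
        hence "(level ?d \<longlongrightarrow> level ?d a) (at a within ball w \<delta>)"
          by (simp add: continuous_at_imp_continuous_at_within continuous_within[symmetric])
        from eventually_compose_filterlim[OF loc this]
        have 1: "\<forall>\<^sub>F u in at a within ball w \<delta>. level ?d u \<in> U \<and> X_jet (level ?d u) = X_jet (level ?d a) \<longrightarrow> I (level ?d u) = I (level ?d a)" .
        have 2: "\<forall>\<^sub>F u in at a within ball w \<delta>. u \<in> ball w \<delta>" by (simp add: eventually_at_filter)
        show "\<forall>\<^sub>F u in at a within ball w \<delta>. I (level ?d a) = I (level ?d u)" using 1 2
          by eventually_elim (use L[OF v(1)] b a X_jet_level in auto)
      qed
    qed (use v \<delta> in auto)
    hence "I v = h ?d" using level_X_jet[OF b[OF v(2)]] by (simp add: h_def)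
    moreover have "real_analytic_at h ?d"
      using real_analytic_at_along_line[OF an[OF L[OF v(1)]], of w ?d "level 1 w - level 0 w"] \<delta>(1)
      unfolding h_def level_affine[of _ w ?d, symmetric] by simp
    ultimately show "real_analytic_at h ?d \<and> I v = h ?d" by blast
  qed
qed

theorem theorem2p11:
  shows
    "(diff_invariant5 branch_jets X_jet \<and>
      (\<forall>U I. diff_invariant5 U I \<longrightarrow>
         (\<forall>w\<in>U. \<exists>V h. open V \<and> w \<in> V \<and> V \<subseteq> U \<and>
            (\<forall>v\<in>V. real_analytic_at (h :: real \<Rightarrow> real) (X_jet v) \<and> I v = h (X_jet v)))))
   \<and> (\<forall>D F. in_branch D F \<and> (\<forall>z\<in>D. inv_X F z = 0) \<longrightarrow>
         (\<forall>z\<in>D. SA3_equiv (graph_surf F D) (graph_pt F z) (graph_surf model {(x, y). y \<noteq> 1}) 0))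
   \<and> (\<forall>D F. in_branch D F \<and> (\<forall>z\<in>D. inv_X F z \<noteq> 0) \<longrightarrow>
         (\<forall>z\<in>D. \<exists>E G a5 a7 c. normal_germ E G a5 a7 c \<and>
            SA3_equiv (graph_surf F D) (graph_pt F z) (graph_surf G E) 0 \<and>
            a5 = inv_X F z \<and> a7 = inv_Y F z))
   \<and> (\<forall>E G a5 a7 c E' G' a5' a7' c'.
         normal_germ E G a5 a7 c \<and> normal_germ E' G' a5' a7' c' \<longrightarrow>
         (SA3_equiv (graph_surf G E) 0 (graph_surf G' E') 0 \<longleftrightarrow>
            a5 = a5' \<and> a7 = a7' \<and> (\<forall>j\<ge>8. c j 0 = c' j 0)))"
proof (intro conjI allI impI ballI)
  show "diff_invariant5 branch_jets X_jet" by (rule diff_invariant5_X_jet)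
next
  fix U I w assume "diff_invariant5 U I" "w \<in> U"
  then obtain V h where "open V" "w \<in> V" "V \<subseteq> U"
    "\<And>v. v \<in> V \<Longrightarrow> real_analytic_at (h :: real \<Rightarrow> real) (X_jet v) \<and> I v = h (X_jet v)"
    by (rule invariant_function_of_X_jet) (rule that)
  thus "\<exists>V h. open V \<and> w \<in> V \<and> V \<subseteq> U \<and>
    (\<forall>v\<in>V. real_analytic_at (h :: real \<Rightarrow> real) (X_jet v) \<and> I v = h (X_jet v))" by blast
next
  fix D F z assume "in_branch D F \<and> (\<forall>z\<in>D. inv_X F z = 0)" "z \<in> D"
  thus "SA3_equiv (graph_surf F D) (graph_pt F z) (graph_surf model {(x, y). y \<noteq> 1}) 0"
    using X_zero_equiv_model by blast
next
  fix D F z assume "in_branch D F \<and> (\<forall>z\<in>D. inv_X F z \<noteq> 0)" and z: "z \<in> D"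
  hence b: "in_branch D F" "inv_X F z \<noteq> 0" by auto
  show "\<exists>E G a5 a7 c. normal_germ E G a5 a7 c \<and>
      SA3_equiv (graph_surf F D) (graph_pt F z) (graph_surf G E) 0 \<and> a5 = inv_X F z \<and> a7 = inv_Y F z"
    by (rule X_nonzero_equiv_normal_germ[OF b(1) z b(2)]) blast
next
  fix E G a5 a7 c E' G' a5' a7' c'
  assume "normal_germ E G a5 a7 c \<and> normal_germ E' G' a5' a7' c'"
  thus "SA3_equiv (graph_surf G E) 0 (graph_surf G' E') 0 \<longleftrightarrow> a5 = a5' \<and> a7 = a7' \<and> (\<forall>j\<ge>8. c j 0 = c' j 0)"
    using normal_germ_equiv_iff by blast
qed

end
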